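(* Let $d$ be a positive integer and let $F$ and $G$ be homogeneous strict polynomial functors of degree $d$. The map induced by the Schur functor $$\mathrm{Ext}^k_{\mathcal{P}_{d,\Bbbk}}(F,G)\to \mathrm{Ext}^k_{\Bbbk\mathfrak{S}_d}(f_d(F),f_d(G))$$ is an isomorphism in degrees $k<p(F,1)+i(G,1)-1$, and it is injective in degree $k=p(F,1)+i(G,1)-1$.
   Context: $\Bbbk$ is a field of characteristic $p>0$. $\mathcal{P}_{d,\Bbbk}$ is the category of homogeneous strict polynomial functors of degree $d$ over $\Bbbk$ (Friedlander–Suslin), with possibly infinite dimensional values; equivalently, the $\Bbbk$-linear functors to $\Bbbk$-vector spaces from the category with objects the finite dimensional $\Bbbk$-vector spaces and with morphisms $V\to W$ the elements of $\Gamma^d(\mathrm{Hom}_\Bbbk(V,W))$. The Schur functor is the exact functor $f_d=\mathrm{Hom}_{\mathcal{P}_{d,\Bbbk}}(\otimes^d,-):\mathcal{P}_{d,\Bbbk}\to\Bbbk\mathfrak{S}_d\text{-Mod}$, where $\otimes^d:V\mapsto V^{\otimes d}$ and $\mathfrak{S}_d$ acts (on the right) on $\otimes^d$ by permuting the factors. $\mathrm{Ext}$ groups are zero in negative degrees. $\Gamma^d(V)=(V^{\otimes d})^{\mathfrak{S}_d}$ and $S^d(V)=(V^{\otimes d})_{\mathfrak{S}_d}$. For a tuple $\lambda=(\lambda_1,\dots,\lambda_n)$ of nonnegative integers, $\Gamma^\lambda=\bigotimes_k\Gamma^{\lambda_k}$, $S^\lambda=\bigotimes_k S^{\lambda_k}$;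 $\lambda$ is $p$-bounded if $\lambda_k<p$ for all $k$. A functor is left $p$-bounded if it is a quotient of a direct sum of functors $\Gamma^\lambda$ with $\lambda$ $p$-bounded, and right $p$-bounded if it embeds in a product of functors $S^\lambda$ with $\lambda$ $p$-bounded. $p(F,1)\in[0,+\infty]$ is the supremum of the integers $n\ge0$ such that $F$ has a projective resolution $P$ with $P_0,\dots,P_{n-1}$ left $p$-bounded; $i(G,1)\in[0,+\infty]$ is the supremum of the integers $n\ge0$ such that $G$ has an injective resolution $J$ with $J^0,\dots,J^{n-1}$ right $p$-bounded. *)

theory Defs
  imports
    "HOL-Algebra.Module"
    "HOL-Algebra.AbelCoset"
    "HOL-Algebra.Algebraic_Closure_Type"
    "HOL-Combinatorics.Permutations"
    "HOL-Library.Extended_Nat"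
    "HOL-Library.Function_Algebras"
begin

section \<open>Vector spaces\<close>

text \<open>
  The ground field is a type \<open>'k :: field\<close>; a vector space is a HOL-Algebra module over
  the ring record of that type. The fields \<open>mult\<close> and \<open>one\<close> that a module record
  inherits from ring records carry no meaning.
\<close>

abbreviation vspace :: "('k::field, 'v) module \<Rightarrow> bool"
  where "vspace M \<equiv> module (ring_of_type_algebra :: 'k ring) M"

definition lin_maps :: "('k::field, 'v) module \<Rightarrow> ('k, 'w) module \<Rightarrow> ('v \<Rightarrow> 'w) set"
  where "lin_maps M N = {h \<in> carrier M \<rightarrow> carrier N.
     (\<forall>x\<in>carrier M. \<forall>y\<in>carrier M. h (x \<oplus>\<^bsub>M\<^esub> y) = h x \<oplus>\<^bsub>N\<^esub> h y) \<and>
     (\<forall>r. \<forall>x\<in>carrier M. h (r \<odot>\<^bsub>M\<^esub> x) = r \<odot>\<^bsub>N\<^esub> h x)}"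

definition lin_isos :: "('k::field, 'v) module \<Rightarrow> ('k, 'w) module \<Rightarrow> ('v \<Rightarrow> 'w) set"
  where "lin_isos M N = {h \<in> lin_maps M N. bij_betw h (carrier M) (carrier N)}"

definition lin_monos :: "('k::field, 'v) module \<Rightarrow> ('k, 'w) module \<Rightarrow> ('v \<Rightarrow> 'w) set"
  where "lin_monos M N = {h \<in> lin_maps M N. inj_on h (carrier M)}"

definition quot_module :: "('k::field, 'v) module \<Rightarrow> 'v set \<Rightarrow> ('k, 'v set) module"
  where "quot_module M N =
    \<lparr>carrier = a_rcosets\<^bsub>M\<^esub> N, monoid.mult = undefined, one = undefined, ring.zero = N,
     ring.add = set_add M, module.smult = (\<lambda>r A. \<Union>x\<in>A. a_r_coset M N (r \<odot>\<^bsub>M\<^esub> x))\<rparr>"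

definition prod_module :: "'i set \<Rightarrow> ('i \<Rightarrow> ('k::field, 'v) module) \<Rightarrow> ('k, 'i \<Rightarrow> 'v) module"
  where "prod_module I M =
    \<lparr>carrier = (\<Pi>\<^sub>E i\<in>I. carrier (M i)), monoid.mult = undefined, one = undefined,
     ring.zero = (\<lambda>i\<in>I. \<zero>\<^bsub>M i\<^esub>), ring.add = (\<lambda>f g. \<lambda>i\<in>I. f i \<oplus>\<^bsub>M i\<^esub> g i),
     module.smult = (\<lambda>r f. \<lambda>i\<in>I. r \<odot>\<^bsub>M i\<^esub> f i)\<rparr>"

definition sum_module :: "'i set \<Rightarrow> ('i \<Rightarrow> ('k::field, 'v) module) \<Rightarrow> ('k, 'i \<Rightarrow> 'v) module"
  where "sum_module I M = (prod_module I M)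
    \<lparr>carrier := {f \<in> (\<Pi>\<^sub>E i\<in>I. carrier (M i)). finite {i\<in>I. f i \<noteq> \<zero>\<^bsub>M i\<^esub>}}\<rparr>"

definition fscale :: "'k::field \<Rightarrow> ('x \<Rightarrow> 'k) \<Rightarrow> 'x \<Rightarrow> 'k"
  where "fscale r f = (\<lambda>x. r * f x)"

abbreviation fspan :: "('x \<Rightarrow> 'k::field) set \<Rightarrow> ('x \<Rightarrow> 'k) set"
  where "fspan \<equiv> Modules.module.span fscale"

definition fun_module :: "('x \<Rightarrow> 'k::field) set \<Rightarrow> ('k, 'x \<Rightarrow> 'k) module"
  where "fun_module A =
    \<lparr>carrier = A, monoid.mult = undefined, one = undefined, ring.zero = 0, ring.add = (+), module.smult = fscale\<rparr>"


section \<open>Linear functors on small linear categories\<close>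

text \<open>
  A \<open>'k\<close>-linear category whose class of objects is the whole type \<open>'o\<close> and whose Hom
  spaces are spaces of \<open>'k\<close>-valued functions on \<open>'x\<close>. \<open>Cmp C a b c g f\<close> is the composite
  of \<open>f : a \<rightarrow> b\<close> and \<open>g : b \<rightarrow> c\<close>.
\<close>

record ('o, 'x, 'k) lincat =
  Hom :: "'o \<Rightarrow> 'o \<Rightarrow> ('x \<Rightarrow> 'k) set"
  Cmp :: "'o \<Rightarrow> 'o \<Rightarrow> 'o \<Rightarrow> ('x \<Rightarrow> 'k) \<Rightarrow> ('x \<Rightarrow> 'k) \<Rightarrow> ('x \<Rightarrow> 'k)"
  Idn :: "'o \<Rightarrow> 'x \<Rightarrow> 'k"

record ('o, 'x, 'k, 'v) linfun =
  Ob :: "'o \<Rightarrow> ('k, 'v) module"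
  Mp :: "'o \<Rightarrow> 'o \<Rightarrow> ('x \<Rightarrow> 'k) \<Rightarrow> 'v \<Rightarrow> 'v"

definition is_functor ::
    "('o, 'x, 'k::field) lincat \<Rightarrow> ('o, 'x, 'k, 'v) linfun \<Rightarrow> bool"
  where "is_functor C F \<longleftrightarrow>
    (\<forall>a. vspace (Ob F a)) \<and>
    (\<forall>a b. \<forall>f\<in>Hom C a b. Mp F a b f \<in> lin_maps (Ob F a) (Ob F b)) \<and>
    (\<forall>a b. \<forall>f\<in>Hom C a b. \<forall>g\<in>Hom C a b. \<forall>x\<in>carrier (Ob F a).
        Mp F a b (f + g) x = Mp F a b f x \<oplus>\<^bsub>Ob F b\<^esub> Mp F a b g x) \<and>
    (\<forall>a b r. \<forall>f\<in>Hom C a b. \<forall>x\<in>carrier (Ob F a).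
        Mp F a b (fscale r f) x = r \<odot>\<^bsub>Ob F b\<^esub> Mp F a b f x) \<and>
    (\<forall>a. \<forall>x\<in>carrier (Ob F a). Mp F a a (Idn C a) x = x) \<and>
    (\<forall>a b c. \<forall>f\<in>Hom C a b. \<forall>g\<in>Hom C b c. \<forall>x\<in>carrier (Ob F a).
        Mp F a c (Cmp C a b c g f) x = Mp F b c g (Mp F a b f x))"

text \<open>
  Components are extensional (undefined off the carrier), so that natural transformations
  are equal as soon as they agree on the carriers.
\<close>

definition nat_trans :: "('o, 'x, 'k::field) lincat \<Rightarrow> ('o, 'x, 'k, 'v) linfun \<Rightarrow>
    ('o, 'x, 'k, 'w) linfun \<Rightarrow> ('o \<Rightarrow> 'v \<Rightarrow> 'w) set"
  where "nat_trans C F G = {\<eta>.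
    (\<forall>a. \<eta> a \<in> lin_maps (Ob F a) (Ob G a) \<inter> extensional (carrier (Ob F a))) \<and>
    (\<forall>a b. \<forall>f\<in>Hom C a b. \<forall>x\<in>carrier (Ob F a). \<eta> b (Mp F a b f x) = Mp G a b f (\<eta> a x))}"

definition ncomp :: "('o, 'x, 'k, 'u) linfun \<Rightarrow> ('o \<Rightarrow> 'v \<Rightarrow> 'w) \<Rightarrow> ('o \<Rightarrow> 'u \<Rightarrow> 'v) \<Rightarrow> 'o \<Rightarrow> 'u \<Rightarrow> 'w"
  where "ncomp F \<eta> \<theta> = (\<lambda>a. compose (carrier (Ob F a)) (\<eta> a) (\<theta> a))"

definition hom_module :: "('o, 'x, 'k::field) lincat \<Rightarrow> ('o, 'x, 'k, 'v) linfun \<Rightarrow>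
    ('o, 'x, 'k, 'w) linfun \<Rightarrow> ('k, 'o \<Rightarrow> 'v \<Rightarrow> 'w) module"
  where "hom_module C F G =
    \<lparr>carrier = nat_trans C F G, monoid.mult = undefined, one = undefined,
     ring.zero = (\<lambda>a. \<lambda>x\<in>carrier (Ob F a). \<zero>\<^bsub>Ob G a\<^esub>),
     ring.add = (\<lambda>\<eta> \<theta> a. \<lambda>x\<in>carrier (Ob F a). \<eta> a x \<oplus>\<^bsub>Ob G a\<^esub> \<theta> a x),
     module.smult = (\<lambda>r \<eta> a. \<lambda>x\<in>carrier (Ob F a). r \<odot>\<^bsub>Ob G a\<^esub> \<eta> a x)\<rparr>"

definition is_epi ::
    "('o, 'x, 'k, 'v) linfun \<Rightarrow> ('o, 'x, 'k, 'w) linfun \<Rightarrow> ('o \<Rightarrow> 'v \<Rightarrow> 'w) \<Rightarrow> bool"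
  where "is_epi F G \<eta> \<longleftrightarrow> (\<forall>a. \<eta> a ` carrier (Ob F a) = carrier (Ob G a))"

definition is_mono :: "('o, 'x, 'k, 'v) linfun \<Rightarrow> ('o \<Rightarrow> 'v \<Rightarrow> 'w) \<Rightarrow> bool"
  where "is_mono F \<eta> \<longleftrightarrow> (\<forall>a. inj_on (\<eta> a) (carrier (Ob F a)))"

definition exact_at :: "('o, 'x, 'k, 'u) linfun \<Rightarrow> ('o \<Rightarrow> 'u \<Rightarrow> 'v) \<Rightarrow> ('o, 'x, 'k, 'v) linfun \<Rightarrow>
    ('o \<Rightarrow> 'v \<Rightarrow> 'w) \<Rightarrow> ('o, 'x, 'k, 'w) linfun \<Rightarrow> bool"
  where "exact_at F \<eta> G \<theta> H \<longleftrightarrow>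
    (\<forall>a. \<eta> a ` carrier (Ob F a) = {y\<in>carrier (Ob G a). \<theta> a y = \<zero>\<^bsub>Ob H a\<^esub>})"

text \<open>
  Projectivity and injectivity are tested on functors with values in the same type \<open>'v\<close>.
  In the categories used below this is the usual notion as soon as \<open>'v\<close> is infinite and at
  least as large as \<open>'k\<close>: every functor with values in \<open>'v\<close> is then a quotient of a direct sum
  of representable functors and embeds in an injective functor, both of which have, up to
  isomorphism, values in \<open>'v\<close> again.
\<close>

definition projective ::
    "('o, 'x, 'k::field) lincat \<Rightarrow> ('o, 'x, 'k, 'v) linfun \<Rightarrow> bool"
  where "projective C P \<longleftrightarrow> is_functor C P \<and>
    (\<forall>(M :: ('o, 'x, 'k, 'v) linfun) (N :: ('o, 'x, 'k, 'v) linfun).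
      is_functor C M \<longrightarrow> is_functor C N \<longrightarrow>
      (\<forall>\<pi>\<in>nat_trans C M N. is_epi M N \<pi> \<longrightarrow>
        (\<forall>\<phi>\<in>nat_trans C P N. \<exists>\<psi>\<in>nat_trans C P M. ncomp P \<pi> \<psi> = \<phi>)))"

definition injective ::
    "('o, 'x, 'k::field) lincat \<Rightarrow> ('o, 'x, 'k, 'v) linfun \<Rightarrow> bool"
  where "injective C J \<longleftrightarrow> is_functor C J \<and>
    (\<forall>(M :: ('o, 'x, 'k, 'v) linfun) (N :: ('o, 'x, 'k, 'v) linfun).
      is_functor C M \<longrightarrow> is_functor C N \<longrightarrow>
      (\<forall>\<iota>\<in>nat_trans C M N. is_mono M \<iota> \<longrightarrow>
        (\<forall>\<phi>\<in>nat_trans C M J. \<exists>\<psi>\<in>nat_trans C N J. ncomp M \<psi> \<iota> = \<phi>)))"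

definition proj_resolution :: "('o, 'x, 'k::field) lincat \<Rightarrow> ('o, 'x, 'k, 'v) linfun \<Rightarrow>
    (nat \<Rightarrow> ('o, 'x, 'k, 'v) linfun) \<Rightarrow> (nat \<Rightarrow> 'o \<Rightarrow> 'v \<Rightarrow> 'v) \<Rightarrow> ('o \<Rightarrow> 'v \<Rightarrow> 'v) \<Rightarrow> bool"
  where "proj_resolution C F P D \<epsilon> \<longleftrightarrow>
    (\<forall>i. projective C (P i)) \<and>
    (\<forall>i. D i \<in> nat_trans C (P (Suc i)) (P i)) \<and>
    \<epsilon> \<in> nat_trans C (P 0) F \<and>
    is_epi (P 0) F \<epsilon> \<and>
    exact_at (P (Suc 0)) (D 0) (P 0) \<epsilon> F \<and>
    (\<forall>i. exact_at (P (Suc (Suc i))) (D (Suc i)) (P (Suc i)) (D i) (P i))"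

definition inj_resolution :: "('o, 'x, 'k::field) lincat \<Rightarrow> ('o, 'x, 'k, 'v) linfun \<Rightarrow>
    (nat \<Rightarrow> ('o, 'x, 'k, 'v) linfun) \<Rightarrow> (nat \<Rightarrow> 'o \<Rightarrow> 'v \<Rightarrow> 'v) \<Rightarrow> ('o \<Rightarrow> 'v \<Rightarrow> 'v) \<Rightarrow> bool"
  where "inj_resolution C G J \<delta> \<iota> \<longleftrightarrow>
    (\<forall>i. injective C (J i)) \<and>
    (\<forall>i. \<delta> i \<in> nat_trans C (J i) (J (Suc i))) \<and>
    \<iota> \<in> nat_trans C G (J 0) \<and>
    is_mono G \<iota> \<and>
    exact_at G \<iota> (J 0) (\<delta> 0) (J (Suc 0)) \<and>
    (\<forall>i. exact_at (J i) (\<delta> i) (J (Suc i)) (\<delta> (Suc i)) (J (Suc (Suc i))))"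

text \<open>
  \<open>Ext_module C P D G k\<close> is the \<open>k\<close>-th cohomology of \<open>Hom(P, G)\<close>, that is
  \<open>Ext\<^sup>k(F, G)\<close> when \<open>(P, D)\<close> is a projective resolution of \<open>F\<close>.
\<close>

definition Ext_cocycles where
  "Ext_cocycles C P D G k =
    {\<alpha> \<in> nat_trans C (P k) G.
      ncomp (P (Suc k)) \<alpha> (D k) = \<zero>\<^bsub>hom_module C (P (Suc k)) G\<^esub>}"

definition Ext_coboundaries where
  "Ext_coboundaries C P D G k = (case k of
      0 \<Rightarrow> {\<zero>\<^bsub>hom_module C (P 0) G\<^esub>}
    | Suc j \<Rightarrow> (\<lambda>\<beta>. ncomp (P (Suc j)) \<beta> (D j)) ` nat_trans C (P j) G)"

definition Ext_module :: "('o, 'x, 'k::field) lincat \<Rightarrow> (nat \<Rightarrow> ('o, 'x, 'k, 'v) linfun) \<Rightarrow>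
    (nat \<Rightarrow> 'o \<Rightarrow> 'v \<Rightarrow> 'v) \<Rightarrow> ('o, 'x, 'k, 'w) linfun \<Rightarrow> nat \<Rightarrow> ('k, ('o \<Rightarrow> 'v \<Rightarrow> 'w) set) module"
  where "Ext_module C P D G k =
    quot_module ((hom_module C (P k) G)\<lparr>carrier := Ext_cocycles C P D G k\<rparr>)
      (Ext_coboundaries C P D G k)"

definition sum_functor ::
    "'i set \<Rightarrow> ('i \<Rightarrow> ('o, 'x, 'k::field, 'v) linfun) \<Rightarrow> ('o, 'x, 'k, 'i \<Rightarrow> 'v) linfun"
  where "sum_functor I F =
    \<lparr>Ob = (\<lambda>a. sum_module I (\<lambda>i. Ob (F i) a)), Mp = (\<lambda>a b f x. \<lambda>i\<in>I. Mp (F i) a b f (x i))\<rparr>"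

definition prod_functor ::
    "'i set \<Rightarrow> ('i \<Rightarrow> ('o, 'x, 'k::field, 'v) linfun) \<Rightarrow> ('o, 'x, 'k, 'i \<Rightarrow> 'v) linfun"
  where "prod_functor I F =
    \<lparr>Ob = (\<lambda>a. prod_module I (\<lambda>i. Ob (F i) a)), Mp = (\<lambda>a b f x. \<lambda>i\<in>I. Mp (F i) a b f (x i))\<rparr>"


section \<open>Tensor powers\<close>

text \<open>
  For a finite set \<open>A\<close>, \<open>tens A d\<close> is the \<open>d\<close>-th tensor power of the vector space with basis
  \<open>A\<close>: the value of a tensor at the word \<open>[x\<^sub>1, \<dots>, x\<^sub>d]\<close> is its coefficient on
  \<open>x\<^sub>1 \<otimes> \<dots> \<otimes> x\<^sub>d\<close>.
\<close>

definition words :: "'x set \<Rightarrow> nat \<Rightarrow> 'x list set"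
  where "words A d = {xs. set xs \<subseteq> A \<and> length xs = d}"

definition tens :: "'x set \<Rightarrow> nat \<Rightarrow> ('x list \<Rightarrow> 'k::field) set"
  where "tens A d = {t. \<forall>xs. t xs \<noteq> 0 \<longrightarrow> xs \<in> words A d}"

text \<open>
  The right action \<open>(v\<^sub>1 \<otimes> \<dots> \<otimes> v\<^sub>d) \<cdot> \<sigma> = v\<^bsub>\<sigma> 1\<^esub> \<otimes> \<dots> \<otimes> v\<^bsub>\<sigma> d\<^esub>\<close>, with
  positions numbered from \<open>0\<close>; on coefficients it becomes precomposition with the inverse.
\<close>

definition tperm :: "(nat \<Rightarrow> nat) \<Rightarrow> ('x list \<Rightarrow> 'k) \<Rightarrow> 'x list \<Rightarrow> 'k"
  where "tperm \<sigma> t = (\<lambda>xs. t (permute_list (inv_into UNIV \<sigma>) xs))"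

abbreviation Sym :: "nat \<Rightarrow> (nat \<Rightarrow> nat) set"
  where "Sym d \<equiv> {\<sigma>. \<sigma> permutes {..<d}}"

definition Gamma_sp :: "'x set \<Rightarrow> nat \<Rightarrow> ('x list \<Rightarrow> 'k::field) set"
  where "Gamma_sp A d = {t \<in> tens A d. \<forall>\<sigma>\<in>Sym d. tperm \<sigma> t = t}"

text \<open>\<open>S\<^sup>d(V)\<close> is the quotient of \<open>V\<^sup>\<otimes>\<^sup>d\<close> by the following subspace.\<close>

definition coinv_ker :: "'x set \<Rightarrow> nat \<Rightarrow> ('x list \<Rightarrow> 'k::field) set"
  where "coinv_ker A d = fspan {t - tperm \<sigma> t | t \<sigma>. t \<in> tens A d \<and> \<sigma> \<in> Sym d}"

text \<open>The tensor \<open>t\<^sub>1 \<otimes> \<dots> \<otimes> t\<^sub>n\<close> for \<open>t\<^sub>k\<close> of degree \<open>\<lambda>\<^sub>k\<close>.\<close>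

fun tprod :: "nat list \<Rightarrow> ('x list \<Rightarrow> 'k::field) list \<Rightarrow> 'x list \<Rightarrow> 'k" where
  "tprod (a # l) (t # ts) xs = t (take a xs) * tprod l ts (drop a xs)"
| "tprod _ _ xs = (if xs = [] then 1 else 0)"

text \<open>
  With \<open>V\<^sup>\<otimes>\<^sup>\<lambda>\<^sup>1 \<otimes> \<dots> \<otimes> V\<^sup>\<otimes>\<^sup>\<lambda>\<^sup>n = V\<^sup>\<otimes>\<^sup>d\<close> (concatenation), \<open>Gamma_lam\<close> is the tensor product of the
  subspaces \<open>\<Gamma>\<close> of the factors, and \<open>S_lam_ker\<close> is the kernel of the tensor product of the
  quotient maps from the factors to the \<open>S\<close>.
\<close>

definition Gamma_lam :: "'x set \<Rightarrow> nat list \<Rightarrow> ('x list \<Rightarrow> 'k::field) set"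
  where "Gamma_lam A lam =
    fspan {tprod lam ts | ts. list_all2 (\<lambda>a t. t \<in> Gamma_sp A a) lam ts}"

definition S_lam_ker :: "'x set \<Rightarrow> nat list \<Rightarrow> ('x list \<Rightarrow> 'k::field) set"
  where "S_lam_ker A lam =
    fspan {tprod lam ts | ts. list_all2 (\<lambda>a t. t \<in> tens A a) lam ts \<and>
      (\<exists>j<length lam. ts ! j \<in> coinv_ker A (lam ! j))}"


section \<open>Strict polynomial functors\<close>

text \<open>
  The objects are the spaces \<open>k\<^sup>n\<close>, which represent every finite dimensional vector space up
  to isomorphism. As \<open>Hom(k\<^sup>m, k\<^sup>n)\<close> has the basis of elementary matrices \<open>(i, j)\<close>,
  \<open>i < n\<close>, \<open>j < m\<close>, the morphisms \<open>k\<^sup>m \<rightarrow> k\<^sup>n\<close> are \<open>\<Gamma>\<^sup>d(Hom(k\<^sup>m, k\<^sup>n))\<close>. Composition is the restriction of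
  \<open>(g\<^sub>1 \<otimes> \<dots> \<otimes> g\<^sub>d, f\<^sub>1 \<otimes> \<dots> \<otimes> f\<^sub>d) \<mapsto> g\<^sub>1f\<^sub>1 \<otimes> \<dots> \<otimes> g\<^sub>df\<^sub>d\<close>.
\<close>

definition Gamma_cat :: "nat \<Rightarrow> (nat, (nat \<times> nat) list, 'k::field) lincat"
  where "Gamma_cat d =
    \<lparr>Hom = (\<lambda>m n. Gamma_sp ({..<n} \<times> {..<m}) d),
     Cmp = (\<lambda>l m n g f zs. if length zs = d
        then \<Sum>ys\<in>words {..<m} d. g (zip (map fst zs) ys) * f (zip ys (map snd zs)) else 0),
     Idn = (\<lambda>n zs. if length zs = d \<and> (\<forall>(i, j)\<in>set zs. i = j \<and> i < n) then 1 else 0)\<rparr>"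

type_synonym ('k, 'v) spf = "(nat, (nat \<times> nat) list, 'k, 'v) linfun"

abbreviation strict_poly_functor :: "nat \<Rightarrow> ('k::field, 'v) spf \<Rightarrow> bool"
  where "strict_poly_functor d F \<equiv> is_functor (Gamma_cat d) F"

text \<open>\<open>f\<^sub>1 \<otimes> \<dots> \<otimes> f\<^sub>d\<close> acts on \<open>(k\<^sup>m)\<^sup>\<otimes>\<^sup>d\<close> factorwise.\<close>

definition tens_map :: "nat \<Rightarrow> nat \<Rightarrow> ((nat \<times> nat) list \<Rightarrow> 'k::field) \<Rightarrow>
    (nat list \<Rightarrow> 'k) \<Rightarrow> nat list \<Rightarrow> 'k"
  where "tens_map d m f t =
    (\<lambda>xs. if length xs = d then \<Sum>ys\<in>words {..<m} d. f (zip xs ys) * t ys else 0)"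

definition tens_functor :: "nat \<Rightarrow> ('k::field, nat list \<Rightarrow> 'k) spf"
  where "tens_functor d =
    \<lparr>Ob = (\<lambda>n. fun_module (tens {..<n} d)), Mp = (\<lambda>m n. tens_map d m)\<rparr>"

definition Gamma_functor :: "nat list \<Rightarrow> ('k::field, nat list \<Rightarrow> 'k) spf"
  where "Gamma_functor lam =
    \<lparr>Ob = (\<lambda>n. fun_module (Gamma_lam {..<n} lam)), Mp = (\<lambda>m n. tens_map (sum_list lam) m)\<rparr>"

definition S_functor :: "nat list \<Rightarrow> ('k::field, (nat list \<Rightarrow> 'k) set) spf"
  where "S_functor lam =
    \<lparr>Ob = (\<lambda>n. quot_module (fun_module (tens {..<n} (sum_list lam))) (S_lam_ker {..<n} lam)),
     Mp = (\<lambda>m n f A. \<Union>t\<in>A. a_r_coset (fun_module (tens {..<n} (sum_list lam)))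
        (S_lam_ker {..<n} lam) (tens_map (sum_list lam) m f t))\<rparr>"

definition p_bounded :: "nat \<Rightarrow> nat list \<Rightarrow> bool"
  where "p_bounded p lam \<longleftrightarrow> (\<forall>a\<in>set lam. a < p)"

text \<open>
  For the direct sums and products below, one index for each element \<open>x\<close> of a value \<open>F(k\<^sup>n)\<close>,
  repeated countably often, always suffices; hence the index type \<open>nat \<times> 'v\<close> is no
  restriction.
\<close>

definition left_p_bounded :: "nat \<Rightarrow> nat \<Rightarrow> ('k::field, 'v) spf \<Rightarrow> bool"
  where "left_p_bounded p d F \<longleftrightarrow>
    (\<exists>(I :: (nat \<times> 'v) set) lam. (\<forall>i\<in>I. p_bounded p (lam i) \<and> sum_list (lam i) = d) \<and>
      (\<exists>\<pi> \<in> nat_trans (Gamma_cat d) (sum_functor I (\<lambda>i. Gamma_functor (lam i))) F.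
         is_epi (sum_functor I (\<lambda>i. Gamma_functor (lam i))) F \<pi>))"

definition right_p_bounded :: "nat \<Rightarrow> nat \<Rightarrow> ('k::field, 'v) spf \<Rightarrow> bool"
  where "right_p_bounded p d F \<longleftrightarrow>
    (\<exists>(I :: (nat \<times> 'v) set) lam. (\<forall>i\<in>I. p_bounded p (lam i) \<and> sum_list (lam i) = d) \<and>
      (\<exists>\<iota> \<in> nat_trans (Gamma_cat d) F (prod_functor I (\<lambda>i. S_functor (lam i))). is_mono F \<iota>))"

definition p_index :: "nat \<Rightarrow> nat \<Rightarrow> ('k::field, 'v) spf \<Rightarrow> enat"
  where "p_index p d F = Sup {enat n | n. \<exists>P D \<epsilon>.
    proj_resolution (Gamma_cat d) F P D \<epsilon> \<and> (\<forall>i<n. left_p_bounded p d (P i))}"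

definition i_index :: "nat \<Rightarrow> nat \<Rightarrow> ('k::field, 'v) spf \<Rightarrow> enat"
  where "i_index p d G = Sup {enat n | n. \<exists>J \<delta> \<iota>.
    inj_resolution (Gamma_cat d) G J \<delta> \<iota> \<and> (\<forall>i<n. right_p_bounded p d (J i))}"


section \<open>The Schur functor\<close>

text \<open>
  The group algebra of the symmetric group as a linear category with one object; its linear
  functors are the left modules over the group algebra.
\<close>

definition Sym_cat :: "nat \<Rightarrow> (unit, nat \<Rightarrow> nat, 'k::field) lincat"
  where "Sym_cat d =
    \<lparr>Hom = (\<lambda>_ _. {a. \<forall>\<sigma>. a \<sigma> \<noteq> 0 \<longrightarrow> \<sigma> \<in> Sym d}),
     Cmp = (\<lambda>_ _ _ a b \<tau>. \<Sum>\<sigma>\<in>Sym d. a \<sigma> * b (inv_into UNIV \<sigma> \<circ> \<tau>)),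
     Idn = (\<lambda>_ \<sigma>. if \<sigma> = id then 1 else 0)\<rparr>"

type_synonym ('k, 'v) sym_mod = "(unit, nat \<Rightarrow> nat, 'k, 'v) linfun"

definition tens_act :: "nat \<Rightarrow> ((nat \<Rightarrow> nat) \<Rightarrow> 'k::field) \<Rightarrow> (nat list \<Rightarrow> 'k) \<Rightarrow> nat list \<Rightarrow> 'k"
  where "tens_act d a t = (\<Sum>\<sigma>\<in>Sym d. fscale (a \<sigma>) (tperm \<sigma> t))"

definition schur :: "nat \<Rightarrow> ('k::field, 'v) spf \<Rightarrow> ('k, nat \<Rightarrow> (nat list \<Rightarrow> 'k) \<Rightarrow> 'v) sym_mod"
  where "schur d F =
    \<lparr>Ob = (\<lambda>_. hom_module (Gamma_cat d) (tens_functor d) F),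
     Mp = (\<lambda>_ _ a \<phi> n. \<lambda>t\<in>tens {..<n} d. \<phi> n (tens_act d a t))\<rparr>"

definition schur_map :: "nat \<Rightarrow> ('k::field, 'v) spf \<Rightarrow> (nat \<Rightarrow> 'v \<Rightarrow> 'w) \<Rightarrow>
    unit \<Rightarrow> (nat \<Rightarrow> (nat list \<Rightarrow> 'k) \<Rightarrow> 'v) \<Rightarrow> nat \<Rightarrow> (nat list \<Rightarrow> 'k) \<Rightarrow> 'w"
  where "schur_map d F \<eta> = (\<lambda>_. \<lambda>\<phi>\<in>carrier (Ob (schur d F) ()). ncomp (tens_functor d) \<eta> \<phi>)"

text \<open>
  The Schur functor being exact, it sends a resolution \<open>P\<close> of \<open>F\<close> to a resolution of its image.
  The map induced on Ext composes the image of a cocycle on \<open>P\<close> with a chain map \<open>\<phi>\<close> to that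
  resolution from a projective resolution \<open>Q\<close> of the image, \<open>\<phi>\<close> lifting the identity.
\<close>

definition schur_lift ::
    "nat \<Rightarrow> (nat \<Rightarrow> ('k::field, 'v) spf) \<Rightarrow> (nat \<Rightarrow> nat \<Rightarrow> 'v \<Rightarrow> 'v) \<Rightarrow> (nat \<Rightarrow> 'v \<Rightarrow> 'v) \<Rightarrow>
     (nat \<Rightarrow> ('k, 'w) sym_mod) \<Rightarrow> (nat \<Rightarrow> unit \<Rightarrow> 'w \<Rightarrow> 'w) \<Rightarrow>
     (unit \<Rightarrow> 'w \<Rightarrow> nat \<Rightarrow> (nat list \<Rightarrow> 'k) \<Rightarrow> 'v) \<Rightarrow>
     (nat \<Rightarrow> unit \<Rightarrow> 'w \<Rightarrow> nat \<Rightarrow> (nat list \<Rightarrow> 'k) \<Rightarrow> 'v) \<Rightarrow> bool"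
  where "schur_lift d P D \<epsilon> Q D' \<epsilon>' \<phi> \<longleftrightarrow>
    (\<forall>i. \<phi> i \<in> nat_trans (Sym_cat d) (Q i) (schur d (P i))) \<and>
    (\<forall>i. ncomp (Q (Suc i)) (schur_map d (P (Suc i)) (D i)) (\<phi> (Suc i)) =
         ncomp (Q (Suc i)) (\<phi> i) (D' i)) \<and>
    ncomp (Q 0) (schur_map d (P 0) \<epsilon>) (\<phi> 0) = \<epsilon>'"

definition schur_Ext ::
    "nat \<Rightarrow> (nat \<Rightarrow> ('k::field, 'v) spf) \<Rightarrow> ('k, 'u) spf \<Rightarrow>
     (nat \<Rightarrow> ('k, 'w) sym_mod) \<Rightarrow> (nat \<Rightarrow> unit \<Rightarrow> 'w \<Rightarrow> 'w) \<Rightarrow>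
     (nat \<Rightarrow> unit \<Rightarrow> 'w \<Rightarrow> nat \<Rightarrow> (nat list \<Rightarrow> 'k) \<Rightarrow> 'v) \<Rightarrow> nat \<Rightarrow>
     (nat \<Rightarrow> 'v \<Rightarrow> 'u) set \<Rightarrow> (unit \<Rightarrow> 'w \<Rightarrow> nat \<Rightarrow> (nat list \<Rightarrow> 'k) \<Rightarrow> 'u) set"
  where "schur_Ext d P G Q D' \<phi> k A =
    (\<Union>\<alpha>\<in>A. a_r_coset (hom_module (Sym_cat d) (Q k) (schur d G))
        (Ext_coboundaries (Sym_cat d) Q D' (schur d G) k)
        (ncomp (Q k) (schur_map d (P k) \<alpha>) (\<phi> k)))"

end

theory Submission imports Defs begin

text \<open>
  Write \<open>f\<close> for the Schur functor. The map on Ext is induced by \<open>Hom(P, G) \<rightarrow> Hom(Q, f G)\<close>, so both claims follow once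
  the mapping cone of this map of complexes is acyclic up to a certain degree. As \<open>P\<close> and \<open>Q\<close> are projective and
  \<open>f\<close> is exact, the cone sends short exact sequences in \<open>G\<close> to short exact sequences of complexes.

  The cone is acyclic in all degrees for \<open>G = \<otimes>\<^sup>d \<otimes> V\<close>, because \<open>Hom(F, G) = Hom(f F, f G)\<close> and \<open>f G\<close> is injective, and
  hence for retracts of such functors. Every \<open>G\<close> has a map to some \<open>\<otimes>\<^sup>d \<otimes> V\<close> whose kernel \<open>N\<close> is killed by \<open>f\<close>.

  If \<open>\<lambda>\<close> is \<open>p\<close>-bounded, the order of the Young subgroup of \<open>\<lambda>\<close> is invertible, so \<open>\<Gamma>\<^sup>\<lambda>\<close> is a quotient of \<open>\<otimes>\<^sup>d\<close>
  and \<open>S\<^sup>\<lambda>\<close> embeds in it. Hence \<open>Hom(P', N) = 0\<close> for left \<open>p\<close>-bounded \<open>P'\<close>, and if \<open>F\<close> has a projective resolution with \<open>n\<close>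
  left \<open>p\<close>-bounded terms, dimension shifting along \<open>N \<rightarrow> G \<rightarrow> \<otimes>\<^sup>d \<otimes> V\<close> makes the cone of every \<open>G\<close> acyclic in degrees below \<open>n\<close>.
  A right \<open>p\<close>-bounded injective functor embeds in some \<open>\<otimes>\<^sup>d \<otimes> V\<close>, hence is a retract of it, and each such term at the
  start of an injective resolution of \<open>G\<close> gives one more degree.
\<close>

section \<open>Linear algebra over carriers\<close>

text \<open>The functors \<open>vfun usc d V\<close> are the values of the right adjoint of the
  Schur functor on modules coinduced from vector spaces, which is why maps into them can be computed
  on either side of it.

  An isomorphism below some degree together with an injection in that degree does not pass through
  long exact sequences as one statement, whereas acyclicity of a cone in a single degree does. In
  the indexing used here, degree \<open>k\<close> of the cone controls injectivity in degree
  \<open>k\<close> and surjectivity in degree \<open>k - 1\<close>; this is the source of the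
  \<open>- 1\<close> in the bound.

  The left hand hypothesis gives acyclicity for all coefficients at once. This uniformity is
  essential: dimension shifting produces cokernels about which nothing is known. The two indices add
  because the induction along the injective resolution starts from the uniform statement.

  A practical constraint is the value type: projectivity, \<open>schur_closed\<close> and the cone
  all refer to functors with values in \<open>'v\<close>, so kernels, images, cokernels and hulls
  must be realised inside \<open>'v\<close> again.\<close>

lemma rta_simps [simp]:
  "carrier (ring_of_type_algebra :: 'k::field ring) = UNIV"
  "add (ring_of_type_algebra :: 'k ring) = (+)"
  "monoid.mult (ring_of_type_algebra :: 'k ring) = (*)"
  "ring.zero (ring_of_type_algebra :: 'k ring) = 0"
  "one (ring_of_type_algebra :: 'k ring) = 1"
  by (auto simp: ring_of_type_algebra_def)

text \<open>Additive inverses are supplied by the scalar \<open>-1\<close>, so one equation replaces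
  the existence statement of the group axioms.\<close>

lemma vspaceI:
  fixes M :: "('k::field, 'v) module"
  assumes "\<And>x y. \<lbrakk>x \<in> carrier M; y \<in> carrier M\<rbrakk> \<Longrightarrow> x \<oplus>\<^bsub>M\<^esub> y \<in> carrier M"
    and "\<zero>\<^bsub>M\<^esub> \<in> carrier M"
    and "\<And>x y z. \<lbrakk>x \<in> carrier M; y \<in> carrier M; z \<in> carrier M\<rbrakk> \<Longrightarrow> (x \<oplus>\<^bsub>M\<^esub> y) \<oplus>\<^bsub>M\<^esub> z = x \<oplus>\<^bsub>M\<^esub> (y \<oplus>\<^bsub>M\<^esub> z)"
    and "\<And>x y. \<lbrakk>x \<in> carrier M; y \<in> carrier M\<rbrakk> \<Longrightarrow> x \<oplus>\<^bsub>M\<^esub> y = y \<oplus>\<^bsub>M\<^esub> x"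
    and "\<And>x. x \<in> carrier M \<Longrightarrow> \<zero>\<^bsub>M\<^esub> \<oplus>\<^bsub>M\<^esub> x = x"
    and inv: "\<And>x. x \<in> carrier M \<Longrightarrow> (-1) \<odot>\<^bsub>M\<^esub> x \<oplus>\<^bsub>M\<^esub> x = \<zero>\<^bsub>M\<^esub>"
    and sc: "\<And>r x. x \<in> carrier M \<Longrightarrow> r \<odot>\<^bsub>M\<^esub> x \<in> carrier M"
    and "\<And>r s x. x \<in> carrier M \<Longrightarrow> (r + s) \<odot>\<^bsub>M\<^esub> x = r \<odot>\<^bsub>M\<^esub> x \<oplus>\<^bsub>M\<^esub> s \<odot>\<^bsub>M\<^esub> x"
    and "\<And>r x y. \<lbrakk>x \<in> carrier M; y \<in> carrier M\<rbrakk> \<Longrightarrow> r \<odot>\<^bsub>M\<^esub> (x \<oplus>\<^bsub>M\<^esub> y) = r \<odot>\<^bsub>M\<^esub> x \<oplus>\<^bsub>M\<^esub> r \<odot>\<^bsub>M\<^esub> y"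
    and "\<And>r s x. x \<in> carrier M \<Longrightarrow> (r * s) \<odot>\<^bsub>M\<^esub> x = r \<odot>\<^bsub>M\<^esub> (s \<odot>\<^bsub>M\<^esub> x)"
    and "\<And>x. x \<in> carrier M \<Longrightarrow> 1 \<odot>\<^bsub>M\<^esub> x = x"
  shows "vspace M"
proof (rule moduleI)
  show "abelian_group M"
  proof (rule abelian_groupI)
    show "\<exists>y\<in>carrier M. y \<oplus>\<^bsub>M\<^esub> x = \<zero>\<^bsub>M\<^esub>" if "x \<in> carrier M" for x
      using inv[OF that] sc[OF that] by blast
  qed (fact assms)+
  show "cring (ring_of_type_algebra :: 'k ring)" by (rule cring_from_type_algebra)
qed (simp_all add: assms(7-))

section \<open>Arithmetic in a vector space given by a carrier\<close>

context
  fixes M :: "('k::field, 'v) module"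
  assumes M: "vspace M"
begin

interpretation M: module "ring_of_type_algebra :: 'k ring" M by (rule M)

lemma vs_group: "abelian_group M" by (rule M.abelian_group_axioms)
lemma vs_zero: "\<zero>\<^bsub>M\<^esub> \<in> carrier M" by simp
lemma vs_add: "\<lbrakk>x \<in> carrier M; y \<in> carrier M\<rbrakk> \<Longrightarrow> x \<oplus>\<^bsub>M\<^esub> y \<in> carrier M" by simp
lemma vs_smult: "x \<in> carrier M \<Longrightarrow> r \<odot>\<^bsub>M\<^esub> x \<in> carrier M" by simp
lemma vs_neg: "x \<in> carrier M \<Longrightarrow> \<ominus>\<^bsub>M\<^esub> x \<in> carrier M" by simp
lemma vs_assoc: "\<lbrakk>x \<in> carrier M; y \<in> carrier M; z \<in> carrier M\<rbrakk> \<Longrightarrow> (x \<oplus>\<^bsub>M\<^esub> y) \<oplus>\<^bsub>M\<^esub> z = x \<oplus>\<^bsub>M\<^esub> (y \<oplus>\<^bsub>M\<^esub> z)"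
  by (rule M.a_assoc)
lemma vs_comm: "\<lbrakk>x \<in> carrier M; y \<in> carrier M\<rbrakk> \<Longrightarrow> x \<oplus>\<^bsub>M\<^esub> y = y \<oplus>\<^bsub>M\<^esub> x"
  by (rule M.a_comm)
lemma vs_lcomm: "\<lbrakk>x \<in> carrier M; y \<in> carrier M; z \<in> carrier M\<rbrakk> \<Longrightarrow> x \<oplus>\<^bsub>M\<^esub> (y \<oplus>\<^bsub>M\<^esub> z) = y \<oplus>\<^bsub>M\<^esub> (x \<oplus>\<^bsub>M\<^esub> z)"
  by (rule M.a_lcomm)
lemma vs_zero_add: "x \<in> carrier M \<Longrightarrow> \<zero>\<^bsub>M\<^esub> \<oplus>\<^bsub>M\<^esub> x = x" by simp
lemma vs_add_zero: "x \<in> carrier M \<Longrightarrow> x \<oplus>\<^bsub>M\<^esub> \<zero>\<^bsub>M\<^esub> = x" by simp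
lemma vs_smult_add_left: "x \<in> carrier M \<Longrightarrow> (r + s) \<odot>\<^bsub>M\<^esub> x = r \<odot>\<^bsub>M\<^esub> x \<oplus>\<^bsub>M\<^esub> s \<odot>\<^bsub>M\<^esub> x"
  using M.smult_l_distr[of r s x] by simp
lemma vs_smult_add: "\<lbrakk>x \<in> carrier M; y \<in> carrier M\<rbrakk> \<Longrightarrow> r \<odot>\<^bsub>M\<^esub> (x \<oplus>\<^bsub>M\<^esub> y) = r \<odot>\<^bsub>M\<^esub> x \<oplus>\<^bsub>M\<^esub> r \<odot>\<^bsub>M\<^esub> y"
  using M.smult_r_distr[of r x y] by simp
lemma vs_smult_smult: "x \<in> carrier M \<Longrightarrow> r \<odot>\<^bsub>M\<^esub> (s \<odot>\<^bsub>M\<^esub> x) = (r * s) \<odot>\<^bsub>M\<^esub> x"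
  using M.smult_assoc1[of r s x] by simp
lemma vs_one: "x \<in> carrier M \<Longrightarrow> 1 \<odot>\<^bsub>M\<^esub> x = x"
  using M.smult_one[of x] by simp
lemma vs_smult_zero: "r \<odot>\<^bsub>M\<^esub> \<zero>\<^bsub>M\<^esub> = \<zero>\<^bsub>M\<^esub>"
  using M.smult_r_null[of r] by simp
lemma vs_zero_smult: "x \<in> carrier M \<Longrightarrow> 0 \<odot>\<^bsub>M\<^esub> x = \<zero>\<^bsub>M\<^esub>"
  using M.smult_l_null[of x] by simp
lemma vs_neg_eq: "(-1) \<odot>\<^bsub>M\<^esub> x = \<ominus>\<^bsub>M\<^esub> x" if x: "x \<in> carrier M"
proof (rule M.minus_equality[symmetric])
  have "(-1) \<odot>\<^bsub>M\<^esub> x \<oplus>\<^bsub>M\<^esub> 1 \<odot>\<^bsub>M\<^esub> x = (-1 + 1) \<odot>\<^bsub>M\<^esub> x"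
    by (rule vs_smult_add_left[OF x, symmetric])
  also have "\<dots> = \<zero>\<^bsub>M\<^esub>" using vs_zero_smult[OF x] by (simp only: ab_left_minus)
  finally show "(-1) \<odot>\<^bsub>M\<^esub> x \<oplus>\<^bsub>M\<^esub> x = \<zero>\<^bsub>M\<^esub>" by (simp only: vs_one[OF x])
qed (use x vs_smult in blast)+
lemma vs_lneg: "x \<in> carrier M \<Longrightarrow> \<ominus>\<^bsub>M\<^esub> x \<oplus>\<^bsub>M\<^esub> x = \<zero>\<^bsub>M\<^esub>"
  by (rule M.l_neg)
lemma vs_rneg: "x \<in> carrier M \<Longrightarrow> x \<oplus>\<^bsub>M\<^esub> \<ominus>\<^bsub>M\<^esub> x = \<zero>\<^bsub>M\<^esub>"
  by (rule M.r_neg)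
lemma vs_diff_zero: "\<lbrakk>x \<in> carrier M; y \<in> carrier M; x \<oplus>\<^bsub>M\<^esub> \<ominus>\<^bsub>M\<^esub> y = \<zero>\<^bsub>M\<^esub>\<rbrakk> \<Longrightarrow> x = y"
  using M.minus_equality[of x "\<ominus>\<^bsub>M\<^esub> y"] by (simp add: M.minus_minus)

end

lemmas vs_closed = vs_zero vs_add vs_smult vs_neg

lemma lin_mapsI:
  assumes "\<And>x. x \<in> carrier M \<Longrightarrow> h x \<in> carrier N"
    and "\<And>x y. \<lbrakk>x \<in> carrier M; y \<in> carrier M\<rbrakk> \<Longrightarrow> h (x \<oplus>\<^bsub>M\<^esub> y) = h x \<oplus>\<^bsub>N\<^esub> h y"
    and "\<And>r x. x \<in> carrier M \<Longrightarrow> h (r \<odot>\<^bsub>M\<^esub> x) = r \<odot>\<^bsub>N\<^esub> h x"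
  shows "h \<in> lin_maps M N"
  using assms by (auto simp: lin_maps_def)

lemma lin_maps_closed: "\<lbrakk>h \<in> lin_maps M N; x \<in> carrier M\<rbrakk> \<Longrightarrow> h x \<in> carrier N"
  by (auto simp: lin_maps_def)

lemma lin_maps_add: "\<lbrakk>h \<in> lin_maps M N; x \<in> carrier M; y \<in> carrier M\<rbrakk> \<Longrightarrow> h (x \<oplus>\<^bsub>M\<^esub> y) = h x \<oplus>\<^bsub>N\<^esub> h y"
  by (auto simp: lin_maps_def)

lemma lin_maps_smult: "\<lbrakk>h \<in> lin_maps M N; x \<in> carrier M\<rbrakk> \<Longrightarrow> h (r \<odot>\<^bsub>M\<^esub> x) = r \<odot>\<^bsub>N\<^esub> h x"
  by (auto simp: lin_maps_def)

lemma lin_maps_zero: "\<lbrakk>h \<in> lin_maps M N; vspace M; vspace N\<rbrakk> \<Longrightarrow> h \<zero>\<^bsub>M\<^esub> = \<zero>\<^bsub>N\<^esub>"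
  using lin_maps_smult[of h M N "\<zero>\<^bsub>M\<^esub>" 0]
  by (simp add: vs_zero vs_zero_smult lin_maps_closed[of h])

lemma lin_maps_neg: "\<lbrakk>h \<in> lin_maps M N; vspace M; vspace N; x \<in> carrier M\<rbrakk> \<Longrightarrow> h (\<ominus>\<^bsub>M\<^esub> x) = \<ominus>\<^bsub>N\<^esub> h x"
  using lin_maps_smult[of h M N x "-1"] by (simp add: vs_neg_eq lin_maps_closed[of h])

lemma lin_maps_comp: "\<lbrakk>h \<in> lin_maps M N; g \<in> lin_maps N K\<rbrakk> \<Longrightarrow> (\<lambda>x. g (h x)) \<in> lin_maps M K"
  by (auto simp: lin_maps_def Pi_iff)

section \<open>Subspaces, kernels and images\<close>

definition subsp :: "('k::field, 'v) module \<Rightarrow> 'v set \<Rightarrow> bool"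
  where "subsp M Y \<longleftrightarrow> Y \<subseteq> carrier M \<and> \<zero>\<^bsub>M\<^esub> \<in> Y \<and> (\<forall>x\<in>Y. \<forall>y\<in>Y. x \<oplus>\<^bsub>M\<^esub> y \<in> Y) \<and>
    (\<forall>r. \<forall>x\<in>Y. r \<odot>\<^bsub>M\<^esub> x \<in> Y)"

lemma subspD:
  assumes "subsp M Y"
  shows "Y \<subseteq> carrier M" "\<zero>\<^bsub>M\<^esub> \<in> Y" "\<lbrakk>x \<in> Y; y \<in> Y\<rbrakk> \<Longrightarrow> x \<oplus>\<^bsub>M\<^esub> y \<in> Y" "x \<in> Y \<Longrightarrow> r \<odot>\<^bsub>M\<^esub> x \<in> Y"
  using assms by (auto simp: subsp_def)

lemma subsp_vspace:
  assumes "vspace M" "subsp M Y"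
  shows "vspace (M\<lparr>carrier := Y\<rparr>)"
proof (rule vspaceI)
  have Y: "x \<in> carrier M" if "x \<in> Y" for x using subspD(1)[OF assms(2)] that by blast
  fix x assume "x \<in> carrier (M\<lparr>carrier := Y\<rparr>)"
  then show "(- 1) \<odot>\<^bsub>M\<lparr>carrier := Y\<rparr>\<^esub> x \<oplus>\<^bsub>M\<lparr>carrier := Y\<rparr>\<^esub> x = \<zero>\<^bsub>M\<lparr>carrier := Y\<rparr>\<^esub>"
    by (simp add: Y vs_neg_eq[OF assms(1)] vs_lneg[OF assms(1)])
qed (use assms in \<open>auto simp: subsp_def subset_iff vs_assoc vs_zero_add vs_smult_add_left
    vs_smult_add vs_smult_smult vs_one intro: vs_comm\<close>)

lemma subsp_kernel:
  assumes "vspace M" "vspace N" "h \<in> lin_maps M N"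
  shows "subsp M {x \<in> carrier M. h x = \<zero>\<^bsub>N\<^esub>}"
  using assms by (auto simp: subsp_def vs_closed lin_maps_zero lin_maps_add lin_maps_smult
      vs_zero_add vs_smult_zero)

lemma subsp_image:
  assumes "vspace M" "vspace N" "h \<in> lin_maps M N"
  shows "subsp N (h ` carrier M)"
  unfolding subsp_def
proof (intro conjI ballI allI)
  show "\<zero>\<^bsub>N\<^esub> \<in> h ` carrier M" using assms by (metis imageI lin_maps_zero vs_zero)
  show "h ` carrier M \<subseteq> carrier N" using assms(3) by (auto simp: lin_maps_closed)
  show "x \<oplus>\<^bsub>N\<^esub> y \<in> h ` carrier M" if "x \<in> h ` carrier M" "y \<in> h ` carrier M" for x y
    using that assms by (auto simp flip: lin_maps_add intro!: vs_add)
  show "r \<odot>\<^bsub>N\<^esub> x \<in> h ` carrier M" if "x \<in> h ` carrier M" for x r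
    using that assms by (auto simp flip: lin_maps_smult intro!: vs_smult)
qed

text \<open>
  A type with the structure of a vector space that contains every \<open>'v\<close>-valued vector space as a
  direct summand: the product of all of them. It makes \<open>sum\<close> and the results of
  \<open>vector_space\<close> available for spaces given by carriers.
\<close>

typedef (overloaded) ('k::field, 'v) usp =
  "{f :: ('k, 'v) module \<Rightarrow> 'v. \<forall>M. if vspace M then f M \<in> carrier M else f M = undefined}"
proof
  show "(\<lambda>M. if vspace M then \<zero>\<^bsub>M\<^esub> else undefined) \<in> ?usp"
    by (simp add: vs_zero)
qed

setup_lifting type_definition_usp

lemma usp_ext:
  assumes "\<And>M. vspace M \<Longrightarrow> Rep_usp f M = Rep_usp g M"
  shows "f = g"
proof -
  have "Rep_usp f M = Rep_usp g M" for M
    using assms[of M] Rep_usp[of f] Rep_usp[of g] by (cases "vspace M") auto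
  then show ?thesis by (simp add: Rep_usp_inject[symmetric] fun_eq_iff)
qed

instantiation usp :: (field, type) ab_group_add
begin

lift_definition zero_usp :: "('a, 'b) usp" is "\<lambda>M. if vspace M then \<zero>\<^bsub>M\<^esub> else undefined"
  by (auto simp: vs_closed)
lift_definition plus_usp :: "('a, 'b) usp \<Rightarrow> ('a, 'b) usp \<Rightarrow> ('a, 'b) usp"
  is "\<lambda>f g M. if vspace M then f M \<oplus>\<^bsub>M\<^esub> g M else undefined"
  by (auto intro!: vs_closed split: if_splits)
lift_definition uminus_usp :: "('a, 'b) usp \<Rightarrow> ('a, 'b) usp"
  is "\<lambda>f M. if vspace M then \<ominus>\<^bsub>M\<^esub> f M else undefined"
  by (auto intro!: vs_closed split: if_splits)
definition minus_usp :: "('a, 'b) usp \<Rightarrow> ('a, 'b) usp \<Rightarrow> ('a, 'b) usp"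
  where "minus_usp f g = f + - g"

instance
proof
  have car: "vspace M \<Longrightarrow> Rep_usp f M \<in> carrier M" for f :: "('a, 'b) usp" and M
    using Rep_usp[of f] by (auto split: if_splits)
  fix a b c :: "('a, 'b) usp"
  show "a + b + c = a + (b + c)"
    by (rule usp_ext) (simp add: plus_usp.rep_eq car vs_assoc)
  show "a + b = b + a"
    by (rule usp_ext) (auto simp: plus_usp.rep_eq car intro: vs_comm)
  show "0 + a = a"
    by (rule usp_ext) (simp add: plus_usp.rep_eq zero_usp.rep_eq car vs_zero_add)
  show "- a + a = 0"
    by (rule usp_ext) (simp add: plus_usp.rep_eq zero_usp.rep_eq uminus_usp.rep_eq car vs_lneg)
  show "a - b = a + - b"
    by (simp add: minus_usp_def)
qed

end

lift_definition usc :: "'k::field \<Rightarrow> ('k, 'v) usp \<Rightarrow> ('k, 'v) usp"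
  is "\<lambda>r f M. if vspace M then r \<odot>\<^bsub>M\<^esub> f M else undefined"
  by (auto intro!: vs_closed split: if_splits)

text \<open>Together with \<open>uin\<close>, the projection onto and the inclusion of the factor
  indexed by \<open>M\<close>. They carry arguments from \<open>M\<close> to \<open>usp\<close> and
  back.\<close>

lift_definition upr :: "('k::field, 'v) module \<Rightarrow> ('k, 'v) usp \<Rightarrow> 'v" is "\<lambda>M f. f M" .

lift_definition uin :: "('k::field, 'v) module \<Rightarrow> 'v \<Rightarrow> ('k, 'v) usp"
  is "\<lambda>M x N. if vspace N then (if N = M \<and> x \<in> carrier M then x else \<zero>\<^bsub>N\<^esub>) else undefined"
  by (auto simp: vs_closed)

lemma upr_closed: "vspace M \<Longrightarrow> upr M f \<in> carrier M"
  by transfer auto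

lemma upr_add: "vspace M \<Longrightarrow> upr M (f + g) = upr M f \<oplus>\<^bsub>M\<^esub> upr M g"
  by transfer auto

lemma upr_usc: "vspace M \<Longrightarrow> upr M (usc r f) = r \<odot>\<^bsub>M\<^esub> upr M f"
  by transfer auto

lemma upr_uin: "\<lbrakk>vspace M; x \<in> carrier M\<rbrakk> \<Longrightarrow> upr M (uin M x) = x"
  by transfer auto

lemma uin_add: "\<lbrakk>vspace M; x \<in> carrier M; y \<in> carrier M\<rbrakk> \<Longrightarrow> uin M (x \<oplus>\<^bsub>M\<^esub> y) = uin M x + uin M y"
  by transfer (auto simp: fun_eq_iff vs_closed vs_zero_add)

lemma uin_smult: "\<lbrakk>vspace M; x \<in> carrier M\<rbrakk> \<Longrightarrow> uin M (r \<odot>\<^bsub>M\<^esub> x) = usc r (uin M x)"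
  by transfer (auto simp: fun_eq_iff vs_closed vs_smult_zero)

lemma uin_zero: "vspace M \<Longrightarrow> uin M \<zero>\<^bsub>M\<^esub> = 0"
  by transfer (auto simp: fun_eq_iff vs_closed)

lemma uin_inject: "\<lbrakk>vspace M; x \<in> carrier M; y \<in> carrier M\<rbrakk> \<Longrightarrow> uin M x = uin M y \<longleftrightarrow> x = y"
  by (metis upr_uin)

interpretation usp: vector_space "usc :: 'k::field \<Rightarrow> ('k, 'v) usp \<Rightarrow> ('k, 'v) usp"
proof
  fix a b :: 'k and x y :: "('k, 'v) usp"
  have car: "vspace M \<Longrightarrow> Rep_usp f M \<in> carrier M" for f :: "('k, 'v) usp" and M
    using Rep_usp[of f] by (auto split: if_splits)
  show "usc a (x + y) = usc a x + usc a y"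
    by (rule usp_ext) (simp add: usc.rep_eq plus_usp.rep_eq car vs_smult_add)
  show "usc (a + b) x = usc a x + usc b x"
    by (rule usp_ext) (simp add: usc.rep_eq plus_usp.rep_eq car vs_smult_add_left)
  show "usc a (usc b x) = usc (a * b) x"
    by (rule usp_ext) (simp add: usc.rep_eq car vs_smult_smult)
  show "usc 1 x = x"
    by (rule usp_ext) (simp add: usc.rep_eq car vs_one)
qed

interpretation usp: vector_space_pair "usc :: 'k::field \<Rightarrow> ('k, 'v) usp \<Rightarrow> ('k, 'v) usp"
    "usc :: 'k::field \<Rightarrow> ('k, 'v) usp \<Rightarrow> ('k, 'v) usp"
  by standard

lemma usp_subspace_image:
  assumes "vspace M" "subsp M Y"
  shows "usp.subspace (uin M ` Y)"
  unfolding usp.subspace_def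
proof (intro conjI ballI allI)
  have Y: "x \<in> carrier M" if "x \<in> Y" for x using subspD(1)[OF assms(2)] that by blast
  show "0 \<in> uin M ` Y" using uin_zero[OF assms(1)] subspD(2)[OF assms(2)] by (metis imageI)
  show "x + y \<in> uin M ` Y" if "x \<in> uin M ` Y" "y \<in> uin M ` Y" for x y
    using that assms subspD(3)[OF assms(2)] by (auto simp: Y simp flip: uin_add)
  show "usc c x \<in> uin M ` Y" if "x \<in> uin M ` Y" for x c
    using that assms subspD(4)[OF assms(2)] by (auto simp: Y simp flip: uin_smult)
qed

text \<open>Every subspace has a complement. The projection is found in \<open>usp\<close>, where
  results about vector space types apply, and then read back with \<open>upr M\<close>.\<close>

lemma subsp_projection:
  assumes M: "vspace M" and Y: "subsp M Y"
  obtains q where "q \<in> lin_maps M M" "\<And>x. x \<in> carrier M \<Longrightarrow> q x \<in> Y" "\<And>x. x \<in> Y \<Longrightarrow> q x = x"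
proof -
  have XM: "x \<in> carrier M" if "x \<in> Y" for x using subspD(1)[OF Y] that by blast
  \<comment> \<open>The identity of \<open>usp\<close> is injective on the subspace; a linear left
    inverse of it that takes values in the subspace is a projection.\<close>
  have "\<exists>g. g ` UNIV \<subseteq> uin M ` Y \<and> Vector_Spaces.linear usc usc g \<and> (\<forall>v\<in>uin M ` Y. g (id v) = v)"
    by (rule usp.linear_exists_left_inverse_on)
      (simp_all add: usp_subspace_image[OF assms] usp.linear_ident inj_on_def)
  then obtain g where g: "\<And>v. g v \<in> uin M ` Y" "Vector_Spaces.linear usc usc g" "\<And>x. x \<in> Y \<Longrightarrow> g (uin M x) = uin M x"
    by (auto simp: image_subset_iff)
  interpret g: Vector_Spaces.linear usc usc g by (rule g(2))
  define q where "q x = upr M (g (uin M x))" for x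
  show ?thesis
  proof
    show "q \<in> lin_maps M M"
      by (rule lin_mapsI) (simp_all add: q_def uin_add uin_smult upr_closed M g.add g.scale upr_add upr_usc)
    show "q x \<in> Y" for x
      using g(1)[of "uin M x"] XM M by (auto simp: q_def upr_uin)
    show "q x = x" if "x \<in> Y" for x
      using g(3)[OF that] XM[OF that] M by (simp add: q_def upr_uin)
  qed
qed

text \<open>Precompose with a projection onto \<open>Y\<close>. This injectivity of vector spaces is
  what later makes the coinduced modules injective.\<close>

lemma linear_extension:
  assumes M: "vspace M" and N: "vspace N" and Y: "subsp M Y" and h: "h \<in> lin_maps (M\<lparr>carrier := Y\<rparr>) N"
  obtains g where "g \<in> lin_maps M N" "\<And>x. x \<in> Y \<Longrightarrow> g x = h x"
proof -
  obtain q where q: "q \<in> lin_maps M M" "\<And>x. x \<in> carrier M \<Longrightarrow> q x \<in> Y" "\<And>x. x \<in> Y \<Longrightarrow> q x = x"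
    using subsp_projection[OF M Y] by metis
  have "q \<in> lin_maps M (M\<lparr>carrier := Y\<rparr>)"
    using q by (auto simp: lin_maps_def)
  then have "(\<lambda>x. h (q x)) \<in> lin_maps M N" using h by (rule lin_maps_comp)
  then show ?thesis using q(3) by (metis that)
qed

section \<open>Functor categories\<close>

lemma
  assumes "is_functor C F"
  shows fun_vs: "vspace (Ob F a)"
    and fun_lin: "f \<in> Hom C a b \<Longrightarrow> Mp F a b f \<in> lin_maps (Ob F a) (Ob F b)"
    and fun_closed: "\<lbrakk>f \<in> Hom C a b; x \<in> carrier (Ob F a)\<rbrakk> \<Longrightarrow> Mp F a b f x \<in> carrier (Ob F b)"
    and fun_add: "\<lbrakk>f \<in> Hom C a b; g \<in> Hom C a b; x \<in> carrier (Ob F a)\<rbrakk> \<Longrightarrow>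
      Mp F a b (f + g) x = Mp F a b f x \<oplus>\<^bsub>Ob F b\<^esub> Mp F a b g x"
    and fun_scale: "\<lbrakk>f \<in> Hom C a b; x \<in> carrier (Ob F a)\<rbrakk> \<Longrightarrow>
      Mp F a b (fscale r f) x = r \<odot>\<^bsub>Ob F b\<^esub> Mp F a b f x"
    and fun_id: "x \<in> carrier (Ob F a) \<Longrightarrow> Mp F a a (Idn C a) x = x"
    and fun_comp: "\<lbrakk>f \<in> Hom C a b; g \<in> Hom C b c; x \<in> carrier (Ob F a)\<rbrakk> \<Longrightarrow>
      Mp F a c (Cmp C a b c g f) x = Mp F b c g (Mp F a b f x)"
proof -
  note R = assms[unfolded is_functor_def]
  show "vspace (Ob F a)" using R by simp
  show "Mp F a b f \<in> lin_maps (Ob F a) (Ob F b)" if "f \<in> Hom C a b" for f using R that by simp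
  from lin_maps_closed[OF this] show "Mp F a b f x \<in> carrier (Ob F b)"
    if "f \<in> Hom C a b" "x \<in> carrier (Ob F a)"
    using that by simp
qed (use assms in \<open>simp_all add: is_functor_def\<close>)

lemma
  assumes "\<eta> \<in> nat_trans C F G"
  shows nt_lin: "\<eta> a \<in> lin_maps (Ob F a) (Ob G a)"
    and nt_ext: "\<eta> a \<in> extensional (carrier (Ob F a))"
    and nt_nat: "\<lbrakk>f \<in> Hom C a b; x \<in> carrier (Ob F a)\<rbrakk> \<Longrightarrow> \<eta> b (Mp F a b f x) = Mp G a b f (\<eta> a x)"
  using assms unfolding nat_trans_def by auto

lemma nt_closed: "\<lbrakk>\<eta> \<in> nat_trans C F G; x \<in> carrier (Ob F a)\<rbrakk> \<Longrightarrow> \<eta> a x \<in> carrier (Ob G a)"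
  by (rule lin_maps_closed[OF nt_lin])

lemma nt_add: "\<lbrakk>\<eta> \<in> nat_trans C F G; x \<in> carrier (Ob F a); y \<in> carrier (Ob F a)\<rbrakk> \<Longrightarrow>
    \<eta> a (x \<oplus>\<^bsub>Ob F a\<^esub> y) = \<eta> a x \<oplus>\<^bsub>Ob G a\<^esub> \<eta> a y"
  by (rule lin_maps_add[OF nt_lin])

lemma nt_smult: "\<lbrakk>\<eta> \<in> nat_trans C F G; x \<in> carrier (Ob F a)\<rbrakk> \<Longrightarrow>
    \<eta> a (r \<odot>\<^bsub>Ob F a\<^esub> x) = r \<odot>\<^bsub>Ob G a\<^esub> \<eta> a x"
  by (rule lin_maps_smult[OF nt_lin])

lemma nt_zero: "\<lbrakk>\<eta> \<in> nat_trans C F G; is_functor C F; is_functor C G\<rbrakk> \<Longrightarrow> \<eta> a \<zero>\<^bsub>Ob F a\<^esub> = \<zero>\<^bsub>Ob G a\<^esub>"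
  by (rule lin_maps_zero[OF nt_lin fun_vs fun_vs])

lemma nt_neg: "\<lbrakk>\<eta> \<in> nat_trans C F G; is_functor C F; is_functor C G; x \<in> carrier (Ob F a)\<rbrakk> \<Longrightarrow>
    \<eta> a (\<ominus>\<^bsub>Ob F a\<^esub> x) = \<ominus>\<^bsub>Ob G a\<^esub> \<eta> a x"
  by (rule lin_maps_neg[OF nt_lin fun_vs fun_vs])

lemma nt_eqI:
  assumes "\<eta> \<in> nat_trans C F G" "\<theta> \<in> nat_trans C F H"
    and "\<And>a x. x \<in> carrier (Ob F a) \<Longrightarrow> \<eta> a x = \<theta> a x"
  shows "\<eta> = \<theta>"
proof
  fix a show "\<eta> a = \<theta> a"
    by (rule extensionalityI[OF nt_ext[OF assms(1)] nt_ext[OF assms(2)] assms(3)])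
qed

text \<open>Restricting to the carriers makes any family of maps extensional, as
  \<open>nat_trans\<close> demands; all transformations below are built this way.\<close>

definition ntr :: "('o, 'x, 'k, 'v) linfun \<Rightarrow> ('o \<Rightarrow> 'v \<Rightarrow> 'w) \<Rightarrow> 'o \<Rightarrow> 'v \<Rightarrow> 'w"
  where "ntr F h = (\<lambda>a. \<lambda>x\<in>carrier (Ob F a). h a x)"

lemma ntr_apply [simp]: "x \<in> carrier (Ob F a) \<Longrightarrow> ntr F h a x = h a x"
  by (simp add: ntr_def)

lemma ntrI:
  assumes F: "is_functor C F" and lin: "\<And>a. h a \<in> lin_maps (Ob F a) (Ob G a)"
    and nat: "\<And>a b f x. \<lbrakk>f \<in> Hom C a b; x \<in> carrier (Ob F a)\<rbrakk> \<Longrightarrow> h b (Mp F a b f x) = Mp G a b f (h a x)"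
  shows "ntr F h \<in> nat_trans C F G"
  unfolding nat_trans_def
proof (intro CollectI conjI allI ballI IntI)
  fix a
  show "ntr F h a \<in> lin_maps (Ob F a) (Ob G a)"
    using lin[of a] fun_vs[OF F, of a]
    by (intro lin_mapsI) (simp_all add: ntr_def vs_closed lin_maps_closed[of "h a"] lin_maps_add[of "h a"] lin_maps_smult[of "h a"])
  show "ntr F h a \<in> extensional (carrier (Ob F a))" by (simp add: ntr_def)
qed (simp add: fun_closed[OF F] nat)

lemma ncomp_apply [simp]: "x \<in> carrier (Ob F a) \<Longrightarrow> ncomp F \<eta> \<theta> a x = \<eta> a (\<theta> a x)"
  by (simp add: ncomp_def compose_def)

lemma ncomp_ntr: "ncomp F \<eta> \<theta> = ntr F (\<lambda>a x. \<eta> a (\<theta> a x))"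
  by (simp add: ncomp_def ntr_def compose_def)

lemma ncomp_closed:
  assumes "is_functor C F" "\<theta> \<in> nat_trans C F G" "\<eta> \<in> nat_trans C G H"
  shows "ncomp F \<eta> \<theta> \<in> nat_trans C F H"
  unfolding ncomp_ntr
  by (rule ntrI[OF assms(1)])
    (simp_all add: lin_maps_comp[OF nt_lin[OF assms(2)] nt_lin[OF assms(3)]] nt_nat[OF assms(2)]
      nt_nat[OF assms(3)] nt_closed[OF assms(2)])

text \<open>The restriction hidden in \<open>ncomp G\<close> is harmless because \<theta> lands in
  the carriers of \<open>G\<close>; nothing is asked of the other two maps.\<close>

lemma ncomp_assoc:
  assumes "\<theta> \<in> nat_trans C F G"
  shows "ncomp F (ncomp G \<kappa> \<eta>) \<theta> = ncomp F \<kappa> (ncomp F \<eta> \<theta>)"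
  by (intro ext) (simp add: ncomp_def compose_def nt_closed[OF assms])

definition idn :: "('o, 'x, 'k, 'v) linfun \<Rightarrow> 'o \<Rightarrow> 'v \<Rightarrow> 'v"
  where "idn F = ntr F (\<lambda>a x. x)"

lemma idn_apply [simp]: "x \<in> carrier (Ob F a) \<Longrightarrow> idn F a x = x"
  by (simp add: idn_def)

lemma idn_closed: "is_functor C F \<Longrightarrow> idn F \<in> nat_trans C F F"
  unfolding idn_def by (rule ntrI) (auto simp: lin_maps_def)

lemma ncomp_idn_left:
  assumes "\<eta> \<in> nat_trans C F G" shows "ncomp F (idn G) \<eta> = \<eta>"
proof (intro ext)
  fix a x show "ncomp F (idn G) \<eta> a x = \<eta> a x"
    using nt_closed[OF assms, of x a] extensional_arb[OF nt_ext[OF assms], of x a]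
    by (cases "x \<in> carrier (Ob F a)") (simp_all add: ncomp_def compose_def)
qed

section \<open>Spaces of natural transformations\<close>

lemma hom_simps [simp]:
  "carrier (hom_module C F G) = nat_trans C F G"
  "x \<in> carrier (Ob F a) \<Longrightarrow> (\<eta> \<oplus>\<^bsub>hom_module C F G\<^esub> \<theta>) a x = \<eta> a x \<oplus>\<^bsub>Ob G a\<^esub> \<theta> a x"
  "x \<in> carrier (Ob F a) \<Longrightarrow> (r \<odot>\<^bsub>hom_module C F G\<^esub> \<eta>) a x = r \<odot>\<^bsub>Ob G a\<^esub> \<eta> a x"
  "x \<in> carrier (Ob F a) \<Longrightarrow> \<zero>\<^bsub>hom_module C F G\<^esub> a x = \<zero>\<^bsub>Ob G a\<^esub>"
  by (simp_all add: hom_module_def)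

lemma hom_vspace:
  fixes F :: "('o, 'x, 'k::field, 'v) linfun" and G :: "('o, 'x, 'k, 'w) linfun"
  assumes F: "is_functor C F" and G: "is_functor C G"
  shows "vspace (hom_module C F G)"
proof -
  let ?H = "hom_module C F G"
  note V = fun_vs[OF G]
  have add: "\<eta> \<oplus>\<^bsub>?H\<^esub> \<theta> \<in> nat_trans C F G" if e: "\<eta> \<in> nat_trans C F G" "\<theta> \<in> nat_trans C F G" for \<eta> \<theta>
  proof -
    have "ntr F (\<lambda>a x. \<eta> a x \<oplus>\<^bsub>Ob G a\<^esub> \<theta> a x) \<in> nat_trans C F G"
    proof (rule ntrI[OF F])
      fix a show "(\<lambda>x. \<eta> a x \<oplus>\<^bsub>Ob G a\<^esub> \<theta> a x) \<in> lin_maps (Ob F a) (Ob G a)"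
        by (rule lin_mapsI) (simp_all add: nt_closed[OF e(1)] nt_closed[OF e(2)] nt_add[OF e(1)] nt_add[OF e(2)]
            nt_smult[OF e(1)] nt_smult[OF e(2)] vs_closed V vs_smult_add vs_assoc vs_lcomm)
    qed (simp add: nt_nat[OF e(1)] nt_nat[OF e(2)] lin_maps_add[OF fun_lin[OF G]] nt_closed[OF e(1)] nt_closed[OF e(2)])
    then show ?thesis by (simp add: hom_module_def ntr_def)
  qed
  have sm: "r \<odot>\<^bsub>?H\<^esub> \<eta> \<in> nat_trans C F G" if e: "\<eta> \<in> nat_trans C F G" for \<eta> r
  proof -
    have "ntr F (\<lambda>a x. r \<odot>\<^bsub>Ob G a\<^esub> \<eta> a x) \<in> nat_trans C F G"
    proof (rule ntrI[OF F])
      fix a show "(\<lambda>x. r \<odot>\<^bsub>Ob G a\<^esub> \<eta> a x) \<in> lin_maps (Ob F a) (Ob G a)"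
        by (rule lin_mapsI) (simp_all add: nt_closed[OF e] nt_add[OF e] nt_smult[OF e] vs_closed V
            vs_smult_add vs_smult_smult mult.commute)
    qed (simp add: nt_nat[OF e] lin_maps_smult[OF fun_lin[OF G]] nt_closed[OF e])
    then show ?thesis by (simp add: hom_module_def ntr_def)
  qed
  have z: "\<zero>\<^bsub>?H\<^esub> \<in> nat_trans C F G"
  proof -
    have "ntr F (\<lambda>a x. \<zero>\<^bsub>Ob G a\<^esub>) \<in> nat_trans C F G"
      by (rule ntrI[OF F]) (auto intro!: lin_mapsI simp: vs_closed V vs_zero_add vs_smult_zero
          lin_maps_zero[OF fun_lin[OF G] V V])
    then show ?thesis by (simp add: hom_module_def ntr_def)
  qed
  show ?thesis
  proof (rule vspaceI)
    fix \<eta> \<theta> \<kappa> r s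
    assume e: "\<eta> \<in> carrier ?H" "\<theta> \<in> carrier ?H" "\<kappa> \<in> carrier ?H"
    note cl = e[simplified] add sm z nt_closed[of _ C F G] V
    show "\<eta> \<oplus>\<^bsub>?H\<^esub> \<theta> \<oplus>\<^bsub>?H\<^esub> \<kappa> = \<eta> \<oplus>\<^bsub>?H\<^esub> (\<theta> \<oplus>\<^bsub>?H\<^esub> \<kappa>)"
      by (rule nt_eqI[where C=C and F=F and G=G and H=G]) (simp_all add: cl vs_assoc)
    show "\<eta> \<oplus>\<^bsub>?H\<^esub> \<theta> = \<theta> \<oplus>\<^bsub>?H\<^esub> \<eta>"
      by (rule nt_eqI[where C=C and F=F and G=G and H=G]) (simp_all add: cl vs_comm)
    show "r \<odot>\<^bsub>?H\<^esub> (\<eta> \<oplus>\<^bsub>?H\<^esub> \<theta>) = r \<odot>\<^bsub>?H\<^esub> \<eta> \<oplus>\<^bsub>?H\<^esub> r \<odot>\<^bsub>?H\<^esub> \<theta>"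
      by (rule nt_eqI[where C=C and F=F and G=G and H=G]) (simp_all add: cl vs_smult_add)
  next
    fix \<eta> r s assume e: "\<eta> \<in> carrier ?H"
    note cl = e[simplified] add sm z nt_closed[of _ C F G] V
    show "\<zero>\<^bsub>?H\<^esub> \<oplus>\<^bsub>?H\<^esub> \<eta> = \<eta>"
      by (rule nt_eqI[where C=C and F=F and G=G and H=G]) (simp_all add: cl vs_zero_add)
    show "- 1 \<odot>\<^bsub>?H\<^esub> \<eta> \<oplus>\<^bsub>?H\<^esub> \<eta> = \<zero>\<^bsub>?H\<^esub>"
      by (rule nt_eqI[where C=C and F=F and G=G and H=G]) (simp_all add: cl vs_neg_eq vs_lneg)
    show "(r + s) \<odot>\<^bsub>?H\<^esub> \<eta> = r \<odot>\<^bsub>?H\<^esub> \<eta> \<oplus>\<^bsub>?H\<^esub> s \<odot>\<^bsub>?H\<^esub> \<eta>"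
      by (rule nt_eqI[where C=C and F=F and G=G and H=G]) (simp_all add: cl vs_smult_add_left)
    show "(r * s) \<odot>\<^bsub>?H\<^esub> \<eta> = r \<odot>\<^bsub>?H\<^esub> (s \<odot>\<^bsub>?H\<^esub> \<eta>)"
      by (rule nt_eqI[where C=C and F=F and G=G and H=G]) (simp_all add: cl vs_smult_smult)
    show "1 \<odot>\<^bsub>?H\<^esub> \<eta> = \<eta>"
      by (rule nt_eqI[where C=C and F=F and G=G and H=G]) (simp_all add: cl vs_one)
  qed (simp_all add: add sm z)
qed

lemma hom_neg:
  assumes "is_functor C F" "is_functor C G" "\<eta> \<in> nat_trans C F G" "x \<in> carrier (Ob F a)"
  shows "(\<ominus>\<^bsub>hom_module C F G\<^esub> \<eta>) a x = \<ominus>\<^bsub>Ob G a\<^esub> \<eta> a x"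
  using vs_neg_eq[OF hom_vspace[OF assms(1,2)], of \<eta>] vs_neg_eq[OF fun_vs[OF assms(2)] nt_closed[OF assms(3,4)]]
    assms by (metis hom_simps(1,3))

lemma hom_closed:
  assumes "is_functor C F" "is_functor C G"
  shows "\<zero>\<^bsub>hom_module C F G\<^esub> \<in> nat_trans C F G"
    and "\<lbrakk>\<eta> \<in> nat_trans C F G; \<theta> \<in> nat_trans C F G\<rbrakk> \<Longrightarrow> \<eta> \<oplus>\<^bsub>hom_module C F G\<^esub> \<theta> \<in> nat_trans C F G"
    and "\<eta> \<in> nat_trans C F G \<Longrightarrow> \<ominus>\<^bsub>hom_module C F G\<^esub> \<eta> \<in> nat_trans C F G"
    and "\<eta> \<in> nat_trans C F G \<Longrightarrow> r \<odot>\<^bsub>hom_module C F G\<^esub> \<eta> \<in> nat_trans C F G"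
  using vs_closed[OF hom_vspace[OF assms]] by simp_all

lemma precomp_lin:
  assumes "is_functor C F" "is_functor C G" "is_functor C H" "\<theta> \<in> nat_trans C F G"
  shows "(\<lambda>\<eta>. ncomp F \<eta> \<theta>) \<in> lin_maps (hom_module C G H) (hom_module C F H)"
proof (rule lin_mapsI)
  fix \<eta> \<kappa> r assume e: "\<eta> \<in> carrier (hom_module C G H)" and k: "\<kappa> \<in> carrier (hom_module C G H)"
  show "ncomp F \<eta> \<theta> \<in> carrier (hom_module C F H)" using assms e by (simp add: ncomp_closed)
  show "ncomp F (\<eta> \<oplus>\<^bsub>hom_module C G H\<^esub> \<kappa>) \<theta> = ncomp F \<eta> \<theta> \<oplus>\<^bsub>hom_module C F H\<^esub> ncomp F \<kappa> \<theta>"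
    by (rule nt_eqI[where C=C and F=F and G=H and H=H])
      (use assms e k in \<open>simp_all add: ncomp_closed hom_closed nt_closed\<close>)
  show "ncomp F (r \<odot>\<^bsub>hom_module C G H\<^esub> \<eta>) \<theta> = r \<odot>\<^bsub>hom_module C F H\<^esub> ncomp F \<eta> \<theta>"
    by (rule nt_eqI[where C=C and F=F and G=H and H=H])
      (use assms e k in \<open>simp_all add: ncomp_closed hom_closed nt_closed\<close>)
qed

lemma postcomp_lin:
  assumes "is_functor C F" "is_functor C G" "is_functor C H" "\<eta> \<in> nat_trans C G H"
  shows "(\<lambda>\<theta>. ncomp F \<eta> \<theta>) \<in> lin_maps (hom_module C F G) (hom_module C F H)"
proof (rule lin_mapsI)
  fix \<theta> \<kappa> r assume e: "\<theta> \<in> carrier (hom_module C F G)" and k: "\<kappa> \<in> carrier (hom_module C F G)"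
  show "ncomp F \<eta> \<theta> \<in> carrier (hom_module C F H)" using assms e by (simp add: ncomp_closed)
  show "ncomp F \<eta> (\<theta> \<oplus>\<^bsub>hom_module C F G\<^esub> \<kappa>) = ncomp F \<eta> \<theta> \<oplus>\<^bsub>hom_module C F H\<^esub> ncomp F \<eta> \<kappa>"
    by (rule nt_eqI[where C=C and F=F and G=H and H=H])
      (use assms e k in \<open>simp_all add: ncomp_closed[OF assms(1) _ assms(4)] hom_closed nt_closed nt_add[of \<eta> C]\<close>)
  show "ncomp F \<eta> (r \<odot>\<^bsub>hom_module C F G\<^esub> \<theta>) = r \<odot>\<^bsub>hom_module C F H\<^esub> ncomp F \<eta> \<theta>"
    by (rule nt_eqI[where C=C and F=F and G=H and H=H])
      (use assms e k in \<open>simp_all add: ncomp_closed[OF assms(1) _ assms(4)] hom_closed nt_closed nt_smult[of \<eta> C]\<close>)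
qed

lemma ncomp_zero_left:
  assumes "is_functor C F" "is_functor C G" "is_functor C H" "\<theta> \<in> nat_trans C F G"
  shows "ncomp F \<zero>\<^bsub>hom_module C G H\<^esub> \<theta> = \<zero>\<^bsub>hom_module C F H\<^esub>"
  using lin_maps_zero[OF precomp_lin[OF assms] hom_vspace hom_vspace] assms by simp

lemma ncomp_zero_right:
  assumes "is_functor C F" "is_functor C G" "is_functor C H" "\<eta> \<in> nat_trans C G H"
  shows "ncomp F \<eta> \<zero>\<^bsub>hom_module C F G\<^esub> = \<zero>\<^bsub>hom_module C F H\<^esub>"
  using lin_maps_zero[OF postcomp_lin[OF assms] hom_vspace hom_vspace] assms by simp

subsection \<open>Subfunctors, quotients, transport\<close>

definition subfun :: "('o, 'x, 'k, 'v) linfun \<Rightarrow> ('o \<Rightarrow> 'v set) \<Rightarrow> ('o, 'x, 'k, 'v) linfun"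
  where "subfun F Y = F\<lparr>Ob := (\<lambda>a. (Ob F a)\<lparr>carrier := Y a\<rparr>)\<rparr>"

definition subf :: "('o, 'x, 'k::field) lincat \<Rightarrow> ('o, 'x, 'k, 'v) linfun \<Rightarrow> ('o \<Rightarrow> 'v set) \<Rightarrow> bool"
  where "subf C F Y \<longleftrightarrow> (\<forall>a. subsp (Ob F a) (Y a)) \<and> (\<forall>a b. \<forall>f\<in>Hom C a b. \<forall>x\<in>Y a. Mp F a b f x \<in> Y b)"

lemma subfun_simps [simp]:
  "Ob (subfun F Y) a = (Ob F a)\<lparr>carrier := Y a\<rparr>" "Mp (subfun F Y) = Mp F"
  by (simp_all add: subfun_def)

lemma subf_carrier: "\<lbrakk>subf C F Y; x \<in> Y a\<rbrakk> \<Longrightarrow> x \<in> carrier (Ob F a)"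
  by (meson subf_def subsetD subspD(1))

lemma subfun_functor:
  assumes F: "is_functor C F" and Y: "subf C F Y"
  shows "is_functor C (subfun F Y)"
proof -
  note c = subf_carrier[OF Y]
  have "vspace ((Ob F a)\<lparr>carrier := Y a\<rparr>)" for a
    using subsp_vspace[OF fun_vs[OF F]] Y by (auto simp: subf_def)
  moreover have "Mp F a b f \<in> lin_maps ((Ob F a)\<lparr>carrier := Y a\<rparr>) ((Ob F b)\<lparr>carrier := Y b\<rparr>)"
    if f: "f \<in> Hom C a b" for a b f
    using f Y by (intro lin_mapsI) (auto simp: subf_def lin_maps_add[OF fun_lin[OF F f]] lin_maps_smult[OF fun_lin[OF F f]] c)
  ultimately show ?thesis
    unfolding is_functor_def
    by (simp add: fun_add[OF F] fun_scale[OF F] fun_id[OF F] fun_comp[OF F] c)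
qed

lemma incl_nt:
  assumes F: "is_functor C F" and Y: "subf C F Y"
  shows "idn (subfun F Y) \<in> nat_trans C (subfun F Y) F"
  unfolding idn_def
  by (rule ntrI[OF subfun_functor[OF assms]]) (auto intro!: lin_mapsI simp: subf_carrier[OF Y])

lemma corestrict_nt:
  assumes "\<eta> \<in> nat_trans C G F" "\<And>a x. x \<in> carrier (Ob G a) \<Longrightarrow> \<eta> a x \<in> Y a"
  shows "\<eta> \<in> nat_trans C G (subfun F Y)"
  using assms unfolding nat_trans_def lin_maps_def by auto

lemma image_subf:
  assumes F: "is_functor C F" and G: "is_functor C G" and e: "\<eta> \<in> nat_trans C F G"
  shows "subf C G (\<lambda>a. \<eta> a ` carrier (Ob F a))"
  unfolding subf_def
  using subsp_image[OF fun_vs[OF F] fun_vs[OF G] nt_lin[OF e]] nt_nat[OF e, symmetric] fun_closed[OF F]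
  by auto

lemma kernel_subf:
  assumes F: "is_functor C F" and G: "is_functor C G" and e: "\<eta> \<in> nat_trans C F G"
  shows "subf C F (\<lambda>a. {x \<in> carrier (Ob F a). \<eta> a x = \<zero>\<^bsub>Ob G a\<^esub>})"
  unfolding subf_def
  using subsp_kernel[OF fun_vs[OF F] fun_vs[OF G] nt_lin[OF e]]
  by (auto simp: nt_nat[OF e] fun_closed[OF F] lin_maps_zero[OF fun_lin[OF G] fun_vs[OF G] fun_vs[OF G]])

text \<open>The quotient is realised on a complement of each \<open>Y a\<close>, so that its values
  stay in the type \<open>'v\<close>. The complements are chosen object by object and are not
  natural; the morphisms are therefore those of \<open>G\<close> followed by the projection
  \<open>k\<close> along \<open>Y\<close>.\<close>

lemma quotient_functor:
  fixes G :: "('o, 'x, 'k::field, 'v) linfun"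
  assumes G: "is_functor C G" and Y: "subf C G Y"
  obtains H :: "('o, 'x, 'k, 'v) linfun" and q where "is_functor C H" "q \<in> nat_trans C G H" "is_epi G H q"
    "\<And>a x. x \<in> carrier (Ob G a) \<Longrightarrow> q a x = \<zero>\<^bsub>Ob H a\<^esub> \<longleftrightarrow> x \<in> Y a"
proof -
  note V = fun_vs[OF G] and c = subf_carrier[OF Y]
  have "\<exists>q. q \<in> lin_maps (Ob G a) (Ob G a) \<and> (\<forall>x\<in>carrier (Ob G a). q x \<in> Y a) \<and> (\<forall>x\<in>Y a. q x = x)" for a
    using subsp_projection[OF V, of a "Y a"] Y unfolding subf_def by metis
  then obtain q where q: "\<And>a. q a \<in> lin_maps (Ob G a) (Ob G a)"
      "\<And>a x. x \<in> carrier (Ob G a) \<Longrightarrow> q a x \<in> Y a" "\<And>a x. x \<in> Y a \<Longrightarrow> q a x = x"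
    by metis
  define k where "k a x = x \<oplus>\<^bsub>Ob G a\<^esub> \<ominus>\<^bsub>Ob G a\<^esub> q a x" for a x
  have qc: "q a x \<in> carrier (Ob G a)" if "x \<in> carrier (Ob G a)" for a x
    using lin_maps_closed[OF q(1) that] .
  have k: "k a \<in> lin_maps (Ob G a) (Ob G a)" for a
    by (rule lin_mapsI) (simp_all add: k_def qc vs_closed V lin_maps_add[OF q(1)] lin_maps_smult[OF q(1)]
        vs_neg_eq[OF V, symmetric] vs_smult_add vs_smult_smult vs_assoc vs_lcomm mult.commute)
  have kc: "k a x \<in> carrier (Ob G a)" if "x \<in> carrier (Ob G a)" for a x
    using lin_maps_closed[OF k that] .
  have k0: "k a x = \<zero>\<^bsub>Ob G a\<^esub> \<longleftrightarrow> x \<in> Y a" if x: "x \<in> carrier (Ob G a)" for a x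
    using vs_diff_zero[OF V x qc[OF x]] q(2)[OF x] by (auto simp: k_def q(3) vs_rneg V x)
  have kY: "k a x = \<zero>\<^bsub>Ob G a\<^esub>" if "x \<in> Y a" for a x
    using that k0 c by blast
  \<comment> \<open>\<open>x\<close> and \<open>k a x\<close> differ by an element of
    \<open>Y a\<close>, which any morphism sends into the kernel of \<open>k b\<close>. This is what
    makes the projected morphisms compose.\<close>
  have kk: "k b (Mp G a b f (k a x)) = k b (Mp G a b f x)" if f: "f \<in> Hom C a b" and x: "x \<in> carrier (Ob G a)" for a b f x
  proof -
    have "Mp G a b f (q a x) \<in> Y b" using q(2)[OF x] Y f by (auto simp: subf_def)
    moreover have "Mp G a b f (k a x) = Mp G a b f x \<oplus>\<^bsub>Ob G b\<^esub> \<ominus>\<^bsub>Ob G b\<^esub> Mp G a b f (q a x)"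
      by (simp add: k_def x qc vs_closed V lin_maps_add[OF fun_lin[OF G f]] lin_maps_neg[OF fun_lin[OF G f] V V])
    ultimately show ?thesis
      by (simp add: lin_maps_add[OF k] lin_maps_neg[OF k V V] fun_closed[OF G f] x qc vs_closed V kY kc)
        (metis V fun_closed[OF G f x] kc vs_add_zero vs_neg vs_rneg vs_zero vs_zero_add)
  qed
  have kk2: "k c (Mp G b c g (Mp G a b f (k a x))) = k c (Mp G b c g (Mp G a b f x))"
    if "f \<in> Hom C a b" "g \<in> Hom C b c" "x \<in> carrier (Ob G a)" for a b c f g x
    using kk[OF that(2), of "Mp G a b f (k a x)"] kk[OF that(2), of "Mp G a b f x"] kk[OF that(1,3)] that
    by (simp add: kc fun_closed[OF G])
  have k2: "k a (k a x) = k a x" if "x \<in> carrier (Ob G a)" for a x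
  proof -
    have "k a (q a x) = \<zero>\<^bsub>Ob G a\<^esub>" using q(2)[OF that] by (rule kY)
    then have "k a (k a x) = k a x \<oplus>\<^bsub>Ob G a\<^esub> \<ominus>\<^bsub>Ob G a\<^esub> \<zero>\<^bsub>Ob G a\<^esub>"
      using that by (subst (2) k_def) (simp add: lin_maps_add[OF k] lin_maps_neg[OF k V V] qc vs_closed V)
    then show ?thesis using vs_rneg[OF V vs_zero[OF V]] vs_zero_add[OF V vs_neg[OF V vs_zero[OF V]]]
      by (simp add: vs_add_zero V kc that)
  qed
  define H where "H = \<lparr>Ob = (\<lambda>a. (Ob G a)\<lparr>carrier := k a ` carrier (Ob G a)\<rparr>),
    Mp = (\<lambda>a b f x. k b (Mp G a b f x))\<rparr>"
  have kH: "subsp (Ob G a) (k a ` carrier (Ob G a))" for a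
    by (rule subsp_image[OF V V k])
  have H: "is_functor C H"
    unfolding is_functor_def
  proof (intro conjI allI ballI)
    show "vspace (Ob H a)" for a by (simp add: H_def subsp_vspace[OF V kH])
    show "Mp H a b f \<in> lin_maps (Ob H a) (Ob H b)" if f: "f \<in> Hom C a b" for a b f
      using lin_maps_comp[OF fun_lin[OF G f] k] f
      by (intro lin_mapsI) (auto simp: H_def kc fun_closed[OF G f] lin_maps_add[OF k] lin_maps_smult[OF k]
          lin_maps_add[OF fun_lin[OF G f]] lin_maps_smult[OF fun_lin[OF G f]])
  qed (auto simp: H_def kc fun_closed[OF G] fun_add[OF G] fun_scale[OF G] fun_id[OF G] fun_comp[OF G]
        lin_maps_add[OF k] lin_maps_smult[OF k] k2 kk kk2)
  have "ntr G k \<in> nat_trans C G H"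
    using k by (intro ntrI[OF G]) (auto simp: H_def lin_maps_def kk)
  moreover have "is_epi G H (ntr G k)" by (auto simp: is_epi_def H_def)
  moreover have "ntr G k a x = \<zero>\<^bsub>Ob H a\<^esub> \<longleftrightarrow> x \<in> Y a" if "x \<in> carrier (Ob G a)" for a x
    using k0 that by (simp add: H_def)
  ultimately show ?thesis using that H by blast
qed

text \<open>Transport of structure along an injection of the carriers. It brings a functor with
  values in a larger type back to values in \<open>'v\<close>.\<close>

lemma transport_functor:
  fixes H :: "('o, 'x, 'k::field, 'u) linfun" and enc :: "'o \<Rightarrow> 'u \<Rightarrow> 'v"
  assumes H: "is_functor C H" and inj: "\<And>a. inj_on (enc a) (carrier (Ob H a))"
  obtains G :: "('o, 'x, 'k, 'v) linfun" and i r where "is_functor C G" "i \<in> nat_trans C G H" "r \<in> nat_trans C H G"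
    "ncomp G r i = idn G" "ncomp H i r = idn H"
proof -
  note V = fun_vs[OF H]
  define dec where "dec a = inv_into (carrier (Ob H a)) (enc a)" for a
  have de [simp]: "dec a (enc a x) = x" if "x \<in> carrier (Ob H a)" for a x
    using that by (simp add: dec_def inj)
  define G where "G = \<lparr>Ob = (\<lambda>a. \<lparr>carrier = enc a ` carrier (Ob H a), monoid.mult = undefined, one = undefined,
       ring.zero = enc a \<zero>\<^bsub>Ob H a\<^esub>, ring.add = (\<lambda>x y. enc a (dec a x \<oplus>\<^bsub>Ob H a\<^esub> dec a y)),
       module.smult = (\<lambda>r x. enc a (r \<odot>\<^bsub>Ob H a\<^esub> dec a x))\<rparr>),
     Mp = (\<lambda>a b f x. enc b (Mp H a b f (dec a x)))\<rparr>"
  have VG: "vspace (Ob G a)" for a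
    by (rule vspaceI)
      (auto simp: G_def vs_closed V vs_assoc vs_zero_add vs_neg_eq vs_lneg vs_smult_add_left vs_smult_add
        vs_smult_smult vs_one vs_comm[OF V])
  have FG: "is_functor C G"
    unfolding is_functor_def
    using VG by (auto simp: G_def fun_closed[OF H] fun_add[OF H] fun_scale[OF H] fun_id[OF H] fun_comp[OF H]
        V vs_closed lin_maps_add[OF fun_lin[OF H]] lin_maps_smult[OF fun_lin[OF H]] intro!: lin_mapsI)
  have i: "ntr G dec \<in> nat_trans C G H"
    by (rule ntrI[OF FG]) (auto simp: G_def vs_closed V fun_closed[OF H] intro!: lin_mapsI)
  have r: "ntr H enc \<in> nat_trans C H G"
    by (rule ntrI[OF H]) (auto simp: G_def vs_closed V fun_closed[OF H] intro!: lin_mapsI)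
  have "ncomp G (ntr H enc) (ntr G dec) = idn G"
    by (rule nt_eqI[OF ncomp_closed[OF FG i r] idn_closed[OF FG]]) (auto simp: nt_closed[OF i] G_def ntr_def)
  moreover have "ncomp H (ntr G dec) (ntr H enc) = idn H"
    by (rule nt_eqI[OF ncomp_closed[OF H r i] idn_closed[OF H]]) (auto simp: nt_closed[OF r] G_def ntr_def)
  ultimately show ?thesis using that FG i r by blast
qed

definition zero_functor :: "('o, 'x, 'k, 'v) linfun"
  where "zero_functor = \<lparr>Ob = (\<lambda>_. \<lparr>carrier = {undefined}, monoid.mult = undefined, one = undefined,
    ring.zero = undefined, ring.add = (\<lambda>_ _. undefined), module.smult = (\<lambda>_ _. undefined)\<rparr>),
    Mp = (\<lambda>_ _ _ _. undefined)\<rparr>"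

lemma zero_functor_functor: "is_functor C zero_functor"
  unfolding is_functor_def by (auto simp: zero_functor_def intro!: vspaceI lin_mapsI)

lemma nt_from_zero_functor:
  fixes C :: "('o, 'x, 'k::field) lincat" and \<eta> :: "'o \<Rightarrow> 'v \<Rightarrow> 'w"
  assumes "is_functor C G" "\<eta> \<in> nat_trans C zero_functor G"
  shows "\<eta> = \<zero>\<^bsub>hom_module C zero_functor G\<^esub>"
proof (rule nt_eqI[OF assms(2) hom_closed(1)[OF zero_functor_functor assms(1)]])
  fix a x assume x: "x \<in> carrier (Ob (zero_functor :: ('o, 'x, 'k, 'v) linfun) a)"
  then have "x = \<zero>\<^bsub>Ob (zero_functor :: ('o, 'x, 'k, 'v) linfun) a\<^esub>" by (simp add: zero_functor_def)
  then show "\<eta> a x = \<zero>\<^bsub>hom_module C zero_functor G\<^esub> a x"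
    using x nt_zero[OF assms(2) zero_functor_functor assms(1)] by simp
qed

lemma zero_functor_projective:
  "projective (C :: ('o, 'x, 'k::field) lincat) (zero_functor :: ('o, 'x, 'k, 'v) linfun)"
  unfolding projective_def
proof (intro conjI allI impI ballI)
  fix M N :: "('o, 'x, 'k, 'v) linfun" and \<pi> \<phi>
  assume M: "is_functor C M" and N: "is_functor C N" and p: "\<pi> \<in> nat_trans C M N"
    and f: "\<phi> \<in> nat_trans C (zero_functor :: ('o, 'x, 'k, 'v) linfun) N"
  let ?Z = "zero_functor :: ('o, 'x, 'k, 'v) linfun"
  have "ncomp ?Z \<pi> \<zero>\<^bsub>hom_module C ?Z M\<^esub> = \<phi>"
    unfolding nt_from_zero_functor[OF N f]
    by (rule ncomp_zero_right[OF zero_functor_functor M N p])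
  then show "\<exists>\<psi>\<in>nat_trans C ?Z M. ncomp ?Z \<pi> \<psi> = \<phi>"
    using hom_closed(1)[OF zero_functor_functor M] by blast
qed (rule zero_functor_functor)

subsection \<open>Projective resolutions\<close>

lemma projective_functor: "projective C P \<Longrightarrow> is_functor C P"
  by (simp add: projective_def)

text \<open>Projectivity is tested against epimorphisms; replacing \<open>B\<close> by the image of
  \<eta> turns \<eta> into one. In this form it applies at every spot of an exact complex.\<close>

lemma projective_lift:
  fixes P A B :: "('o, 'x, 'k::field, 'v) linfun"
  assumes P: "projective C P" and A: "is_functor C A" and B: "is_functor C B"
    and e: "\<eta> \<in> nat_trans C A B" and b: "\<beta> \<in> nat_trans C P B"
    and im: "\<And>a x. x \<in> carrier (Ob P a) \<Longrightarrow> \<beta> a x \<in> \<eta> a ` carrier (Ob A a)"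
  obtains \<psi> where "\<psi> \<in> nat_trans C P A" "ncomp P \<eta> \<psi> = \<beta>"
proof -
  let ?B = "subfun B (\<lambda>a. \<eta> a ` carrier (Ob A a))"
  have "is_functor C ?B" by (rule subfun_functor[OF B image_subf[OF A B e]])
  moreover have "\<eta> \<in> nat_trans C A ?B" by (rule corestrict_nt[OF e]) auto
  moreover have "\<beta> \<in> nat_trans C P ?B" by (rule corestrict_nt[OF b im])
  moreover have "is_epi A ?B \<eta>" by (simp add: is_epi_def)
  ultimately show ?thesis using P A that unfolding projective_def by blast
qed

lemma
  assumes "proj_resolution C F P D \<epsilon>"
  shows res_projective: "projective C (P i)"
    and res_functor: "is_functor C (P i)"
    and res_D: "D i \<in> nat_trans C (P (Suc i)) (P i)"
    and res_eps: "\<epsilon> \<in> nat_trans C (P 0) F"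
    and res_surj: "\<epsilon> a ` carrier (Ob (P 0) a) = carrier (Ob F a)"
    and res_exact0: "D 0 a ` carrier (Ob (P (Suc 0)) a) = {y \<in> carrier (Ob (P 0) a). \<epsilon> a y = \<zero>\<^bsub>Ob F a\<^esub>}"
    and res_exact: "D (Suc i) a ` carrier (Ob (P (Suc (Suc i))) a) =
      {y \<in> carrier (Ob (P (Suc i)) a). D i a y = \<zero>\<^bsub>Ob (P i) a\<^esub>}"
proof -
  note R = assms[unfolded proj_resolution_def exact_at_def is_epi_def]
  from R show "projective C (P i)" by (elim conjE) (erule spec)
  then show "is_functor C (P i)" by (rule projective_functor)
  from R show "D i \<in> nat_trans C (P (Suc i)) (P i)" by (elim conjE) (erule spec)+
  from R show "\<epsilon> \<in> nat_trans C (P 0) F" by (elim conjE)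
  from R show "\<epsilon> a ` carrier (Ob (P 0) a) = carrier (Ob F a)" by (elim conjE) (erule spec)
  from R show "D 0 a ` carrier (Ob (P (Suc 0)) a) = {y \<in> carrier (Ob (P 0) a). \<epsilon> a y = \<zero>\<^bsub>Ob F a\<^esub>}"
    by (elim conjE) (erule spec)
  from R show "D (Suc i) a ` carrier (Ob (P (Suc (Suc i))) a) =
      {y \<in> carrier (Ob (P (Suc i)) a). D i a y = \<zero>\<^bsub>Ob (P i) a\<^esub>}"
    by (elim conjE) (drule spec, erule spec)
qed

lemma res_eps_D:
  assumes "proj_resolution C F P D \<epsilon>" "x \<in> carrier (Ob (P (Suc 0)) a)"
  shows "\<epsilon> a (D 0 a x) = \<zero>\<^bsub>Ob F a\<^esub>"
  using imageI[OF assms(2), of "D 0 a"] unfolding res_exact0[OF assms(1)] by simp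

lemma res_D_D:
  assumes "proj_resolution C F P D \<epsilon>" "x \<in> carrier (Ob (P (Suc (Suc i))) a)"
  shows "D i a (D (Suc i) a x) = \<zero>\<^bsub>Ob (P i) a\<^esub>"
  using imageI[OF assms(2), of "D (Suc i) a"] unfolding res_exact[OF assms(1)] by simp

text \<open>The comparison theorem: projectivity of \<open>P\<close> and exactness of
  \<open>P'\<close> lift the identity of \<open>F\<close> degree by degree.\<close>

lemma chain_lift:
  fixes P P' :: "nat \<Rightarrow> ('o, 'x, 'k::field, 'v) linfun"
  assumes F: "is_functor C F" and R: "proj_resolution C F P D \<epsilon>" and R': "proj_resolution C F P' D' \<epsilon>'"
  obtains u where "\<And>i. u i \<in> nat_trans C (P i) (P' i)"
    "\<And>a x. x \<in> carrier (Ob (P 0) a) \<Longrightarrow> \<epsilon>' a (u 0 a x) = \<epsilon> a x"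
    "\<And>i a x. x \<in> carrier (Ob (P (Suc i)) a) \<Longrightarrow> D' i a (u (Suc i) a x) = u i a (D i a x)"
proof -
  note f = res_functor[OF R] and f' = res_functor[OF R']
  \<comment> \<open>The invariant of the recursion: \<open>u\<close> after the differential of
    \<open>P\<close> lands in the kernel of the next map of \<open>P'\<close>, hence in the image of
    its differential. In degree \<open>0\<close> this follows from compatibility with the
    augmentations.\<close>
  define Z where "Z i u \<longleftrightarrow> u \<in> nat_trans C (P i) (P' i) \<and>
    (case i of 0 \<Rightarrow> \<forall>a. \<forall>x\<in>carrier (Ob (P 0) a). \<epsilon>' a (u a x) = \<epsilon> a x
     | Suc j \<Rightarrow> \<forall>a. \<forall>x\<in>carrier (Ob (P (Suc (Suc j))) a). D' j a (u a (D (Suc j) a x)) = \<zero>\<^bsub>Ob (P' j) a\<^esub>)" for i u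
  have "\<exists>u. \<forall>i. Z i (u i) \<and> (\<forall>a. \<forall>x\<in>carrier (Ob (P (Suc i)) a). D' i a (u (Suc i) a x) = u i a (D i a x))"
  proof (rule dependent_nat_choice)
    obtain u where "u \<in> nat_trans C (P 0) (P' 0)" "ncomp (P 0) \<epsilon>' u = \<epsilon>"
    proof (rule projective_lift[OF res_projective[OF R] f' F res_eps[OF R'] res_eps[OF R]])
      show "\<epsilon> a x \<in> \<epsilon>' a ` carrier (Ob (P' 0) a)" if "x \<in> carrier (Ob (P 0) a)" for a x
        using nt_closed[OF res_eps[OF R] that] res_surj[OF R'] by auto
    qed
    then show "\<exists>u. Z 0 u" by (auto simp: Z_def intro!: exI[of _ u])
  next
    fix u i assume u: "Z i u"
    then have un: "u \<in> nat_trans C (P i) (P' i)" by (simp add: Z_def)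
    have un': "ncomp (P (Suc i)) u (D i) \<in> nat_trans C (P (Suc i)) (P' i)"
      by (rule ncomp_closed[OF f res_D[OF R] un])
    have "ncomp (P (Suc i)) u (D i) a x \<in> D' i a ` carrier (Ob (P' (Suc i)) a)" if x: "x \<in> carrier (Ob (P (Suc i)) a)" for a x
    proof (cases i)
      case 0
      then show ?thesis using u x nt_closed[OF un' x] nt_closed[OF res_D[OF R]] res_eps_D[OF R]
        by (auto simp: res_exact0[OF R'] Z_def)
    next
      case (Suc j)
      then show ?thesis using u x nt_closed[OF un' x] by (auto simp: res_exact[OF R'] Z_def)
    qed
    then obtain v where v: "v \<in> nat_trans C (P (Suc i)) (P' (Suc i))" "ncomp (P (Suc i)) (D' i) v = ncomp (P (Suc i)) u (D i)"
      using projective_lift[OF res_projective[OF R] f' f' res_D[OF R'] un'] by metis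
    have v2: "D' i a (v a x) = u a (D i a x)" if "x \<in> carrier (Ob (P (Suc i)) a)" for a x
      using v(2) that by (metis ncomp_apply)
    have "Z (Suc i) v"
      using v(1) by (auto simp: Z_def v2 nt_closed[OF res_D[OF R]] res_D_D[OF R] nt_zero[OF un f f'])
    then show "\<exists>v. Z (Suc i) v \<and> (\<forall>a. \<forall>x\<in>carrier (Ob (P (Suc i)) a). D' i a (v a x) = u a (D i a x))"
      using v2 by blast
  qed
  then obtain u where u: "\<And>i. Z i (u i)" "\<And>i a x. x \<in> carrier (Ob (P (Suc i)) a) \<Longrightarrow> D' i a (u (Suc i) a x) = u i a (D i a x)"
    by blast
  show ?thesis
  proof (rule that[of u])
    show "u i \<in> nat_trans C (P i) (P' i)" for i using u(1)[of i] by (simp add: Z_def)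
    show "\<epsilon>' a (u 0 a x) = \<epsilon> a x" if "x \<in> carrier (Ob (P 0) a)" for a x
      using u(1)[of 0] that by (simp add: Z_def)
  qed (rule u(2))
qed

text \<open>A chain map of \<open>P\<close> to itself that lifts the zero map of \<open>F\<close> is
  null-homotopic; the homotopy is built by lifting cycles through the exact complex.\<close>

lemma chain_homotopy:
  fixes P :: "nat \<Rightarrow> ('o, 'x, 'k::field, 'v) linfun"
  assumes F: "is_functor C F" and R: "proj_resolution C F P D \<epsilon>"
    and g: "\<And>i. g i \<in> nat_trans C (P i) (P i)"
    and g0: "\<And>a x. x \<in> carrier (Ob (P 0) a) \<Longrightarrow> \<epsilon> a (g 0 a x) = \<zero>\<^bsub>Ob F a\<^esub>"
    and gD: "\<And>i a x. x \<in> carrier (Ob (P (Suc i)) a) \<Longrightarrow> D i a (g (Suc i) a x) = g i a (D i a x)"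
  obtains s where "\<And>i. s i \<in> nat_trans C (P i) (P (Suc i))"
    "\<And>a x. x \<in> carrier (Ob (P 0) a) \<Longrightarrow> g 0 a x = D 0 a (s 0 a x)"
    "\<And>i a x. x \<in> carrier (Ob (P (Suc i)) a) \<Longrightarrow>
      g (Suc i) a x = D (Suc i) a (s (Suc i) a x) \<oplus>\<^bsub>Ob (P (Suc i)) a\<^esub> s i a (D i a x)"
proof -
  note f = res_functor[OF R] and d = res_D[OF R] and V = fun_vs[OF res_functor[OF R]]
  \<comment> \<open>The invariant: \<open>g i\<close> and \<open>D i\<close> after \<open>s\<close>
    agree on the image of \<open>D i\<close>, which makes the defect in the next degree a
    cycle.\<close>
  define Z where "Z i s \<longleftrightarrow> s \<in> nat_trans C (P i) (P (Suc i)) \<and>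
    (\<forall>a. \<forall>x\<in>carrier (Ob (P (Suc i)) a). g i a (D i a x) = D i a (s a (D i a x))) \<and>
    (i = 0 \<longrightarrow> (\<forall>a. \<forall>x\<in>carrier (Ob (P 0) a). g 0 a x = D 0 a (s a x)))" for i s
  have "\<exists>s. \<forall>i. Z i (s i) \<and> (\<forall>a. \<forall>x\<in>carrier (Ob (P (Suc i)) a).
      g (Suc i) a x = D (Suc i) a (s (Suc i) a x) \<oplus>\<^bsub>Ob (P (Suc i)) a\<^esub> s i a (D i a x))"
  proof (rule dependent_nat_choice)
    obtain s where s: "s \<in> nat_trans C (P 0) (P (Suc 0))" "ncomp (P 0) (D 0) s = g 0"
    proof (rule projective_lift[OF res_projective[OF R] f f d g])
      show "g 0 a x \<in> D 0 a ` carrier (Ob (P (Suc 0)) a)" if "x \<in> carrier (Ob (P 0) a)" for a x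
        using nt_closed[OF g that] g0[OF that] res_exact0[OF R] by auto
    qed
    have "D 0 a (s a x) = g 0 a x" if "x \<in> carrier (Ob (P 0) a)" for a x
      using s(2) that by (metis ncomp_apply)
    then show "\<exists>s. Z 0 s" using s(1) by (auto simp: Z_def nt_closed[OF d] intro!: exI[of _ s])
  next
    fix s i assume s: "Z i s"
    then have sn: "s \<in> nat_trans C (P i) (P (Suc i))" by (simp add: Z_def)
    let ?H = "hom_module C (P (Suc i)) (P (Suc i))"
    \<comment> \<open>What the homotopy found so far leaves of \<open>g (Suc i)\<close>. It is a
      cycle by the invariant, hence lifts through \<open>D (Suc i)\<close>.\<close>
    define b where "b = g (Suc i) \<oplus>\<^bsub>?H\<^esub> \<ominus>\<^bsub>?H\<^esub> ncomp (P (Suc i)) s (D i)"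
    have sd: "ncomp (P (Suc i)) s (D i) \<in> nat_trans C (P (Suc i)) (P (Suc i))"
      by (rule ncomp_closed[OF f d sn])
    have b: "b \<in> nat_trans C (P (Suc i)) (P (Suc i))" unfolding b_def
      by (intro hom_closed f g sd)
    have bx: "b a x = g (Suc i) a x \<oplus>\<^bsub>Ob (P (Suc i)) a\<^esub> \<ominus>\<^bsub>Ob (P (Suc i)) a\<^esub> s a (D i a x)"
      if "x \<in> carrier (Ob (P (Suc i)) a)" for a x
      using that by (simp add: b_def hom_neg[OF f f sd])
    have "b a x \<in> D (Suc i) a ` carrier (Ob (P (Suc (Suc i))) a)" if x: "x \<in> carrier (Ob (P (Suc i)) a)" for a x
    proof -
      have "D i a (b a x) = g i a (D i a x) \<oplus>\<^bsub>Ob (P i) a\<^esub> \<ominus>\<^bsub>Ob (P i) a\<^esub> D i a (s a (D i a x))"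
        by (simp add: bx x nt_add[OF d] nt_neg[OF d f f] nt_closed[OF g] nt_closed[OF sn] nt_closed[OF d] vs_neg V gD)
      also have "\<dots> = \<zero>\<^bsub>Ob (P i) a\<^esub>"
        using s x by (simp add: Z_def vs_rneg V nt_closed[OF d] nt_closed[OF sn])
      finally show ?thesis using nt_closed[OF b x] res_exact[OF R] by auto
    qed
    then obtain t where t: "t \<in> nat_trans C (P (Suc i)) (P (Suc (Suc i)))" "ncomp (P (Suc i)) (D (Suc i)) t = b"
      using projective_lift[OF res_projective[OF R] f f d b] by metis
    have t2: "g (Suc i) a x = D (Suc i) a (t a x) \<oplus>\<^bsub>Ob (P (Suc i)) a\<^esub> s a (D i a x)"
      if x: "x \<in> carrier (Ob (P (Suc i)) a)" for a x
    proof -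
      have "D (Suc i) a (t a x) = b a x" using t(2) x by (metis ncomp_apply)
      then show ?thesis
        by (simp add: bx x vs_assoc V nt_closed[OF g] nt_closed[OF sn] nt_closed[OF d] vs_closed vs_lneg vs_add_zero)
    qed
    have "Z (Suc i) t"
      using t(1) by (auto simp: Z_def t2 nt_closed[OF d] nt_closed[OF t(1)] res_D_D[OF R] nt_zero[OF sn f f] V vs_add_zero)
    then show "\<exists>t. Z (Suc i) t \<and> (\<forall>a. \<forall>x\<in>carrier (Ob (P (Suc i)) a).
        g (Suc i) a x = D (Suc i) a (t a x) \<oplus>\<^bsub>Ob (P (Suc i)) a\<^esub> s a (D i a x))"
      using t2 by blast
  qed
  then obtain s where "\<And>i. Z i (s i)" "\<And>i a x. x \<in> carrier (Ob (P (Suc i)) a) \<Longrightarrow>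
      g (Suc i) a x = D (Suc i) a (s (Suc i) a x) \<oplus>\<^bsub>Ob (P (Suc i)) a\<^esub> s i a (D i a x)"
    by blast
  then show ?thesis using that[of s] by (simp add: Z_def)
qed

text \<open>The index of \<open>F\<close> speaks of some resolution \<open>P'\<close>, while the
  cohomology in question is that of the given \<open>P\<close>. Chain maps \<open>u\<close> and
  \<open>v\<close> go back and forth; \<alpha> vanishes on the image of \<open>v k\<close> by
  hypothesis, so \<alpha> equals its composite with the null-homotopic map
  \<open>id - v u\<close>.\<close>

lemma ext_vanishing:
  fixes P P' :: "nat \<Rightarrow> ('o, 'x, 'k::field, 'v) linfun"
  assumes F: "is_functor C F" and N: "is_functor C N"
    and R: "proj_resolution C F P D \<epsilon>" and R': "proj_resolution C F P' D' \<epsilon>'"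
    and van: "nat_trans C (P' k) N \<subseteq> {\<zero>\<^bsub>hom_module C (P' k) N\<^esub>}"
    and a: "\<alpha> \<in> Ext_cocycles C P D N k"
  shows "\<alpha> \<in> Ext_coboundaries C P D N k"
proof -
  note f = res_functor[OF R] and f' = res_functor[OF R'] and d = res_D[OF R] and V = fun_vs[OF res_functor[OF R]]
  obtain u where u: "\<And>i. u i \<in> nat_trans C (P i) (P' i)"
    "\<And>a x. x \<in> carrier (Ob (P 0) a) \<Longrightarrow> \<epsilon>' a (u 0 a x) = \<epsilon> a x"
    "\<And>i a x. x \<in> carrier (Ob (P (Suc i)) a) \<Longrightarrow> D' i a (u (Suc i) a x) = u i a (D i a x)"
    using chain_lift[OF F R R'] by metis
  obtain v where v: "\<And>i. v i \<in> nat_trans C (P' i) (P i)"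
    "\<And>a x. x \<in> carrier (Ob (P' 0) a) \<Longrightarrow> \<epsilon> a (v 0 a x) = \<epsilon>' a x"
    "\<And>i a x. x \<in> carrier (Ob (P' (Suc i)) a) \<Longrightarrow> D i a (v (Suc i) a x) = v i a (D' i a x)"
    using chain_lift[OF F R' R] by metis
  let ?H = "\<lambda>i. hom_module C (P i) (P i)"
  define g where "g i = idn (P i) \<oplus>\<^bsub>?H i\<^esub> \<ominus>\<^bsub>?H i\<^esub> ncomp (P i) (v i) (u i)" for i
  have vu: "ncomp (P i) (v i) (u i) \<in> nat_trans C (P i) (P i)" for i by (rule ncomp_closed[OF f u(1) v(1)])
  have g: "g i \<in> nat_trans C (P i) (P i)" for i
    unfolding g_def by (intro hom_closed f vu idn_closed)
  have gx: "g i a x = x \<oplus>\<^bsub>Ob (P i) a\<^esub> \<ominus>\<^bsub>Ob (P i) a\<^esub> v i a (u i a x)" if "x \<in> carrier (Ob (P i) a)" for i a x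
    using that by (simp add: g_def hom_neg[OF f f vu])
  have vuc: "v i a (u i a x) \<in> carrier (Ob (P i) a)" if "x \<in> carrier (Ob (P i) a)" for i a x
    using nt_closed[OF v(1) nt_closed[OF u(1) that]] .
  obtain s where s: "\<And>i. s i \<in> nat_trans C (P i) (P (Suc i))"
    "\<And>a x. x \<in> carrier (Ob (P 0) a) \<Longrightarrow> g 0 a x = D 0 a (s 0 a x)"
    "\<And>i a x. x \<in> carrier (Ob (P (Suc i)) a) \<Longrightarrow>
      g (Suc i) a x = D (Suc i) a (s (Suc i) a x) \<oplus>\<^bsub>Ob (P (Suc i)) a\<^esub> s i a (D i a x)"
  proof (rule chain_homotopy[OF F R g])
    fix a x assume x: "x \<in> carrier (Ob (P 0) a)"
    then show "\<epsilon> a (g 0 a x) = \<zero>\<^bsub>Ob F a\<^esub>"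
      by (simp add: gx nt_add[OF res_eps[OF R]] nt_neg[OF res_eps[OF R] f F] vuc V vs_closed u(2) v(2)
          nt_closed[OF u(1)] vs_rneg fun_vs[OF F] nt_closed[OF res_eps[OF R]])
  next
    fix i a x assume x: "x \<in> carrier (Ob (P (Suc i)) a)"
    then show "D i a (g (Suc i) a x) = g i a (D i a x)"
      by (simp add: gx nt_add[OF d] nt_neg[OF d f f] vuc V vs_closed u(3) v(3) nt_closed[OF u(1)] nt_closed[OF d])
  qed metis
  have an: "\<alpha> \<in> nat_trans C (P k) N" and aD: "ncomp (P (Suc k)) \<alpha> (D k) = \<zero>\<^bsub>hom_module C (P (Suc k)) N\<^esub>"
    using a by (auto simp: Ext_cocycles_def)
  have aD': "\<alpha> a (D k a x) = \<zero>\<^bsub>Ob N a\<^esub>" if "x \<in> carrier (Ob (P (Suc k)) a)" for a x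
    using fun_cong[OF fun_cong[OF aD, of a], of x] that by simp
  have av: "\<alpha> a (v k a x) = \<zero>\<^bsub>Ob N a\<^esub>" if "x \<in> carrier (Ob (P' k) a)" for a x
  proof -
    have "ncomp (P' k) \<alpha> (v k) = \<zero>\<^bsub>hom_module C (P' k) N\<^esub>"
      using van ncomp_closed[OF f' v(1) an] by blast
    from fun_cong[OF fun_cong[OF this, of a], of x] show ?thesis using that by simp
  qed
  have ag: "\<alpha> a (g k a x) = \<alpha> a x" if x: "x \<in> carrier (Ob (P k) a)" for a x
  proof -
    have "\<alpha> a (g k a x) \<oplus>\<^bsub>Ob N a\<^esub> \<zero>\<^bsub>Ob N a\<^esub> = \<alpha> a (g k a x \<oplus>\<^bsub>Ob (P k) a\<^esub> v k a (u k a x))"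
      using x by (simp add: nt_add[OF an] nt_closed[OF g] vuc av nt_closed[OF u(1)])
    also have "g k a x \<oplus>\<^bsub>Ob (P k) a\<^esub> v k a (u k a x) = x"
      using x by (simp add: gx vuc V vs_assoc vs_closed vs_lneg vs_add_zero)
    finally show ?thesis using vs_add_zero[OF fun_vs[OF N] nt_closed[OF an nt_closed[OF g x]]] by simp
  qed
  \<comment> \<open>Inserting the homotopy gives
    \<open>\<alpha> = \<alpha> D s + \<alpha> s D\<close>, and the first summand dies because
    \<alpha> is a cocycle. In degree \<open>0\<close> only the first summand exists.\<close>
  show ?thesis
  proof (cases k)
    case 0
    have "\<alpha> = \<zero>\<^bsub>hom_module C (P k) N\<^esub>"
    proof (rule nt_eqI[OF an hom_closed(1)[OF f N]])
      fix a x assume x: "x \<in> carrier (Ob (P k) a)"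
      then show "\<alpha> a x = \<zero>\<^bsub>hom_module C (P k) N\<^esub> a x"
        using ag[OF x] s(2)[of x a] aD'[of "s 0 a x" a] nt_closed[OF s(1), of x 0 a] by (simp add: 0)
    qed
    then show ?thesis by (simp add: Ext_coboundaries_def 0)
  next
    case (Suc j)
    have as: "ncomp (P j) \<alpha> (s j) \<in> nat_trans C (P j) N"
      using ncomp_closed[OF f s(1)] an by (simp add: Suc)
    have "\<alpha> = ncomp (P (Suc j)) (ncomp (P j) \<alpha> (s j)) (D j)"
    proof (rule nt_eqI[OF an[unfolded Suc] ncomp_closed[OF f d as]])
      fix a x assume x: "x \<in> carrier (Ob (P (Suc j)) a)"
      have "\<alpha> a x = \<alpha> a (D k a (s k a x) \<oplus>\<^bsub>Ob (P k) a\<^esub> s j a (D j a x))"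
        using ag[of x a] s(3)[OF x] x by (simp add: Suc)
      also have "\<dots> = \<alpha> a (s j a (D j a x))"
        using x aD'[of "s k a x" a]
        by (simp add: nt_add[OF an[unfolded Suc]] nt_closed[OF d] nt_closed[OF s(1)] nt_closed[OF an[unfolded Suc]] vs_zero_add fun_vs[OF N] Suc)
      finally show "\<alpha> a x = ncomp (P (Suc j)) (ncomp (P j) \<alpha> (s j)) (D j) a x"
        using x by (simp add: nt_closed[OF d])
    qed
    then show ?thesis using as by (auto simp: Ext_coboundaries_def Suc)
  qed
qed

section \<open>Tensors\<close>

lemma sum_fun_apply: "(\<Sum>i\<in>I. f i) x = (\<Sum>i\<in>I. f i x)"
  by (induction I rule: infinite_finite_induct) auto

abbreviation iv :: "('a \<Rightarrow> 'b) \<Rightarrow> 'b \<Rightarrow> 'a"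
  where "iv \<equiv> inv_into UNIV"

section \<open>Words and permutations of their positions\<close>

lemma words_length: "xs \<in> words A d \<Longrightarrow> length xs = d"
  by (simp add: words_def)

lemma finite_words: "finite A \<Longrightarrow> finite (words A d)"
  unfolding words_def using finite_lists_length_eq[of A d] by simp

lemma Sym_inv: "\<sigma> \<in> Sym d \<Longrightarrow> iv \<sigma> \<in> Sym d"
  by (simp add: permutes_inv)

lemma Sym_comp: "\<lbrakk>\<sigma> \<in> Sym d; \<tau> \<in> Sym d\<rbrakk> \<Longrightarrow> \<sigma> \<circ> \<tau> \<in> Sym d"
  by (simp add: permutes_compose)

lemma finite_Sym [simp]: "finite (Sym d)"
  by (simp add: finite_permutations)

lemma bij_Sym_comp:
  assumes "\<tau> \<in> Sym d"
  shows "bij_betw (\<lambda>\<sigma>. \<tau> \<circ> \<sigma>) (Sym d) (Sym d)"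
proof (rule bij_betwI[where g = "\<lambda>\<sigma>. iv \<tau> \<circ> \<sigma>"])
  have "\<tau> \<circ> iv \<tau> = id" "iv \<tau> \<circ> \<tau> = id" using assms by (simp_all add: permutes_inv_o)
  then show "iv \<tau> \<circ> (\<tau> \<circ> \<sigma>) = \<sigma>" "\<tau> \<circ> (iv \<tau> \<circ> \<sigma>) = \<sigma>" for \<sigma>
    by (simp_all add: comp_assoc[symmetric])
qed (use assms in \<open>auto intro: permutes_compose permutes_inv\<close>)

lemma bij_Sym_inv: "bij_betw iv (Sym d) (Sym d)"
  by (rule bij_betwI[where g = iv]) (auto simp: permutes_inv inv_inv_eq permutes_bij)

lemma pl_comp: "\<lbrakk>\<sigma> \<in> Sym d; \<tau> \<in> Sym d; length xs = d\<rbrakk> \<Longrightarrow>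
    permute_list \<tau> (permute_list \<sigma> xs) = permute_list (\<sigma> \<circ> \<tau>) xs"
  by (simp add: permute_list_compose)

lemma pl_inv: "\<lbrakk>\<sigma> \<in> Sym d; length xs = d\<rbrakk> \<Longrightarrow> permute_list \<sigma> (permute_list (iv \<sigma>) xs) = xs"
  "\<lbrakk>\<sigma> \<in> Sym d; length xs = d\<rbrakk> \<Longrightarrow> permute_list (iv \<sigma>) (permute_list \<sigma> xs) = xs"
  using pl_comp[of "iv \<sigma>" d \<sigma> xs] pl_comp[of \<sigma> d "iv \<sigma>" xs] Sym_inv[of \<sigma> d]
  by (auto simp: permutes_inv_o)

lemma pl_words_iff: "\<lbrakk>\<sigma> \<in> Sym d; length xs = d\<rbrakk> \<Longrightarrow> permute_list \<sigma> xs \<in> words A d \<longleftrightarrow> xs \<in> words A d"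
  by (simp add: words_def)

lemma bij_pl_words:
  assumes "\<sigma> \<in> Sym d"
  shows "bij_betw (permute_list \<sigma>) (words A d) (words A d)"
  by (rule bij_betwI[where g = "permute_list (iv \<sigma>)"])
    (use assms Sym_inv[OF assms] in \<open>auto simp: pl_words_iff pl_inv words_length\<close>)

lemma pl_zip: "\<lbrakk>\<sigma> \<in> Sym d; length xs = d; length ys = d\<rbrakk> \<Longrightarrow>
    permute_list \<sigma> (zip xs ys) = zip (permute_list \<sigma> xs) (permute_list \<sigma> ys)"
  by (simp add: permute_list_zip)

lemma zip_words: "\<lbrakk>length xs = d; length ys = d\<rbrakk> \<Longrightarrow> zip xs ys \<in> words (A \<times> B) d \<longleftrightarrow> xs \<in> words A d \<and> ys \<in> words B d"
  by (auto simp: words_def subset_iff set_zip in_set_conv_nth) (metis | force)+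

lemma Gamma_sp_tens: "f \<in> Gamma_sp A d \<Longrightarrow> f xs \<noteq> 0 \<Longrightarrow> xs \<in> words A d"
  by (auto simp: Gamma_sp_def tens_def)

lemma Gamma_sp_perm:
  assumes "f \<in> Gamma_sp A d" "\<sigma> \<in> Sym d" "length xs = d"
  shows "f (permute_list \<sigma> xs) = f xs"
proof -
  have "tperm (iv \<sigma>) f = f" using assms Sym_inv[OF assms(2)] unfolding Gamma_sp_def by blast
  from fun_cong[OF this, of xs] show ?thesis
    using assms(2) by (simp add: tperm_def inv_inv_eq permutes_bij)
qed

text \<open>
  \<open>vfun sc d V\<close> is the functor \<open>\<otimes>\<^sup>d \<otimes> V\<close> for a subspace \<open>V\<close> of the vector space type \<open>'e\<close> with
  scalar multiplication \<open>sc\<close>.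
\<close>

definition vtens :: "'x set \<Rightarrow> nat \<Rightarrow> 'e set \<Rightarrow> ('x list \<Rightarrow> 'e::zero) set"
  where "vtens A d V = {g. \<forall>xs. (xs \<notin> words A d \<longrightarrow> g xs = 0) \<and> g xs \<in> V}"

definition vmap :: "('k \<Rightarrow> 'e \<Rightarrow> 'e::comm_monoid_add) \<Rightarrow> nat \<Rightarrow> nat \<Rightarrow> ((nat \<times> nat) list \<Rightarrow> 'k::field) \<Rightarrow>
    (nat list \<Rightarrow> 'e) \<Rightarrow> nat list \<Rightarrow> 'e"
  where "vmap sc d m f g = (\<lambda>xs. if length xs = d then \<Sum>ys\<in>words {..<m} d. sc (f (zip xs ys)) (g ys) else 0)"

definition vfun :: "('k \<Rightarrow> 'e \<Rightarrow> 'e::ab_group_add) \<Rightarrow> nat \<Rightarrow> 'e set \<Rightarrow> ('k::field, nat list \<Rightarrow> 'e) spf"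
  where "vfun sc d V = \<lparr>Ob = (\<lambda>n. \<lparr>carrier = vtens {..<n} d V, monoid.mult = undefined, one = undefined,
      ring.zero = 0, ring.add = (+), module.smult = (\<lambda>r g x. sc r (g x))\<rparr>),
    Mp = (\<lambda>m n. vmap sc d m)\<rparr>"

lemma tens_vtens: "tens A d = vtens A d UNIV"
  by (auto simp: tens_def vtens_def)

lemma vtens_0: "\<lbrakk>g \<in> vtens A d V; xs \<notin> words A d\<rbrakk> \<Longrightarrow> g xs = 0"
  by (auto simp: vtens_def)

lemma tens_0: "\<lbrakk>t \<in> tens A d; xs \<notin> words A d\<rbrakk> \<Longrightarrow> t xs = 0"
  by (auto simp: tens_def)

section \<open>Symmetric tensors acting as matrices on tensor powers\<close>

lemma Gamma_cat_simps [simp]: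
  "Hom (Gamma_cat d) m n = Gamma_sp ({..<n} \<times> {..<m}) d"
  "Cmp (Gamma_cat d) l m n g f = (\<lambda>zs. if length zs = d
        then \<Sum>ys\<in>words {..<m} d. g (zip (map fst zs) ys) * f (zip ys (map snd zs)) else 0)"
  "Idn (Gamma_cat d) n = (\<lambda>zs. if length zs = d \<and> (\<forall>(i, j)\<in>set zs. i = j \<and> i < n) then 1 else 0)"
  by (simp_all add: Gamma_cat_def)

lemma Idn_zip: "\<lbrakk>length xs = d; length ys = d; ys \<in> words {..<n} d\<rbrakk> \<Longrightarrow>
    Idn (Gamma_cat d) n (zip xs ys) = (if xs = ys then 1 else (0::'k::field))"
proof -
  assume a: "length xs = d" "length ys = d" "ys \<in> words {..<n} d"
  have "(\<forall>(i, j)\<in>set (zip xs ys). i = j \<and> i < n) \<longleftrightarrow> xs = ys"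
  proof
    assume h: "\<forall>(i, j)\<in>set (zip xs ys). i = j \<and> i < n"
    have "xs ! i = ys ! i" if "i < d" for i
      using bspec[OF h, of "(xs ! i, ys ! i)"] nth_mem[of i "zip xs ys"] a that by simp
    then show "xs = ys" using a by (intro nth_equalityI) simp_all
  qed (use a in \<open>auto simp: words_def zip_same_conv_map\<close>)
  then show ?thesis using a by simp
qed

lemma tperm_tens:
  assumes "t \<in> vtens A d V" "\<sigma> \<in> Sym d"
  shows "tperm \<sigma> t \<in> vtens A d V"
  unfolding vtens_def
proof (intro CollectI allI conjI impI)
  fix xs
  show "tperm \<sigma> t xs \<in> V" using assms by (simp add: vtens_def tperm_def)
  assume "xs \<notin> words A d"
  then have "permute_list (iv \<sigma>) xs \<notin> words A d"
    using pl_words_iff[OF Sym_inv[OF assms(2)], of xs] by (auto simp: words_def)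
  then show "tperm \<sigma> t xs = 0" using assms by (auto simp: vtens_def tperm_def)
qed

text \<open>Precomposition and inversion each reverse the order, so tensors inherit the right action
  that \<open>permute_list\<close> has on words. Words of other lengths lie outside the support and
  are treated separately.\<close>

lemma tperm_comp:
  assumes t: "t \<in> vtens A d V" and s: "\<sigma> \<in> Sym d" "\<tau> \<in> Sym d"
  shows "tperm \<tau> (tperm \<sigma> t) = tperm (\<sigma> \<circ> \<tau>) t"
proof
  fix xs
  show "tperm \<tau> (tperm \<sigma> t) xs = tperm (\<sigma> \<circ> \<tau>) t xs"
  proof (cases "length xs = d")
    case True
    have "iv (\<sigma> \<circ> \<tau>) = iv \<tau> \<circ> iv \<sigma>" using s by (simp add: o_inv_distrib permutes_bij)
    then show ?thesis using True by (simp add: tperm_def pl_comp[OF Sym_inv[OF s(2)] Sym_inv[OF s(1)]])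
  next
    case False
    then have "xs \<notin> words A d" by (auto simp: words_def)
    then show ?thesis
      using vtens_0[OF tperm_tens[OF tperm_tens[OF t s(1)] s(2)]] vtens_0[OF tperm_tens[OF t Sym_comp[OF s]]]
      by simp
  qed
qed

context vector_space
begin

lemma vmap_closed:
  assumes f: "f \<in> Gamma_sp ({..<n} \<times> {..<m}) d" and g: "g \<in> vtens {..<m} d V" and V: "subspace V"
  shows "vmap scale d m f g \<in> vtens {..<n} d V"
  unfolding vtens_def
proof (intro CollectI allI conjI impI)
  fix xs
  show "vmap scale d m f g xs \<in> V"
    using g V by (auto simp: vmap_def vtens_def intro!: subspace_sum subspace_scale subspace_0)
  assume "xs \<notin> words {..<n} d"
  then have "f (zip xs ys) = 0" if "length xs = d" "ys \<in> words {..<m} d" for ys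
    using Gamma_sp_tens[OF f, of "zip xs ys"] zip_words[OF that(1) words_length[OF that(2)], of "{..<n}" "{..<m}"]
    by blast
  then show "vmap scale d m f g xs = 0" by (simp add: vmap_def)
qed

lemma vmap_add: "vmap scale d m f (g + h) = vmap scale d m f g + vmap scale d m f h"
  by (auto simp: vmap_def fun_eq_iff scale_right_distrib sum.distrib)

lemma vmap_add_left: "vmap scale d m (f + f') g = vmap scale d m f g + vmap scale d m f' g"
  by (auto simp: vmap_def fun_eq_iff scale_left_distrib sum.distrib)

lemma vmap_scale: "vmap scale d m f (\<lambda>x. scale r (g x)) = (\<lambda>x. scale r (vmap scale d m f g x))"
  by (auto simp: vmap_def fun_eq_iff scale_sum_right mult.commute)

lemma vmap_scale_left: "vmap scale d m (fscale r f) g = (\<lambda>x. scale r (vmap scale d m f g x))"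
  by (auto simp: vmap_def fun_eq_iff scale_sum_right fscale_def)

lemma vmap_Idn:
  assumes "g \<in> vtens {..<n} d V"
  shows "vmap scale d n (Idn (Gamma_cat d) n) g = g"
proof
  fix xs
  show "vmap scale d n (Idn (Gamma_cat d) n) g xs = g xs"
  proof (cases "length xs = d")
    case True
    then have "vmap scale d n (Idn (Gamma_cat d) n) g xs =
        (\<Sum>ys\<in>words {..<n} d. if ys = xs then g ys else 0)"
      unfolding vmap_def by (auto simp del: Gamma_cat_simps simp: Idn_zip words_length intro!: sum.cong)
    also have "\<dots> = g xs" using vtens_0[OF assms, of xs] by (simp add: finite_words sum.delta)
    finally show ?thesis .
  qed (use vtens_0[OF assms, of xs] in \<open>auto simp: vmap_def words_def\<close>)
qed

lemma vmap_Cmp: "vmap scale d l (Cmp (Gamma_cat d) l m n g f) h = vmap scale d m g (vmap scale d l f h)"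
proof
  fix xs
  show "vmap scale d l (Cmp (Gamma_cat d) l m n g f) h xs = vmap scale d m g (vmap scale d l f h) xs"
  proof (cases "length xs = d")
    case True
    then have "vmap scale d l (Cmp (Gamma_cat d) l m n g f) h xs =
        (\<Sum>zs\<in>words {..<l} d. \<Sum>ys\<in>words {..<m} d. scale (g (zip xs ys) * f (zip ys zs)) (h zs))"
      unfolding vmap_def by (auto simp: words_length scale_sum_left intro!: sum.cong)
    also have "\<dots> = (\<Sum>ys\<in>words {..<m} d. \<Sum>zs\<in>words {..<l} d. scale (g (zip xs ys) * f (zip ys zs)) (h zs))"
      by (rule sum.swap)
    also have "\<dots> = vmap scale d m g (vmap scale d l f h) xs"
      unfolding vmap_def using True by (auto simp: words_length scale_sum_right intro!: sum.cong)
    finally show ?thesis .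
  qed (simp add: vmap_def)
qed

text \<open>The invariance of \<open>f\<close> under simultaneous permutation of rows and columns
  moves \<sigma> from the summation variable to the output word. This is where symmetric tensors are
  seen to commute with the permutation of factors.\<close>

lemma vmap_perm:
  assumes f: "f \<in> Gamma_sp ({..<n} \<times> {..<m}) d" and s: "\<sigma> \<in> Sym d" and len: "length xs = d"
  shows "(\<Sum>ys\<in>words {..<m} d. scale (f (zip xs ys)) (g (permute_list \<sigma> ys))) = vmap scale d m f g (permute_list \<sigma> xs)"
proof -
  have "(\<Sum>ys\<in>words {..<m} d. scale (f (zip xs ys)) (g (permute_list \<sigma> ys))) =
     (\<Sum>ys\<in>words {..<m} d. scale (f (zip (permute_list \<sigma> xs) (permute_list \<sigma> ys))) (g (permute_list \<sigma> ys)))"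
  proof (rule sum.cong[OF refl])
    fix ys assume "ys \<in> words {..<m} d"
    then have "length ys = d" by (rule words_length)
    then show "scale (f (zip xs ys)) (g (permute_list \<sigma> ys)) =
        scale (f (zip (permute_list \<sigma> xs) (permute_list \<sigma> ys))) (g (permute_list \<sigma> ys))"
      using Gamma_sp_perm[OF f s, of "zip xs ys"] len by (simp add: pl_zip[OF s])
  qed
  also have "\<dots> = (\<Sum>ys\<in>words {..<m} d. scale (f (zip (permute_list \<sigma> xs) ys)) (g ys))"
    by (rule sum.reindex_bij_betw[OF bij_pl_words[OF s]])
  finally show ?thesis using len by (simp add: vmap_def)
qed

lemma vmap_tperm:
  assumes f: "f \<in> Gamma_sp ({..<n} \<times> {..<m}) d" and s: "\<sigma> \<in> Sym d"
  shows "vmap scale d m f (tperm \<sigma> g) = tperm \<sigma> (vmap scale d m f g)"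
proof
  fix xs
  show "vmap scale d m f (tperm \<sigma> g) xs = tperm \<sigma> (vmap scale d m f g) xs"
    using vmap_perm[OF f Sym_inv[OF s], of xs g] by (cases "length xs = d") (auto simp: vmap_def tperm_def)
qed

lemma vfun_functor:
  assumes V: "subspace V"
  shows "is_functor (Gamma_cat d) (vfun scale d V)"
  unfolding is_functor_def
proof (intro conjI allI ballI)
  fix m n l r x and f g :: "(nat \<times> nat) list \<Rightarrow> 'a"
  show "vspace (Ob (vfun scale d V) n)"
    using V by (intro vspaceI)
      (auto simp: vfun_def vtens_def subspace_def scale_left_distrib scale_right_distrib fun_eq_iff algebra_simps)
  assume f: "f \<in> Hom (Gamma_cat d) m n"
  then show "Mp (vfun scale d V) m n f \<in> lin_maps (Ob (vfun scale d V) m) (Ob (vfun scale d V) n)"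
    using vmap_closed[of f n m d _ V] V by (intro lin_mapsI) (auto simp: vfun_def vmap_add vmap_scale)
  assume "x \<in> carrier (Ob (vfun scale d V) m)"
  then show "Mp (vfun scale d V) m n (fscale r f) x = r \<odot>\<^bsub>Ob (vfun scale d V) n\<^esub> Mp (vfun scale d V) m n f x"
    by (simp add: vfun_def vmap_scale_left)
  show "Mp (vfun scale d V) m n (f + g) x = Mp (vfun scale d V) m n f x \<oplus>\<^bsub>Ob (vfun scale d V) n\<^esub> Mp (vfun scale d V) m n g x"
    by (simp add: vfun_def vmap_add_left)
  show "Mp (vfun scale d V) m l (Cmp (Gamma_cat d) m n l g f) x = Mp (vfun scale d V) n l g (Mp (vfun scale d V) m n f x)"
    using vmap_Cmp by (simp add: vfun_def)
next
  fix n x assume "x \<in> carrier (Ob (vfun scale d V) n)"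
  then show "Mp (vfun scale d V) n n (Idn (Gamma_cat d) n) x = x"
    using vmap_Idn by (simp add: vfun_def)
qed

end

interpretation kvs: vector_space "(*) :: 'k::field \<Rightarrow> 'k \<Rightarrow> 'k"
  by standard (auto simp: algebra_simps)

declare kvs.scale_scale [simp del]

lemma tens_map_vmap: "tens_map d m = vmap (*) d m"
  by (simp add: tens_map_def vmap_def fun_eq_iff)

lemma tens_functor_vfun: "tens_functor d = vfun (*) d UNIV"
  by (simp add: tens_functor_def vfun_def fun_module_def tens_vtens tens_map_vmap fscale_def fun_eq_iff)

lemma tens_functor_functor: "is_functor (Gamma_cat d) (tens_functor d :: ('k::field, _) spf)"
  unfolding tens_functor_vfun by (rule kvs.vfun_functor) simp

lemma tens_functor_simps [simp]:
  "carrier (Ob (tens_functor d) n) = tens {..<n} d"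
  "Mp (tens_functor d) m n = tens_map d m"
  "\<zero>\<^bsub>Ob (tens_functor d) n\<^esub> = 0"
  "s \<oplus>\<^bsub>Ob (tens_functor d) n\<^esub> t = s + t"
  "r \<odot>\<^bsub>Ob (tens_functor d) n\<^esub> t = fscale r t"
  by (simp_all add: tens_functor_def fun_module_def)

lemma tens_map_closed: "\<lbrakk>f \<in> Gamma_sp ({..<n} \<times> {..<m}) d; t \<in> tens {..<m} d\<rbrakk> \<Longrightarrow> tens_map d m f t \<in> tens {..<n} d"
  using fun_closed[OF tens_functor_functor, of f d m n t] by simp

lemma tens_add: "\<lbrakk>s \<in> tens A d; t \<in> tens A d\<rbrakk> \<Longrightarrow> s + t \<in> tens A d"
  by (auto simp: tens_vtens vtens_def)

lemma tens_fscale: "t \<in> tens A d \<Longrightarrow> fscale r t \<in> tens A d"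
  by (auto simp: tens_def fscale_def)

lemma tens_sum: "(\<And>i. i \<in> I \<Longrightarrow> t i \<in> tens A d) \<Longrightarrow> (\<Sum>i\<in>I. t i) \<in> tens A d"
  by (induction I rule: infinite_finite_induct) (auto simp: tens_add, auto simp: tens_def)

definition dl :: "'x list \<Rightarrow> 'x list \<Rightarrow> 'k::field"
  where "dl w = (\<lambda>xs. if xs = w then 1 else 0)"

text \<open>
  \<open>idw d\<close> is \<open>e\<^sub>0 \<otimes> \<dots> \<otimes> e\<^sub>d\<^sub>-\<^sub>1\<close>. It generates \<open>\<otimes>\<^sup>d\<close>, and \<open>t \<mapsto> bx d t (idw d)\<close> below
  splits the evaluation of morphisms at it, so that \<open>\<otimes>\<^sup>d\<close> behaves like a representable functor.
\<close>

abbreviation idw :: "nat \<Rightarrow> nat list \<Rightarrow> 'k::field"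
  where "idw d \<equiv> dl [0..<d]"

lemma dl_tens: "w \<in> words A d \<Longrightarrow> dl w \<in> tens A d"
  by (auto simp: dl_def tens_def)

lemma upt_words: "[0..<d] \<in> words {..<d} d"
  by (auto simp: words_def)

text \<open>The letters of \<open>[0..<d]\<close> are distinct, so its stabiliser is trivial. All
  evaluations at \<open>idw d\<close> below collapse a sum over permutations to one term for this
  reason.\<close>

lemma pl_upt: "\<sigma> \<in> Sym d \<Longrightarrow> permute_list \<sigma> [0..<d] = [0..<d] \<longleftrightarrow> \<sigma> = id"
proof
  assume s: "\<sigma> \<in> Sym d" and e: "permute_list \<sigma> [0..<d] = [0..<d]"
  have "\<sigma> i = i" for i
  proof (cases "i < d")
    case True
    then have "permute_list \<sigma> [0..<d] ! i = \<sigma> i" using s permutes_in_image[of \<sigma> "{..<d}" i]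
      by (auto simp: permute_list_def)
    then show ?thesis using e True by simp
  qed (use s in \<open>auto simp: permutes_def\<close>)
  then show "\<sigma> = id" by auto
qed simp

text \<open>The symmetrization of \<open>s \<otimes> t\<close>, as a morphism from the source of \<open>t\<close> to that of \<open>s\<close>.\<close>

definition bx :: "nat \<Rightarrow> (nat list \<Rightarrow> 'k::field) \<Rightarrow> (nat list \<Rightarrow> 'k) \<Rightarrow> (nat \<times> nat) list \<Rightarrow> 'k"
  where "bx d s t = (\<lambda>zs. \<Sum>\<sigma>\<in>Sym d. s (permute_list \<sigma> (map fst zs)) * t (permute_list \<sigma> (map snd zs)))"

lemma bx_Gamma:
  assumes s: "s \<in> tens {..<n} d" and t: "t \<in> tens {..<m} d"
  shows "bx d s t \<in> Gamma_sp ({..<n} \<times> {..<m}) d"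
proof -
  have z: "bx d s t zs = 0" if "zs \<notin> words ({..<n} \<times> {..<m}) d" for zs
    unfolding bx_def
  proof (rule sum.neutral, rule ballI)
    fix \<sigma> assume sg: "\<sigma> \<in> Sym d"
    show "s (permute_list \<sigma> (map fst zs)) * t (permute_list \<sigma> (map snd zs)) = 0"
    proof (rule ccontr)
      assume "\<not> ?thesis"
      then have "permute_list \<sigma> (map fst zs) \<in> words {..<n} d" "permute_list \<sigma> (map snd zs) \<in> words {..<m} d"
        using s t by (auto simp: tens_def)
      moreover then have l: "length zs = d" by (auto simp: words_def)
      ultimately have "map fst zs \<in> words {..<n} d" "map snd zs \<in> words {..<m} d"
        using pl_words_iff[OF sg, of "map fst zs"] pl_words_iff[OF sg, of "map snd zs"] by simp_all
      then have "zs \<in> words ({..<n} \<times> {..<m}) d"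
        using zip_words[of "map fst zs" d "map snd zs" "{..<n}" "{..<m}"] l by (simp add: zip_map_fst_snd)
      with that show False ..
    qed
  qed
  have tp: "tperm \<tau> (bx d s t) zs = bx d s t zs" if ta: "\<tau> \<in> Sym d" for \<tau> zs
  proof (cases "length zs = d")
    case True
    let ?f = "\<lambda>\<sigma>. s (permute_list \<sigma> (map fst zs)) * t (permute_list \<sigma> (map snd zs))"
    have "tperm \<tau> (bx d s t) zs = (\<Sum>\<sigma>\<in>Sym d. ?f (iv \<tau> \<circ> \<sigma>))"
      unfolding tperm_def bx_def
      using Sym_inv[OF ta] True
      by (intro sum.cong[OF refl]) (simp add: permute_list_map[symmetric] permute_list_compose)
    also have "\<dots> = (\<Sum>\<sigma>\<in>Sym d. ?f \<sigma>)"
      by (rule sum.reindex_bij_betw[OF bij_Sym_comp[OF Sym_inv[OF ta]]])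
    finally show ?thesis by (simp add: bx_def)
  next
    case False
    then show ?thesis using z[of zs] z[of "permute_list (iv \<tau>) zs"] by (auto simp: tperm_def words_def)
  qed
  have "tperm \<tau> (bx d s t) = bx d s t" if "\<tau> \<in> Sym d" for \<tau>
    by (rule ext) (rule tp[OF that])
  moreover have "bx d s t \<in> tens ({..<n} \<times> {..<m}) d"
    unfolding tens_def
  proof (intro CollectI allI impI)
    fix zs assume "bx d s t zs \<noteq> 0"
    then show "zs \<in> words ({..<n} \<times> {..<m}) d" using z[of zs] by blast
  qed
  ultimately show ?thesis unfolding Gamma_sp_def by blast
qed

lemma bx_add: "bx d (s + s') t = bx d s t + bx d s' t"
  by (simp add: bx_def fun_eq_iff distrib_right sum.distrib)

lemma bx_fscale: "bx d (fscale r s) t = fscale r (bx d s t)"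
  by (simp add: bx_def fscale_def fun_eq_iff sum_distrib_left mult.assoc)

context vector_space
begin

text \<open>\<open>bx d s t\<close> acts as a symmetrized operator of rank one: pair with a permuted
  \<open>t\<close>, multiply by the equally permuted \<open>s\<close>, and add up.\<close>

lemma vmap_bx:
  assumes "length xs = d"
  shows "vmap scale d m (bx d s t) g xs =
    (\<Sum>\<sigma>\<in>Sym d. scale (s (permute_list \<sigma> xs)) (\<Sum>ys\<in>words {..<m} d. scale (t (permute_list \<sigma> ys)) (g ys)))"
proof -
  have "vmap scale d m (bx d s t) g xs =
      (\<Sum>ys\<in>words {..<m} d. \<Sum>\<sigma>\<in>Sym d. scale (s (permute_list \<sigma> xs) * t (permute_list \<sigma> ys)) (g ys))"
    unfolding vmap_def bx_def using assms by (auto simp: scale_sum_left words_length intro!: sum.cong)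
  also have "\<dots> = (\<Sum>\<sigma>\<in>Sym d. \<Sum>ys\<in>words {..<m} d. scale (s (permute_list \<sigma> xs) * t (permute_list \<sigma> ys)) (g ys))"
    by (rule sum.swap)
  finally show ?thesis by (simp add: scale_sum_right)
qed

text \<open>Only the identity permutation survives at \<open>[0..<d]\<close>. Thus the morphisms
  \<open>bx d (idw d) (dl w)\<close> read off single coefficients, and elements of tensor powers are
  detected by their images over the object \<open>d\<close>.\<close>

lemma vmap_bx_dl:
  assumes "g \<in> vtens {..<m} d V"
  shows "vmap scale d m (bx d (idw d) (dl w)) g [0..<d] = g w"
proof -
  have "vmap scale d m (bx d (idw d) (dl w)) g [0..<d] =
      (\<Sum>\<sigma>\<in>Sym d. if \<sigma> = id then \<Sum>ys\<in>words {..<m} d. if ys = w then g ys else 0 else 0)"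
    unfolding vmap_bx[of "[0..<d]" d, simplified]
    by (intro sum.cong[OF refl]) (auto simp: dl_def pl_upt intro!: sum.cong)
  also have "\<dots> = g w"
    using vtens_0[OF assms, of w] by (simp add: sum.delta finite_words permutes_id)
  finally show ?thesis .
qed

end

text \<open>The pairing of \<open>idw d\<close> with its own permutations is the Kronecker delta at
  the identity, so in the sum over permutations only \<open>t\<close> itself remains.\<close>

lemma tens_map_bx_idw:
  assumes t: "t \<in> tens {..<n} d"
  shows "tens_map d d (bx d t (idw d)) (idw d) = t"
proof
  fix xs
  show "tens_map d d (bx d t (idw d)) (idw d) xs = t xs"
  proof (cases "length xs = d")
    case True
    have i: "(\<Sum>ys\<in>words {..<d} d. idw d (permute_list \<sigma> ys) * idw d ys) = (if \<sigma> = id then 1 else (0::'a))"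
      if "\<sigma> \<in> Sym d" for \<sigma>
    proof -
      have "(\<Sum>ys\<in>words {..<d} d. idw d (permute_list \<sigma> ys) * idw d ys) =
          (\<Sum>ys\<in>words {..<d} d. if ys = [0..<d] then (if \<sigma> = id then 1 else 0) else (0::'a))"
        using that by (intro sum.cong[OF refl]) (auto simp: dl_def pl_upt)
      then show ?thesis using upt_words[of d] by (simp add: sum.delta finite_words)
    qed
    have "tens_map d d (bx d t (idw d)) (idw d) xs = (\<Sum>\<sigma>\<in>Sym d. t (permute_list \<sigma> xs) * (if \<sigma> = id then 1 else 0))"
      unfolding tens_map_vmap kvs.vmap_bx[OF True] by (intro sum.cong[OF refl]) (simp only: i)
    also have "\<dots> = (\<Sum>\<sigma>\<in>Sym d. if \<sigma> = id then t xs else 0)"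
      by (intro sum.cong[OF refl]) auto
    also have "\<dots> = t xs"
      by (simp add: sum.delta permutes_id)
    finally show ?thesis .
  next
    case False
    then show ?thesis using tens_0[OF t, of xs] by (auto simp: tens_map_def words_def)
  qed
qed

text \<open>\<open>f\<close> passes under each permutation by \<open>vmap_perm\<close>. Hence
  \<open>bx\<close> is natural in its first tensor, which makes \<open>yo\<close> below a natural
  transformation.\<close>

lemma Cmp_bx:
  assumes f: "f \<in> Gamma_sp ({..<n} \<times> {..<m}) d" and s: "s \<in> tens {..<m} d" and t: "t \<in> tens {..<l} d"
  shows "Cmp (Gamma_cat d) l m n f (bx d s t) = bx d (tens_map d m f s) t"
proof
  fix zs
  show "Cmp (Gamma_cat d) l m n f (bx d s t) zs = bx d (tens_map d m f s) t zs"
  proof (cases "length zs = d")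
    case True
    let ?x = "map fst zs" and ?y = "map snd zs"
    have "Cmp (Gamma_cat d) l m n f (bx d s t) zs = (\<Sum>ys\<in>words {..<m} d. f (zip ?x ys) * bx d s t (zip ys ?y))"
      using True by simp
    also have "\<dots> = (\<Sum>ys\<in>words {..<m} d. \<Sum>\<sigma>\<in>Sym d.
        f (zip ?x ys) * s (permute_list \<sigma> ys) * t (permute_list \<sigma> ?y))"
    proof (rule sum.cong[OF refl])
      fix ys assume "ys \<in> words {..<m} d"
      then have "length ys = d" by (rule words_length)
      then show "f (zip ?x ys) * bx d s t (zip ys ?y) =
          (\<Sum>\<sigma>\<in>Sym d. f (zip ?x ys) * s (permute_list \<sigma> ys) * t (permute_list \<sigma> ?y))"
        using True by (simp add: bx_def sum_distrib_left mult.assoc)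
    qed
    also have "\<dots> = (\<Sum>\<sigma>\<in>Sym d. (\<Sum>ys\<in>words {..<m} d. f (zip ?x ys) * s (permute_list \<sigma> ys)) * t (permute_list \<sigma> ?y))"
      by (subst sum.swap) (simp add: sum_distrib_right)
    also have "\<dots> = bx d (tens_map d m f s) t zs"
      unfolding bx_def tens_map_vmap using True
      by (intro sum.cong[OF refl]) (simp add: kvs.vmap_perm[OF f])
    finally show ?thesis .
  next
    case False
    then show ?thesis
      using Gamma_sp_tens[OF bx_Gamma[OF tens_map_closed[OF f s] t], of zs] by (auto simp: words_def)
  qed
qed

text \<open>The counterpart for the second tensor, expanded in basis words: as a finite linear
  combination of morphisms it can be pushed through a functor and a linear map by
  \<open>functor_sum\<close>.\<close>

lemma bx_Cmp_dl:
  assumes f: "f \<in> Gamma_sp ({..<n} \<times> {..<m}) d" and w: "w \<in> words {..<n} d" and s: "s \<in> tens {..<l} d"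
  shows "Cmp (Gamma_cat d) m n l (bx d s (dl w)) f = (\<Sum>v\<in>words {..<m} d. fscale (f (zip w v)) (bx d s (dl v)))"
proof
  fix zs
  note fw = finite_words[of "{..<n}", simplified] finite_words[of "{..<m}", simplified]
  show "Cmp (Gamma_cat d) m n l (bx d s (dl w)) f zs = (\<Sum>v\<in>words {..<m} d. fscale (f (zip w v)) (bx d s (dl v))) zs"
  proof (cases "length zs = d")
    case True
    let ?x = "map fst zs" and ?y = "map snd zs"
    have lw: "length w = d" using w by (rule words_length)
    have a: "(\<Sum>ys\<in>words {..<n} d. dl w (permute_list \<sigma> ys) * f (zip ys ?y)) = f (zip w (permute_list \<sigma> ?y))"
      if sg: "\<sigma> \<in> Sym d" for \<sigma>
    proof -
      have "(\<Sum>ys\<in>words {..<n} d. dl w (permute_list \<sigma> ys) * f (zip ys ?y)) =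
          (\<Sum>ys\<in>words {..<n} d. dl w (permute_list \<sigma> ys) * f (zip (permute_list \<sigma> ys) (permute_list \<sigma> ?y)))"
      proof (rule sum.cong[OF refl])
        fix ys assume "ys \<in> words {..<n} d"
        then have "length ys = d" by (rule words_length)
        then show "dl w (permute_list \<sigma> ys) * f (zip ys ?y) =
            dl w (permute_list \<sigma> ys) * f (zip (permute_list \<sigma> ys) (permute_list \<sigma> ?y))"
          using Gamma_sp_perm[OF f sg, of "zip ys ?y"] True pl_zip[OF sg, of ys ?y] by simp
      qed
      also have "\<dots> = (\<Sum>ys\<in>words {..<n} d. dl w ys * f (zip ys (permute_list \<sigma> ?y)))"
        by (rule sum.reindex_bij_betw[OF bij_pl_words[OF sg]])
      also have "\<dots> = (\<Sum>ys\<in>words {..<n} d. if ys = w then f (zip w (permute_list \<sigma> ?y)) else 0)"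
        by (intro sum.cong[OF refl]) (auto simp: dl_def)
      finally show ?thesis using w by (simp add: sum.delta fw)
    qed
    have b: "(\<Sum>v\<in>words {..<m} d. f (zip w v) * dl v (permute_list \<sigma> ?y)) = f (zip w (permute_list \<sigma> ?y))"
      if sg: "\<sigma> \<in> Sym d" for \<sigma>
    proof -
      have "(\<Sum>v\<in>words {..<m} d. f (zip w v) * dl v (permute_list \<sigma> ?y)) =
          (\<Sum>v\<in>words {..<m} d. if v = permute_list \<sigma> ?y then f (zip w v) else 0)"
        by (intro sum.cong[OF refl]) (auto simp: dl_def)
      also have "\<dots> = f (zip w (permute_list \<sigma> ?y))"
        using Gamma_sp_tens[OF f, of "zip w (permute_list \<sigma> ?y)"] True lw
        by (auto simp: sum.delta fw zip_words)
      finally show ?thesis .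
    qed
    have "Cmp (Gamma_cat d) m n l (bx d s (dl w)) f zs =
        (\<Sum>ys\<in>words {..<n} d. bx d s (dl w) (zip ?x ys) * f (zip ys ?y))"
      using True by simp
    also have "\<dots> = (\<Sum>ys\<in>words {..<n} d. \<Sum>\<sigma>\<in>Sym d.
        s (permute_list \<sigma> ?x) * (dl w (permute_list \<sigma> ys) * f (zip ys ?y)))"
    proof (rule sum.cong[OF refl])
      fix ys assume "ys \<in> words {..<n} d"
      then have "length ys = d" by (rule words_length)
      then show "bx d s (dl w) (zip ?x ys) * f (zip ys ?y) =
          (\<Sum>\<sigma>\<in>Sym d. s (permute_list \<sigma> ?x) * (dl w (permute_list \<sigma> ys) * f (zip ys ?y)))"
        using True by (simp add: bx_def sum_distrib_right mult.assoc)
    qed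
    also have "\<dots> = (\<Sum>\<sigma>\<in>Sym d. s (permute_list \<sigma> ?x) * (\<Sum>ys\<in>words {..<n} d. dl w (permute_list \<sigma> ys) * f (zip ys ?y)))"
      by (subst sum.swap) (simp add: sum_distrib_left)
    also have "\<dots> = (\<Sum>\<sigma>\<in>Sym d. s (permute_list \<sigma> ?x) * (\<Sum>v\<in>words {..<m} d. f (zip w v) * dl v (permute_list \<sigma> ?y)))"
      by (intro sum.cong[OF refl]) (simp only: a b)
    also have "\<dots> = (\<Sum>v\<in>words {..<m} d. \<Sum>\<sigma>\<in>Sym d. f (zip w v) * (s (permute_list \<sigma> ?x) * dl v (permute_list \<sigma> ?y)))"
      by (subst sum.swap) (simp add: sum_distrib_left mult.left_commute)
    also have "\<dots> = (\<Sum>v\<in>words {..<m} d. fscale (f (zip w v)) (bx d s (dl v))) zs"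
      by (simp add: sum_fun_apply fscale_def bx_def sum_distrib_left)
    finally show ?thesis .
  next
    case False
    have "bx d s (dl v) zs = 0" if "v \<in> words {..<m} d" for v
      using Gamma_sp_tens[OF bx_Gamma[OF s dl_tens[OF that]], of zs] False by (auto simp: words_def)
    then show ?thesis using False by (auto simp: sum_fun_apply fscale_def intro!: sum.neutral[symmetric])
  qed
qed

lemma Gamma_sp_0: "(0 :: 'x list \<Rightarrow> 'k::field) \<in> Gamma_sp A d"
  by (auto simp: Gamma_sp_def tens_def tperm_def fun_eq_iff)

lemma Gamma_sp_add: "\<lbrakk>f \<in> Gamma_sp A d; g \<in> Gamma_sp A d\<rbrakk> \<Longrightarrow> f + g \<in> Gamma_sp A d"
  by (auto simp: Gamma_sp_def tens_add) (auto simp: tperm_def fun_eq_iff)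

lemma Gamma_sp_fscale: "f \<in> Gamma_sp A d \<Longrightarrow> fscale r f \<in> Gamma_sp A d"
  by (auto simp: Gamma_sp_def tens_fscale) (auto simp: tperm_def fun_eq_iff fscale_def)

section \<open>The Schur functor\<close>

text \<open>Evaluation at \<open>idw d\<close> embeds the Schur functor of \<open>F\<close> into the
  value of \<open>F\<close> at \<open>d\<close>, and \<open>yo\<close> is a retraction of it. The
  image is the weight space of weight \<open>(1, ..., 1)\<close>, cut out by the idempotent
  \<open>bx d (idw d) (idw d)\<close>.\<close>

definition yo :: "nat \<Rightarrow> ('k::field, 'v) spf \<Rightarrow> 'v \<Rightarrow> nat \<Rightarrow> (nat list \<Rightarrow> 'k) \<Rightarrow> 'v"
  where "yo d F x = ntr (tens_functor d) (\<lambda>n t. Mp F d n (bx d t (idw d)) x)"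

lemma idw_tens: "idw d \<in> tens {..<d} d"
  by (rule dl_tens[OF upt_words])

lemma bx_Hom: "t \<in> tens {..<n} d \<Longrightarrow> bx d t (idw d) \<in> Gamma_sp ({..<n} \<times> {..<d}) d"
  by (rule bx_Gamma[OF _ idw_tens])

lemma yo_apply [simp]: "t \<in> tens {..<n} d \<Longrightarrow> yo d F x n t = Mp F d n (bx d t (idw d)) x"
  by (simp add: yo_def)

lemma yo_nt:
  assumes F: "strict_poly_functor d F" and x: "x \<in> carrier (Ob F d)"
  shows "yo d F x \<in> nat_trans (Gamma_cat d) (tens_functor d) F"
  unfolding yo_def
proof (rule ntrI[OF tens_functor_functor])
  fix n
  show "(\<lambda>t. Mp F d n (bx d t (idw d)) x) \<in> lin_maps (Ob (tens_functor d) n) (Ob F n)"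
  proof (rule lin_mapsI)
    fix s t :: "nat list \<Rightarrow> 'a" and r
    assume t: "t \<in> carrier (Ob (tens_functor d) n)"
    have B: "bx d t (idw d) \<in> Hom (Gamma_cat d) d n" if "t \<in> tens {..<n} d" for t
      using bx_Hom[OF that] by simp
    show "Mp F d n (bx d t (idw d)) x \<in> carrier (Ob F n)"
      using fun_closed[OF F B x] t by simp
    show "Mp F d n (bx d (r \<odot>\<^bsub>Ob (tens_functor d) n\<^esub> t) (idw d)) x = r \<odot>\<^bsub>Ob F n\<^esub> Mp F d n (bx d t (idw d)) x"
      using fun_scale[OF F B x] t by (simp add: bx_fscale)
    assume s: "s \<in> carrier (Ob (tens_functor d) n)"
    show "Mp F d n (bx d (s \<oplus>\<^bsub>Ob (tens_functor d) n\<^esub> t) (idw d)) x =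
        Mp F d n (bx d s (idw d)) x \<oplus>\<^bsub>Ob F n\<^esub> Mp F d n (bx d t (idw d)) x"
      using fun_add[OF F B B x] s t by (simp add: bx_add)
  qed
next
  fix m n :: nat and f :: "(nat \<times> nat) list \<Rightarrow> 'a" and t :: "nat list \<Rightarrow> 'a"
  assume f: "f \<in> Hom (Gamma_cat d) m n" and t: "t \<in> carrier (Ob (tens_functor d) m)"
  have "Mp F d n (Cmp (Gamma_cat d) d m n f (bx d t (idw d))) x = Mp F m n f (Mp F d m (bx d t (idw d)) x)"
    by (rule fun_comp[OF F _ f x]) (use bx_Hom t in simp)
  then show "Mp F d n (bx d (Mp (tens_functor d) m n f t) (idw d)) x = Mp F m n f (Mp F d m (bx d t (idw d)) x)"
    using Cmp_bx[OF f[simplified] t[simplified] idw_tens] by simp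
qed

text \<open>Naturality along \<open>bx d t (idw d)\<close>, which carries \<open>idw d\<close> to
  \<open>t\<close>: a morphism out of the tensor power is determined by one value.\<close>

lemma yoneda:
  assumes p: "\<phi> \<in> nat_trans (Gamma_cat d) (tens_functor d) F" and t: "t \<in> tens {..<n} d"
  shows "\<phi> n t = Mp F d n (bx d t (idw d)) (\<phi> d (idw d))"
proof -
  have "\<phi> n (Mp (tens_functor d) d n (bx d t (idw d)) (idw d)) = Mp F d n (bx d t (idw d)) (\<phi> d (idw d))"
    by (rule nt_nat[OF p]) (simp_all add: bx_Hom t idw_tens)
  then show ?thesis by (simp add: tens_map_bx_idw[OF t])
qed

lemma schur_carrier [simp]: "carrier (Ob (schur d F) a) = nat_trans (Gamma_cat d) (tens_functor d) F"
  by (simp add: schur_def)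

lemma schur_Ob: "Ob (schur d F) a = hom_module (Gamma_cat d) (tens_functor d) F"
  by (simp add: schur_def)

lemma schur_Mp: "t \<in> tens {..<n} d \<Longrightarrow> Mp (schur d F) a b g \<phi> n t = \<phi> n (tens_act d g t)"
  by (simp add: schur_def)

lemma schur_ext:
  assumes "\<phi> \<in> nat_trans (Gamma_cat d) (tens_functor d) F" "\<psi> \<in> nat_trans (Gamma_cat d) (tens_functor d) F"
    and "\<phi> d (idw d) = \<psi> d (idw d)"
  shows "\<phi> = \<psi>"
  by (rule nt_eqI[OF assms(1,2)]) (simp add: yoneda[OF assms(1)] yoneda[OF assms(2)] assms(3))

lemma yo_ev: "\<phi> \<in> nat_trans (Gamma_cat d) (tens_functor d) F \<Longrightarrow> strict_poly_functor d F \<Longrightarrow> yo d F (\<phi> d (idw d)) = \<phi>"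
  by (rule schur_ext[OF yo_nt]) (simp_all add: nt_closed idw_tens yoneda[of \<phi> d F "idw d" d, symmetric])

lemma yo_natural:
  assumes F: "strict_poly_functor d F" and G: "strict_poly_functor d G"
    and e: "\<eta> \<in> nat_trans (Gamma_cat d) F G" and x: "x \<in> carrier (Ob F d)"
  shows "ncomp (tens_functor d) \<eta> (yo d F x) = yo d G (\<eta> d x)"
proof (rule nt_eqI[OF ncomp_closed[OF tens_functor_functor yo_nt[OF F x] e] yo_nt[OF G nt_closed[OF e x]]])
  fix n t assume "t \<in> carrier (Ob (tens_functor d :: ('a, _) spf) n)"
  then show "ncomp (tens_functor d) \<eta> (yo d F x) n t = yo d G (\<eta> d x) n t"
    using nt_nat[OF e _ x] by (simp add: bx_Hom)
qed

lemma tens_act_closed: "t \<in> tens A d \<Longrightarrow> tens_act d a t \<in> tens A d"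
  unfolding tens_act_def by (intro tens_sum tens_fscale) (simp add: tens_vtens tperm_tens)

lemma tens_act_apply: "tens_act d a t xs = (\<Sum>\<sigma>\<in>Sym d. a \<sigma> * tperm \<sigma> t xs)"
  by (simp add: tens_act_def sum_fun_apply fscale_def)

lemma tens_act_add: "tens_act d a (s + t) = tens_act d a s + tens_act d a t"
  by (rule ext) (simp add: tens_act_apply tperm_def distrib_left sum.distrib)

lemma tens_act_fscale: "tens_act d a (fscale r t) = fscale r (tens_act d a t)"
  by (rule ext) (simp add: tens_act_apply tperm_def fscale_def sum_distrib_left mult.left_commute)

lemma tens_act_add_left: "tens_act d (a + b) t = tens_act d a t + tens_act d b t"
  by (rule ext) (simp add: tens_act_apply distrib_right sum.distrib)

lemma tens_act_fscale_left: "tens_act d (fscale r a) t = fscale r (tens_act d a t)"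
  by (rule ext) (simp add: tens_act_apply fscale_def sum_distrib_left mult.assoc)

lemma tens_act_Idn: "tens_act d (Idn (Sym_cat d) ()) t = t"
proof
  fix xs
  have "tens_act d (Idn (Sym_cat d) ()) t xs = (\<Sum>\<sigma>\<in>Sym d. if \<sigma> = id then t xs else 0)"
    unfolding tens_act_apply by (intro sum.cong[OF refl]) (auto simp: Sym_cat_def tperm_def)
  then show "tens_act d (Idn (Sym_cat d) ()) t xs = t xs" by (simp add: sum.delta permutes_id)
qed

text \<open>The action on tensors is a right action, so the product of \<open>a\<close> and
  \<open>b\<close> applies \<open>a\<close> first. Precomposition reverses this once more, and the
  Schur functor takes values in left modules.\<close>

lemma tens_act_Cmp:
  assumes t: "t \<in> tens A d"
  shows "tens_act d (Cmp (Sym_cat d) x y z a b) t = tens_act d b (tens_act d a t)"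
proof
  fix xs
  have r: "(\<Sum>\<rho>\<in>Sym d. b (iv \<sigma> \<circ> \<rho>) * tperm \<rho> t xs) = (\<Sum>\<tau>\<in>Sym d. b \<tau> * tperm (\<sigma> \<circ> \<tau>) t xs)" if s: "\<sigma> \<in> Sym d" for \<sigma>
  proof -
    have i: "iv \<sigma> \<circ> (\<sigma> \<circ> \<tau>) = \<tau>" for \<tau>
      using s by (simp add: comp_assoc[symmetric] permutes_inv_o)
    show ?thesis
      using sum.reindex_bij_betw[OF bij_Sym_comp[OF s], of "\<lambda>\<rho>. b (iv \<sigma> \<circ> \<rho>) * tperm \<rho> t xs"] by (simp add: i)
  qed
  have "tens_act d (Cmp (Sym_cat d) x y z a b) t xs =
      (\<Sum>\<rho>\<in>Sym d. \<Sum>\<sigma>\<in>Sym d. a \<sigma> * (b (iv \<sigma> \<circ> \<rho>) * tperm \<rho> t xs))"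
    by (simp add: tens_act_apply Sym_cat_def sum_distrib_right mult.assoc)
  also have "\<dots> = (\<Sum>\<sigma>\<in>Sym d. a \<sigma> * (\<Sum>\<rho>\<in>Sym d. b (iv \<sigma> \<circ> \<rho>) * tperm \<rho> t xs))"
    by (subst sum.swap) (simp add: sum_distrib_left)
  also have "\<dots> = (\<Sum>\<sigma>\<in>Sym d. a \<sigma> * (\<Sum>\<tau>\<in>Sym d. b \<tau> * tperm (\<sigma> \<circ> \<tau>) t xs))"
    by (intro sum.cong[OF refl]) (simp only: r)
  also have "\<dots> = (\<Sum>\<sigma>\<in>Sym d. a \<sigma> * (\<Sum>\<tau>\<in>Sym d. b \<tau> * tperm \<tau> (tperm \<sigma> t) xs))"
  proof (rule sum.cong[OF refl])
    fix \<sigma> assume s: "\<sigma> \<in> Sym d"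
    have "(\<Sum>\<tau>\<in>Sym d. b \<tau> * tperm (\<sigma> \<circ> \<tau>) t xs) = (\<Sum>\<tau>\<in>Sym d. b \<tau> * tperm \<tau> (tperm \<sigma> t) xs)"
      by (rule sum.cong[OF refl]) (simp only: tperm_comp[OF t[unfolded tens_vtens] s])
    then show "a \<sigma> * (\<Sum>\<tau>\<in>Sym d. b \<tau> * tperm (\<sigma> \<circ> \<tau>) t xs) =
        a \<sigma> * (\<Sum>\<tau>\<in>Sym d. b \<tau> * tperm \<tau> (tperm \<sigma> t) xs)" by simp
  qed
  also have "\<dots> = (\<Sum>\<tau>\<in>Sym d. b \<tau> * (\<Sum>\<sigma>\<in>Sym d. a \<sigma> * tperm \<tau> (tperm \<sigma> t) xs))"
    unfolding sum_distrib_left by (subst sum.swap) (simp add: mult.left_commute)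
  also have "\<dots> = tens_act d b (tens_act d a t) xs"
    unfolding tens_act_apply[of d b] by (intro sum.cong[OF refl]) (simp add: tperm_def tens_act_apply)
  finally show "tens_act d (Cmp (Sym_cat d) x y z a b) t xs = tens_act d b (tens_act d a t) xs" .
qed

lemma tens_act_map:
  assumes f: "f \<in> Gamma_sp ({..<n} \<times> {..<m}) d"
  shows "tens_act d a (tens_map d m f t) = tens_map d m f (tens_act d a t)"
proof
  fix xs
  have "tens_act d a (tens_map d m f t) xs = (\<Sum>\<sigma>\<in>Sym d. a \<sigma> * tens_map d m f (tperm \<sigma> t) xs)"
    unfolding tens_act_apply tens_map_vmap by (intro sum.cong[OF refl]) (simp add: kvs.vmap_tperm[OF f])
  also have "\<dots> = tens_map d m f (tens_act d a t) xs"
  proof (cases "length xs = d")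
    case True
    have "(\<Sum>\<sigma>\<in>Sym d. a \<sigma> * (\<Sum>ys\<in>words {..<m} d. f (zip xs ys) * tperm \<sigma> t ys)) =
        (\<Sum>ys\<in>words {..<m} d. f (zip xs ys) * (\<Sum>\<sigma>\<in>Sym d. a \<sigma> * tperm \<sigma> t ys))"
      unfolding sum_distrib_left by (subst sum.swap) (simp add: mult.left_commute)
    then show ?thesis using True by (simp add: tens_map_def tens_act_apply)
  qed (simp add: tens_map_def)
  finally show "tens_act d a (tens_map d m f t) xs = tens_map d m f (tens_act d a t) xs" .
qed

lemma schur_act_nt:
  assumes p: "\<phi> \<in> nat_trans (Gamma_cat d) (tens_functor d) F"
  shows "Mp (schur d F) a b g \<phi> \<in> nat_trans (Gamma_cat d) (tens_functor d) F"
proof -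
  have "ntr (tens_functor d) (\<lambda>n t. \<phi> n (tens_act d g t)) \<in> nat_trans (Gamma_cat d) (tens_functor d) F"
  proof (rule ntrI[OF tens_functor_functor])
    fix n
    show "(\<lambda>t. \<phi> n (tens_act d g t)) \<in> lin_maps (Ob (tens_functor d) n) (Ob F n)"
    proof (rule lin_mapsI)
      fix s t r assume t: "t \<in> carrier (Ob (tens_functor d :: ('a, _) spf) n)"
      show "\<phi> n (tens_act d g t) \<in> carrier (Ob F n)"
        by (rule nt_closed[OF p]) (use t in \<open>simp add: tens_act_closed\<close>)
      show "\<phi> n (tens_act d g (r \<odot>\<^bsub>Ob (tens_functor d) n\<^esub> t)) = r \<odot>\<^bsub>Ob F n\<^esub> \<phi> n (tens_act d g t)"
        using nt_smult[OF p, of "tens_act d g t" n r] t by (simp add: tens_act_closed tens_act_fscale)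
      assume s: "s \<in> carrier (Ob (tens_functor d :: ('a, _) spf) n)"
      show "\<phi> n (tens_act d g (s \<oplus>\<^bsub>Ob (tens_functor d) n\<^esub> t)) =
          \<phi> n (tens_act d g s) \<oplus>\<^bsub>Ob F n\<^esub> \<phi> n (tens_act d g t)"
        using nt_add[OF p, of "tens_act d g s" n "tens_act d g t"] s t by (simp add: tens_act_closed tens_act_add)
    qed
  next
    fix m n t and f :: "(nat \<times> nat) list \<Rightarrow> 'a"
    assume f: "f \<in> Hom (Gamma_cat d) m n" and t: "t \<in> carrier (Ob (tens_functor d :: ('a, _) spf) m)"
    then show "\<phi> n (tens_act d g (Mp (tens_functor d) m n f t)) = Mp F m n f (\<phi> m (tens_act d g t))"
      using nt_nat[OF p f, of "tens_act d g t"] by (simp add: tens_act_map tens_act_closed)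
  qed
  then show ?thesis by (simp add: schur_def ntr_def)
qed

lemma Sym_cat_simps:
  "Hom (Sym_cat d) x y = {a. \<forall>\<sigma>. a \<sigma> \<noteq> 0 \<longrightarrow> \<sigma> \<in> Sym d}"
  by (simp add: Sym_cat_def)

lemma schur_functor:
  assumes F: "strict_poly_functor d F"
  shows "is_functor (Sym_cat d) (schur d F)"
  unfolding is_functor_def
proof (intro conjI allI ballI)
  let ?H = "hom_module (Gamma_cat d) (tens_functor d) F"
  note V = hom_vspace[OF tens_functor_functor F]
  fix a b c :: unit and f g r x
  show "vspace (Ob (schur d F) a)" by (simp add: schur_Ob V)
  show "Mp (schur d F) a b f \<in> lin_maps (Ob (schur d F) a) (Ob (schur d F) b)"
  proof (rule lin_mapsI)
    fix x y r assume x: "x \<in> carrier (Ob (schur d F) a)"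
    then show "Mp (schur d F) a b f x \<in> carrier (Ob (schur d F) b)" by (simp add: schur_act_nt)
    show "Mp (schur d F) a b f (r \<odot>\<^bsub>Ob (schur d F) a\<^esub> x) = r \<odot>\<^bsub>Ob (schur d F) b\<^esub> Mp (schur d F) a b f x"
      by (rule nt_eqI[where C="Gamma_cat d" and F="tens_functor d" and G=F and H=F])
        (use x in \<open>simp_all add: schur_Ob schur_act_nt hom_closed[OF tens_functor_functor F] schur_Mp tens_act_closed\<close>)
    assume y: "y \<in> carrier (Ob (schur d F) a)"
    show "Mp (schur d F) a b f (x \<oplus>\<^bsub>Ob (schur d F) a\<^esub> y) = Mp (schur d F) a b f x \<oplus>\<^bsub>Ob (schur d F) b\<^esub> Mp (schur d F) a b f y"
      by (rule nt_eqI[where C="Gamma_cat d" and F="tens_functor d" and G=F and H=F])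
        (use x y in \<open>simp_all add: schur_Ob schur_act_nt hom_closed[OF tens_functor_functor F] schur_Mp tens_act_closed\<close>)
  qed
  assume x: "x \<in> carrier (Ob (schur d F) a)"
  then have x': "x \<in> nat_trans (Gamma_cat d) (tens_functor d) F" by simp
  show "Mp (schur d F) a b (f + g) x = Mp (schur d F) a b f x \<oplus>\<^bsub>Ob (schur d F) b\<^esub> Mp (schur d F) a b g x"
    by (rule nt_eqI[where C="Gamma_cat d" and F="tens_functor d" and G=F and H=F])
      (use x' nt_add[OF x'] in \<open>simp_all add: schur_Ob schur_act_nt hom_closed[OF tens_functor_functor F] schur_Mp
          tens_act_closed tens_act_add_left\<close>)
  show "Mp (schur d F) a b (fscale r f) x = r \<odot>\<^bsub>Ob (schur d F) b\<^esub> Mp (schur d F) a b f x"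
    by (rule nt_eqI[where C="Gamma_cat d" and F="tens_functor d" and G=F and H=F])
      (use x' nt_smult[OF x'] in \<open>simp_all add: schur_Ob schur_act_nt hom_closed[OF tens_functor_functor F] schur_Mp
          tens_act_closed tens_act_fscale_left\<close>)
  show "Mp (schur d F) a a (Idn (Sym_cat d) a) x = x"
    by (rule nt_eqI[OF schur_act_nt[OF x'] x']) (simp add: schur_Mp tens_act_Idn)
  show "Mp (schur d F) a c (Cmp (Sym_cat d) a b c g f) x = Mp (schur d F) b c g (Mp (schur d F) a b f x)"
    by (rule nt_eqI[OF schur_act_nt[OF x'] schur_act_nt[OF schur_act_nt[OF x']]])
      (simp add: schur_Mp tens_act_Cmp tens_act_closed)
qed

lemma schur_map_apply [simp]:
  "\<phi> \<in> nat_trans (Gamma_cat d) (tens_functor d) F \<Longrightarrow> schur_map d F \<eta> a \<phi> = ncomp (tens_functor d) \<eta> \<phi>"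
  by (simp add: schur_map_def)

lemma schur_map_ntr: "schur_map d F \<eta> = ntr (schur d F) (\<lambda>_ \<phi>. ncomp (tens_functor d) \<eta> \<phi>)"
  by (simp add: schur_map_def ntr_def fun_eq_iff)

lemma schur_map_nt:
  assumes F: "strict_poly_functor d F" and G: "strict_poly_functor d G" and e: "\<eta> \<in> nat_trans (Gamma_cat d) F G"
  shows "schur_map d F \<eta> \<in> nat_trans (Sym_cat d) (schur d F) (schur d G)"
  unfolding schur_map_ntr
proof (rule ntrI[OF schur_functor[OF F]])
  show "(\<lambda>\<phi>. ncomp (tens_functor d) \<eta> \<phi>) \<in> lin_maps (Ob (schur d F) a) (Ob (schur d G) a)" for a
    unfolding schur_Ob by (rule postcomp_lin[OF tens_functor_functor F G e])
  fix a b f \<phi> assume "\<phi> \<in> carrier (Ob (schur d F) a)"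
  then have p: "\<phi> \<in> nat_trans (Gamma_cat d) (tens_functor d) F" by simp
  note c = ncomp_closed[OF tens_functor_functor _ e]
  show "ncomp (tens_functor d) \<eta> (Mp (schur d F) a b f \<phi>) = Mp (schur d G) a b f (ncomp (tens_functor d) \<eta> \<phi>)"
    by (rule nt_eqI[OF c[OF schur_act_nt[OF p]] schur_act_nt[OF c[OF p]]]) (simp add: schur_Mp tens_act_closed)
qed

lemma schur_map_comp:
  assumes "\<theta> \<in> nat_trans (Gamma_cat d) F G"
  shows "schur_map d F (ncomp F \<eta> \<theta>) = ncomp (schur d F) (schur_map d G \<eta>) (schur_map d F \<theta>)"
proof (rule ext, rule ext)
  fix a \<phi>
  have "ncomp (tens_functor d) \<theta> \<phi> \<in> nat_trans (Gamma_cat d) (tens_functor d) G"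
    if "\<phi> \<in> nat_trans (Gamma_cat d) (tens_functor d) F"
    using ncomp_closed[OF tens_functor_functor that assms] .
  then show "schur_map d F (ncomp F \<eta> \<theta>) a \<phi> = ncomp (schur d F) (schur_map d G \<eta>) (schur_map d F \<theta>) a \<phi>"
    by (auto simp: schur_map_def ncomp_def[of "schur d F"] compose_def ncomp_assoc)
qed

lemma schur_map_idn:
  assumes "strict_poly_functor d F"
  shows "schur_map d F (idn F) = idn (schur d F)"
  by (auto simp: schur_map_def idn_def[of "schur d F"] ntr_def fun_eq_iff ncomp_idn_left)

lemma schur_map_lin:
  assumes F: "strict_poly_functor d F" and G: "strict_poly_functor d G"
  shows "schur_map d F \<in> lin_maps (hom_module (Gamma_cat d) F G) (hom_module (Sym_cat d) (schur d F) (schur d G))"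
proof (rule lin_mapsI)
  fix \<eta> \<theta> r assume e: "\<eta> \<in> carrier (hom_module (Gamma_cat d) F G)"
  note c = hom_closed[OF F G] and c' = hom_closed[OF schur_functor[OF F] schur_functor[OF G]]
  show "schur_map d F \<eta> \<in> carrier (hom_module (Sym_cat d) (schur d F) (schur d G))"
    using e schur_map_nt[OF F G] by simp
  note L = precomp_lin[OF tens_functor_functor F G]
  show "schur_map d F (r \<odot>\<^bsub>hom_module (Gamma_cat d) F G\<^esub> \<eta>) =
      r \<odot>\<^bsub>hom_module (Sym_cat d) (schur d F) (schur d G)\<^esub> schur_map d F \<eta>"
    by (rule nt_eqI[OF schur_map_nt[OF F G] c'(4)])
      (use e in \<open>simp_all add: c schur_map_nt[OF F G] schur_Ob lin_maps_smult[OF L]\<close>)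
  assume t: "\<theta> \<in> carrier (hom_module (Gamma_cat d) F G)"
  show "schur_map d F (\<eta> \<oplus>\<^bsub>hom_module (Gamma_cat d) F G\<^esub> \<theta>) =
      schur_map d F \<eta> \<oplus>\<^bsub>hom_module (Sym_cat d) (schur d F) (schur d G)\<^esub> schur_map d F \<theta>"
    by (rule nt_eqI[OF schur_map_nt[OF F G] c'(2)])
      (use e t in \<open>simp_all add: c schur_map_nt[OF F G] schur_Ob lin_maps_add[OF L]\<close>)
qed

text \<open>Surjectivity at the single object \<open>d\<close> is enough: a preimage of the value at
  \<open>idw d\<close> is turned by \<open>yo\<close> into a preimage of the whole morphism.
  Exactness in \<open>schur_exact\<close> rests on the same argument.\<close>

lemma schur_epi:
  assumes F: "strict_poly_functor d F" and G: "strict_poly_functor d G"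
    and e: "\<eta> \<in> nat_trans (Gamma_cat d) F G" and ep: "\<eta> d ` carrier (Ob F d) = carrier (Ob G d)"
  shows "schur_map d F \<eta> a ` carrier (Ob (schur d F) a) = carrier (Ob (schur d G) a)"
proof (intro equalityI subsetI)
  fix \<psi> assume "\<psi> \<in> carrier (Ob (schur d G) a)"
  then have p: "\<psi> \<in> nat_trans (Gamma_cat d) (tens_functor d) G" by simp
  have "\<psi> d (idw d) \<in> carrier (Ob G d)" by (rule nt_closed[OF p]) (simp add: idw_tens)
  then obtain x where x: "x \<in> carrier (Ob F d)" "\<eta> d x = \<psi> d (idw d)" using ep by (metis imageE)
  have "schur_map d F \<eta> a (yo d F x) = \<psi>"
    using yo_natural[OF F G e x(1)] yo_ev[OF p G] x yo_nt[OF F x(1)] by simp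
  then show "\<psi> \<in> schur_map d F \<eta> a ` carrier (Ob (schur d F) a)"
    using yo_nt[OF F x(1)] by (metis imageI schur_carrier)
qed (use ncomp_closed[OF tens_functor_functor _ e] in \<open>auto\<close>)

lemma schur_exact:
  assumes F: "strict_poly_functor d F" and G: "strict_poly_functor d G" and H: "strict_poly_functor d H"
    and e: "\<eta> \<in> nat_trans (Gamma_cat d) F G" and t: "\<theta> \<in> nat_trans (Gamma_cat d) G H"
    and ex: "exact_at F \<eta> G \<theta> H"
  shows "exact_at (schur d F) (schur_map d F \<eta>) (schur d G) (schur_map d G \<theta>) (schur d H)"
  unfolding exact_at_def
proof (intro allI equalityI subsetI)
  fix a \<psi> assume "\<psi> \<in> {y \<in> carrier (Ob (schur d G) a). schur_map d G \<theta> a y = \<zero>\<^bsub>Ob (schur d H) a\<^esub>}"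
  then have p: "\<psi> \<in> nat_trans (Gamma_cat d) (tens_functor d) G"
    and z: "ncomp (tens_functor d) \<theta> \<psi> = \<zero>\<^bsub>hom_module (Gamma_cat d) (tens_functor d) H\<^esub>" by (auto simp: schur_Ob)
  have "\<psi> d (idw d) \<in> carrier (Ob G d)" by (rule nt_closed[OF p]) (simp add: idw_tens)
  moreover have "\<theta> d (\<psi> d (idw d)) = \<zero>\<^bsub>Ob H d\<^esub>"
    using fun_cong[OF fun_cong[OF z, of d], of "idw d"] by (simp add: idw_tens)
  ultimately have "\<psi> d (idw d) \<in> \<eta> d ` carrier (Ob F d)" using ex unfolding exact_at_def by blast
  then obtain x where x: "x \<in> carrier (Ob F d)" "\<eta> d x = \<psi> d (idw d)" by (metis imageE)
  have "schur_map d F \<eta> a (yo d F x) = \<psi>"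
    using yo_natural[OF F G e x(1)] yo_ev[OF p G] x yo_nt[OF F x(1)] by simp
  then show "\<psi> \<in> schur_map d F \<eta> a ` carrier (Ob (schur d F) a)"
    using yo_nt[OF F x(1)] by (metis imageI schur_carrier)
next
  fix a \<psi> assume "\<psi> \<in> schur_map d F \<eta> a ` carrier (Ob (schur d F) a)"
  then obtain \<phi> where p: "\<phi> \<in> nat_trans (Gamma_cat d) (tens_functor d) F" and ps: "\<psi> = ncomp (tens_functor d) \<eta> \<phi>"
    by auto
  have pn: "\<psi> \<in> nat_trans (Gamma_cat d) (tens_functor d) G"
    using ncomp_closed[OF tens_functor_functor p e] by (simp add: ps)
  have z: "\<theta> n (\<eta> n x) = \<zero>\<^bsub>Ob H n\<^esub>" if "x \<in> carrier (Ob F n)" for n x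
    using ex that unfolding exact_at_def by blast
  have "ncomp (tens_functor d) \<theta> \<psi> = \<zero>\<^bsub>hom_module (Gamma_cat d) (tens_functor d) H\<^esub>"
    by (rule nt_eqI[OF ncomp_closed[OF tens_functor_functor pn t] hom_closed(1)[OF tens_functor_functor H]])
      (use nt_closed[OF p] in \<open>simp add: ps z\<close>)
  then show "\<psi> \<in> {y \<in> carrier (Ob (schur d G) a). schur_map d G \<theta> a y = \<zero>\<^bsub>Ob (schur d H) a\<^esub>}"
    using pn by (simp add: schur_Ob)
qed

section \<open>Functors right orthogonal to the kernel of the Schur functor\<close>

definition lin_usp :: "('k::field, 'v) module \<Rightarrow> ('k, 'u) usp set \<Rightarrow> ('v \<Rightarrow> ('k, 'u) usp) \<Rightarrow> bool"
  where "lin_usp M V l \<longleftrightarrow> (\<forall>x\<in>carrier M. l x \<in> V) \<and>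
    (\<forall>x\<in>carrier M. \<forall>y\<in>carrier M. l (x \<oplus>\<^bsub>M\<^esub> y) = l x + l y) \<and>
    (\<forall>r. \<forall>x\<in>carrier M. l (r \<odot>\<^bsub>M\<^esub> x) = usc r (l x))"

lemma lin_uspD:
  assumes "lin_usp M V l" "x \<in> carrier M"
  shows "l x \<in> V" "y \<in> carrier M \<Longrightarrow> l (x \<oplus>\<^bsub>M\<^esub> y) = l x + l y" "l (r \<odot>\<^bsub>M\<^esub> x) = usc r (l x)"
  using assms by (auto simp: lin_usp_def)

text \<open>Linearity of a functor on morphisms, extended to finite sums. The map \<open>l\<close>
  into the type \<open>usp\<close> allows an ordinary \<open>sum\<close> on the right instead of one
  over a carrier.\<close>

lemma functor_sum:
  assumes F: "is_functor C F" and x: "x \<in> carrier (Ob F a)" and l: "lin_usp (Ob F b) V l"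
    and z: "0 \<in> Hom C a b" and add: "\<And>f g. \<lbrakk>f \<in> Hom C a b; g \<in> Hom C a b\<rbrakk> \<Longrightarrow> f + g \<in> Hom C a b"
    and sc: "\<And>f r. f \<in> Hom C a b \<Longrightarrow> fscale r f \<in> Hom C a b"
    and h: "\<And>i. i \<in> I \<Longrightarrow> h i \<in> Hom C a b" and I: "finite I"
  shows "l (Mp F a b (\<Sum>i\<in>I. fscale (c i) (h i)) x) = (\<Sum>i\<in>I. usc (c i) (l (Mp F a b (h i) x)))"
proof -
  have z0: "Mp F a b 0 x = \<zero>\<^bsub>Ob F b\<^esub>"
    using fun_scale[OF F z x, of 0] fun_closed[OF F z x] by (simp add: fscale_def zero_fun_def vs_zero_smult fun_vs[OF F])
  have l0: "l \<zero>\<^bsub>Ob F b\<^esub> = 0"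
    using lin_uspD(3)[OF l vs_zero[OF fun_vs[OF F]], of 0] by (simp add: vs_smult_zero fun_vs[OF F])
  show ?thesis
    using I h
  proof (induction I rule: finite_induct)
    case (insert j J)
    have m: "(\<Sum>i\<in>J'. fscale (c i) (h i)) \<in> Hom C a b" if "J' \<subseteq> J" for J'
      using that insert.prems by (induction J' rule: infinite_finite_induct) (auto simp: z intro!: add sc)
    have hj: "h j \<in> Hom C a b" using insert.prems by simp
    have "l (Mp F a b (\<Sum>i\<in>insert j J. fscale (c i) (h i)) x) =
        l (Mp F a b (fscale (c j) (h j)) x) + l (Mp F a b (\<Sum>i\<in>J. fscale (c i) (h i)) x)"
      using insert.hyps fun_add[OF F sc[OF hj, of "c j"] m[OF order_refl] x]
      by (simp add: lin_uspD(2)[OF l] fun_closed[OF F _ x] m sc[OF hj])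
    also have "l (Mp F a b (fscale (c j) (h j)) x) = usc (c j) (l (Mp F a b (h j) x))"
      by (simp add: fun_scale[OF F hj x] lin_uspD(3)[OF l] fun_closed[OF F hj x])
    finally show ?case using insert by simp
  qed (simp add: z0 l0)
qed

text \<open>
  The morphism \<open>F \<rightarrow> \<otimes>\<^sup>d \<otimes> V\<close> given by a linear map \<open>l\<close> from \<open>F(k\<^sup>d)\<close> to \<open>V\<close>. Its kernel, for injective
  \<open>l\<close>, is the largest subfunctor of \<open>F\<close> killed by the Schur functor.
\<close>

definition tvmap :: "nat \<Rightarrow> ('k::field, 'v) spf \<Rightarrow> ('v \<Rightarrow> ('k, 'u) usp) \<Rightarrow> nat \<Rightarrow> 'v \<Rightarrow> nat list \<Rightarrow> ('k, 'u) usp"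
  where "tvmap d F l = ntr F (\<lambda>n y w. if w \<in> words {..<n} d then l (Mp F n d (bx d (idw d) (dl w)) y) else 0)"

lemma dl_Hom: "w \<in> words {..<n} d \<Longrightarrow> bx d (idw d) (dl w) \<in> Gamma_sp ({..<d} \<times> {..<n}) d"
  by (rule bx_Gamma[OF idw_tens dl_tens])

lemma vfun_simps [simp]:
  "carrier (Ob (vfun sc d V) n) = vtens {..<n} d V"
  "Mp (vfun sc d V) m n = vmap sc d m"
  "\<zero>\<^bsub>Ob (vfun sc d V) n\<^esub> = 0"
  "g \<oplus>\<^bsub>Ob (vfun sc d V) n\<^esub> h = g + h"
  "r \<odot>\<^bsub>Ob (vfun sc d V) n\<^esub> g = (\<lambda>x. sc r (g x))"
  by (simp_all add: vfun_def)

lemma tvmap_apply: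
  "\<lbrakk>y \<in> carrier (Ob F n); w \<in> words {..<n} d\<rbrakk> \<Longrightarrow> tvmap d F l n y w = l (Mp F n d (bx d (idw d) (dl w)) y)"
  by (simp add: tvmap_def)

text \<open>Coefficient \<open>w\<close> after \<open>f\<close> is read by the composite of
  \<open>bx d (idw d) (dl w)\<close> with \<open>f\<close>; by \<open>bx_Cmp_dl\<close> it expands
  with the matrix coefficients \<open>f (zip w v)\<close>, which is the formula of
  \<open>vmap\<close>.\<close>

lemma tvmap_nt:
  assumes F: "strict_poly_functor d F" and V: "usp.subspace V" and l: "lin_usp (Ob F d) V l"
  shows "tvmap d F l \<in> nat_trans (Gamma_cat d) F (vfun usc d V)"
  unfolding tvmap_def
proof (rule ntrI[OF F])
  let ?h = "\<lambda>n y w. if w \<in> words {..<n} d then l (Mp F n d (bx d (idw d) (dl w)) y) else 0"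
  have c: "Mp F n d (bx d (idw d) (dl w)) y \<in> carrier (Ob F d)"
    if "w \<in> words {..<n} d" "y \<in> carrier (Ob F n)" for n w y
    using fun_closed[OF F _ that(2)] dl_Hom[OF that(1)] by simp
  have cl: "?h n y \<in> vtens {..<n} d V" if "y \<in> carrier (Ob F n)" for n y
    using usp.subspace_0[OF V] lin_uspD(1)[OF l c] that by (auto simp: vtens_def)
  show "?h n \<in> lin_maps (Ob F n) (Ob (vfun usc d V) n)" for n
  proof (rule lin_mapsI)
    fix x y r assume x: "x \<in> carrier (Ob F n)"
    show "?h n x \<in> carrier (Ob (vfun usc d V) n)" using cl[OF x] by simp
    have L: "Mp F n d (bx d (idw d) (dl w)) \<in> lin_maps (Ob F n) (Ob F d)" if "w \<in> words {..<n} d" for w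
      using fun_lin[OF F] dl_Hom[OF that] by simp
    show "?h n (r \<odot>\<^bsub>Ob F n\<^esub> x) = r \<odot>\<^bsub>Ob (vfun usc d V) n\<^esub> ?h n x"
      by (rule ext) (simp add: lin_maps_smult[OF L x] lin_uspD(3)[OF l c[OF _ x]])
    assume y: "y \<in> carrier (Ob F n)"
    show "?h n (x \<oplus>\<^bsub>Ob F n\<^esub> y) = ?h n x \<oplus>\<^bsub>Ob (vfun usc d V) n\<^esub> ?h n y"
      by (rule ext) (simp add: lin_maps_add[OF L x y] lin_uspD(2)[OF l c[OF _ x] c[OF _ y]])
  qed
  fix m n y and f :: "(nat \<times> nat) list \<Rightarrow> 'a"
  assume f0: "f \<in> Hom (Gamma_cat d) m n" and y: "y \<in> carrier (Ob F m)"
  then have f: "f \<in> Gamma_sp ({..<n} \<times> {..<m}) d" by simp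
  show "?h n (Mp F m n f y) = Mp (vfun usc d V) m n f (?h m y)"
  proof
    fix w
    show "?h n (Mp F m n f y) w = Mp (vfun usc d V) m n f (?h m y) w"
    proof (cases "w \<in> words {..<n} d")
      case True
      have "l (Mp F n d (bx d (idw d) (dl w)) (Mp F m n f y)) =
          l (Mp F m d (Cmp (Gamma_cat d) m n d (bx d (idw d) (dl w)) f) y)"
        by (subst fun_comp[OF F f0 _ y]) (simp_all add: dl_Hom[OF True])
      also have "\<dots> = (\<Sum>v\<in>words {..<m} d. usc (f (zip w v)) (l (Mp F m d (bx d (idw d) (dl v)) y)))"
        unfolding bx_Cmp_dl[OF f True idw_tens]
        by (rule functor_sum[OF F y l]) (simp_all add: Gamma_sp_0 Gamma_sp_add Gamma_sp_fscale dl_Hom finite_words)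
      also have "\<dots> = vmap usc d m f (?h m y) w"
        using True by (simp add: vmap_def words_length)
      finally show ?thesis using True by simp
    next
      case False
      then show ?thesis using vtens_0[OF usp.vmap_closed[OF f cl[OF y] V]] by simp
    qed
  qed
qed

text \<open>
  \<open>\<otimes>\<^sup>d \<otimes> V\<close> is sent by the Schur functor to a module coinduced from \<open>V\<close>; \<open>hat\<close> recovers the linear map
  to \<open>V\<close> that corresponds to a homomorphism to this module.
\<close>

definition hat :: "nat \<Rightarrow> (unit \<Rightarrow> 'w \<Rightarrow> nat \<Rightarrow> (nat list \<Rightarrow> 'k::field) \<Rightarrow> nat list \<Rightarrow> 'e) \<Rightarrow> 'w \<Rightarrow> 'e"
  where "hat d \<psi> m = \<psi> () m d (idw d) [0..<d]"

section \<open>Frobenius reciprocity for coinduced modules\<close>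

definition sg :: "(nat \<Rightarrow> nat) \<Rightarrow> (nat \<Rightarrow> nat) \<Rightarrow> 'k::field"
  where "sg \<sigma> = (\<lambda>\<tau>. if \<tau> = \<sigma> then 1 else 0)"

lemma sg_Hom: "\<sigma> \<in> Sym d \<Longrightarrow> sg \<sigma> \<in> Hom (Sym_cat d) x y"
  by (simp add: Sym_cat_simps sg_def)

lemma Sym_cat_add:
  assumes "f \<in> Hom (Sym_cat d) x y" "g \<in> Hom (Sym_cat d) x y"
  shows "f + g \<in> Hom (Sym_cat d) x y"
proof -
  have "f \<sigma> \<noteq> 0 \<or> g \<sigma> \<noteq> 0" if "f \<sigma> + g \<sigma> \<noteq> 0" for \<sigma> using that by auto
  then show ?thesis using assms by (auto simp: Sym_cat_simps)
qed

lemma tens_act_sg: "\<sigma> \<in> Sym d \<Longrightarrow> tens_act d (sg \<sigma>) t = tperm \<sigma> t"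
proof
  fix xs assume s: "\<sigma> \<in> Sym d"
  have "tens_act d (sg \<sigma>) t xs = (\<Sum>\<tau>\<in>Sym d. if \<tau> = \<sigma> then tperm \<sigma> t xs else 0)"
    unfolding tens_act_apply by (intro sum.cong[OF refl]) (simp add: sg_def)
  then show "tens_act d (sg \<sigma>) t xs = tperm \<sigma> t xs" using s by (simp add: sum.delta)
qed

lemma idw_tperm:
  assumes "\<sigma> \<in> Sym d" "\<rho> \<in> Sym d"
  shows "tperm \<sigma> (idw d) (permute_list \<rho> [0..<d]) = (if \<rho> = \<sigma> then 1 else 0)"
proof -
  have "permute_list (iv \<sigma>) (permute_list \<rho> [0..<d]) = [0..<d] \<longleftrightarrow> \<rho> \<circ> iv \<sigma> = id"
    using pl_comp[OF assms(2) Sym_inv[OF assms(1)], of "[0..<d]"] pl_upt[OF Sym_comp[OF assms(2) Sym_inv[OF assms(1)]]] by simp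
  also have "\<dots> \<longleftrightarrow> \<rho> = \<sigma>"
  proof
    assume "\<rho> \<circ> iv \<sigma> = id"
    then have "(\<rho> \<circ> iv \<sigma>) \<circ> \<sigma> = id \<circ> \<sigma>" by simp
    then show "\<rho> = \<sigma>" using assms by (simp add: comp_assoc permutes_inv_o)
  qed (use assms in \<open>simp add: permutes_inv_o\<close>)
  finally show ?thesis by (simp add: tperm_def dl_def)
qed

text \<open>By Yoneda the value at \<open>idw d\<close> is reproduced by
  \<open>bx d (idw d) (idw d)\<close>, and equivariance identifies the pairings that occur with
  values of \<open>hat\<close> at translates of \<open>m\<close>. So \<psi> is determined by
  \<open>hat d \<psi>\<close>.\<close>

lemma hat_formula:
  assumes M: "is_functor (Sym_cat d) M" and V: "usp.subspace V"
    and p: "\<psi> \<in> nat_trans (Sym_cat d) M (schur d (vfun usc d V))" and m: "m \<in> carrier (Ob M ())"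
    and w: "length w = d"
  shows "\<psi> () m d (idw d) w = (\<Sum>\<rho>\<in>Sym d. usc (idw d (permute_list \<rho> w)) (hat d \<psi> (Mp M () () (sg \<rho>) m)))"
proof -
  let ?x = "\<psi> () m d (idw d)"
  have pm: "\<psi> () m \<in> nat_trans (Gamma_cat d) (tens_functor d) (vfun usc d V)"
    using nt_closed[OF p m] by simp
  have h: "hat d \<psi> (Mp M () () (sg \<rho>) m) = (\<Sum>ys\<in>words {..<d} d. usc (idw d (permute_list \<rho> ys)) (?x ys))"
    if r: "\<rho> \<in> Sym d" for \<rho>
  proof -
    have rt: "tperm \<rho> (idw d) \<in> tens {..<d} d"
      unfolding tens_vtens by (rule tperm_tens[OF idw_tens[unfolded tens_vtens] r])
    have "hat d \<psi> (Mp M () () (sg \<rho>) m) = \<psi> () m d (tperm \<rho> (idw d)) [0..<d]"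
      unfolding hat_def nt_nat[OF p sg_Hom[OF r] m] schur_Mp[OF idw_tens] tens_act_sg[OF r] ..
    also have "\<dots> = vmap usc d d (bx d (tperm \<rho> (idw d)) (idw d)) ?x [0..<d]"
      by (subst yoneda[OF pm rt]) simp
    also have "\<dots> = (\<Sum>\<sigma>\<in>Sym d. if \<sigma> = \<rho> then \<Sum>ys\<in>words {..<d} d. usc (idw d (permute_list \<rho> ys)) (?x ys) else 0)"
      unfolding usp.vmap_bx[of "[0..<d]" d, simplified]
      by (intro sum.cong[OF refl]) (simp add: idw_tperm[OF r])
    finally show ?thesis using r by (simp add: sum.delta)
  qed
  have "?x w = vmap usc d d (bx d (idw d) (idw d)) ?x w"
    using yoneda[OF pm idw_tens] by simp
  also have "\<dots> = (\<Sum>\<rho>\<in>Sym d. usc (idw d (permute_list \<rho> w)) (hat d \<psi> (Mp M () () (sg \<rho>) m)))"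
    unfolding usp.vmap_bx[OF w] by (intro sum.cong[OF refl]) (simp add: h)
  finally show ?thesis .
qed

lemma hat_inject:
  assumes M: "is_functor (Sym_cat d) M" and V: "usp.subspace V"
    and p: "\<psi> \<in> nat_trans (Sym_cat d) M (schur d (vfun usc d V))"
    and q: "\<chi> \<in> nat_trans (Sym_cat d) M (schur d (vfun usc d V))"
    and eq: "\<And>m. m \<in> carrier (Ob M ()) \<Longrightarrow> hat d \<psi> m = hat d \<chi> m"
  shows "\<psi> = \<chi>"
proof (rule nt_eqI[OF p q])
  fix a :: unit and m assume m0: "m \<in> carrier (Ob M a)"
  then have m: "m \<in> carrier (Ob M ())" by simp
  have pm: "\<psi> () m \<in> nat_trans (Gamma_cat d) (tens_functor d) (vfun usc d V)"
    and qm: "\<chi> () m \<in> nat_trans (Gamma_cat d) (tens_functor d) (vfun usc d V)"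
    using nt_closed[OF p m] nt_closed[OF q m] by simp_all
  have "\<psi> () m = \<chi> () m"
  proof (rule schur_ext[OF pm qm], rule ext)
    fix w
    have v: "\<psi> () m d (idw d) \<in> vtens {..<d} d V" "\<chi> () m d (idw d) \<in> vtens {..<d} d V"
      using nt_closed[OF pm, of "idw d" d] nt_closed[OF qm, of "idw d" d] by (simp_all add: idw_tens)
    show "\<psi> () m d (idw d) w = \<chi> () m d (idw d) w"
    proof (cases "length w = d")
      case True
      show ?thesis
        unfolding hat_formula[OF M V p m True] hat_formula[OF M V q m True]
        by (intro sum.cong[OF refl]) (simp add: eq fun_closed[OF M sg_Hom m])
    next
      case False
      then have "w \<notin> words {..<d} d" by (auto simp: words_def)
      then show ?thesis using vtens_0[OF v(1)] vtens_0[OF v(2)] by simp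
    qed
  qed
  then show "\<psi> a m = \<chi> a m" by simp
qed

text \<open>A family \<open>v\<close> indexed by the symmetric group gives the morphism that sends
  \<open>t\<close> to the sum of the permuted tensors \<open>tperm (iv \<rho>) t\<close> with
  coefficients \<open>v \<rho>\<close>. This is the coinduced module in explicit form.\<close>

lemma coind_nt:
  assumes V: "usp.subspace V" and v: "\<And>\<rho>. \<rho> \<in> Sym d \<Longrightarrow> v \<rho> \<in> V"
  shows "ntr (tens_functor d) (\<lambda>n t w. \<Sum>\<rho>\<in>Sym d. usc (tperm (iv \<rho>) t w) (v \<rho>))
    \<in> nat_trans (Gamma_cat d) (tens_functor d) (vfun usc d V)"
proof (rule ntrI[OF tens_functor_functor])
  let ?h = "\<lambda>t w. \<Sum>\<rho>\<in>Sym d. usc (tperm (iv \<rho>) t w) (v \<rho>)"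
  fix n
  show "?h \<in> lin_maps (Ob (tens_functor d) n) (Ob (vfun usc d V) n)"
  proof (rule lin_mapsI)
    fix s t :: "nat list \<Rightarrow> 'a" and r assume t: "t \<in> carrier (Ob (tens_functor d) n)"
    have "tperm (iv \<rho>) t w = 0" if "\<rho> \<in> Sym d" "w \<notin> words {..<n} d" for \<rho> w
      using vtens_0[OF tperm_tens[OF _ Sym_inv[OF that(1)]] that(2)] t by (simp add: tens_vtens)
    then show "?h t \<in> carrier (Ob (vfun usc d V) n)"
      using v by (auto simp: vtens_def intro!: usp.subspace_sum[OF V] usp.subspace_scale[OF V] sum.neutral)
    show "?h (r \<odot>\<^bsub>Ob (tens_functor d) n\<^esub> t) = r \<odot>\<^bsub>Ob (vfun usc d V) n\<^esub> ?h t"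
      by (rule ext) (simp add: tperm_def fscale_def usp.scale_sum_right)
    show "?h (s \<oplus>\<^bsub>Ob (tens_functor d) n\<^esub> t) = ?h s \<oplus>\<^bsub>Ob (vfun usc d V) n\<^esub> ?h t"
      by (rule ext) (simp add: tperm_def usp.scale_left_distrib sum.distrib)
  qed
next
  let ?h = "\<lambda>t w. \<Sum>\<rho>\<in>Sym d. usc (tperm (iv \<rho>) t w) (v \<rho>)"
  fix m n t and f :: "(nat \<times> nat) list \<Rightarrow> 'a"
  assume "f \<in> Hom (Gamma_cat d) m n"
  then have f: "f \<in> Gamma_sp ({..<n} \<times> {..<m}) d" by simp
  show "?h (Mp (tens_functor d) m n f t) = Mp (vfun usc d V) m n f (?h t)"
  proof
    fix w
    have "?h (tens_map d m f t) w = (\<Sum>\<rho>\<in>Sym d. usc (tens_map d m f (tperm (iv \<rho>) t) w) (v \<rho>))"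
      unfolding tens_map_vmap by (intro sum.cong[OF refl]) (simp only: kvs.vmap_tperm[OF f Sym_inv])
    also have "\<dots> = vmap usc d m f (?h t) w"
    proof (cases "length w = d")
      case True
      have "(\<Sum>\<rho>\<in>Sym d. usc (\<Sum>ys\<in>words {..<m} d. f (zip w ys) * tperm (iv \<rho>) t ys) (v \<rho>)) =
          (\<Sum>ys\<in>words {..<m} d. usc (f (zip w ys)) (\<Sum>\<rho>\<in>Sym d. usc (tperm (iv \<rho>) t ys) (v \<rho>)))"
        unfolding usp.scale_sum_left usp.scale_sum_right by (subst sum.swap) simp
      then show ?thesis using True by (simp add: vmap_def tens_map_def)
    qed (simp add: vmap_def tens_map_def)
    finally show "?h (Mp (tens_functor d) m n f t) w = Mp (vfun usc d V) m n f (?h t) w" by simp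
  qed
qed

text \<open>Frobenius reciprocity: the homomorphism belonging to \<open>l\<close> sends
  \<open>m\<close> to the family of all \<open>l (\<rho> m)\<close>. Equivariance is the only point
  that takes work.\<close>

lemma hat_surj:
  fixes M :: "('k::field, 'w) sym_mod" and V :: "('k, 'u) usp set"
  assumes M: "is_functor (Sym_cat d) M" and V: "usp.subspace V" and l: "lin_usp (Ob M ()) V l"
  obtains \<psi> where "\<psi> \<in> nat_trans (Sym_cat d) M (schur d (vfun usc d V))"
    "\<And>m. m \<in> carrier (Ob M ()) \<Longrightarrow> hat d \<psi> m = l m"
proof -
  note TV = usp.vfun_functor[OF V, of d]
  define L where "L m \<rho> = l (Mp M () () (sg \<rho>) m)" for m \<rho>
  define h where "h m = ntr (tens_functor d) (\<lambda>n t w. \<Sum>\<rho>\<in>Sym d. usc (tperm (iv \<rho>) t w) (L m \<rho>))" for m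
  have hx: "h m n t w = (\<Sum>\<rho>\<in>Sym d. usc (tperm (iv \<rho>) t w) (L m \<rho>))" if "t \<in> tens {..<n} d" for m n t w
    using that by (simp add: h_def)
  have c: "Mp M () () (sg \<rho>) m \<in> carrier (Ob M ())" if "m \<in> carrier (Ob M ())" "\<rho> \<in> Sym d" for m \<rho>
    using fun_closed[OF M sg_Hom[OF that(2)] that(1)] .
  have h: "h m \<in> nat_trans (Gamma_cat d) (tens_functor d) (vfun usc d V)" if "m \<in> carrier (Ob M ())" for m
    unfolding h_def by (rule coind_nt[OF V]) (simp add: L_def lin_uspD(1)[OF l c[OF that]])
  let ?H = "hom_module (Gamma_cat d) (tens_functor d) (vfun usc d V)"
  note hc = hom_closed[OF tens_functor_functor TV]
  have "ntr M (\<lambda>_. h) \<in> nat_trans (Sym_cat d) M (schur d (vfun usc d V))"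
  proof (rule ntrI[OF M])
    fix a :: unit
    show "h \<in> lin_maps (Ob M a) (Ob (schur d (vfun usc d V)) a)"
    proof (rule lin_mapsI)
      fix m m' r assume "m \<in> carrier (Ob M a)"
      then have m: "m \<in> carrier (Ob M ())" by simp
      show "h m \<in> carrier (Ob (schur d (vfun usc d V)) a)" using h[OF m] by simp
      have rm: "r \<odot>\<^bsub>Ob M ()\<^esub> m \<in> carrier (Ob M ())" by (rule vs_smult[OF fun_vs[OF M] m])
      have "h (r \<odot>\<^bsub>Ob M ()\<^esub> m) = r \<odot>\<^bsub>?H\<^esub> h m"
        by (rule nt_eqI[OF h[OF rm] hc(4)[OF h[OF m]]])
          (auto simp: hx L_def lin_maps_smult[OF fun_lin[OF M sg_Hom] m] lin_uspD(3)[OF l c[OF m]]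
            usp.scale_sum_right mult.commute intro!: sum.cong)
      then show "h (r \<odot>\<^bsub>Ob M a\<^esub> m) = r \<odot>\<^bsub>Ob (schur d (vfun usc d V)) a\<^esub> h m" by (simp add: schur_Ob)
      assume "m' \<in> carrier (Ob M a)"
      then have m': "m' \<in> carrier (Ob M ())" by simp
      have mm: "m \<oplus>\<^bsub>Ob M ()\<^esub> m' \<in> carrier (Ob M ())" by (rule vs_add[OF fun_vs[OF M] m m'])
      have "h (m \<oplus>\<^bsub>Ob M ()\<^esub> m') = h m \<oplus>\<^bsub>?H\<^esub> h m'"
        by (rule nt_eqI[OF h[OF mm] hc(2)[OF h[OF m] h[OF m']]])
          (auto simp: hx L_def lin_maps_add[OF fun_lin[OF M sg_Hom] m m'] lin_uspD(2)[OF l c[OF m] c[OF m']]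
            usp.scale_right_distrib sum.distrib fun_eq_iff)
      then show "h (m \<oplus>\<^bsub>Ob M a\<^esub> m') = h m \<oplus>\<^bsub>Ob (schur d (vfun usc d V)) a\<^esub> h m'" by (simp add: schur_Ob)
    qed
  next
    fix a b :: unit and g :: "(nat \<Rightarrow> nat) \<Rightarrow> 'k" and m
    assume g0: "g \<in> Hom (Sym_cat d) a b" and "m \<in> carrier (Ob M a)"
    then have m: "m \<in> carrier (Ob M ())" and g: "g \<in> Hom (Sym_cat d) () ()" by simp_all
    have gm: "Mp M () () g m \<in> carrier (Ob M ())" by (rule fun_closed[OF M g m])
    have gs: "g \<sigma> = 0" if "\<sigma> \<notin> Sym d" for \<sigma> using g that by (auto simp: Sym_cat_simps)
    have Lg: "L (Mp M () () g m) \<sigma> = (\<Sum>\<rho>\<in>Sym d. usc (g (iv \<sigma> \<circ> \<rho>)) (L m \<rho>))" if s: "\<sigma> \<in> Sym d" for \<sigma>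
    proof -
      \<comment> \<open>The product of \<sigma> and \<open>g\<close> in the basis of group elements:
        the coefficient at \<rho> is that of \<open>g\<close> at
        \<open>iv \<sigma> \<circ> \<rho>\<close>.\<close>
      have "Cmp (Sym_cat d) () () () (sg \<sigma>) g = (\<Sum>\<rho>\<in>Sym d. fscale (g (iv \<sigma> \<circ> \<rho>)) (sg \<rho>))"
      proof
        fix \<tau>
        have "Cmp (Sym_cat d) () () () (sg \<sigma>) g \<tau> = (\<Sum>\<rho>\<in>Sym d. if \<rho> = \<sigma> then g (iv \<sigma> \<circ> \<tau>) else 0)"
        proof -
          have "Cmp (Sym_cat d) () () () (sg \<sigma>) g \<tau> = (\<Sum>\<rho>\<in>Sym d. sg \<sigma> \<rho> * g (iv \<rho> \<circ> \<tau>))"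
            by (simp add: Sym_cat_def)
          also have "\<dots> = (\<Sum>\<rho>\<in>Sym d. if \<rho> = \<sigma> then g (iv \<sigma> \<circ> \<tau>) else 0)"
            by (intro sum.cong[OF refl]) (simp add: sg_def)
          finally show ?thesis .
        qed
        also have "\<dots> = g (iv \<sigma> \<circ> \<tau>)" using s by (simp add: sum.delta)
        also have "\<dots> = (\<Sum>\<rho>\<in>Sym d. if \<rho> = \<tau> then g (iv \<sigma> \<circ> \<tau>) else 0)"
        proof (cases "\<tau> \<in> Sym d")
          case False
          have "iv \<sigma> \<circ> \<tau> \<notin> Sym d"
          proof
            assume "iv \<sigma> \<circ> \<tau> \<in> Sym d"
            then have "\<sigma> \<circ> (iv \<sigma> \<circ> \<tau>) \<in> Sym d" by (rule Sym_comp[OF s])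
            then show False using False s by (simp add: comp_assoc[symmetric] permutes_inv_o)
          qed
          then show ?thesis using False by (simp add: gs sum.delta)
        qed (simp add: sum.delta)
        also have "\<dots> = (\<Sum>\<rho>\<in>Sym d. fscale (g (iv \<sigma> \<circ> \<rho>)) (sg \<rho>)) \<tau>"
          unfolding sum_fun_apply by (intro sum.cong[OF refl]) (auto simp: fscale_def sg_def)
        finally show "Cmp (Sym_cat d) () () () (sg \<sigma>) g \<tau> = (\<Sum>\<rho>\<in>Sym d. fscale (g (iv \<sigma> \<circ> \<rho>)) (sg \<rho>)) \<tau>" .
      qed
      then have "L (Mp M () () g m) \<sigma> = l (Mp M () () (\<Sum>\<rho>\<in>Sym d. fscale (g (iv \<sigma> \<circ> \<rho>)) (sg \<rho>)) m)"
        unfolding L_def using fun_comp[OF M g sg_Hom[OF s] m] by simp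
      also have "\<dots> = (\<Sum>\<rho>\<in>Sym d. usc (g (iv \<sigma> \<circ> \<rho>)) (L m \<rho>))"
        unfolding L_def
        by (rule functor_sum[OF M m l _ Sym_cat_add _ sg_Hom]) (auto simp: Sym_cat_simps fscale_def)
      finally show ?thesis .
    qed
    have "h (Mp M () () g m) = Mp (schur d (vfun usc d V)) a b g (h m)"
    proof (rule nt_eqI[OF h[OF gm] schur_act_nt[OF h[OF m]]], rule ext)
      fix n t w assume "t \<in> carrier (Ob (tens_functor d :: ('k, _) spf) n)"
      then have t: "t \<in> tens {..<n} d" by simp
      note tv = t[unfolded tens_vtens]
      have "h (Mp M () () g m) n t w = (\<Sum>\<sigma>\<in>Sym d. \<Sum>\<rho>\<in>Sym d. usc (tperm (iv \<sigma>) t w * g (iv \<sigma> \<circ> \<rho>)) (L m \<rho>))"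
        unfolding hx[OF t] by (intro sum.cong[OF refl]) (simp add: Lg usp.scale_sum_right)
      also have "\<dots> = (\<Sum>\<rho>\<in>Sym d. usc (\<Sum>\<sigma>\<in>Sym d. tperm (iv \<sigma>) t w * g (iv \<sigma> \<circ> \<rho>)) (L m \<rho>))"
        by (subst sum.swap) (simp add: usp.scale_sum_left)
      also have "\<dots> = (\<Sum>\<rho>\<in>Sym d. usc (tperm (iv \<rho>) (tens_act d g t) w) (L m \<rho>))"
      proof (rule sum.cong[OF refl])
        fix \<rho> assume r: "\<rho> \<in> Sym d"
        \<comment> \<open>The substitution of \<open>\<rho> \<circ> iv \<sigma>\<close> for \<sigma>
          turns the argument of \<open>g\<close> into \<sigma>, and the permutation of
          \<open>t\<close> into \<sigma> followed by the inverse of \<rho>.\<close>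
        have "(\<Sum>\<sigma>\<in>Sym d. tperm (iv \<sigma>) t w * g (iv \<sigma> \<circ> \<rho>)) =
            (\<Sum>\<sigma>\<in>Sym d. tperm (iv (\<rho> \<circ> iv \<sigma>)) t w * g (iv (\<rho> \<circ> iv \<sigma>) \<circ> \<rho>))"
          by (rule sum.reindex_bij_betw[OF bij_betw_trans[OF bij_Sym_inv bij_Sym_comp[OF r]], symmetric, unfolded o_def[of "\<lambda>\<sigma>. \<rho> \<circ> \<sigma>"]])
        also have "\<dots> = (\<Sum>\<sigma>\<in>Sym d. g \<sigma> * tperm (iv \<rho>) (tperm \<sigma> t) w)"
        proof (rule sum.cong[OF refl])
          fix \<sigma> assume s: "\<sigma> \<in> Sym d"
          have i: "iv (\<rho> \<circ> iv \<sigma>) = \<sigma> \<circ> iv \<rho>"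
            using o_inv_distrib[of \<rho> "iv \<sigma>"] permutes_bij[of \<rho> "{..<d}"] permutes_bij[of \<sigma> "{..<d}"]
              permutes_bij[of "iv \<sigma>" "{..<d}"] r s by (simp add: inv_inv_eq permutes_inv)
          have "\<sigma> \<circ> iv \<rho> \<circ> \<rho> = \<sigma>" using r by (simp add: comp_assoc permutes_inv_o)
          then show "tperm (iv (\<rho> \<circ> iv \<sigma>)) t w * g (iv (\<rho> \<circ> iv \<sigma>) \<circ> \<rho>) = g \<sigma> * tperm (iv \<rho>) (tperm \<sigma> t) w"
            unfolding i by (simp add: tperm_comp[OF tv s Sym_inv[OF r]])
        qed
        also have "\<dots> = tperm (iv \<rho>) (tens_act d g t) w"
          by (simp add: tperm_def tens_act_apply)
        finally show "usc (\<Sum>\<sigma>\<in>Sym d. tperm (iv \<sigma>) t w * g (iv \<sigma> \<circ> \<rho>)) (L m \<rho>) =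
            usc (tperm (iv \<rho>) (tens_act d g t) w) (L m \<rho>)" by simp
      qed
      also have "\<dots> = Mp (schur d (vfun usc d V)) a b g (h m) n t w"
        unfolding schur_Mp[OF t] hx[OF tens_act_closed[OF t]] ..
      finally show "h (Mp M () () g m) n t w = Mp (schur d (vfun usc d V)) a b g (h m) n t w" .
    qed
    then show "h (Mp M a b g m) = Mp (schur d (vfun usc d V)) a b g (h m)" by simp
  qed
  moreover have "hat d (ntr M (\<lambda>_. h)) m = l m" if m: "m \<in> carrier (Ob M ())" for m
  proof -
    have "hat d (ntr M (\<lambda>_. h)) m = (\<Sum>\<rho>\<in>Sym d. usc (tperm (iv \<rho>) (idw d) [0..<d]) (L m \<rho>))"
      using m by (simp add: hat_def hx[OF idw_tens])
    also have "\<dots> = (\<Sum>\<rho>\<in>Sym d. if \<rho> = id then L m id else 0)"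
    proof (rule sum.cong[OF refl])
      fix \<rho> assume r: "\<rho> \<in> Sym d"
      have "tperm (iv \<rho>) (idw d) [0..<d] = (if \<rho> = id then 1 else (0::'k))"
        using pl_upt[OF r] r by (simp add: tperm_def dl_def inv_inv_eq permutes_bij)
      then show "usc (tperm (iv \<rho>) (idw d) [0..<d]) (L m \<rho>) = (if \<rho> = id then L m id else 0)" by simp
    qed
    also have "\<dots> = L m id" by (simp add: sum.delta permutes_id)
    also have "\<dots> = l m"
    proof -
      have "(sg id :: _ \<Rightarrow> 'k) = Idn (Sym_cat d) ()" by (simp add: sg_def Sym_cat_def)
      then show ?thesis unfolding L_def by (simp add: fun_id[OF M m])
    qed
    finally show ?thesis .
  qed
  ultimately show ?thesis using that by blast
qed

text \<open>
  Two properties of \<open>\<otimes>\<^sup>d \<otimes> V\<close> that pass to retracts, hence to many injective functors. The second says that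
  the Schur functor sends \<open>J\<close> to an injective module, in a form that only involves the three given terms.
\<close>

definition schur_closed :: "nat \<Rightarrow> 'v itself \<Rightarrow> ('k::field, 'u) spf \<Rightarrow> bool"
  where "schur_closed d T J \<longleftrightarrow> strict_poly_functor d J \<and>
    (\<forall>F :: ('k, 'v) spf. strict_poly_functor d F \<longrightarrow>
      bij_betw (schur_map d F) (nat_trans (Gamma_cat d) F J) (nat_trans (Sym_cat d) (schur d F) (schur d J))) \<and>
    (\<forall>(A :: ('k, nat \<Rightarrow> (nat list \<Rightarrow> 'k) \<Rightarrow> 'v) sym_mod) (B :: ('k, nat \<Rightarrow> (nat list \<Rightarrow> 'k) \<Rightarrow> 'v) sym_mod)
        (C :: ('k, nat \<Rightarrow> (nat list \<Rightarrow> 'k) \<Rightarrow> 'v) sym_mod).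
      is_functor (Sym_cat d) A \<longrightarrow> is_functor (Sym_cat d) B \<longrightarrow> is_functor (Sym_cat d) C \<longrightarrow>
      (\<forall>\<eta>\<in>nat_trans (Sym_cat d) A B. \<forall>\<theta>\<in>nat_trans (Sym_cat d) B C. exact_at A \<eta> B \<theta> C \<longrightarrow>
        (\<forall>\<gamma>\<in>nat_trans (Sym_cat d) B (schur d J). ncomp A \<gamma> \<eta> = \<zero>\<^bsub>hom_module (Sym_cat d) A (schur d J)\<^esub> \<longrightarrow>
          (\<exists>\<kappa>\<in>nat_trans (Sym_cat d) C (schur d J). ncomp B \<kappa> \<theta> = \<gamma>))))"

section \<open>Maps to tensor powers with coefficients, before and after the Schur functor\<close>

definition usp_mod :: "('k::field, 'v) usp set \<Rightarrow> ('k, ('k, 'v) usp) module"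
  where "usp_mod V = \<lparr>carrier = V, monoid.mult = undefined, one = undefined, ring.zero = 0, ring.add = (+), module.smult = usc\<rparr>"

lemma usp_mod_vspace: "usp.subspace V \<Longrightarrow> vspace (usp_mod V)"
  by (rule vspaceI) (auto simp: usp_mod_def usp.subspace_def usp.scale_left_distrib usp.scale_right_distrib algebra_simps)

lemma lin_usp_iff: "lin_usp M V l \<longleftrightarrow> l \<in> lin_maps M (usp_mod V)"
  by (auto simp: lin_usp_def lin_maps_def usp_mod_def)

lemma hat_lin:
  assumes M: "is_functor (Sym_cat d) M" and p: "\<psi> \<in> nat_trans (Sym_cat d) M (schur d (vfun usc d V))"
  shows "lin_usp (Ob M ()) V (hat d \<psi>)"
  unfolding lin_usp_def
proof (intro conjI ballI allI)
  note c = nt_closed[OF p]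
  fix x r assume x: "x \<in> carrier (Ob M ())"
  have "\<psi> () x d (idw d) \<in> vtens {..<d} d V"
    using nt_closed[of "\<psi> () x" "Gamma_cat d" "tens_functor d" "vfun usc d V" "idw d" d] c[OF x] by (simp add: idw_tens)
  then show "hat d \<psi> x \<in> V" by (auto simp: hat_def vtens_def)
  show "hat d \<psi> (r \<odot>\<^bsub>Ob M ()\<^esub> x) = usc r (hat d \<psi> x)"
    by (simp add: hat_def nt_smult[OF p x] schur_Ob idw_tens)
  fix y assume y: "y \<in> carrier (Ob M ())"
  show "hat d \<psi> (x \<oplus>\<^bsub>Ob M ()\<^esub> y) = hat d \<psi> x + hat d \<psi> y"
    by (simp add: hat_def nt_add[OF p x y] schur_Ob idw_tens)
qed

lemma yo_lin:
  assumes F: "strict_poly_functor d F"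
  shows "yo d F \<in> lin_maps (Ob F d) (hom_module (Gamma_cat d) (tens_functor d) F)"
proof (rule lin_mapsI)
  note hc = hom_closed[OF tens_functor_functor F] and V = fun_vs[OF F]
  have L: "Mp F d n (bx d t (idw d)) \<in> lin_maps (Ob F d) (Ob F n)" if "t \<in> tens {..<n} d" for t n
    using fun_lin[OF F, of "bx d t (idw d)" d n] bx_Hom[OF that] by simp
  fix x y r assume x: "x \<in> carrier (Ob F d)"
  show "yo d F x \<in> carrier (hom_module (Gamma_cat d) (tens_functor d) F)" using yo_nt[OF F x] by simp
  show "yo d F (r \<odot>\<^bsub>Ob F d\<^esub> x) = r \<odot>\<^bsub>hom_module (Gamma_cat d) (tens_functor d) F\<^esub> yo d F x"
    by (rule nt_eqI[OF yo_nt[OF F vs_smult[OF V x]] hc(4)[OF yo_nt[OF F x]]]) (simp add: lin_maps_smult[OF L x])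
  assume y: "y \<in> carrier (Ob F d)"
  show "yo d F (x \<oplus>\<^bsub>Ob F d\<^esub> y) = yo d F x \<oplus>\<^bsub>hom_module (Gamma_cat d) (tens_functor d) F\<^esub> yo d F y"
    by (rule nt_eqI[OF yo_nt[OF F vs_add[OF V x y]] hc(2)[OF yo_nt[OF F x] yo_nt[OF F y]]]) (simp add: lin_maps_add[OF L x y])
qed

text \<open>Any coefficient of \<theta> at \<open>y\<close> is read off after pushing
  \<open>y\<close> to the object \<open>d\<close>. The pushed element \<open>z\<close> lies in the
  weight space that the Schur functor sees, so the coefficient depends only on
  \<open>schur_map d F \<theta>\<close>.\<close>

lemma tv_inject:
  assumes F: "strict_poly_functor d F" and V: "usp.subspace V"
    and t: "\<theta> \<in> nat_trans (Gamma_cat d) F (vfun usc d V)" and t': "\<theta>' \<in> nat_trans (Gamma_cat d) F (vfun usc d V)"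
    and eq: "schur_map d F \<theta> = schur_map d F \<theta>'"
  shows "\<theta> = \<theta>'"
proof (rule nt_eqI[OF t t'], rule ext)
  fix n y w assume y: "y \<in> carrier (Ob F n)"
  have c: "\<theta> n y \<in> vtens {..<n} d V" "\<theta>' n y \<in> vtens {..<n} d V"
    using nt_closed[OF t y] nt_closed[OF t' y] by simp_all
  show "\<theta> n y w = \<theta>' n y w"
  proof (cases "w \<in> words {..<n} d")
    case False
    then show ?thesis using vtens_0[OF c(1)] vtens_0[OF c(2)] by simp
  next
    case True
    have wh: "bx d (idw d) (dl w) \<in> Hom (Gamma_cat d) n d" using dl_Hom[OF True] by simp
    define z where "z = Mp F n d (bx d (idw d) (dl w)) y"
    have z: "z \<in> carrier (Ob F d)" unfolding z_def by (rule fun_closed[OF F wh y])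
    \<comment> \<open>\<open>z\<close> is fixed by the idempotent
      \<open>bx d (idw d) (idw d)\<close>, because composing the reader of \<open>w\<close> with it
      changes nothing. Hence \<open>z\<close> is recovered from \<open>yo d F z\<close>.\<close>
    have ez: "yo d F z d (idw d) = z"
    proof -
      have "Mp F n d (Cmp (Gamma_cat d) n d d (bx d (idw d) (idw d)) (bx d (idw d) (dl w))) y =
          Mp F d d (bx d (idw d) (idw d)) z"
        unfolding z_def by (rule fun_comp[OF F wh _ y]) (simp add: bx_Hom idw_tens)
      also have "\<dots> = yo d F z d (idw d)" by (simp add: idw_tens)
      finally show ?thesis
        unfolding Cmp_bx[OF bx_Hom[OF idw_tens] idw_tens dl_tens[OF True]] tens_map_bx_idw[OF idw_tens] z_def by simp
    qed
    have th: "\<kappa> n y w = schur_map d F \<kappa> () (yo d F z) d (idw d) [0..<d]"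
      if k: "\<kappa> \<in> nat_trans (Gamma_cat d) F (vfun usc d V)" for \<kappa>
    proof -
      have kc: "\<kappa> n y \<in> vtens {..<n} d V" using nt_closed[OF k y] by simp
      have "\<kappa> n y w = vmap usc d n (bx d (idw d) (dl w)) (\<kappa> n y) [0..<d]"
        by (rule usp.vmap_bx_dl[OF kc, symmetric])
      also have "\<dots> = \<kappa> d z [0..<d]"
        unfolding z_def using nt_nat[OF k wh y] by simp
      finally show ?thesis by (simp add: yo_nt[OF F z] idw_tens ez del: yo_apply)
    qed
    show ?thesis unfolding th[OF t] th[OF t'] eq ..
  qed
qed

text \<open>Frobenius reciprocity turns \<psi> into a linear map on the weight space; pulled back
  along \<open>yo\<close> to the whole value at \<open>d\<close>, it defines a preimage through
  \<open>tvmap\<close>.\<close>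

lemma tv_surj:
  assumes F: "strict_poly_functor d F" and V: "usp.subspace V"
    and p: "\<psi> \<in> nat_trans (Sym_cat d) (schur d F) (schur d (vfun usc d V))"
  obtains \<theta> where "\<theta> \<in> nat_trans (Gamma_cat d) F (vfun usc d V)" "schur_map d F \<theta> = \<psi>"
proof -
  note SF = schur_functor[OF F] and TV = usp.vfun_functor[OF V, of d]
  define l where "l = (\<lambda>x. hat d \<psi> (yo d F x))"
  have "hat d \<psi> \<in> lin_maps (hom_module (Gamma_cat d) (tens_functor d) F) (usp_mod V)"
    using hat_lin[OF SF p] by (simp add: lin_usp_iff schur_Ob)
  then have l: "lin_usp (Ob F d) V l" unfolding l_def lin_usp_iff by (rule lin_maps_comp[OF yo_lin[OF F]])
  note tn = tvmap_nt[OF F V l]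
  have "schur_map d F (tvmap d F l) = \<psi>"
  proof (rule hat_inject[OF SF V schur_map_nt[OF F TV tn] p])
    fix \<phi> assume "\<phi> \<in> carrier (Ob (schur d F) ())"
    then have f: "\<phi> \<in> nat_trans (Gamma_cat d) (tens_functor d) F" by simp
    have c: "\<phi> d (idw d) \<in> carrier (Ob F d)" by (rule nt_closed[OF f]) (simp add: idw_tens)
    have "hat d (schur_map d F (tvmap d F l)) \<phi> = tvmap d F l d (\<phi> d (idw d)) [0..<d]"
      by (simp add: hat_def f idw_tens)
    also have "\<dots> = l (Mp F d d (bx d (idw d) (idw d)) (\<phi> d (idw d)))"
      by (rule tvmap_apply[OF c upt_words])
    also have "\<dots> = l (\<phi> d (idw d))" using yoneda[OF f idw_tens] by simp
    also have "\<dots> = hat d \<psi> \<phi>" unfolding l_def by (simp add: yo_ev[OF f F])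
    finally show "hat d (schur_map d F (tvmap d F l)) \<phi> = hat d \<psi> \<phi>" .
  qed
  with tn that show ?thesis by blast
qed

text \<open>Through \<open>hat\<close>, homomorphisms to the coinduced module are plain linear maps
  to \<open>V\<close>. The linear map of \<gamma> kills the kernel of \<theta>, so it descends to
  the image of \<theta> and extends to all of \<open>C\<close>; equivariance comes for free.\<close>

lemma tv_injective:
  assumes A: "is_functor (Sym_cat d) A" and B: "is_functor (Sym_cat d) B" and C: "is_functor (Sym_cat d) C"
    and V: "usp.subspace V"
    and e: "\<eta> \<in> nat_trans (Sym_cat d) A B" and t: "\<theta> \<in> nat_trans (Sym_cat d) B C" and ex: "exact_at A \<eta> B \<theta> C"
    and g: "\<gamma> \<in> nat_trans (Sym_cat d) B (schur d (vfun usc d V))"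
    and z: "ncomp A \<gamma> \<eta> = \<zero>\<^bsub>hom_module (Sym_cat d) A (schur d (vfun usc d V))\<^esub>"
  obtains \<kappa> where "\<kappa> \<in> nat_trans (Sym_cat d) C (schur d (vfun usc d V))" "ncomp B \<kappa> \<theta> = \<gamma>"
proof -
  let ?I = "\<theta> () ` carrier (Ob B ())"
  note VB = fun_vs[OF B] and VC = fun_vs[OF C]
  have hl: "hat d \<gamma> \<in> lin_maps (Ob B ()) (usp_mod V)" using hat_lin[OF B g] by (simp add: lin_usp_iff)
  have UV: "vspace (usp_mod V)" by (rule usp_mod_vspace[OF V])
  have k0: "hat d \<gamma> x = 0" if x: "x \<in> carrier (Ob B ())" and "\<theta> () x = \<zero>\<^bsub>Ob C ()\<^esub>" for x
  proof -
    have "x \<in> \<eta> () ` carrier (Ob A ())" using ex that unfolding exact_at_def by blast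
    then obtain a where a: "a \<in> carrier (Ob A ())" "x = \<eta> () a" by (metis imageE)
    then have "\<gamma> () x = \<zero>\<^bsub>hom_module (Gamma_cat d) (tens_functor d) (vfun usc d V)\<^esub>"
      using fun_cong[OF fun_cong[OF z, of "()"], of a] by (simp add: schur_Ob)
    then show ?thesis by (simp add: hat_def idw_tens)
  qed
  have wd: "hat d \<gamma> x = hat d \<gamma> y" if x: "x \<in> carrier (Ob B ())" and y: "y \<in> carrier (Ob B ())" and e: "\<theta> () x = \<theta> () y" for x y
  proof -
    let ?z = "x \<oplus>\<^bsub>Ob B ()\<^esub> \<ominus>\<^bsub>Ob B ()\<^esub> y"
    have zc: "?z \<in> carrier (Ob B ())" using x y by (simp add: vs_closed VB)
    have "\<theta> () ?z = \<zero>\<^bsub>Ob C ()\<^esub>"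
      using x y by (simp add: nt_add[OF t] nt_neg[OF t B C] vs_closed VB e vs_rneg VC nt_closed[OF t])
    then have "hat d \<gamma> ?z = 0" by (rule k0[OF zc])
    moreover have "hat d \<gamma> (?z \<oplus>\<^bsub>Ob B ()\<^esub> y) = hat d \<gamma> ?z + hat d \<gamma> y"
      using lin_maps_add[OF hl zc y] by (simp add: usp_mod_def)
    moreover have "?z \<oplus>\<^bsub>Ob B ()\<^esub> y = x" using x y by (simp add: vs_assoc VB vs_closed vs_lneg vs_add_zero)
    ultimately show ?thesis by simp
  qed
  \<comment> \<open>The map induced on the image of \<theta>; by \<open>wd\<close> the choice of a
    preimage is immaterial.\<close>
  define h where "h y = hat d \<gamma> (SOME x. x \<in> carrier (Ob B ()) \<and> \<theta> () x = y)" for y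
  have h: "h (\<theta> () x) = hat d \<gamma> x" if x: "x \<in> carrier (Ob B ())" for x
  proof -
    have "(SOME x'. x' \<in> carrier (Ob B ()) \<and> \<theta> () x' = \<theta> () x) \<in> carrier (Ob B ()) \<and>
        \<theta> () (SOME x'. x' \<in> carrier (Ob B ()) \<and> \<theta> () x' = \<theta> () x) = \<theta> () x"
      by (rule someI[of _ x]) (use x in simp)
    then show ?thesis unfolding h_def using wd x by blast
  qed
  have I: "subsp (Ob C ()) ?I" by (rule subsp_image[OF VB VC nt_lin[OF t]])
  have "h \<in> lin_maps ((Ob C ())\<lparr>carrier := ?I\<rparr>) (usp_mod V)"
  proof (rule lin_mapsI)
    fix u v r assume "u \<in> carrier ((Ob C ())\<lparr>carrier := ?I\<rparr>)"
    then obtain x where x: "x \<in> carrier (Ob B ())" "u = \<theta> () x" by auto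
    show "h u \<in> carrier (usp_mod V)" using x h lin_maps_closed[OF hl x(1)] by simp
    have "h (r \<odot>\<^bsub>Ob C ()\<^esub> u) = r \<odot>\<^bsub>usp_mod V\<^esub> h u"
      using h[OF vs_smult[OF VB x(1)], of r] lin_maps_smult[OF hl x(1), of r] by (simp add: x h nt_smult[OF t])
    then show "h (r \<odot>\<^bsub>(Ob C ())\<lparr>carrier := ?I\<rparr>\<^esub> u) = r \<odot>\<^bsub>usp_mod V\<^esub> h u" by simp
    assume "v \<in> carrier ((Ob C ())\<lparr>carrier := ?I\<rparr>)"
    then obtain y where y: "y \<in> carrier (Ob B ())" "v = \<theta> () y" by auto
    have "h (u \<oplus>\<^bsub>Ob C ()\<^esub> v) = h u \<oplus>\<^bsub>usp_mod V\<^esub> h v"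
      using h[OF vs_add[OF VB x(1) y(1)]] lin_maps_add[OF hl x(1) y(1)] x y by (simp add: h nt_add[OF t])
    then show "h (u \<oplus>\<^bsub>(Ob C ())\<lparr>carrier := ?I\<rparr>\<^esub> v) = h u \<oplus>\<^bsub>usp_mod V\<^esub> h v" by simp
  qed
  then obtain l where l: "l \<in> lin_maps (Ob C ()) (usp_mod V)" "\<And>y. y \<in> ?I \<Longrightarrow> l y = h y"
    using linear_extension[OF VC UV I] by metis
  obtain \<kappa> where k: "\<kappa> \<in> nat_trans (Sym_cat d) C (schur d (vfun usc d V))" "\<And>m. m \<in> carrier (Ob C ()) \<Longrightarrow> hat d \<kappa> m = l m"
    using hat_surj[OF C V, of l] l(1) by (auto simp: lin_usp_iff)
  have "ncomp B \<kappa> \<theta> = \<gamma>"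
  proof (rule hat_inject[OF B V ncomp_closed[OF B t k(1)] g])
    fix m assume m: "m \<in> carrier (Ob B ())"
    have "hat d (ncomp B \<kappa> \<theta>) m = hat d \<kappa> (\<theta> () m)" using m by (simp add: hat_def)
    then show "hat d (ncomp B \<kappa> \<theta>) m = hat d \<gamma> m"
      using k(2)[OF nt_closed[OF t m]] l(2) h[OF m] m by simp
  qed
  with k(1) that show ?thesis by blast
qed

lemma tv_good:
  fixes V :: "('k::field, 'u) usp set"
  assumes V: "usp.subspace V"
  shows "schur_closed d TYPE('v) (vfun usc d V)"
  unfolding schur_closed_def
proof (intro conjI allI impI ballI)
  show "strict_poly_functor d (vfun usc d V)" by (rule usp.vfun_functor[OF V])
  fix F :: "('k, 'v) spf" assume F: "strict_poly_functor d F"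
  show "bij_betw (schur_map d F) (nat_trans (Gamma_cat d) F (vfun usc d V))
      (nat_trans (Sym_cat d) (schur d F) (schur d (vfun usc d V)))"
    unfolding bij_betw_def
  proof (intro conjI inj_onI equalityI subsetI)
    show "\<theta> = \<theta>'" if "\<theta> \<in> nat_trans (Gamma_cat d) F (vfun usc d V)" "\<theta>' \<in> nat_trans (Gamma_cat d) F (vfun usc d V)"
      "schur_map d F \<theta> = schur_map d F \<theta>'" for \<theta> \<theta>' by (rule tv_inject[OF F V that])
    show "\<psi> \<in> schur_map d F ` nat_trans (Gamma_cat d) F (vfun usc d V)"
      if "\<psi> \<in> nat_trans (Sym_cat d) (schur d F) (schur d (vfun usc d V))" for \<psi>
      using tv_surj[OF F V that] by (metis imageI)
  qed (use schur_map_nt[OF F usp.vfun_functor[OF V]] in blast)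
qed (metis tv_injective[OF _ _ _ V])

text \<open>A map into \<open>J'\<close> is sent to \<open>J\<close> by \<open>i\<close>, the
  problem is solved there, and \<open>r\<close> brings the solution back.\<close>

lemma schur_closed_retract:
  fixes J :: "('k::field, 'u) spf" and J' :: "('k, 't) spf" and T :: "'v itself"
  assumes J: "schur_closed d T J" and J': "strict_poly_functor d J'"
    and i: "i \<in> nat_trans (Gamma_cat d) J' J" and r: "r \<in> nat_trans (Gamma_cat d) J J'" and ri: "ncomp J' r i = idn J'"
  shows "schur_closed d T J'"
  unfolding schur_closed_def
proof (intro conjI allI impI ballI)
  have Jf: "strict_poly_functor d J" using J by (simp add: schur_closed_def)
  note si = schur_map_nt[OF J' Jf i] and sr = schur_map_nt[OF Jf J' r]
  have sri: "ncomp (schur d J') (schur_map d J r) (schur_map d J' i) = idn (schur d J')"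
    using schur_map_comp[OF i, of r] by (simp add: ri schur_map_idn[OF J'])
  have retr: "ncomp B (schur_map d J r) (ncomp B (schur_map d J' i) \<psi>) = \<psi>"
    if "\<psi> \<in> nat_trans (Sym_cat d) B (schur d J')" for B \<psi>
    using ncomp_assoc[OF that, of "schur_map d J r" "schur_map d J' i"] by (simp add: sri ncomp_idn_left[OF that])
  show "strict_poly_functor d J'" by (rule J')
  {
    fix F :: "('k, 'v) spf" assume F: "strict_poly_functor d F"
    then have b: "bij_betw (schur_map d F) (nat_trans (Gamma_cat d) F J) (nat_trans (Sym_cat d) (schur d F) (schur d J))"
      using J by (simp add: schur_closed_def)
    show "bij_betw (schur_map d F) (nat_trans (Gamma_cat d) F J') (nat_trans (Sym_cat d) (schur d F) (schur d J'))"
      unfolding bij_betw_def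
    proof (intro conjI inj_onI equalityI subsetI)
      fix \<theta> \<theta>' assume t: "\<theta> \<in> nat_trans (Gamma_cat d) F J'" "\<theta>' \<in> nat_trans (Gamma_cat d) F J'"
        "schur_map d F \<theta> = schur_map d F \<theta>'"
      have "schur_map d F (ncomp F i \<theta>) = schur_map d F (ncomp F i \<theta>')"
        by (simp add: schur_map_comp[OF t(1)] schur_map_comp[OF t(2)] t(3))
      then have "ncomp F i \<theta> = ncomp F i \<theta>'"
        using b ncomp_closed[OF F t(1) i] ncomp_closed[OF F t(2) i] unfolding bij_betw_def by (metis inj_onD)
      then have "ncomp F r (ncomp F i \<theta>) = ncomp F r (ncomp F i \<theta>')" by simp
      then show "\<theta> = \<theta>'"
        by (simp add: ncomp_assoc[OF t(1), symmetric] ncomp_assoc[OF t(2), symmetric] ri ncomp_idn_left[OF t(1)] ncomp_idn_left[OF t(2)])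
    next
      fix \<psi> assume p: "\<psi> \<in> nat_trans (Sym_cat d) (schur d F) (schur d J')"
      have "ncomp (schur d F) (schur_map d J' i) \<psi> \<in> nat_trans (Sym_cat d) (schur d F) (schur d J)"
        by (rule ncomp_closed[OF schur_functor[OF F] p si])
      then obtain \<theta> where t: "\<theta> \<in> nat_trans (Gamma_cat d) F J" "schur_map d F \<theta> = ncomp (schur d F) (schur_map d J' i) \<psi>"
        using b unfolding bij_betw_def by (metis imageE)
      have "schur_map d F (ncomp F r \<theta>) = \<psi>"
        by (simp add: schur_map_comp[OF t(1)] t(2) retr[OF p])
      then show "\<psi> \<in> schur_map d F ` nat_trans (Gamma_cat d) F J'"
        using ncomp_closed[OF F t(1) r] by (metis imageI)
    qed (use schur_map_nt[OF F J'] in blast)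
  }
  fix A B C :: "('k, nat \<Rightarrow> (nat list \<Rightarrow> 'k) \<Rightarrow> 'v) sym_mod" and \<eta> \<theta> \<gamma>
  assume F: "is_functor (Sym_cat d) A" "is_functor (Sym_cat d) B" "is_functor (Sym_cat d) C"
    and e: "\<eta> \<in> nat_trans (Sym_cat d) A B" and t: "\<theta> \<in> nat_trans (Sym_cat d) B C" and ex: "exact_at A \<eta> B \<theta> C"
    and g: "\<gamma> \<in> nat_trans (Sym_cat d) B (schur d J')"
    and z: "ncomp A \<gamma> \<eta> = \<zero>\<^bsub>hom_module (Sym_cat d) A (schur d J')\<^esub>"
  have g': "ncomp B (schur_map d J' i) \<gamma> \<in> nat_trans (Sym_cat d) B (schur d J)"
    by (rule ncomp_closed[OF F(2) g si])
  have "ncomp A (ncomp B (schur_map d J' i) \<gamma>) \<eta> = \<zero>\<^bsub>hom_module (Sym_cat d) A (schur d J)\<^esub>"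
    unfolding ncomp_assoc[OF e] z by (rule ncomp_zero_right[OF F(1) schur_functor[OF J'] schur_functor[OF Jf] si])
  then obtain \<kappa> where k: "\<kappa> \<in> nat_trans (Sym_cat d) C (schur d J)" "ncomp B \<kappa> \<theta> = ncomp B (schur_map d J' i) \<gamma>"
    using J F e t ex g' unfolding schur_closed_def by blast
  have "ncomp B (ncomp C (schur_map d J r) \<kappa>) \<theta> = \<gamma>"
    unfolding ncomp_assoc[OF t] k(2) by (rule retr[OF g])
  then show "\<exists>\<kappa>\<in>nat_trans (Sym_cat d) C (schur d J'). ncomp B \<kappa> \<theta> = \<gamma>"
    using ncomp_closed[OF F(3) k(1) sr] by blast
qed

text \<open>An infinite type absorbs its square. Iterating the pairing is injective on lists of
  equal length, and the length, coded through \<open>n\<close>, is recorded separately.\<close>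

lemma inj_list:
  assumes "infinite (UNIV :: 'v set)"
  obtains c :: "'v list \<Rightarrow> 'v" where "inj c"
proof -
  obtain g :: "'v \<times> 'v \<Rightarrow> 'v" where "bij_betw g (UNIV \<times> UNIV) UNIV"
    using card_of_ordIso[THEN iffD2, OF card_of_Times_same_infinite[OF assms]] by (elim exE)
  then have "inj g" by (simp add: bij_betw_def)
  then have g: "g p = g q \<longleftrightarrow> p = q" for p q by (rule inj_eq)
  obtain n :: "nat \<Rightarrow> 'v" where n: "inj n"
    using infinite_countable_subset[OF assms] by blast
  define e where "e = (\<lambda>xs. foldr (\<lambda>x y. g (x, y)) xs (n 0))"
  have e: "length xs = length ys \<Longrightarrow> e xs = e ys \<Longrightarrow> xs = ys" for xs ys
    by (induction xs ys rule: list_induct2) (auto simp: e_def g)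
  have "inj (\<lambda>xs. g (n (length xs), e xs))"
    by (rule injI) (use n e in \<open>auto simp: g inj_def\<close>)
  then show ?thesis by (rule that)
qed

text \<open>\<open>V\<close> is a copy of the value of \<open>G\<close> at \<open>d\<close>, and the
  map is \<open>tvmap\<close> for the inclusion. An element of the target has finitely many
  coefficients, hence is coded by a list over \<open>'v\<close>, and then by one element of
  \<open>'v\<close>.\<close>

lemma schur_closed_hull:
  fixes G :: "('k::field, 'v) spf"
  assumes inf: "infinite (UNIV :: 'v set)" and G: "strict_poly_functor d G"
  obtains J :: "('k, 'v) spf" and \<kappa> where "schur_closed d TYPE('v) J" "\<kappa> \<in> nat_trans (Gamma_cat d) G J"
    "\<And>n y. y \<in> carrier (Ob G n) \<Longrightarrow> \<kappa> n y = \<zero>\<^bsub>Ob J n\<^esub> \<longleftrightarrow>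
      (\<forall>w\<in>words {..<n} d. Mp G n d (bx d (idw d) (dl w)) y = \<zero>\<^bsub>Ob G d\<^esub>)"
proof -
  let ?M = "Ob G d"
  note VM = fun_vs[OF G, of d]
  define V where "V = uin ?M ` carrier ?M"
  have "subsp ?M (carrier ?M)" by (simp add: subsp_def vs_closed VM)
  then have V: "usp.subspace V" unfolding V_def by (rule usp_subspace_image[OF VM])
  have l: "lin_usp ?M V (uin ?M)" by (simp add: lin_usp_def V_def uin_add uin_smult VM)
  note TV = usp.vfun_functor[OF V, of d]
  obtain c :: "'v list \<Rightarrow> 'v" where c: "inj c" using inj_list[OF inf] .
  \<comment> \<open>Any enumeration of the finitely many words will do; repetitions do not harm the
    injectivity of the coding.\<close>
  define ws where "ws n = (SOME xs. set xs = words {..<n} d)" for n :: nat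
  have ws: "set (ws n) = words {..<n} d" for n
    unfolding ws_def by (rule someI_ex[OF finite_list[OF finite_words]]) simp
  define enc where "enc n g = c (map (\<lambda>w. upr ?M (g w)) (ws n))" for n and g :: "nat list \<Rightarrow> ('k, 'v) usp"
  have "inj_on (enc n) (carrier (Ob (vfun usc d V) n))" for n
  proof (rule inj_onI, rule ext)
    fix g h w assume g: "g \<in> carrier (Ob (vfun usc d V) n)" "h \<in> carrier (Ob (vfun usc d V) n)" and e: "enc n g = enc n h"
    have "map (\<lambda>w. upr ?M (g w)) (ws n) = map (\<lambda>w. upr ?M (h w)) (ws n)"
      by (rule injD[OF c]) (use e in \<open>simp add: enc_def\<close>)
    then have m: "upr ?M (g w) = upr ?M (h w)" if "w \<in> words {..<n} d" using that ws[of n] by (simp only: map_eq_conv)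
    show "g w = h w"
    proof (cases "w \<in> words {..<n} d")
      case True
      have "g w \<in> V" "h w \<in> V" using g by (auto simp: vtens_def)
      then show ?thesis using m[OF True] unfolding V_def by (auto simp: upr_uin[OF VM])
    qed (use g vtens_0[of g "{..<n}" d V w] vtens_0[of h "{..<n}" d V w] in simp)
  qed
  then obtain J :: "('k, 'v) spf" and i r where J: "strict_poly_functor d J" and i: "i \<in> nat_trans (Gamma_cat d) J (vfun usc d V)"
    and r: "r \<in> nat_trans (Gamma_cat d) (vfun usc d V) J" and ri: "ncomp J r i = idn J" and ir: "ncomp (vfun usc d V) i r = idn (vfun usc d V)"
    using transport_functor[OF TV] by metis
  have gJ: "schur_closed d TYPE('v) J" by (rule schur_closed_retract[OF tv_good[OF V] J i r ri])
  note t = tvmap_nt[OF G V l]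
  have k: "ncomp G r (tvmap d G (uin ?M)) \<in> nat_trans (Gamma_cat d) G J" by (rule ncomp_closed[OF G t r])
  have "ncomp G r (tvmap d G (uin ?M)) n y = \<zero>\<^bsub>Ob J n\<^esub> \<longleftrightarrow>
      (\<forall>w\<in>words {..<n} d. Mp G n d (bx d (idw d) (dl w)) y = \<zero>\<^bsub>Ob G d\<^esub>)" if y: "y \<in> carrier (Ob G n)" for n y
  proof -
    let ?g = "tvmap d G (uin ?M) n y"
    have gc: "?g \<in> carrier (Ob (vfun usc d V) n)" by (rule nt_closed[OF t y])
    have "r n ?g = \<zero>\<^bsub>Ob J n\<^esub> \<longleftrightarrow> ?g = \<zero>\<^bsub>Ob (vfun usc d V) n\<^esub>"
    proof
      assume "r n ?g = \<zero>\<^bsub>Ob J n\<^esub>"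
      then have "i n (r n ?g) = \<zero>\<^bsub>Ob (vfun usc d V) n\<^esub>" using nt_zero[OF i J TV] by simp
      moreover have "i n (r n ?g) = ?g" using fun_cong[OF fun_cong[OF ir, of n], of ?g] gc by simp
      ultimately show "?g = \<zero>\<^bsub>Ob (vfun usc d V) n\<^esub>" by simp
    qed (use nt_zero[OF r TV J] in simp)
    also have "\<dots> \<longleftrightarrow> (\<forall>w\<in>words {..<n} d. ?g w = 0)"
      using vtens_0[of ?g "{..<n}" d V] gc by (auto simp: fun_eq_iff)
    also have "\<dots> \<longleftrightarrow> (\<forall>w\<in>words {..<n} d. Mp G n d (bx d (idw d) (dl w)) y = \<zero>\<^bsub>Ob G d\<^esub>)"
    proof (rule ball_cong[OF refl])
      fix w assume w: "w \<in> words {..<n} d"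
      have "Mp G n d (bx d (idw d) (dl w)) y \<in> carrier ?M" using fun_closed[OF G _ y] dl_Hom[OF w] by simp
      then show "?g w = 0 \<longleftrightarrow> Mp G n d (bx d (idw d) (dl w)) y = \<zero>\<^bsub>Ob G d\<^esub>"
        unfolding tvmap_apply[OF y w] using uin_inject[OF VM _ vs_zero[OF VM]] uin_zero[OF VM] by metis
    qed
    finally show ?thesis using y by simp
  qed
  with gJ k that show ?thesis by blast
qed

section \<open>Young symmetrizers and p-bounded functors\<close>

interpretation fvs: Modules.module "fscale :: 'k::field \<Rightarrow> ('x \<Rightarrow> 'k) \<Rightarrow> 'x \<Rightarrow> 'k"
  by standard (auto simp: fscale_def fun_eq_iff algebra_simps)

declare fvs.scale_scale [simp del]

lemma fspan_induct [consumes 1, case_names base step]: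
  assumes "t \<in> fspan S" "P 0" "\<And>c x y. \<lbrakk>x \<in> S; P y\<rbrakk> \<Longrightarrow> P (fscale c x + y)"
  shows "P t"
  by (rule fvs.span_induct_alt[of t S P]) (fact assms)+

lemma fsubspaceI:
  assumes "0 \<in> S" "\<And>x y. \<lbrakk>x \<in> S; y \<in> S\<rbrakk> \<Longrightarrow> x + y \<in> S" "\<And>c x. x \<in> S \<Longrightarrow> fscale c x \<in> S"
  shows "fvs.subspace S"
  using assms by (simp add: fvs.subspace_def)

lemma fspan_zero: "0 \<in> fspan S"
  by (rule fvs.span_zero)

lemma tens_subspace: "fvs.subspace (tens A d)"
  by (rule fsubspaceI) (auto intro: tens_add tens_fscale, auto simp: tens_def)

section \<open>Young subgroups and their norm elements\<close>

definition blk :: "nat \<Rightarrow> (nat \<Rightarrow> nat) \<Rightarrow> (nat \<Rightarrow> nat) \<Rightarrow> nat \<Rightarrow> nat"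
  where "blk a \<sigma> \<tau> = (\<lambda>i. if i < a then \<sigma> i else a + \<tau> (i - a))"

fun young :: "nat list \<Rightarrow> (nat \<Rightarrow> nat) set" where
  "young [] = {id}"
| "young (a # l) = (\<lambda>(\<sigma>, \<tau>). blk a \<sigma> \<tau>) ` (Sym a \<times> young l)"

lemma Sym_lt: "\<lbrakk>\<sigma> \<in> Sym a; i < a\<rbrakk> \<Longrightarrow> \<sigma> i < a"
  using permutes_in_image[of \<sigma> "{..<a}" i] by simp

lemma blk_Sym:
  assumes s: "\<sigma> \<in> Sym a" and t: "\<tau> \<in> Sym b"
  shows "blk a \<sigma> \<tau> \<in> Sym (a + b)"
proof -
  have "blk a (iv \<sigma>) (iv \<tau>) (blk a \<sigma> \<tau> i) = i" "blk a \<sigma> \<tau> (blk a (iv \<sigma>) (iv \<tau>) i) = i" for i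
    using Sym_lt[OF s, of i] Sym_lt[OF Sym_inv[OF s], of i] permutes_inverses[of \<sigma> "{..<a}"]
      permutes_inverses[of \<tau> "{..<b}"] s t by (auto simp: blk_def)
  then have "bij (blk a \<sigma> \<tau>)" by (intro o_bij[of "blk a (iv \<sigma>) (iv \<tau>)"]) (auto simp: fun_eq_iff)
  moreover have "blk a \<sigma> \<tau> i = i" if "i \<notin> {..<a + b}" for i
    using that t by (simp add: blk_def permutes_def)
  ultimately show ?thesis by (simp add: permutes_def bij_iff)
qed

lemma young_Sym: "\<sigma> \<in> young l \<Longrightarrow> \<sigma> \<in> Sym (sum_list l)"
proof (induction l arbitrary: \<sigma>)
  case (Cons a l)
  then show ?case using blk_Sym by auto
qed simp

lemma blk_inject:
  assumes "\<sigma> \<in> Sym a" "\<sigma>' \<in> Sym a" "blk a \<sigma> \<tau> = blk a \<sigma>' \<tau>'"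
  shows "\<sigma> = \<sigma>' \<and> \<tau> = \<tau>'"
proof
  note e = fun_cong[OF assms(3)]
  have "\<sigma> i = \<sigma>' i" for i
    using e[of i] assms(1,2) by (cases "i < a") (auto simp: blk_def permutes_def)
  then show "\<sigma> = \<sigma>'" by auto
  have "\<tau> i = \<tau>' i" for i using e[of "a + i"] by (simp add: blk_def)
  then show "\<tau> = \<tau>'" by auto
qed

lemma sum_young_Cons:
  "(\<Sum>\<rho>\<in>young (a # l). h \<rho>) = (\<Sum>\<sigma>\<in>Sym a. \<Sum>\<tau>\<in>young l. h (blk a \<sigma> \<tau>))"
proof -
  have "inj_on (\<lambda>(\<sigma>, \<tau>). blk a \<sigma> \<tau>) (Sym a \<times> young l)"
  proof (rule inj_onI, clarify)
    fix \<sigma> \<tau> \<sigma>' \<tau>'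
    assume "\<sigma> permutes {..<a}" "\<sigma>' permutes {..<a}" "blk a \<sigma> \<tau> = blk a \<sigma>' \<tau>'"
    then show "\<sigma> = \<sigma>' \<and> \<tau> = \<tau>'" by (intro blk_inject[of \<sigma> a]) simp_all
  qed
  then have "(\<Sum>\<rho>\<in>young (a # l). h \<rho>) = (\<Sum>x\<in>Sym a \<times> young l. h (case x of (\<sigma>, \<tau>) \<Rightarrow> blk a \<sigma> \<tau>))"
    by (simp add: sum.reindex)
  also have "\<dots> = (\<Sum>(\<sigma>, \<tau>)\<in>Sym a \<times> young l. h (blk a \<sigma> \<tau>))"
    by (intro sum.cong) auto
  also have "\<dots> = (\<Sum>\<sigma>\<in>Sym a. \<Sum>\<tau>\<in>young l. h (blk a \<sigma> \<tau>))"
    by (rule sum.cartesian_product[symmetric])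
  finally show ?thesis .
qed

lemma pl_blk:
  assumes s: "\<sigma> \<in> Sym a" and len: "length xs = a + b"
  shows "permute_list (blk a \<sigma> \<tau>) xs = permute_list \<sigma> (take a xs) @ permute_list \<tau> (drop a xs)"
  using len Sym_lt[OF s]
  by (intro nth_equalityI) (auto simp: permute_list_def blk_def nth_append)

text \<open>The norm element of the Young subgroup, not divided by the group order and so available
  in every characteristic. Its image lies in \<open>Gamma_lam\<close> and it kills
  \<open>S_lam_ker\<close>; on single blocks it is \<open>symz\<close>.\<close>

definition ysym :: "nat list \<Rightarrow> ('x list \<Rightarrow> 'k::field) \<Rightarrow> 'x list \<Rightarrow> 'k"
  where "ysym lam t = (\<lambda>xs. \<Sum>\<sigma>\<in>young lam. t (permute_list \<sigma> xs))"

definition symz :: "nat \<Rightarrow> ('x list \<Rightarrow> 'k::field) \<Rightarrow> 'x list \<Rightarrow> 'k"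
  where "symz a t = (\<lambda>xs. \<Sum>\<sigma>\<in>Sym a. t (permute_list \<sigma> xs))"

lemma tperm_iv: "\<sigma> \<in> Sym a \<Longrightarrow> tperm (iv \<sigma>) t = (\<lambda>xs. t (permute_list \<sigma> xs))"
  by (simp add: tperm_def inv_inv_eq permutes_bij)

lemma perm_tens: "\<lbrakk>t \<in> tens A d; \<sigma> \<in> Sym d\<rbrakk> \<Longrightarrow> (\<lambda>xs. t (permute_list \<sigma> xs)) \<in> tens A d"
  using tperm_tens[OF _ Sym_inv[of \<sigma> d], of t A UNIV] by (simp add: tperm_iv tens_vtens)

lemma ysym_tens: "t \<in> tens A (sum_list lam) \<Longrightarrow> ysym lam t \<in> tens A (sum_list lam)"
proof -
  assume "t \<in> tens A (sum_list lam)"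
  then have "(\<Sum>\<sigma>\<in>young lam. (\<lambda>xs. t (permute_list \<sigma> xs))) \<in> tens A (sum_list lam)"
    by (intro tens_sum perm_tens young_Sym)
  moreover have "(\<Sum>\<sigma>\<in>young lam. (\<lambda>xs. t (permute_list \<sigma> xs))) = ysym lam t"
    by (rule ext) (simp add: sum_fun_apply ysym_def)
  ultimately show ?thesis by simp
qed

lemma ysym_add: "ysym lam (s + t) = ysym lam s + ysym lam t"
  by (rule ext) (simp add: ysym_def sum.distrib)

lemma ysym_fscale: "ysym lam (fscale r t) = fscale r (ysym lam t)"
  by (rule ext) (simp add: ysym_def fscale_def sum_distrib_left)

lemma ysym_0: "ysym lam 0 = 0"
  by (rule ext) (simp add: ysym_def)

lemma ysym_tens_map:
  assumes f: "f \<in> Gamma_sp ({..<n} \<times> {..<m}) (sum_list lam)"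
  shows "ysym lam (tens_map (sum_list lam) m f t) = tens_map (sum_list lam) m f (ysym lam t)"
proof
  fix xs
  let ?d = "sum_list lam"
  show "ysym lam (tens_map ?d m f t) xs = tens_map ?d m f (ysym lam t) xs"
  proof (cases "length xs = ?d")
    case True
    have "ysym lam (tens_map ?d m f t) xs =
        (\<Sum>\<sigma>\<in>young lam. \<Sum>ys\<in>words {..<m} ?d. f (zip xs ys) * t (permute_list \<sigma> ys))"
      unfolding ysym_def tens_map_vmap
      by (intro sum.cong[OF refl]) (simp add: kvs.vmap_perm[OF f young_Sym True])
    also have "\<dots> = tens_map ?d m f (ysym lam t) xs"
      by (subst sum.swap) (simp add: tens_map_def True ysym_def sum_distrib_left)
    finally show ?thesis .
  qed (simp add: ysym_def tens_map_def)
qed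

lemma symz_tens: "t \<in> tens A a \<Longrightarrow> symz a t \<in> tens A a"
proof -
  assume "t \<in> tens A a"
  then have "(\<Sum>\<sigma>\<in>Sym a. (\<lambda>xs. t (permute_list \<sigma> xs))) \<in> tens A a" by (intro tens_sum perm_tens)
  moreover have "(\<Sum>\<sigma>\<in>Sym a. (\<lambda>xs. t (permute_list \<sigma> xs))) = symz a t" by (rule ext) (simp add: sum_fun_apply symz_def)
  ultimately show ?thesis by simp
qed

lemma symz_perm:
  assumes t: "t \<in> tens A a" and ta: "\<tau> \<in> Sym a"
  shows "symz a t (permute_list \<tau> xs) = symz a t xs"
proof (cases "length xs = a")
  case True
  have "symz a t (permute_list \<tau> xs) = (\<Sum>\<sigma>\<in>Sym a. t (permute_list (\<tau> \<circ> \<sigma>) xs))"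
    unfolding symz_def by (intro sum.cong[OF refl]) (simp add: pl_comp[OF ta _ True])
  also have "\<dots> = symz a t xs"
    unfolding symz_def by (rule sum.reindex_bij_betw[OF bij_Sym_comp[OF ta]])
  finally show ?thesis .
next
  case False
  then show ?thesis
    using tens_0[OF symz_tens[OF t], of xs] tens_0[OF symz_tens[OF t], of "permute_list \<tau> xs"] by (auto simp: words_def)
qed

lemma symz_Gamma: "t \<in> tens A a \<Longrightarrow> symz a t \<in> Gamma_sp A a"
  using symz_tens[of t A a] symz_perm[OF _ Sym_inv, of t A a] by (auto simp: Gamma_sp_def tperm_def fun_eq_iff)

lemma symz_of_Gamma: "g \<in> Gamma_sp A a \<Longrightarrow> symz a g = fscale (of_nat (fact a)) g"
proof
  fix xs assume g: "g \<in> Gamma_sp A a"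
  have "g (permute_list \<sigma> xs) = g xs" if s: "\<sigma> \<in> Sym a" for \<sigma>
  proof (cases "length xs = a")
    case False
    then have "xs \<notin> words A a" "permute_list \<sigma> xs \<notin> words A a" by (auto simp: words_def)
    then show ?thesis using Gamma_sp_tens[OF g] by metis
  qed (use Gamma_sp_perm[OF g s] in simp)
  then show "symz a g xs = fscale (of_nat (fact a)) g xs"
    by (simp add: symz_def fscale_def card_permutations[of "{..<a}" a])
qed

lemma symz_add: "symz a (s + t) = symz a s + symz a t"
  by (rule ext) (simp add: symz_def sum.distrib)

lemma symz_fscale: "symz a (fscale r t) = fscale r (symz a t)"
  by (rule ext) (simp add: symz_def fscale_def sum_distrib_left)

text \<open>A sum over the whole group does not change when its argument is permuted first, so the
  generators of \<open>coinv_ker\<close> are killed.\<close>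

lemma symz_coinv: "t \<in> coinv_ker A a \<Longrightarrow> symz a t = 0"
  unfolding coinv_ker_def
proof (induction rule: fspan_induct)
  case base show "symz a 0 = 0" by (rule ext) (simp add: symz_def)
next
  case (step c x y)
  then obtain t \<sigma> where x: "x = t - tperm \<sigma> t" and t: "t \<in> tens A a" and s: "\<sigma> \<in> Sym a" by auto
  have "symz a (tperm \<sigma> t) = symz a t"
  proof
    fix xs
    have "symz a (tperm \<sigma> t) xs = (\<Sum>\<rho>\<in>Sym a. t (permute_list (iv \<sigma>) (permute_list \<rho> xs)))"
      by (simp add: symz_def tperm_def)
    also have "\<dots> = symz a t xs"
    proof (cases "length xs = a")
      case True
      have b: "bij_betw (\<lambda>\<rho>. \<rho> \<circ> iv \<sigma>) (Sym a) (Sym a)"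
      proof (rule bij_betwI[where g = "\<lambda>\<rho>. \<rho> \<circ> \<sigma>"])
        have "\<sigma> \<circ> iv \<sigma> = id" "iv \<sigma> \<circ> \<sigma> = id" using s by (simp_all add: permutes_inv_o)
        then show "\<rho> \<circ> iv \<sigma> \<circ> \<sigma> = \<rho>" "\<rho> \<circ> \<sigma> \<circ> iv \<sigma> = \<rho>" for \<rho> by (simp_all add: comp_assoc)
      qed (use s in \<open>auto intro: permutes_compose permutes_inv\<close>)
      have "(\<Sum>\<rho>\<in>Sym a. t (permute_list (iv \<sigma>) (permute_list \<rho> xs))) = (\<Sum>\<rho>\<in>Sym a. t (permute_list (\<rho> \<circ> iv \<sigma>) xs))"
        by (intro sum.cong[OF refl]) (simp only: pl_comp[OF _ Sym_inv[OF s] True])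
      also have "\<dots> = symz a t xs" unfolding symz_def by (rule sum.reindex_bij_betw[OF b])
      finally show ?thesis .
    next
      case False
      have "t ys = 0" if "length ys = length xs" for ys
        using tens_0[OF t, of ys] False that by (auto simp: words_def)
      then show ?thesis by (simp add: symz_def)
    qed
    finally show "symz a (tperm \<sigma> t) xs = symz a t xs" .
  qed
  moreover have "symz a (t - tperm \<sigma> t) = symz a t - symz a (tperm \<sigma> t)"
    by (rule ext) (simp add: symz_def sum_subtractf)
  ultimately have "symz a x = 0" by (simp add: x)
  moreover have "symz a y = 0" by (rule step(2))
  ultimately show "symz a (fscale c x + y) = 0" by (simp add: symz_add symz_fscale)
qed

section \<open>Norm elements on products of tensors\<close>

lemma tprod_tens: "list_all2 (\<lambda>a t. t \<in> tens A a) lam ts \<Longrightarrow> tprod lam ts \<in> tens A (sum_list lam)"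
proof (induction lam ts rule: list_all2_induct)
  case Nil
  then show ?case by (auto simp: tens_def words_def)
next
  case (Cons a l t ts)
  show ?case
    unfolding tens_def
  proof (intro CollectI allI impI)
    fix xs assume "tprod (a # l) (t # ts) xs \<noteq> 0"
    then have "take a xs \<in> words A a" "drop a xs \<in> words A (sum_list l)"
      using Cons by (auto simp: tens_def)
    moreover have "set xs = set (take a xs) \<union> set (drop a xs)" by (metis append_take_drop_id set_append)
    ultimately show "xs \<in> words A (sum_list (a # l))" by (auto simp: words_def)
  qed
qed

lemma tens_eqI: "\<lbrakk>s \<in> tens A d; t \<in> tens A d; \<And>xs. xs \<in> words A d \<Longrightarrow> s xs = t xs\<rbrakk> \<Longrightarrow> s = t"
  by (rule ext) (metis tens_0)

text \<open>A block permutation acts separately on the first \<open>a\<close> letters and on the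
  rest, so the sum over the Young subgroup splits into a product of sums over its blocks.\<close>

lemma ysym_tprod:
  assumes "list_all2 (\<lambda>a t. t \<in> tens A a) lam ts"
  shows "ysym lam (tprod lam ts) = tprod lam (map2 symz lam ts)"
  using assms
proof (induction lam ts rule: list_all2_induct)
  case Nil
  show ?case by (rule ext) (simp add: ysym_def)
next
  case (Cons a l t ts)
  have l: "list_all2 (\<lambda>a t. t \<in> tens A a) (a # l) (t # ts)" using Cons by simp
  have l': "list_all2 (\<lambda>a t. t \<in> tens A a) (a # l) (map2 symz (a # l) (t # ts))"
    using l by (auto simp: list_all2_conv_all_nth nth_Cons' symz_tens)
  show ?case
  proof (rule tens_eqI[OF ysym_tens[OF tprod_tens[OF l]] tprod_tens[OF l']])
    fix xs assume "xs \<in> words A (sum_list (a # l))"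
    then have len: "length xs = a + sum_list l" by (simp add: words_length)
    have "ysym (a # l) (tprod (a # l) (t # ts)) xs =
        (\<Sum>\<sigma>\<in>Sym a. \<Sum>\<tau>\<in>young l. t (permute_list \<sigma> (take a xs)) * tprod l ts (permute_list \<tau> (drop a xs)))"
      unfolding ysym_def sum_young_Cons
      by (intro sum.cong[OF refl]) (simp add: pl_blk[OF _ len] len)
    also have "\<dots> = symz a t (take a xs) * ysym l (tprod l ts) (drop a xs)"
      by (simp add: symz_def ysym_def sum_product)
    finally show "ysym (a # l) (tprod (a # l) (t # ts)) xs = tprod (a # l) (map2 symz (a # l) (t # ts)) xs"
      by (simp add: Cons)
  qed
qed

lemma dl_tprod:
  fixes w :: "'a list"
  assumes "w \<in> words A (sum_list lam)"
  obtains ts :: "('a list \<Rightarrow> 'b::field) list"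
  where "list_all2 (\<lambda>a t. t \<in> tens A a) lam ts" "dl w = tprod lam ts"
proof -
  have "\<exists>ts :: ('a list \<Rightarrow> 'b) list. list_all2 (\<lambda>a t. t \<in> tens A a) lam ts \<and> dl w = tprod lam ts"
    using assms
  proof (induction lam arbitrary: w)
    case Nil
    then show ?case by (intro exI[of _ "[]"]) (auto simp: dl_def words_def fun_eq_iff)
  next
    case (Cons a l)
    have tk: "take a w \<in> words A a" and dr: "drop a w \<in> words A (sum_list l)"
      using Cons.prems set_take_subset[of a w] set_drop_subset[of a w] by (auto simp: words_def)
    obtain ts where ts: "list_all2 (\<lambda>a t. t \<in> tens A a) l ts" "(dl (drop a w) :: _ \<Rightarrow> 'b) = tprod l ts"
      using Cons.IH[OF dr] by blast
    have "(dl w xs :: 'b) = dl (take a w) (take a xs) * dl (drop a w) (drop a xs)" for xs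
    proof -
      have "xs = w \<longleftrightarrow> take a xs = take a w \<and> drop a xs = drop a w"
        by (metis append_take_drop_id)
      then show ?thesis by (simp add: dl_def)
    qed
    then show ?case
      using ts dl_tens[OF tk] by (intro exI[of _ "dl (take a w) # ts"]) (auto simp: fun_eq_iff)
  qed
  then show ?thesis using that by blast
qed

lemma tens_expand:
  assumes A: "finite A" and t: "t \<in> tens A d"
  shows "t = (\<Sum>w\<in>words A d. fscale (t w) (dl w))"
proof
  fix xs
  have "(\<Sum>w\<in>words A d. fscale (t w) (dl w)) xs = (\<Sum>w\<in>words A d. if w = xs then t xs else 0)"
    unfolding sum_fun_apply by (intro sum.cong[OF refl]) (auto simp: fscale_def dl_def)
  then show "t xs = (\<Sum>w\<in>words A d. fscale (t w) (dl w)) xs"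
    using tens_0[OF t, of xs] by (simp add: sum.delta finite_words[OF A])
qed

text \<open>Basis words are products of shorter basis words, so product tensors span and a linear
  statement need only be checked on them.\<close>

lemma tens_induct:
  fixes t :: "'a list \<Rightarrow> 'b::field"
  assumes A: "finite A" and t: "t \<in> tens A (sum_list lam)" and W: "fvs.subspace {t. Q t}"
    and gen: "\<And>ts. list_all2 (\<lambda>a t. t \<in> tens A a) lam ts \<Longrightarrow> Q (tprod lam ts)"
  shows "Q t"
proof -
  have "dl w \<in> {t. Q t}" if w: "w \<in> words A (sum_list lam)" for w
  proof -
    obtain ts where ts: "list_all2 (\<lambda>a t. t \<in> tens A a) lam ts" "(dl w :: _ \<Rightarrow> 'b) = tprod lam ts"
      using dl_tprod[OF w] by blast
    show ?thesis unfolding ts(2) using gen[OF ts(1)] by simp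
  qed
  then have "(\<Sum>w\<in>words A (sum_list lam). fscale (t w) (dl w)) \<in> {t. Q t}"
    by (intro fvs.subspace_sum[OF W] fvs.subspace_scale[OF W])
  then show ?thesis by (simp flip: tens_expand[OF A t])
qed

lemma ysym_Gamma_lam:
  assumes A: "finite A" and t: "t \<in> tens A (sum_list lam)"
  shows "ysym lam t \<in> Gamma_lam A lam"
proof (rule tens_induct[OF A t])
  show "fvs.subspace {t. ysym lam t \<in> Gamma_lam A lam}"
    unfolding Gamma_lam_def
    by (rule fsubspaceI) (simp_all add: ysym_0 ysym_add ysym_fscale fspan_zero fvs.span_add fvs.span_scale)
  fix ts assume ts: "list_all2 (\<lambda>a t. t \<in> tens A a) lam ts"
  have "list_all2 (\<lambda>a t. t \<in> Gamma_sp A a) lam (map2 symz lam ts)"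
    using ts by (auto simp: list_all2_conv_all_nth symz_Gamma)
  then show "ysym lam (tprod lam ts) \<in> Gamma_lam A lam"
    unfolding ysym_tprod[OF ts] Gamma_lam_def by (intro fvs.span_base) blast
qed

text \<open>The order of the Young subgroup as an element of the field.\<close>

definition cfact :: "nat list \<Rightarrow> 'k::field"
  where "cfact lam = (\<Prod>a\<leftarrow>lam. of_nat (fact a))"

lemma tprod_cfact:
  "length lam = length ts \<Longrightarrow> tprod lam (map2 (\<lambda>a. fscale (of_nat (fact a))) lam ts) = fscale (cfact lam) (tprod lam ts)"
  by (induction lam ts rule: list_induct2) (auto simp: cfact_def fscale_def fun_eq_iff)

lemma Gamma_lam_tens: "Gamma_lam A lam \<subseteq> tens A (sum_list lam)"
  unfolding Gamma_lam_def
proof (rule fvs.span_minimal[OF _ tens_subspace], safe)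
  fix ts :: "('a list \<Rightarrow> 'b) list" assume "list_all2 (\<lambda>a t. t \<in> Gamma_sp A a) lam ts"
  then have "list_all2 (\<lambda>a t. t \<in> tens A a) lam ts" by (rule list_all2_mono) (simp add: Gamma_sp_def)
  then show "tprod lam ts \<in> tens A (sum_list lam)" by (rule tprod_tens)
qed

text \<open>The norm of an invariant is the group order times it. Combined with
  \<open>ysym_Gamma_lam\<close>, dividing by an invertible \<open>cfact lam\<close> makes
  \<open>ysym lam\<close> a projection of the tensor power onto \<open>Gamma_lam\<close>.\<close>

lemma ysym_of_Gamma_lam: "g \<in> Gamma_lam A lam \<Longrightarrow> ysym lam g = fscale (cfact lam) g"
  unfolding Gamma_lam_def
proof (induction rule: fspan_induct)
  case base show "ysym lam 0 = fscale (cfact lam) 0" by (simp add: ysym_0)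
next
  case (step c x y)
  then obtain ts where x: "x = tprod lam ts" and ts: "list_all2 (\<lambda>a t. t \<in> Gamma_sp A a) lam ts" by auto
  have l: "list_all2 (\<lambda>a t. t \<in> tens A a) lam ts" using ts by (rule list_all2_mono) (simp add: Gamma_sp_def)
  have m: "map2 symz lam ts = map2 (\<lambda>a. fscale (of_nat (fact a))) lam ts"
    using ts by (intro nth_equalityI) (auto simp: list_all2_conv_all_nth symz_of_Gamma)
  have "ysym lam x = fscale (cfact lam) x"
    unfolding x ysym_tprod[OF l] m by (rule tprod_cfact[OF list_all2_lengthD[OF l]])
  moreover have "ysym lam y = fscale (cfact lam) y" by (rule step(2))
  ultimately show "ysym lam (fscale c x + y) = fscale (cfact lam) (fscale c x + y)"
    by (simp add: ysym_add ysym_fscale fvs.scale_right_distrib fvs.scale_left_commute)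
qed

lemma tprod_zero: "\<lbrakk>length lam = length ts; j < length lam; ts ! j = 0\<rbrakk> \<Longrightarrow> tprod lam ts = 0"
proof (induction lam ts arbitrary: j rule: list_induct2)
  case (Cons a l t ts)
  then show ?case by (cases j) (auto simp: fun_eq_iff)
qed simp

lemma ysym_S_lam_ker: "t \<in> S_lam_ker A lam \<Longrightarrow> ysym lam t = 0"
  unfolding S_lam_ker_def
proof (induction rule: fspan_induct)
  case base show "ysym lam 0 = 0" by (rule ysym_0)
next
  case (step c x y)
  then obtain ts j where x: "x = tprod lam ts" and ts: "list_all2 (\<lambda>a t. t \<in> tens A a) lam ts"
    and j: "j < length lam" "ts ! j \<in> coinv_ker A (lam ! j)" by auto
  have "tprod lam (map2 symz lam ts) = 0"
    by (rule tprod_zero[of _ _ j]) (use ts j list_all2_lengthD[OF ts] symz_coinv in auto)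
  then have "ysym lam x = 0" unfolding x by (simp add: ysym_tprod[OF ts])
  moreover have "ysym lam y = 0" by (rule step(2))
  ultimately show "ysym lam (fscale c x + y) = 0" by (simp add: ysym_add ysym_fscale)
qed

text \<open>Write the difference as a sum over all permutations of \<open>t\<close> minus its
  permuted copy; every summand is a generator.\<close>

lemma coinv_symz:
  assumes t: "t \<in> tens A a"
  shows "fscale (of_nat (fact a)) t - symz a t \<in> coinv_ker A a"
proof -
  have "fscale (of_nat (fact a)) t - symz a t = (\<Sum>\<sigma>\<in>Sym a. t - tperm (iv \<sigma>) t)"
  proof
    fix xs
    have "(\<Sum>\<sigma>\<in>Sym a. t - tperm (iv \<sigma>) t) xs = (\<Sum>\<sigma>\<in>Sym a. t xs - t (permute_list \<sigma> xs))"
      unfolding sum_fun_apply by (intro sum.cong[OF refl]) (simp add: tperm_iv)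
    then show "(fscale (of_nat (fact a)) t - symz a t) xs = (\<Sum>\<sigma>\<in>Sym a. t - tperm (iv \<sigma>) t) xs"
      by (simp add: sum_subtractf symz_def fscale_def card_permutations[of "{..<a}" a])
  qed
  also have "\<dots> \<in> coinv_ker A a"
    unfolding coinv_ker_def using t Sym_inv by (intro fvs.span_sum fvs.span_base) blast
  finally show ?thesis .
qed

lemma S_lam_ker_Cons:
  assumes u: "u \<in> S_lam_ker A l" and t: "t \<in> tens A a"
  shows "(\<lambda>xs. t (take a xs) * u (drop a xs)) \<in> S_lam_ker A (a # l)"
  using u unfolding S_lam_ker_def[of A l]
proof (induction rule: fspan_induct)
  case base
  have "(\<lambda>xs. t (take a xs) * (0 :: 'a list \<Rightarrow> 'b) (drop a xs)) = 0" by (simp add: fun_eq_iff)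
  then show ?case by (simp add: S_lam_ker_def fspan_zero)
next
  case (step c x y)
  then obtain ts j where x: "x = tprod l ts" and ts: "list_all2 (\<lambda>a t. t \<in> tens A a) l ts"
    and j: "j < length l" "ts ! j \<in> coinv_ker A (l ! j)" by auto
  have "tprod (a # l) (t # ts) \<in> S_lam_ker A (a # l)"
    unfolding S_lam_ker_def using ts t j by (intro fvs.span_base CollectI exI[of _ "t # ts"]) force
  then have "fscale c (tprod (a # l) (t # ts)) + (\<lambda>xs. t (take a xs) * y (drop a xs)) \<in> S_lam_ker A (a # l)"
    using step unfolding S_lam_ker_def by (intro fvs.span_add fvs.span_scale)
  moreover have "fscale c (tprod (a # l) (t # ts)) + (\<lambda>xs. t (take a xs) * y (drop a xs)) =
      (\<lambda>xs. t (take a xs) * (fscale c x + y) (drop a xs))"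
    by (simp add: fun_eq_iff fscale_def x algebra_simps)
  ultimately show ?case by simp
qed

text \<open>Telescoping: the factors are exchanged one at a time, and each exchange contributes a
  product with one factor in \<open>coinv_ker\<close>.\<close>

lemma tprod_diff:
  assumes "list_all2 (\<lambda>a t. t \<in> tens A a) lam ts" "list_all2 (\<lambda>a t. t \<in> tens A a) lam ts'"
    and "\<And>j. j < length lam \<Longrightarrow> ts ! j - ts' ! j \<in> coinv_ker A (lam ! j)"
  shows "tprod lam ts - tprod lam ts' \<in> S_lam_ker A lam"
  using assms
proof (induction lam arbitrary: ts ts')
  case Nil
  then have "ts = ts'" by simp
  then have e: "tprod [] ts - tprod [] ts' = 0" by simp
  show ?case unfolding e S_lam_ker_def by (rule fspan_zero)
next
  case (Cons a l)
  obtain t us where ts: "ts = t # us" "t \<in> tens A a" "list_all2 (\<lambda>a t. t \<in> tens A a) l us"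
    using Cons.prems(1) by (auto simp: list_all2_Cons1)
  obtain t' us' where ts': "ts' = t' # us'" "t' \<in> tens A a" "list_all2 (\<lambda>a t. t \<in> tens A a) l us'"
    using Cons.prems(2) by (auto simp: list_all2_Cons1)
  have "ts ! 0 - ts' ! 0 \<in> coinv_ker A ((a # l) ! 0)" by (rule Cons.prems(3)) simp
  then have d0: "t - t' \<in> coinv_ker A a" unfolding ts(1) ts'(1) by simp
  have "us ! j - us' ! j \<in> coinv_ker A (l ! j)" if "j < length l" for j
  proof -
    have "ts ! Suc j - ts' ! Suc j \<in> coinv_ker A ((a # l) ! Suc j)" by (rule Cons.prems(3)) (use that in simp)
    then show ?thesis unfolding ts(1) ts'(1) by simp
  qed
  then have IH: "tprod l us - tprod l us' \<in> S_lam_ker A l" by (rule Cons.IH[OF ts(3) ts'(3)])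
  have "t - t' \<in> tens A a" using ts(2) ts'(2) by (rule fvs.subspace_diff[OF tens_subspace])
  then have "tprod (a # l) ((t - t') # us) \<in> S_lam_ker A (a # l)"
    unfolding S_lam_ker_def using ts(3) d0
    by (intro fvs.span_base CollectI exI[of _ "(t - t') # us"]) force
  moreover have "(\<lambda>xs. t' (take a xs) * (tprod l us - tprod l us') (drop a xs)) \<in> S_lam_ker A (a # l)"
    by (rule S_lam_ker_Cons[OF IH ts'(2)])
  ultimately have "tprod (a # l) ((t - t') # us) + (\<lambda>xs. t' (take a xs) * (tprod l us - tprod l us') (drop a xs))
      \<in> S_lam_ker A (a # l)"
    unfolding S_lam_ker_def by (rule fvs.span_add)
  moreover have "tprod (a # l) ((t - t') # us) + (\<lambda>xs. t' (take a xs) * (tprod l us - tprod l us') (drop a xs)) =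
      tprod (a # l) ts - tprod (a # l) ts'"
    unfolding ts(1) ts'(1) by (simp add: fun_eq_iff algebra_simps)
  ultimately show "tprod (a # l) ts - tprod (a # l) ts' \<in> S_lam_ker A (a # l)" by simp
qed

text \<open>Modulo \<open>S_lam_ker\<close> the norm is multiplication by \<open>cfact lam\<close>.
  When this scalar is invertible, the norm therefore embeds the quotient
  \<open>S_functor lam\<close> into the tensor power.\<close>

lemma cfact_ysym:
  fixes t :: "'a list \<Rightarrow> 'b::field"
  assumes A: "finite A" and t: "t \<in> tens A (sum_list lam)"
  shows "fscale (cfact lam) t - ysym lam t \<in> S_lam_ker A lam"
proof (rule tens_induct[OF A t])
  have e1: "fscale (cfact lam) (x + y) - ysym lam (x + y) = (fscale (cfact lam) x - ysym lam x) + (fscale (cfact lam) y - ysym lam y)"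
    for x y :: "'a list \<Rightarrow> 'b" by (simp add: ysym_add fvs.scale_right_distrib)
  have e2: "fscale (cfact lam) (fscale c x) - ysym lam (fscale c x) = fscale c (fscale (cfact lam) x - ysym lam x)"
    for c and x :: "'a list \<Rightarrow> 'b" by (simp add: ysym_fscale fvs.scale_right_diff_distrib fvs.scale_left_commute)
  show "fvs.subspace {t :: 'a list \<Rightarrow> 'b. fscale (cfact lam) t - ysym lam t \<in> S_lam_ker A lam}"
  proof (rule fsubspaceI)
    have "0 \<in> S_lam_ker A lam" unfolding S_lam_ker_def by (rule fspan_zero)
    then show "0 \<in> {t :: 'a list \<Rightarrow> 'b. fscale (cfact lam) t - ysym lam t \<in> S_lam_ker A lam}" by (simp add: ysym_0)
  next
    fix x y :: "'a list \<Rightarrow> 'b" assume "x \<in> {t :: 'a list \<Rightarrow> 'b. fscale (cfact lam) t - ysym lam t \<in> S_lam_ker A lam}"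
      "y \<in> {t :: 'a list \<Rightarrow> 'b. fscale (cfact lam) t - ysym lam t \<in> S_lam_ker A lam}"
    then show "x + y \<in> {t :: 'a list \<Rightarrow> 'b. fscale (cfact lam) t - ysym lam t \<in> S_lam_ker A lam}"
      unfolding mem_Collect_eq e1 S_lam_ker_def by (rule fvs.span_add)
  next
    fix c and x :: "'a list \<Rightarrow> 'b" assume "x \<in> {t :: 'a list \<Rightarrow> 'b. fscale (cfact lam) t - ysym lam t \<in> S_lam_ker A lam}"
    then show "fscale c x \<in> {t :: 'a list \<Rightarrow> 'b. fscale (cfact lam) t - ysym lam t \<in> S_lam_ker A lam}"
      unfolding mem_Collect_eq e2 S_lam_ker_def by (rule fvs.span_scale)
  qed
  fix ts assume ts: "list_all2 (\<lambda>a t. t \<in> tens A a) lam ts"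
  have "tprod lam (map2 (\<lambda>a. fscale (of_nat (fact a))) lam ts) - tprod lam (map2 symz lam ts) \<in> S_lam_ker A lam"
    by (rule tprod_diff) (use ts in \<open>auto simp: list_all2_conv_all_nth symz_tens tens_fscale coinv_symz\<close>)
  then show "fscale (cfact lam) (tprod lam ts) - ysym lam (tprod lam ts) \<in> S_lam_ker A lam"
    by (simp add: ysym_tprod[OF ts] tprod_cfact[OF list_all2_lengthD[OF ts]])
qed

text \<open>A prime does not divide the factorial of a smaller number. This is where
  \<open>p_bounded\<close> enters the argument.\<close>

lemma cfact_nonzero:
  assumes p: "CHAR('k::field) = p" "p > 0" and b: "p_bounded p lam"
  shows "cfact lam \<noteq> (0 :: 'k)"
proof -
  have pr: "prime p" using p prime_CHAR_semidom[where 'a = 'k] by simp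
  have "of_nat (fact a) \<noteq> (0 :: 'k)" if "a < p" for a
    using that p pr by (simp add: of_nat_eq_0_iff_char_dvd prime_dvd_fact_iff)
  with b show ?thesis by (induction lam) (auto simp: cfact_def p_bounded_def)
qed

text \<open>Each summand \<open>Gamma_functor (lam i)\<close> is the image of the tensor power under
  \<open>ysym (lam i)\<close>, and \<open>N\<close> receives no nonzero map from the tensor power.
  So \<theta> after \<pi> vanishes on the summands, hence on all finite sums of their
  elements.\<close>

lemma left_p_bounded_hom_zero:
  fixes P :: "('k::field, 'v) spf" and N :: "('k, 'u) spf"
  assumes p: "CHAR('k) = p" "p > 0" and L: "left_p_bounded p d P"
    and P: "strict_poly_functor d P" and N: "strict_poly_functor d N"
    and N0: "nat_trans (Gamma_cat d) (tens_functor d) N \<subseteq> {\<zero>\<^bsub>hom_module (Gamma_cat d) (tens_functor d) N\<^esub>}"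
    and t: "\<theta> \<in> nat_trans (Gamma_cat d) P N"
  shows "\<theta> = \<zero>\<^bsub>hom_module (Gamma_cat d) P N\<^esub>"
proof (rule nt_eqI[OF t hom_closed(1)[OF P N]])
  obtain I :: "(nat \<times> 'v) set" and lam \<pi> where
      b: "\<And>i. i \<in> I \<Longrightarrow> p_bounded p (lam i) \<and> sum_list (lam i) = d"
    and pi: "\<pi> \<in> nat_trans (Gamma_cat d) (sum_functor I (\<lambda>i. Gamma_functor (lam i))) P"
    and ep: "is_epi (sum_functor I (\<lambda>i. Gamma_functor (lam i))) P \<pi>"
    using L unfolding left_p_bounded_def by blast
  let ?S = "sum_functor I (\<lambda>i. Gamma_functor (lam i)) :: ('k, _) spf"
  have Sc: "z \<in> carrier (Ob ?S n) \<longleftrightarrow> z \<in> (\<Pi>\<^sub>E i\<in>I. Gamma_lam {..<n} (lam i)) \<and> finite {i\<in>I. z i \<noteq> 0}" for z n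
    by (simp add: sum_functor_def sum_module_def Gamma_functor_def fun_module_def)
  have Sadd: "x \<oplus>\<^bsub>Ob ?S n\<^esub> y = (\<lambda>i\<in>I. x i + y i)" and Ssm: "r \<odot>\<^bsub>Ob ?S n\<^esub> x = (\<lambda>i\<in>I. fscale r (x i))"
    and Smp: "Mp ?S m n f x = (\<lambda>i\<in>I. tens_map (sum_list (lam i)) m f (x i))" for x y r m n f
    by (simp_all add: sum_functor_def sum_module_def prod_module_def Gamma_functor_def fun_module_def)
  have G0: "0 \<in> Gamma_lam {..<n} l" for n l unfolding Gamma_lam_def by (rule fspan_zero)
  \<comment> \<open>The inclusion of the summand with index \<open>i\<close> into the direct
    sum.\<close>
  define e where "e i g = (\<lambda>j\<in>I. if j = i then g else 0)" for i and g :: "nat list \<Rightarrow> 'k"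
  have ec: "e i g \<in> carrier (Ob ?S n)" if "i \<in> I" "g \<in> Gamma_lam {..<n} (lam i)" for i g n
  proof -
    have "finite {j\<in>I. e i g j \<noteq> 0}" by (rule finite_subset[of _ "{i}"]) (auto simp: e_def)
    then show ?thesis unfolding Sc using that G0 by (auto simp: e_def)
  qed
  have key: "\<theta> n (\<pi> n (e i g)) = \<zero>\<^bsub>Ob N n\<^esub>" if i: "i \<in> I" and g: "g \<in> Gamma_lam {..<n} (lam i)" for i g n
  proof -
    have d: "sum_list (lam i) = d" and pb: "p_bounded p (lam i)" using b[OF i] by auto
    have yc: "ysym (lam i) t \<in> Gamma_lam {..<m} (lam i)" if "t \<in> tens {..<m} d" for m :: nat and t :: "nat list \<Rightarrow> 'k"
      by (rule ysym_Gamma_lam) (use that d in auto)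
    \<comment> \<open>The restriction of \<theta> after \<pi> to one summand, pulled back along the
      norm to a transformation from the tensor power to \<open>N\<close>.\<close>
    define z where "z = ntr (tens_functor d) (\<lambda>n t. \<theta> n (\<pi> n (e i (ysym (lam i) t))))"
    have ey: "e i (ysym (lam i) t) \<in> carrier (Ob ?S m)" if "t \<in> tens {..<m} d" for m t
      by (rule ec[OF i yc[OF that]])
    have "z \<in> nat_trans (Gamma_cat d) (tens_functor d) N"
      unfolding z_def
    proof (rule ntrI[OF tens_functor_functor])
      fix m
      show "(\<lambda>t. \<theta> m (\<pi> m (e i (ysym (lam i) t)))) \<in> lin_maps (Ob (tens_functor d) m) (Ob N m)"
      proof (rule lin_mapsI)
        fix s t :: "nat list \<Rightarrow> 'k" and r assume t0: "t \<in> carrier (Ob (tens_functor d) m)"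
        then have t1: "e i (ysym (lam i) t) \<in> carrier (Ob ?S m)" using ey by simp
        show "\<theta> m (\<pi> m (e i (ysym (lam i) t))) \<in> carrier (Ob N m)"
          by (rule nt_closed[OF t nt_closed[OF pi t1]])
        have "e i (ysym (lam i) (fscale r t)) = r \<odot>\<^bsub>Ob ?S m\<^esub> e i (ysym (lam i) t)"
          unfolding Ssm
        proof
          fix j
          have "fscale r 0 = (0 :: nat list \<Rightarrow> 'k)" by (simp add: fscale_def fun_eq_iff)
          then show "e i (ysym (lam i) (fscale r t)) j = (\<lambda>j\<in>I. fscale r (e i (ysym (lam i) t) j)) j"
            by (simp add: e_def ysym_fscale)
        qed
        then show "\<theta> m (\<pi> m (e i (ysym (lam i) (r \<odot>\<^bsub>Ob (tens_functor d) m\<^esub> t)))) =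
            r \<odot>\<^bsub>Ob N m\<^esub> \<theta> m (\<pi> m (e i (ysym (lam i) t)))"
          by (simp add: nt_smult[OF pi t1] nt_smult[OF t nt_closed[OF pi t1]])
        assume s0: "s \<in> carrier (Ob (tens_functor d) m)"
        then have s1: "e i (ysym (lam i) s) \<in> carrier (Ob ?S m)" using ey by simp
        have "e i (ysym (lam i) (s + t)) = e i (ysym (lam i) s) \<oplus>\<^bsub>Ob ?S m\<^esub> e i (ysym (lam i) t)"
          unfolding Sadd by (rule ext) (auto simp: e_def ysym_add)
        then show "\<theta> m (\<pi> m (e i (ysym (lam i) (s \<oplus>\<^bsub>Ob (tens_functor d) m\<^esub> t)))) =
            \<theta> m (\<pi> m (e i (ysym (lam i) s))) \<oplus>\<^bsub>Ob N m\<^esub> \<theta> m (\<pi> m (e i (ysym (lam i) t)))"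
          by (simp add: nt_add[OF pi s1 t1] nt_add[OF t nt_closed[OF pi s1] nt_closed[OF pi t1]])
      qed
    next
      fix m n and t' :: "nat list \<Rightarrow> 'k" and f :: "(nat \<times> nat) list \<Rightarrow> 'k"
      assume f: "f \<in> Hom (Gamma_cat d) m n" and t0: "t' \<in> carrier (Ob (tens_functor d) m)"
      then have t1: "e i (ysym (lam i) t') \<in> carrier (Ob ?S m)" using ey by simp
      have "e i (ysym (lam i) (tens_map d m f t')) = Mp ?S m n f (e i (ysym (lam i) t'))"
      proof
        fix j
        have "tens_map d' m f 0 = 0" for d' by (simp add: tens_map_def fun_eq_iff)
        moreover have "ysym (lam i) (tens_map d m f t') = tens_map d m f (ysym (lam i) t')"
          using ysym_tens_map[of f n m "lam i" t'] f d by simp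
        ultimately show "e i (ysym (lam i) (tens_map d m f t')) j = Mp ?S m n f (e i (ysym (lam i) t')) j"
          unfolding Smp using i d by (auto simp: e_def)
      qed
      then show "\<theta> n (\<pi> n (e i (ysym (lam i) (Mp (tens_functor d) m n f t')))) =
          Mp N m n f (\<theta> m (\<pi> m (e i (ysym (lam i) t'))))"
        by (simp add: nt_nat[OF pi f t1] nt_nat[OF t f nt_closed[OF pi t1]])
    qed
    then have z0: "z = \<zero>\<^bsub>hom_module (Gamma_cat d) (tens_functor d) N\<^esub>" using N0 by blast
    \<comment> \<open>The norm multiplies elements of \<open>Gamma_lam\<close> by
      \<open>cfact (lam i)\<close>; scaling by the inverse makes \<open>?g\<close> a preimage of
      \<open>g\<close>.\<close>
    let ?g = "fscale (inverse (cfact (lam i))) g"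
    have gt: "?g \<in> tens {..<n} d" using Gamma_lam_tens[of "{..<n}" "lam i"] g d by (auto intro!: tens_fscale)
    have "ysym (lam i) ?g = g"
    proof -
      have "ysym (lam i) ?g = fscale (inverse (cfact (lam i))) (fscale (cfact (lam i)) g)"
        by (simp only: ysym_fscale ysym_of_Gamma_lam[OF g])
      also have "\<dots> = g" using cfact_nonzero[OF p pb] by (simp add: fscale_def fun_eq_iff)
      finally show ?thesis .
    qed
    then have "\<theta> n (\<pi> n (e i g)) = z n ?g" using gt by (simp add: z_def)
    also have "\<dots> = \<zero>\<^bsub>Ob N n\<^esub>" using gt by (simp add: z0)
    finally show ?thesis .
  qed
  note VP = fun_vs[OF P] and VN = fun_vs[OF N]
  \<comment> \<open>Induction over a finite set that contains the support, splitting off one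
    component at a time.\<close>
  have all: "\<theta> n (\<pi> n z) = \<zero>\<^bsub>Ob N n\<^esub>" if "finite A" "z \<in> carrier (Ob ?S n)" "{i\<in>I. z i \<noteq> 0} \<subseteq> A" for A z n
    using that
  proof (induction A arbitrary: z rule: finite_induct)
    case empty
    have zz: "z = 0 \<odot>\<^bsub>Ob ?S n\<^esub> z"
      unfolding Ssm using empty Sc[of z n] by (auto simp: fscale_def fun_eq_iff PiE_def extensional_def)
    have "\<pi> n z = \<pi> n (0 \<odot>\<^bsub>Ob ?S n\<^esub> z)" by (rule arg_cong[OF zz])
    also have "\<dots> = 0 \<odot>\<^bsub>Ob P n\<^esub> \<pi> n z" by (rule nt_smult[OF pi empty(1)])
    also have "\<dots> = \<zero>\<^bsub>Ob P n\<^esub>" by (rule vs_zero_smult[OF VP nt_closed[OF pi empty(1)]])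
    finally have "\<pi> n z = \<zero>\<^bsub>Ob P n\<^esub>" .
    then show ?case by (simp add: nt_zero[OF t P N])
  next
    case (insert i A)
    have pr: "{j\<in>I. z j \<noteq> 0} \<subseteq> insert i A" by (rule insert.prems(2))
    show ?case
    proof (cases "i \<in> I")
      case False
      then have "{j\<in>I. z j \<noteq> 0} \<subseteq> A" using pr by blast
      then show ?thesis by (rule insert.IH[OF insert.prems(1)])
    next
      case True
      define z' where "z' = z(i := 0)"
      have zi: "z i \<in> Gamma_lam {..<n} (lam i)" using insert.prems(1) True unfolding Sc by blast
      have "finite {j\<in>I. z' j \<noteq> 0}"
        by (rule finite_subset[of _ "{j\<in>I. z j \<noteq> 0}"]) (use insert.prems(1) in \<open>auto simp: z'_def Sc\<close>)
      moreover have "z' \<in> (\<Pi>\<^sub>E i\<in>I. Gamma_lam {..<n} (lam i))"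
        using insert.prems(1) True G0 unfolding Sc z'_def by (auto simp: PiE_def extensional_def Pi_iff)
      ultimately have z': "z' \<in> carrier (Ob ?S n)" by (simp add: Sc)
      have s': "{j\<in>I. z' j \<noteq> 0} \<subseteq> A" using pr by (auto simp: z'_def)
      have zz: "z = e i (z i) \<oplus>\<^bsub>Ob ?S n\<^esub> z'"
        unfolding Sadd using insert.prems(1) Sc[of z n]
        by (intro ext) (auto simp: e_def z'_def PiE_def extensional_def)
      have "\<pi> n z = \<pi> n (e i (z i) \<oplus>\<^bsub>Ob ?S n\<^esub> z')" by (rule arg_cong[OF zz])
      also have "\<dots> = \<pi> n (e i (z i)) \<oplus>\<^bsub>Ob P n\<^esub> \<pi> n z'"
        by (rule nt_add[OF pi ec[OF True zi] z'])
      finally have "\<pi> n z = \<pi> n (e i (z i)) \<oplus>\<^bsub>Ob P n\<^esub> \<pi> n z'" .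
      then have "\<theta> n (\<pi> n z) = \<theta> n (\<pi> n (e i (z i))) \<oplus>\<^bsub>Ob N n\<^esub> \<theta> n (\<pi> n z')"
        by (simp only: nt_add[OF t nt_closed[OF pi ec[OF True zi]] nt_closed[OF pi z']])
      then show ?thesis by (simp add: key[OF True zi] insert.IH[OF z' s'] vs_zero_add VN vs_zero)
    qed
  qed
  fix n x assume x: "x \<in> carrier (Ob P n)"
  then have "x \<in> \<pi> n ` carrier (Ob ?S n)" using ep unfolding is_epi_def by simp
  then obtain z where z: "z \<in> carrier (Ob ?S n)" "x = \<pi> n z" by (rule imageE)
  have "finite {i\<in>I. z i \<noteq> 0}" using z(1) Sc by blast
  then have "\<theta> n x = \<zero>\<^bsub>Ob N n\<^esub>" unfolding z(2) by (rule all[OF _ z(1) order_refl])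
  then show "\<theta> n x = \<zero>\<^bsub>hom_module (Gamma_cat d) P N\<^esub> n x" using x by simp
qed

text \<open>Dual to the above: the norm embeds each \<open>S_functor (lam i)\<close> into a tensor
  power, whose elements are detected by the morphisms \<open>bx d (idw d) (dl w)\<close>. An element
  of \<open>J\<close> killed by all of them therefore has trivial components. The argument is
  carried out on coset representatives.\<close>

lemma right_p_bounded_separated:
  fixes J :: "('k::field, 'v) spf"
  assumes p: "CHAR('k) = p" "p > 0" and R: "right_p_bounded p d J" and J: "strict_poly_functor d J"
    and y: "y \<in> carrier (Ob J n)"
    and z: "\<And>w. w \<in> words {..<n} d \<Longrightarrow> Mp J n d (bx d (idw d) (dl w)) y = \<zero>\<^bsub>Ob J d\<^esub>"
  shows "y = \<zero>\<^bsub>Ob J n\<^esub>"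
proof -
  obtain I :: "(nat \<times> 'v) set" and lam \<iota> where
      b: "\<And>i. i \<in> I \<Longrightarrow> p_bounded p (lam i) \<and> sum_list (lam i) = d"
    and io: "\<iota> \<in> nat_trans (Gamma_cat d) J (prod_functor I (\<lambda>i. S_functor (lam i)))"
    and mo: "is_mono J \<iota>"
    using R unfolding right_p_bounded_def by blast
  let ?S = "prod_functor I (\<lambda>i. S_functor (lam i)) :: ('k, _) spf"
  let ?T = "\<lambda>n. fun_module (tens {..<n} d) :: ('k, _) module" and ?K = "\<lambda>n i. S_lam_ker {..<n} (lam i) :: (nat list \<Rightarrow> 'k) set"
  have cos: "a_r_coset (?T n) H t = (\<lambda>h. h + t) ` H" for n H t
    by (auto simp: a_r_coset_def' fun_module_def)
  have K0: "0 \<in> ?K n i" for n i unfolding S_lam_ker_def by (rule fspan_zero)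
  have Kadd: "u + v \<in> ?K n i" if "u \<in> ?K n i" "v \<in> ?K n i" for u v n i
    using that unfolding S_lam_ker_def by (rule fvs.span_add)
  have Ksub: "u - v \<in> ?K n i" if "u \<in> ?K n i" "v \<in> ?K n i" for u v n i
    using that unfolding S_lam_ker_def by (rule fvs.span_diff)
  have Sc: "x i \<in> a_rcosets\<^bsub>?T m\<^esub> (?K m i)" if "x \<in> carrier (Ob ?S m)" "i \<in> I" for x m i
    using that b[OF that(2)] by (auto simp: prod_functor_def prod_module_def S_functor_def quot_module_def)
  \<comment> \<open>The image of zero is computed as a multiple by the scalar \<open>0\<close>,
    which only uses that \<iota> commutes with scalars and that the quotient scales its
    cosets.\<close>
  have z0: "\<iota> m \<zero>\<^bsub>Ob J m\<^esub> = (\<lambda>i\<in>I. ?K m i)" for m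
  proof -
    let ?x = "\<zero>\<^bsub>Ob J m\<^esub>"
    have xc: "?x \<in> carrier (Ob J m)" by (rule vs_zero[OF fun_vs[OF J]])
    have ic: "\<iota> m ?x \<in> carrier (Ob ?S m)" by (rule nt_closed[OF io xc])
    have "\<iota> m ?x = 0 \<odot>\<^bsub>Ob ?S m\<^esub> \<iota> m ?x"
      using nt_smult[OF io xc, of 0] by (simp add: vs_smult_zero fun_vs[OF J])
    also have "\<dots> = (\<lambda>i\<in>I. ?K m i)"
    proof
      fix i
      show "(0 \<odot>\<^bsub>Ob ?S m\<^esub> \<iota> m ?x) i = (\<lambda>i\<in>I. ?K m i) i"
      proof (cases "i \<in> I")
        case True
        have d: "sum_list (lam i) = d" using b[OF True] by simp
        obtain t where t: "\<iota> m ?x i = a_r_coset (?T m) (?K m i) t"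
          using Sc[OF ic True] unfolding A_RCOSETS_def' by blast
        have ne: "\<iota> m ?x i \<noteq> {}" unfolding t cos using K0 by blast
        have "(0 \<odot>\<^bsub>Ob ?S m\<^esub> \<iota> m ?x) i = (\<Union>u\<in>\<iota> m ?x i. a_r_coset (?T m) (?K m i) (fscale 0 u))"
          using True d by (simp add: prod_functor_def prod_module_def S_functor_def quot_module_def fun_module_def)
        also have "\<dots> = ?K m i"
        proof -
          have "fscale 0 u = 0" for u :: "nat list \<Rightarrow> 'k" by (simp add: fscale_def fun_eq_iff)
          then show ?thesis using ne unfolding cos by simp
        qed
        finally show ?thesis using True by simp
      qed (simp add: prod_functor_def prod_module_def)
    qed
    finally show ?thesis .
  qed
  have "\<iota> n y = \<iota> n \<zero>\<^bsub>Ob J n\<^esub>"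
    unfolding z0
  proof
    fix i
    have yc: "\<iota> n y \<in> carrier (Ob ?S n)" by (rule nt_closed[OF io y])
    show "\<iota> n y i = (\<lambda>i\<in>I. ?K n i) i"
    proof (cases "i \<in> I")
      case True
      have d: "sum_list (lam i) = d" and pb: "p_bounded p (lam i)" using b[OF True] by auto
      obtain t where t: "t \<in> tens {..<n} d" "\<iota> n y i = a_r_coset (?T n) (?K n i) t"
        using Sc[OF yc True] unfolding A_RCOSETS_def' by (auto simp: fun_module_def)
      have ti: "t \<in> \<iota> n y i" unfolding t(2) cos using K0[of n i] by (auto intro!: image_eqI[of _ _ 0])
      \<comment> \<open>The reader of \<open>w\<close> sends \<open>y\<close> to zero, hence sends
        the representative \<open>t\<close> into \<open>S_lam_ker\<close>, which the norm kills. As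
        the norm commutes with morphisms, the coefficient of the norm of \<open>t\<close> at
        \<open>w\<close> is zero.\<close>
      have "ysym (lam i) t w = 0" if w: "w \<in> words {..<n} d" for w
      proof -
        let ?c = "bx d (idw d) (dl w) :: _ \<Rightarrow> 'k"
        have c: "?c \<in> Hom (Gamma_cat d) n d" and c': "?c \<in> Gamma_sp ({..<d} \<times> {..<n}) (sum_list (lam i))"
          using dl_Hom[OF w] d by simp_all
        have "Mp ?S n d ?c (\<iota> n y) = (\<lambda>i\<in>I. ?K d i)"
          using nt_nat[OF io c y] by (simp add: z[OF w] z0)
        then have "Mp ?S n d ?c (\<iota> n y) i = ?K d i" using True by simp
        then have "(\<Union>u\<in>\<iota> n y i. a_r_coset (?T d) (?K d i) (tens_map d n ?c u)) = ?K d i"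
          using True d by (simp add: prod_functor_def S_functor_def)
        moreover have "tens_map d n ?c t \<in> a_r_coset (?T d) (?K d i) (tens_map d n ?c t)"
          unfolding cos using K0[of d i] by (auto intro!: image_eqI[of _ _ 0])
        ultimately have "tens_map d n ?c t \<in> ?K d i" using ti by blast
        then have "ysym (lam i) (tens_map d n ?c t) = 0" by (rule ysym_S_lam_ker)
        then have "tens_map d n ?c (ysym (lam i) t) [0..<d] = 0"
          using ysym_tens_map[OF c'] d by simp
        moreover have "ysym (lam i) t \<in> vtens {..<n} d UNIV"
          using ysym_tens[of t "{..<n}" "lam i"] t(1) d by (simp add: tens_vtens)
        ultimately show ?thesis
          unfolding tens_map_vmap using kvs.vmap_bx_dl by metis
      qed
      moreover have yt: "ysym (lam i) t \<in> tens {..<n} d" using ysym_tens[of t "{..<n}" "lam i"] t(1) d by simp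
      ultimately have "ysym (lam i) t = 0" using tens_0[OF yt] by (intro ext) (metis zero_fun_apply)
      then have "fscale (cfact (lam i)) t \<in> ?K n i"
        using cfact_ysym[of "{..<n}" t "lam i"] t(1) d by simp
      then have "fscale (inverse (cfact (lam i))) (fscale (cfact (lam i)) t) \<in> ?K n i"
        unfolding S_lam_ker_def by (rule fvs.span_scale)
      moreover have "fscale (inverse (cfact (lam i))) (fscale (cfact (lam i)) t) = t"
        using cfact_nonzero[OF p pb] by (simp add: fscale_def fun_eq_iff)
      ultimately have tK: "t \<in> ?K n i" by simp
      have "\<iota> n y i = ?K n i"
        unfolding t(2) cos
      proof (intro equalityI subsetI)
        fix u assume "u \<in> ?K n i"
        then show "u \<in> (\<lambda>h. h + t) ` ?K n i" using Ksub[OF _ tK, of u] by (intro image_eqI[of _ _ "u - t"]) simp_all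
      qed (use Kadd[OF _ tK] in blast)
      then show ?thesis using True by simp
    next
      case False
      have ey: "\<iota> n y \<in> extensional I" using yc by (simp add: prod_functor_def prod_module_def PiE_def)
      show ?thesis unfolding extensional_arb[OF ey False] restrict_apply using False by (rule if_not_P[symmetric])
    qed
  qed
  then show ?thesis
    by (rule inj_onD[OF mo[unfolded is_mono_def, rule_format] _ y vs_zero[OF fun_vs[OF J]]])
qed

section \<open>Exact sequences of cochain complexes\<close>

text \<open>
  Two instances of the long exact cohomology sequence, in a fixed degree. The sets of coboundaries
  are parameters because in degree \<open>0\<close> they are trivial.
\<close>

lemma les_sub:
  assumes B0: "group B0" and C0: "group C0" and B1: "group B1"
    and p0: "p0 \<in> hom B0 C0" and dB: "dB \<in> hom B0 B1"
    and i1: "i1 \<in> carrier A1 \<rightarrow> carrier B1" and inj: "inj_on i1 (carrier A1)"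
    and dA: "dA \<in> carrier A0 \<rightarrow> carrier A1"
    and ex: "\<And>b. \<lbrakk>b \<in> carrier B0; p0 b = \<one>\<^bsub>C0\<^esub>\<rbrakk> \<Longrightarrow> b \<in> i0 ` carrier A0"
    and c1: "\<And>a. a \<in> carrier A0 \<Longrightarrow> i1 (dA a) = dB (i0 a)"
    and c2: "\<And>b. b \<in> carrier B0 \<Longrightarrow> p1 (dB b) = dC (p0 b)"
    and c3: "\<And>a. a \<in> carrier A1 \<Longrightarrow> dB1 (i1 a) = i2 (dA1 a)"
    and pi: "\<And>a. a \<in> carrier A1 \<Longrightarrow> p1 (i1 a) = \<one>\<^bsub>C1\<^esub>" and i21: "i2 \<one>\<^bsub>A2\<^esub> = \<one>\<^bsub>B2\<^esub>"
    and ZB: "\<And>b. \<lbrakk>b \<in> carrier B1; dB1 b = \<one>\<^bsub>B2\<^esub>\<rbrakk> \<Longrightarrow> b \<in> dB ` carrier B0"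
    and ZC: "\<And>c. \<lbrakk>c \<in> carrier C0; dC c = \<one>\<^bsub>C1\<^esub>\<rbrakk> \<Longrightarrow> c \<in> bC"
    and lift: "\<And>c. c \<in> bC \<Longrightarrow> \<exists>b\<in>carrier B0. p0 b = c \<and> dB b = \<one>\<^bsub>B1\<^esub>"
    and a: "a \<in> carrier A1" "dA1 a = \<one>\<^bsub>A2\<^esub>"
  shows "a \<in> dA ` carrier A0"
proof -
  interpret p: group_hom B0 C0 p0 by (intro group_hom.intro group_hom_axioms.intro B0 C0 p0)
  interpret d: group_hom B0 B1 dB by (intro group_hom.intro group_hom_axioms.intro B0 B1 dB)
  have ia: "i1 a \<in> carrier B1" using i1 a(1) by auto
  have "dB1 (i1 a) = \<one>\<^bsub>B2\<^esub>" by (simp add: c3 a i21)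
  from ZB[OF ia this] obtain b where b: "b \<in> carrier B0" "i1 a = dB b" by (rule imageE)
  have "dC (p0 b) = p1 (dB b)" by (simp add: c2 b(1))
  also have "\<dots> = \<one>\<^bsub>C1\<^esub>" using pi[OF a(1)] b(2) by simp
  finally have "p0 b \<in> bC" using ZC[of "p0 b"] b(1) by simp
  \<comment> \<open>Subtracting from \<open>b\<close> a cocycle \<open>b'\<close> with the same
    image in \<open>C0\<close> does not change \<open>dB b\<close> and moves \<open>b\<close> into
    the image of \<open>A0\<close>.\<close>
  from lift[OF this] obtain b' where b': "b' \<in> carrier B0" "p0 b' = p0 b" "dB b' = \<one>\<^bsub>B1\<^esub>" by blast
  have "p0 (b \<otimes>\<^bsub>B0\<^esub> inv\<^bsub>B0\<^esub> b') = \<one>\<^bsub>C0\<^esub>" using b(1) b' by simp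
  then obtain a' where a': "a' \<in> carrier A0" "b \<otimes>\<^bsub>B0\<^esub> inv\<^bsub>B0\<^esub> b' = i0 a'"
    using ex[of "b \<otimes>\<^bsub>B0\<^esub> inv\<^bsub>B0\<^esub> b'"] b(1) b'(1) by auto
  have "i1 (dA a') = dB (b \<otimes>\<^bsub>B0\<^esub> inv\<^bsub>B0\<^esub> b')" by (simp add: c1 a')
  also have "\<dots> = i1 a" using b b' by simp
  finally have "dA a' = a" using inj a(1) dA a'(1) by (auto dest: inj_onD)
  then show ?thesis using a'(1) by blast
qed

text \<open>Exactness at the middle term: modulo a boundary that lifts one of \<open>C\<close>, a
  cocycle of \<open>B\<close> comes from \<open>A\<close>, and injectivity of \<open>i1\<close>
  makes its preimage a cocycle.\<close>

lemma les_mid: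
  assumes B: "group B" and C: "group C" and B1: "group B1" and A1: "\<one>\<^bsub>A1\<^esub> \<in> carrier A1"
    and p: "p \<in> hom B C" and dB: "dB \<in> hom B B1"
    and i: "i \<in> carrier A \<rightarrow> carrier B" and inj: "inj_on i1 (carrier A1)" and dA: "dA \<in> carrier A \<rightarrow> carrier A1"
    and ex: "\<And>b. \<lbrakk>b \<in> carrier B; p b = \<one>\<^bsub>C\<^esub>\<rbrakk> \<Longrightarrow> b \<in> i ` carrier A"
    and c1: "\<And>a. a \<in> carrier A \<Longrightarrow> i1 (dA a) = dB (i a)"
    and c2: "\<And>b. b \<in> carrier B \<Longrightarrow> p1 (dB b) = dC (p b)"
    and i11: "i1 \<one>\<^bsub>A1\<^esub> = \<one>\<^bsub>B1\<^esub>" and p11: "p1 \<one>\<^bsub>B1\<^esub> = \<one>\<^bsub>C1\<^esub>"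
    and ZA: "\<And>a. \<lbrakk>a \<in> carrier A; dA a = \<one>\<^bsub>A1\<^esub>\<rbrakk> \<Longrightarrow> a \<in> bA"
    and ZC: "\<And>c. \<lbrakk>c \<in> carrier C; dC c = \<one>\<^bsub>C1\<^esub>\<rbrakk> \<Longrightarrow> c \<in> bC"
    and lift: "\<And>c. c \<in> bC \<Longrightarrow> \<exists>b\<in>bB. b \<in> carrier B \<and> p b = c \<and> dB b = \<one>\<^bsub>B1\<^esub>"
    and bA: "\<And>a. a \<in> bA \<Longrightarrow> i a \<in> bB" and bB: "\<And>b b'. \<lbrakk>b \<in> bB; b' \<in> bB\<rbrakk> \<Longrightarrow> b \<otimes>\<^bsub>B\<^esub> b' \<in> bB"
    and b: "b \<in> carrier B" "dB b = \<one>\<^bsub>B1\<^esub>"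
  shows "b \<in> bB"
proof -
  interpret p: group_hom B C p by (intro group_hom.intro group_hom_axioms.intro B C p)
  interpret d: group_hom B B1 dB by (intro group_hom.intro group_hom_axioms.intro B B1 dB)
  have "dC (p b) = \<one>\<^bsub>C1\<^esub>" using c2[OF b(1)] by (simp add: b(2) p11)
  then have "p b \<in> bC" using ZC[of "p b"] b(1) by simp
  from lift[OF this] obtain b' where b': "b' \<in> bB" "b' \<in> carrier B" "p b' = p b" "dB b' = \<one>\<^bsub>B1\<^esub>" by blast
  have "p (b \<otimes>\<^bsub>B\<^esub> inv\<^bsub>B\<^esub> b') = \<one>\<^bsub>C\<^esub>" using b(1) b' by simp
  then obtain a where a: "a \<in> carrier A" "b \<otimes>\<^bsub>B\<^esub> inv\<^bsub>B\<^esub> b' = i a"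
    using ex[of "b \<otimes>\<^bsub>B\<^esub> inv\<^bsub>B\<^esub> b'"] b(1) b'(2) by auto
  have "i1 (dA a) = dB (b \<otimes>\<^bsub>B\<^esub> inv\<^bsub>B\<^esub> b')" by (simp add: c1 a)
  also have "\<dots> = i1 \<one>\<^bsub>A1\<^esub>" using b b' by (simp add: i11)
  finally have "dA a = \<one>\<^bsub>A1\<^esub>" using inj A1 dA a(1) by (auto dest: inj_onD)
  then have "i a \<otimes>\<^bsub>B\<^esub> b' \<in> bB" by (intro bB bA ZA a(1) b'(1))
  moreover have "i a \<otimes>\<^bsub>B\<^esub> b' = b" using b(1) b'(2) by (simp add: a(2)[symmetric] p.G.m_assoc)
  ultimately show ?thesis by simp
qed

lemma nt_factor_mono:
  assumes F: "is_functor C F" and G: "is_functor C G" and H: "is_functor C H"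
    and i: "\<iota> \<in> nat_trans C G H" and mo: "\<And>a. inj_on (\<iota> a) (carrier (Ob G a))" and t: "\<theta> \<in> nat_trans C F H"
    and im: "\<And>a x. x \<in> carrier (Ob F a) \<Longrightarrow> \<theta> a x \<in> \<iota> a ` carrier (Ob G a)"
  obtains \<eta> where "\<eta> \<in> nat_trans C F G" "ncomp F \<iota> \<eta> = \<theta>"
proof -
  define h where "h a x = inv_into (carrier (Ob G a)) (\<iota> a) (\<theta> a x)" for a x
  have h: "h a x \<in> carrier (Ob G a)" "\<iota> a (h a x) = \<theta> a x" if "x \<in> carrier (Ob F a)" for a x
    using inv_into_into[OF im[OF that]] f_inv_into_f[OF im[OF that]] by (simp_all add: h_def)
  have eq: "u = v" if "\<iota> a u = \<iota> a v" "u \<in> carrier (Ob G a)" "v \<in> carrier (Ob G a)" for a u v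
    using inj_onD[OF mo that] .
  have "ntr F h \<in> nat_trans C F G"
  proof (rule ntrI[OF F])
    fix a show "h a \<in> lin_maps (Ob F a) (Ob G a)"
    proof (rule lin_mapsI)
      fix x y r assume x: "x \<in> carrier (Ob F a)"
      show "h a x \<in> carrier (Ob G a)" by (rule h[OF x])
      show "h a (r \<odot>\<^bsub>Ob F a\<^esub> x) = r \<odot>\<^bsub>Ob G a\<^esub> h a x"
        by (rule eq[where a=a]) (simp_all add: h x vs_closed fun_vs[OF F] fun_vs[OF G] nt_smult[OF i] nt_smult[OF t])
      assume y: "y \<in> carrier (Ob F a)"
      show "h a (x \<oplus>\<^bsub>Ob F a\<^esub> y) = h a x \<oplus>\<^bsub>Ob G a\<^esub> h a y"
        by (rule eq[where a=a]) (simp_all add: h x y vs_closed fun_vs[OF F] fun_vs[OF G] nt_add[OF i] nt_add[OF t])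
    qed
  next
    fix a b f x assume f: "f \<in> Hom C a b" and x: "x \<in> carrier (Ob F a)"
    show "h b (Mp F a b f x) = Mp G a b f (h a x)"
      by (rule eq[where a=b]) (simp_all add: h x fun_closed[OF F f] fun_closed[OF G f] nt_nat[OF i f] nt_nat[OF t f])
  qed
  moreover have "ncomp F \<iota> (ntr F h) = \<theta>"
    by (rule nt_eqI[OF ncomp_closed[OF F calculation i] t]) (simp add: h)
  ultimately show ?thesis by (rule that)
qed

section \<open>The cone of the comparison map\<close>

locale schur_comparison =
  fixes d :: nat and F :: "('k::field, 'v) spf" and P D \<epsilon>
    and Q :: "nat \<Rightarrow> ('k, nat \<Rightarrow> (nat list \<Rightarrow> 'k) \<Rightarrow> 'v) sym_mod" and D' \<epsilon>' \<phi>
  assumes F: "strict_poly_functor d F" and RP: "proj_resolution (Gamma_cat d) F P D \<epsilon>"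
    and RQ: "proj_resolution (Sym_cat d) (schur d F) Q D' \<epsilon>'" and lift: "schur_lift d P D \<epsilon> Q D' \<epsilon>' \<phi>"
begin

abbreviation "\<G> \<equiv> (Gamma_cat d :: (nat, (nat \<times> nat) list, 'k) lincat)"
abbreviation "\<S> \<equiv> (Sym_cat d :: (unit, nat \<Rightarrow> nat, 'k) lincat)"

text \<open>Prepending a zero term to \<open>Q\<close> makes degree \<open>0\<close> of the cone uniform with the others.\<close>

definition Qt :: "nat \<Rightarrow> ('k, nat \<Rightarrow> (nat list \<Rightarrow> 'k) \<Rightarrow> 'v) sym_mod"
  where "Qt k = (case k of 0 \<Rightarrow> zero_functor | Suc i \<Rightarrow> Q i)"

definition Dt :: "nat \<Rightarrow> unit \<Rightarrow> (nat \<Rightarrow> (nat list \<Rightarrow> 'k) \<Rightarrow> 'v) \<Rightarrow> nat \<Rightarrow> (nat list \<Rightarrow> 'k) \<Rightarrow> 'v"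
  where "Dt k = (case k of 0 \<Rightarrow> \<zero>\<^bsub>hom_module \<S> (Q 0) zero_functor\<^esub> | Suc i \<Rightarrow> D' i)"

lemma Qt_simps [simp]: "Qt 0 = zero_functor" "Qt (Suc k) = Q k"
  by (simp_all add: Qt_def)

lemma Dt_simps [simp]: "Dt 0 = \<zero>\<^bsub>hom_module \<S> (Q 0) zero_functor\<^esub>" "Dt (Suc k) = D' k"
  by (simp_all add: Dt_def)

lemmas PF = res_functor[OF RP] and PD = res_D[OF RP] and QF = res_functor[OF RQ] and QD = res_D[OF RQ]
lemmas SF = schur_functor[OF F] and SPF = schur_functor[OF PF]

lemma Qt_proj: "projective \<S> (Qt k)"
  using zero_functor_projective res_projective[OF RQ] by (cases k) auto

lemma Qt_functor: "is_functor \<S> (Qt k)"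
  by (rule projective_functor[OF Qt_proj])

lemma Dt_nt: "Dt k \<in> nat_trans \<S> (Qt (Suc k)) (Qt k)"
  using QD by (cases k) (simp_all add: hom_closed(1)[OF QF zero_functor_functor])

lemma phi_nt: "\<phi> k \<in> nat_trans \<S> (Q k) (schur d (P k))"
  using lift by (simp add: schur_lift_def)

lemma phi_D: "ncomp (Q (Suc k)) (schur_map d (P (Suc k)) (D k)) (\<phi> (Suc k)) = ncomp (Q (Suc k)) (\<phi> k) (D' k)"
  using lift by (simp add: schur_lift_def)

lemma phi_eps: "ncomp (Q 0) (schur_map d (P 0) \<epsilon>) (\<phi> 0) = \<epsilon>'"
  using lift by (simp add: schur_lift_def)

text \<open>The cochain map from \<open>Hom(P, G)\<close> to \<open>Hom(Q, f G)\<close> that induces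
  \<open>schur_Ext\<close> on cohomology.\<close>

definition comp_map :: "nat \<Rightarrow> (nat \<Rightarrow> 'v \<Rightarrow> 'v) \<Rightarrow> unit \<Rightarrow> (nat \<Rightarrow> (nat list \<Rightarrow> 'k) \<Rightarrow> 'v) \<Rightarrow> nat \<Rightarrow> (nat list \<Rightarrow> 'k) \<Rightarrow> 'v"
  where "comp_map k \<alpha> = ncomp (Q k) (schur_map d (P k) \<alpha>) (\<phi> k)"

lemma comp_map_lin:
  fixes G :: "('k, 'v) spf"
  assumes G: "strict_poly_functor d G"
  shows "comp_map k \<in> lin_maps (hom_module \<G> (P k) G) (hom_module \<S> (Q k) (schur d G))"
proof -
  have "(\<lambda>\<alpha>. ncomp (Q k) (schur_map d (P k) \<alpha>) (\<phi> k)) \<in> lin_maps (hom_module \<G> (P k) G) (hom_module \<S> (Q k) (schur d G))"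
    by (rule lin_maps_comp[OF schur_map_lin[OF PF G] precomp_lin[OF QF SPF schur_functor[OF G] phi_nt]])
  then show ?thesis by (simp add: comp_map_def[abs_def])
qed

lemma comp_map_D:
  fixes G :: "('k, 'v) spf"
  assumes G: "strict_poly_functor d G" and a: "\<alpha> \<in> nat_trans \<G> (P k) G"
  shows "comp_map (Suc k) (ncomp (P (Suc k)) \<alpha> (D k)) = ncomp (Q (Suc k)) (comp_map k \<alpha>) (D' k)"
  unfolding comp_map_def schur_map_comp[OF PD] ncomp_assoc[OF phi_nt] ncomp_assoc[OF QD] phi_D ..

lemma comp_map_post:
  assumes "\<alpha> \<in> nat_trans \<G> (P k) G"
  shows "comp_map k (ncomp (P k) \<eta> \<alpha>) = ncomp (Q k) (schur_map d G \<eta>) (comp_map k \<alpha>)"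
  unfolding comp_map_def schur_map_comp[OF assms] ncomp_assoc[OF phi_nt] ..

text \<open>The mapping cone shifted down by one, so that degree \<open>k\<close> pairs
  \<open>P k\<close> with \<open>Q (k - 1)\<close>. Its vanishing in degree \<open>k\<close> means
  injectivity on the \<open>k\<close>-th and surjectivity on the \<open>(k - 1)\<close>-st
  cohomology. Only the additive structure is kept, since the diagram chases are about
  groups.\<close>

definition cone where "cone k (G :: ('k, 'v) spf) = add_monoid (hom_module \<G> (P k) G) \<times>\<times> add_monoid (hom_module \<S> (Qt k) (schur d G))"

text \<open>The minus sign makes the two contributions of \<open>comp_map\<close> to the square of
  the differential cancel.\<close>

definition cone_diff where "cone_diff k (G :: ('k, 'v) spf) w = (ncomp (P (Suc k)) (fst w) (D k),
  comp_map k (fst w) \<oplus>\<^bsub>hom_module \<S> (Q k) (schur d G)\<^esub>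
    \<ominus>\<^bsub>hom_module \<S> (Q k) (schur d G)\<^esub> ncomp (Q k) (snd w) (Dt k))"

definition cone_map where "cone_map k G \<eta> w = (ncomp (P k) \<eta> (fst w), ncomp (Qt k) (schur_map d G \<eta>) (snd w))"

definition cone_bd where "cone_bd k G = (case k of 0 \<Rightarrow> {\<one>\<^bsub>cone 0 G\<^esub>} | Suc j \<Rightarrow> cone_diff j G ` carrier (cone j G))"

definition acyclic_at where "acyclic_at k G \<longleftrightarrow> (\<forall>w\<in>carrier (cone k G). cone_diff k G w = \<one>\<^bsub>cone (Suc k) G\<^esub> \<longrightarrow> w \<in> cone_bd k G)"

lemma cone_simps [simp]:
  "carrier (cone k G) = nat_trans \<G> (P k) G \<times> nat_trans \<S> (Qt k) (schur d G)"
  "\<one>\<^bsub>cone k G\<^esub> = (\<zero>\<^bsub>hom_module \<G> (P k) G\<^esub>, \<zero>\<^bsub>hom_module \<S> (Qt k) (schur d G)\<^esub>)"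
  "v \<otimes>\<^bsub>cone k G\<^esub> w = (fst v \<oplus>\<^bsub>hom_module \<G> (P k) G\<^esub> fst w, snd v \<oplus>\<^bsub>hom_module \<S> (Qt k) (schur d G)\<^esub> snd w)"
  by (auto simp: cone_def DirProd_def split: prod.splits)

section \<open>The cone as a complex of groups\<close>

context
  fixes G :: "('k, 'v) spf" assumes G: "strict_poly_functor d G"
begin

lemmas HP = hom_vspace[OF PF G] and HQ = hom_vspace[OF QF schur_functor[OF G]]
  and HQt = hom_vspace[OF Qt_functor schur_functor[OF G]]

lemma cone_group: "group (cone k G)"
  unfolding cone_def
  by (intro DirProd_group abelian_group.a_group vs_group HP HQt)

lemma pre_D: "(\<lambda>\<alpha>. ncomp (P (Suc k)) \<alpha> (D k)) \<in> lin_maps (hom_module \<G> (P k) G) (hom_module \<G> (P (Suc k)) G)"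
  by (rule precomp_lin[OF PF PF G PD])

lemma pre_Dt: "(\<lambda>\<gamma>. ncomp (Q k) \<gamma> (Dt k)) \<in> lin_maps (hom_module \<S> (Qt k) (schur d G)) (hom_module \<S> (Q k) (schur d G))"
  using precomp_lin[OF Qt_functor Qt_functor schur_functor[OF G] Dt_nt[of k]] by simp

lemma cone_diff_closed: "w \<in> carrier (cone k G) \<Longrightarrow> cone_diff k G w \<in> carrier (cone (Suc k) G)"
  using lin_maps_closed[OF pre_D, of "fst w" k] lin_maps_closed[OF pre_Dt, of "snd w" k]
    lin_maps_closed[OF comp_map_lin[OF G], of "fst w" k] hom_closed[OF QF schur_functor[OF G]]
  by (auto simp: cone_diff_def)

lemma cone_diff_hom: "cone_diff k G \<in> hom (cone k G) (cone (Suc k) G)"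
proof (rule homI)
  fix v w assume v: "v \<in> carrier (cone k G)" and w: "w \<in> carrier (cone k G)"
  show "cone_diff k G v \<in> carrier (cone (Suc k) G)" by (rule cone_diff_closed[OF v])
  note L = comp_map_lin[OF G]
  have m: "fst v \<in> carrier (hom_module \<G> (P k) G)" "fst w \<in> carrier (hom_module \<G> (P k) G)"
    "snd v \<in> carrier (hom_module \<S> (Qt k) (schur d G))" "snd w \<in> carrier (hom_module \<S> (Qt k) (schur d G))"
    using v w by auto
  let ?N = "hom_module \<S> (Q k) (schur d G)"
  have cl: "comp_map k (fst v) \<in> carrier ?N" "comp_map k (fst w) \<in> carrier ?N"
    "ncomp (Q k) (snd v) (Dt k) \<in> carrier ?N" "ncomp (Q k) (snd w) (Dt k) \<in> carrier ?N"
    by (rule lin_maps_closed[OF L m(1)] lin_maps_closed[OF L m(2)] lin_maps_closed[OF pre_Dt m(3)] lin_maps_closed[OF pre_Dt m(4)])+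
  have neg: "\<ominus>\<^bsub>?N\<^esub> (x \<oplus>\<^bsub>?N\<^esub> y) = \<ominus>\<^bsub>?N\<^esub> x \<oplus>\<^bsub>?N\<^esub> \<ominus>\<^bsub>?N\<^esub> y" if "x \<in> carrier ?N" "y \<in> carrier ?N" for x y
    using vs_smult_add[OF HQ that, of "-1"] that by (simp only: vs_neg_eq[OF HQ] vs_add[OF HQ])
  have s: "(a \<oplus>\<^bsub>?N\<^esub> b) \<oplus>\<^bsub>?N\<^esub> (x \<oplus>\<^bsub>?N\<^esub> y) = (a \<oplus>\<^bsub>?N\<^esub> x) \<oplus>\<^bsub>?N\<^esub> (b \<oplus>\<^bsub>?N\<^esub> y)"
    if "a \<in> carrier ?N" "b \<in> carrier ?N" "x \<in> carrier ?N" "y \<in> carrier ?N" for a b x y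
    using that by (simp only: vs_assoc[OF HQ] vs_lcomm[OF HQ] vs_add[OF HQ])
  show "cone_diff k G (v \<otimes>\<^bsub>cone k G\<^esub> w) = cone_diff k G v \<otimes>\<^bsub>cone (Suc k) G\<^esub> cone_diff k G w"
    unfolding cone_diff_def cone_simps fst_conv snd_conv Qt_simps
      lin_maps_add[OF pre_D m(1,2)] lin_maps_add[OF L m(1,2)] lin_maps_add[OF pre_Dt m(3,4)]
    unfolding neg[OF cl(3,4)] s[OF cl(1,2) vs_neg[OF HQ cl(3)] vs_neg[OF HQ cl(4)]] ..
qed

lemma cone_diff_dd:
  assumes w: "w \<in> carrier (cone k G)"
  shows "cone_diff (Suc k) G (cone_diff k G w) = \<one>\<^bsub>cone (Suc (Suc k)) G\<^esub>"
proof -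
  let ?a = "fst w" and ?g = "snd w"
  have a: "?a \<in> nat_trans \<G> (P k) G" and g: "?g \<in> nat_trans \<S> (Qt k) (schur d G)" using w by auto
  have aD: "ncomp (P (Suc k)) ?a (D k) \<in> nat_trans \<G> (P (Suc k)) G" by (rule ncomp_closed[OF PF PD a])
  have DD: "ncomp (P (Suc (Suc k))) (D k) (D (Suc k)) = \<zero>\<^bsub>hom_module \<G> (P (Suc (Suc k))) (P k)\<^esub>"
    by (rule nt_eqI[OF ncomp_closed[OF PF PD PD] hom_closed(1)[OF PF PF]]) (simp add: res_D_D[OF RP])
  have DtDt: "ncomp (Q (Suc k)) (Dt k) (D' k) = \<zero>\<^bsub>hom_module \<S> (Q (Suc k)) (Qt k)\<^esub>"
  proof (cases k)
    case 0
    then show ?thesis by (simp add: ncomp_zero_left[OF QF QF zero_functor_functor QD])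
  next
    case (Suc j)
    have "ncomp (Q (Suc (Suc j))) (D' j) (D' (Suc j)) = \<zero>\<^bsub>hom_module \<S> (Q (Suc (Suc j))) (Q j)\<^esub>"
      by (rule nt_eqI[OF ncomp_closed[OF QF QD QD] hom_closed(1)[OF QF QF]]) (simp add: res_D_D[OF RQ])
    then show ?thesis by (simp add: Suc)
  qed
  let ?N = "hom_module \<S> (Q k) (schur d G)" and ?N1 = "hom_module \<S> (Q (Suc k)) (schur d G)"
  have 1: "ncomp (P (Suc (Suc k))) (ncomp (P (Suc k)) ?a (D k)) (D (Suc k)) = \<zero>\<^bsub>hom_module \<G> (P (Suc (Suc k))) G\<^esub>"
    unfolding ncomp_assoc[OF PD] DD by (rule ncomp_zero_right[OF PF PF G a])
  note pl = precomp_lin[OF QF QF schur_functor[OF G] QD[of k]]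
  have c: "comp_map k ?a \<in> carrier ?N" "ncomp (Q k) ?g (Dt k) \<in> carrier ?N"
    using lin_maps_closed[OF comp_map_lin[OF G], of ?a k] lin_maps_closed[OF pre_Dt, of ?g k] a g by auto
  have "ncomp (Q (Suc k)) (ncomp (Q k) ?g (Dt k)) (D' k) = ncomp (Q (Suc k)) ?g (ncomp (Q (Suc k)) (Dt k) (D' k))"
    by (rule ncomp_assoc[OF QD])
  also have "\<dots> = \<zero>\<^bsub>?N1\<^esub>"
    unfolding DtDt by (rule ncomp_zero_right[OF QF Qt_functor schur_functor[OF G] g])
  finally have z: "ncomp (Q (Suc k)) (ncomp (Q k) ?g (Dt k)) (D' k) = \<zero>\<^bsub>?N1\<^esub>" .
  have nz: "\<ominus>\<^bsub>?N1\<^esub> \<zero>\<^bsub>?N1\<^esub> = \<zero>\<^bsub>?N1\<^esub>"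
    using vs_neg_eq[OF HQ vs_zero[OF HQ]] vs_smult_zero[OF HQ] by simp
  have e: "ncomp (Q (Suc k)) (snd (cone_diff k G w)) (D' k) = ncomp (Q (Suc k)) (comp_map k ?a) (D' k)"
    unfolding cone_diff_def snd_conv lin_maps_add[OF pl c(1) vs_neg[OF HQ c(2)]] lin_maps_neg[OF pl HQ HQ c(2)] z nz
    by (rule vs_add_zero[OF HQ lin_maps_closed[OF pl c(1)]])
  have c1: "ncomp (Q (Suc k)) (comp_map k ?a) (D' k) \<in> carrier ?N1" by (rule lin_maps_closed[OF pl c(1)])
  show ?thesis
    unfolding cone_diff_def[of "Suc k"] Dt_simps e
    by (simp add: cone_diff_def 1 comp_map_D[OF G a] vs_rneg[OF HQ c1])
qed

lemma cone_bd_mult: "\<lbrakk>v \<in> cone_bd k G; w \<in> cone_bd k G\<rbrakk> \<Longrightarrow> v \<otimes>\<^bsub>cone k G\<^esub> w \<in> cone_bd k G"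
proof (cases k)
  case 0
  then show "\<lbrakk>v \<in> cone_bd k G; w \<in> cone_bd k G\<rbrakk> \<Longrightarrow> ?thesis"
    by (simp add: cone_bd_def vs_zero_add[OF HP vs_zero[OF HP]] vs_zero_add[OF HQt vs_zero[OF HQt], of 0, simplified])
next
  case (Suc j)
  assume "v \<in> cone_bd k G" "w \<in> cone_bd k G"
  then obtain v' w' where v: "v' \<in> carrier (cone j G)" "v = cone_diff j G v'" and w: "w' \<in> carrier (cone j G)" "w = cone_diff j G w'"
    unfolding cone_bd_def Suc by auto
  have "v \<otimes>\<^bsub>cone k G\<^esub> w = cone_diff j G (v' \<otimes>\<^bsub>cone j G\<^esub> w')"
    unfolding v(2) w(2) Suc by (rule hom_mult[OF cone_diff_hom v(1) w(1), symmetric])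
  moreover have "v' \<otimes>\<^bsub>cone j G\<^esub> w' \<in> carrier (cone j G)"
    using cone_group[of j] v(1) w(1) by (intro monoid.m_closed group.is_monoid)
  ultimately show ?thesis unfolding cone_bd_def Suc by auto
qed

end

section \<open>Functoriality of the cone in the coefficients\<close>

context
  fixes G H :: "('k, 'v) spf" and \<eta> assumes G: "strict_poly_functor d G" and H: "strict_poly_functor d H" and e: "\<eta> \<in> nat_trans \<G> G H"
begin

lemma cone_map_hom: "cone_map k G \<eta> \<in> hom (cone k G) (cone k H)"
proof (rule homI)
  note L = postcomp_lin[OF PF G H e, of k]
    and L' = postcomp_lin[OF Qt_functor schur_functor[OF G] schur_functor[OF H] schur_map_nt[OF G H e], of k]
  fix v w assume "v \<in> carrier (cone k G)" "w \<in> carrier (cone k G)"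
  then have m: "fst v \<in> carrier (hom_module \<G> (P k) G)" "fst w \<in> carrier (hom_module \<G> (P k) G)"
    "snd v \<in> carrier (hom_module \<S> (Qt k) (schur d G))" "snd w \<in> carrier (hom_module \<S> (Qt k) (schur d G))"
    by auto
  show "cone_map k G \<eta> v \<in> carrier (cone k H)"
    using lin_maps_closed[OF L m(1)] lin_maps_closed[OF L' m(3)] by (simp add: cone_map_def)
  show "cone_map k G \<eta> (v \<otimes>\<^bsub>cone k G\<^esub> w) = cone_map k G \<eta> v \<otimes>\<^bsub>cone k H\<^esub> cone_map k G \<eta> w"
    unfolding cone_map_def cone_simps fst_conv snd_conv lin_maps_add[OF L m(1,2)] lin_maps_add[OF L' m(3,4)] ..
qed

lemma cone_map_closed: "w \<in> carrier (cone k G) \<Longrightarrow> cone_map k G \<eta> w \<in> carrier (cone k H)"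
  using cone_map_hom by (rule hom_in_carrier)

lemma cone_map_one: "cone_map k G \<eta> \<one>\<^bsub>cone k G\<^esub> = \<one>\<^bsub>cone k H\<^esub>"
  by (rule hom_one[OF cone_map_hom cone_group[OF G] cone_group[OF H]])

lemma cone_map_dd:
  assumes w: "w \<in> carrier (cone k G)"
  shows "cone_map (Suc k) G \<eta> (cone_diff k G w) = cone_diff k H (cone_map k G \<eta> w)"
proof -
  let ?N = "hom_module \<S> (Q k) (schur d G)" and ?f = "schur_map d G \<eta>"
  have a: "fst w \<in> nat_trans \<G> (P k) G" and g: "snd w \<in> nat_trans \<S> (Qt k) (schur d G)" using w by auto
  note SG = schur_functor[OF G] and SH = schur_functor[OF H] and sm = schur_map_nt[OF G H e]
  note L = postcomp_lin[OF QF SG SH sm, of k]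
  have c: "comp_map k (fst w) \<in> carrier ?N" "ncomp (Q k) (snd w) (Dt k) \<in> carrier ?N"
    using lin_maps_closed[OF comp_map_lin[OF G], of "fst w" k] lin_maps_closed[OF pre_Dt[OF G], of "snd w" k] a g by auto
  have Dt: "Dt k \<in> nat_trans \<S> (Q k) (Qt k)" using Dt_nt[of k] by simp
  have "ncomp (Q k) ?f (comp_map k (fst w) \<oplus>\<^bsub>?N\<^esub> \<ominus>\<^bsub>?N\<^esub> ncomp (Q k) (snd w) (Dt k)) =
      comp_map k (ncomp (P k) \<eta> (fst w)) \<oplus>\<^bsub>hom_module \<S> (Q k) (schur d H)\<^esub>
      \<ominus>\<^bsub>hom_module \<S> (Q k) (schur d H)\<^esub> ncomp (Q k) (ncomp (Qt k) ?f (snd w)) (Dt k)"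
    unfolding lin_maps_add[OF L c(1) vs_neg[OF HQ[OF G] c(2)]] lin_maps_neg[OF L HQ[OF G] HQ[OF H] c(2)]
      comp_map_post[OF a] ncomp_assoc[OF Dt] ..
  then show ?thesis by (simp add: cone_map_def cone_diff_def ncomp_assoc[OF PD])
qed

end

end

lemma mono_cancel:
  assumes mo: "\<And>a. inj_on (\<iota> a) (carrier (Ob G a))"
    and t: "\<theta> \<in> nat_trans C F G" "\<theta>' \<in> nat_trans C F G" and e: "ncomp F \<iota> \<theta> = ncomp F \<iota> \<theta>'"
  shows "\<theta> = \<theta>'"
proof (rule nt_eqI[OF t])
  fix a x assume x: "x \<in> carrier (Ob F a)"
  have "\<iota> a (\<theta> a x) = \<iota> a (\<theta>' a x)" using fun_cong[OF fun_cong[OF e, of a], of x] x by simp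
  then show "\<theta> a x = \<theta>' a x" by (rule inj_onD[OF mo]) (rule nt_closed[OF t(1) x] nt_closed[OF t(2) x])+
qed

lemma exact_image:
  assumes ex: "exact_at G \<iota> J q H" and t: "\<theta> \<in> nat_trans C F J"
    and z: "ncomp F q \<theta> = \<zero>\<^bsub>hom_module C F H\<^esub>" and x: "x \<in> carrier (Ob F a)"
  shows "\<theta> a x \<in> \<iota> a ` carrier (Ob G a)"
proof -
  have "q a (\<theta> a x) = \<zero>\<^bsub>Ob H a\<^esub>" using fun_cong[OF fun_cong[OF z, of a], of x] x by simp
  then show ?thesis using ex nt_closed[OF t x] unfolding exact_at_def by simp
qed

lemma exact_comp_zero:
  assumes F: "is_functor C G" "is_functor C J" "is_functor C H" and i: "\<iota> \<in> nat_trans C G J" and q: "q \<in> nat_trans C J H"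
    and ex: "exact_at G \<iota> J q H"
  shows "ncomp G q \<iota> = \<zero>\<^bsub>hom_module C G H\<^esub>"
proof (rule nt_eqI[OF ncomp_closed[OF F(1) i q] hom_closed(1)[OF F(1,3)]])
  fix a x assume x: "x \<in> carrier (Ob G a)"
  then have "\<iota> a x \<in> {y \<in> carrier (Ob J a). q a y = \<zero>\<^bsub>Ob H a\<^esub>}"
    using ex unfolding exact_at_def by blast
  then show "ncomp G q \<iota> a x = \<zero>\<^bsub>hom_module C G H\<^esub> a x" using x by simp
qed

lemma schur_mono:
  assumes G: "strict_poly_functor d G" and i: "\<iota> \<in> nat_trans (Gamma_cat d) G J"
    and mo: "\<And>a. inj_on (\<iota> a) (carrier (Ob G a))"
  shows "inj_on (schur_map d G \<iota> a) (carrier (Ob (schur d G) a))"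
  by (rule inj_onI) (simp, rule mono_cancel[OF mo])

lemma schur_map_zero:
  assumes "strict_poly_functor d F" "strict_poly_functor d G"
  shows "schur_map d F \<zero>\<^bsub>hom_module (Gamma_cat d) F G\<^esub> = \<zero>\<^bsub>hom_module (Sym_cat d) (schur d F) (schur d G)\<^esub>"
  using lin_maps_zero[OF schur_map_lin hom_vspace hom_vspace] assms schur_functor by metis

section \<open>Short exact sequences of coefficients and acyclicity of the cone\<close>

context schur_comparison
begin

definition ses where "ses (G :: ('k, 'v) spf) \<iota> (J :: ('k, 'v) spf) q (H :: ('k, 'v) spf) \<longleftrightarrow> strict_poly_functor d G \<and> strict_poly_functor d J \<and>
  strict_poly_functor d H \<and> \<iota> \<in> nat_trans \<G> G J \<and> q \<in> nat_trans \<G> J H \<and>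
  is_mono G \<iota> \<and> exact_at G \<iota> J q H \<and> is_epi J H q"

lemma acyclic_atD: "\<lbrakk>acyclic_at k G; w \<in> carrier (cone k G); cone_diff k G w = \<one>\<^bsub>cone (Suc k) G\<^esub>\<rbrakk> \<Longrightarrow> w \<in> cone_bd k G"
  unfolding acyclic_at_def by blast

context
  fixes G J H :: "('k, 'v) spf" and \<iota> q
  assumes ses: "ses G \<iota> J q H"
begin

lemma sesD:
  shows G: "strict_poly_functor d G" and J: "strict_poly_functor d J" and H: "strict_poly_functor d H"
    and i: "\<iota> \<in> nat_trans \<G> G J" and q: "q \<in> nat_trans \<G> J H" and ex: "exact_at G \<iota> J q H"
    and mo: "inj_on (\<iota> a) (carrier (Ob G a))" and ep: "q a ` carrier (Ob J a) = carrier (Ob H a)"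
  using ses by (simp_all add: ses_def is_mono_def is_epi_def)

lemmas SG = schur_functor[OF G] and SJ = schur_functor[OF J] and SH = schur_functor[OF H]
  and si = schur_map_nt[OF G J i] and sq = schur_map_nt[OF J H q]

lemma cone_map_inj: "inj_on (cone_map k G \<iota>) (carrier (cone k G))"
proof (rule inj_onI)
  fix v w assume v: "v \<in> carrier (cone k G)" and w: "w \<in> carrier (cone k G)" and e: "cone_map k G \<iota> v = cone_map k G \<iota> w"
  have "fst v = fst w"
    by (rule mono_cancel[OF mo, where C=\<G> and F="P k"]) (use v w e in \<open>auto simp: cone_map_def\<close>)
  moreover have "snd v = snd w"
    by (rule mono_cancel[OF schur_mono[OF G i mo], where C=\<S> and F="Qt k"]) (use v w e in \<open>auto simp: cone_map_def\<close>)
  ultimately show "v = w" by (rule prod_eqI)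
qed

lemma cone_map_exact:
  assumes w: "w \<in> carrier (cone k J)" and z: "cone_map k J q w = \<one>\<^bsub>cone k H\<^esub>"
  shows "w \<in> cone_map k G \<iota> ` carrier (cone k G)"
proof -
  have a: "fst w \<in> nat_trans \<G> (P k) J" and g: "snd w \<in> nat_trans \<S> (Qt k) (schur d J)" using w by auto
  have za: "ncomp (P k) q (fst w) = \<zero>\<^bsub>hom_module \<G> (P k) H\<^esub>"
    and zg: "ncomp (Qt k) (schur_map d J q) (snd w) = \<zero>\<^bsub>hom_module \<S> (Qt k) (schur d H)\<^esub>"
    using z by (simp_all add: cone_map_def)
  obtain \<alpha> where \<alpha>: "\<alpha> \<in> nat_trans \<G> (P k) G" "ncomp (P k) \<iota> \<alpha> = fst w"
    using nt_factor_mono[OF PF G J i mo a exact_image[OF ex a za]] by metis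
  obtain \<gamma> where \<gamma>: "\<gamma> \<in> nat_trans \<S> (Qt k) (schur d G)" "ncomp (Qt k) (schur_map d G \<iota>) \<gamma> = snd w"
    using nt_factor_mono[OF Qt_functor SG SJ si schur_mono[OF G i mo] g
        exact_image[OF schur_exact[OF G J H i q ex] g zg]] by metis
  have "w = cone_map k G \<iota> (\<alpha>, \<gamma>)" by (simp add: cone_map_def \<alpha>(2) \<gamma>(2))
  then show ?thesis using \<alpha>(1) \<gamma>(1) by auto
qed

text \<open>Right exactness of the cone: \<open>P k\<close> and \<open>Qt k\<close> are projective,
  and the Schur functor sends \<open>q\<close> to an epimorphism.\<close>

lemma cone_map_surj:
  assumes w: "w \<in> carrier (cone k H)"
  shows "\<exists>v\<in>carrier (cone k J). cone_map k J q v = w"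
proof -
  have a: "fst w \<in> nat_trans \<G> (P k) H" and g: "snd w \<in> nat_trans \<S> (Qt k) (schur d H)" using w by auto
  obtain \<alpha> where \<alpha>: "\<alpha> \<in> nat_trans \<G> (P k) J" "ncomp (P k) q \<alpha> = fst w"
    by (rule projective_lift[OF res_projective[OF RP] J H q a]) (simp add: ep nt_closed[OF a])
  obtain \<gamma> where \<gamma>: "\<gamma> \<in> nat_trans \<S> (Qt k) (schur d J)" "ncomp (Qt k) (schur_map d J q) \<gamma> = snd w"
    by (rule projective_lift[OF Qt_proj SJ SH sq g]) (simp only: schur_epi[OF J H q ep] nt_closed[OF g])
  have "cone_map k J q (\<alpha>, \<gamma>) = w" by (simp add: cone_map_def \<alpha>(2) \<gamma>(2))
  then show ?thesis using \<alpha>(1) \<gamma>(1) by auto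
qed

lemma cone_map_comp: 
  assumes w: "w \<in> carrier (cone k G)"
  shows "cone_map k J q (cone_map k G \<iota> w) = \<one>\<^bsub>cone k H\<^esub>"
proof -
  have a: "fst w \<in> nat_trans \<G> (P k) G" and g: "snd w \<in> nat_trans \<S> (Qt k) (schur d G)" using w by auto
  have "ncomp (P k) q (ncomp (P k) \<iota> (fst w)) = \<zero>\<^bsub>hom_module \<G> (P k) H\<^esub>"
    unfolding ncomp_assoc[OF a, symmetric] exact_comp_zero[OF G J H i q ex] by (rule ncomp_zero_left[OF PF G H a])
  moreover have "ncomp (Qt k) (schur_map d J q) (ncomp (Qt k) (schur_map d G \<iota>) (snd w)) = \<zero>\<^bsub>hom_module \<S> (Qt k) (schur d H)\<^esub>"
    unfolding ncomp_assoc[OF g, symmetric] exact_comp_zero[OF SG SJ SH si sq schur_exact[OF G J H i q ex]]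
    by (rule ncomp_zero_left[OF Qt_functor SG SH g])
  ultimately show ?thesis by (simp add: cone_map_def)
qed

text \<open>Lift the cochain first and apply the differential afterwards; the lift is then a
  boundary and automatically a cocycle. In degree \<open>0\<close> the boundary is the neutral
  element.\<close>

lemma cone_bd_lift:
  assumes "c \<in> cone_bd k H"
  shows "\<exists>b\<in>cone_bd k J. b \<in> carrier (cone k J) \<and> cone_map k J q b = c \<and> cone_diff k J b = \<one>\<^bsub>cone (Suc k) J\<^esub>"
proof (cases k)
  case 0
  have "\<one>\<^bsub>cone 0 J\<^esub> \<in> carrier (cone 0 J)" using cone_group[OF J] by (intro monoid.one_closed group.is_monoid)
  then show ?thesis
    using assms cone_map_one[OF J H q, of 0] hom_one[OF cone_diff_hom[OF J, of 0] cone_group[OF J] cone_group[OF J]]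
    unfolding 0 cone_bd_def by (intro bexI[of _ "\<one>\<^bsub>cone 0 J\<^esub>"]) (simp_all del: cone_simps)
next
  case (Suc j)
  obtain c' where c: "c' \<in> carrier (cone j H)" "c = cone_diff j H c'" using assms unfolding Suc cone_bd_def by auto
  obtain b where b: "b \<in> carrier (cone j J)" "cone_map j J q b = c'" using cone_map_surj[OF c(1)] by blast
  have "cone_diff j J b \<in> cone_bd k J" unfolding Suc cone_bd_def using b(1) by auto
  moreover have "cone_diff j J b \<in> carrier (cone k J)" unfolding Suc by (rule cone_diff_closed[OF J b(1)])
  moreover have "cone_map k J q (cone_diff j J b) = c" unfolding Suc cone_map_dd[OF J H q b(1)] b(2) c(2) ..
  moreover have "cone_diff k J (cone_diff j J b) = \<one>\<^bsub>cone (Suc k) J\<^esub>" unfolding Suc by (rule cone_diff_dd[OF J b(1)])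
  ultimately show ?thesis by blast
qed

text \<open>In the long exact sequence, cohomology of \<open>G\<close> in degree
  \<open>k + 1\<close> sits between that of \<open>H\<close> in degree \<open>k\<close> and that of
  \<open>J\<close> in degree \<open>k + 1\<close>. This is the dimension shift that gains a
  degree.\<close>

lemma acyclic_sub:
  assumes ZJ: "acyclic_at (Suc k) J" and ZH: "acyclic_at k H"
  shows "acyclic_at (Suc k) G"
  unfolding acyclic_at_def
proof (intro ballI impI)
  fix w assume w: "w \<in> carrier (cone (Suc k) G)" "cone_diff (Suc k) G w = \<one>\<^bsub>cone (Suc (Suc k)) G\<^esub>"
  have "w \<in> cone_diff k G ` carrier (cone k G)"
  proof (rule les_sub[where ?B0.0 = "cone k J" and ?C0.0 = "cone k H" and ?B1.0 = "cone (Suc k) J" and ?A1.0 = "cone (Suc k) G"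
      and ?A0.0 = "cone k G" and ?A2.0 = "cone (Suc (Suc k)) G" and ?B2.0 = "cone (Suc (Suc k)) J" and ?C1.0 = "cone (Suc k) H"
      and ?p0.0 = "cone_map k J q" and dB = "cone_diff k J" and ?i1.0 = "cone_map (Suc k) G \<iota>" and dA = "cone_diff k G" and ?i0.0 = "cone_map k G \<iota>"
      and ?p1.0 = "cone_map (Suc k) J q" and dC = "cone_diff k H" and ?dB1.0 = "cone_diff (Suc k) J" and ?i2.0 = "cone_map (Suc (Suc k)) G \<iota>"
      and ?dA1.0 = "cone_diff (Suc k) G" and bC = "cone_bd k H"])
    show "group (cone k J)" "group (cone k H)" "group (cone (Suc k) J)" by (rule cone_group[OF J] cone_group[OF H])+
    show "cone_map k J q \<in> hom (cone k J) (cone k H)" by (rule cone_map_hom[OF J H q])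
    show "cone_diff k J \<in> hom (cone k J) (cone (Suc k) J)" by (rule cone_diff_hom[OF J])
    show "cone_map (Suc k) G \<iota> \<in> carrier (cone (Suc k) G) \<rightarrow> carrier (cone (Suc k) J)" using cone_map_closed[OF G J i] by blast
    show "inj_on (cone_map (Suc k) G \<iota>) (carrier (cone (Suc k) G))" by (rule cone_map_inj)
    show "cone_diff k G \<in> carrier (cone k G) \<rightarrow> carrier (cone (Suc k) G)" using cone_diff_closed[OF G] by blast
    show "b \<in> cone_map k G \<iota> ` carrier (cone k G)" if "b \<in> carrier (cone k J)" "cone_map k J q b = \<one>\<^bsub>cone k H\<^esub>" for b
      by (rule cone_map_exact[OF that])
    show "cone_map (Suc k) G \<iota> (cone_diff k G a) = cone_diff k J (cone_map k G \<iota> a)" if "a \<in> carrier (cone k G)" for a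
      by (rule cone_map_dd[OF G J i that])
    show "cone_map (Suc k) J q (cone_diff k J b) = cone_diff k H (cone_map k J q b)" if "b \<in> carrier (cone k J)" for b
      by (rule cone_map_dd[OF J H q that])
    show "cone_diff (Suc k) J (cone_map (Suc k) G \<iota> a) = cone_map (Suc (Suc k)) G \<iota> (cone_diff (Suc k) G a)" if "a \<in> carrier (cone (Suc k) G)" for a
      by (rule cone_map_dd[OF G J i that, symmetric])
    show "cone_map (Suc k) J q (cone_map (Suc k) G \<iota> a) = \<one>\<^bsub>cone (Suc k) H\<^esub>" if "a \<in> carrier (cone (Suc k) G)" for a
      by (rule cone_map_comp[OF that])
    show "cone_map (Suc (Suc k)) G \<iota> \<one>\<^bsub>cone (Suc (Suc k)) G\<^esub> = \<one>\<^bsub>cone (Suc (Suc k)) J\<^esub>" by (rule cone_map_one[OF G J i])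
    show "b \<in> cone_diff k J ` carrier (cone k J)" if "b \<in> carrier (cone (Suc k) J)" "cone_diff (Suc k) J b = \<one>\<^bsub>cone (Suc (Suc k)) J\<^esub>" for b
      using acyclic_atD[OF ZJ that] by (simp add: cone_bd_def)
    show "c \<in> cone_bd k H" if "c \<in> carrier (cone k H)" "cone_diff k H c = \<one>\<^bsub>cone (Suc k) H\<^esub>" for c
      by (rule acyclic_atD[OF ZH that])
    show "\<exists>b\<in>carrier (cone k J). cone_map k J q b = c \<and> cone_diff k J b = \<one>\<^bsub>cone (Suc k) J\<^esub>" if "c \<in> cone_bd k H" for c
      using cone_bd_lift[OF that] by blast
  qed (fact w)+
  then show "w \<in> cone_bd (Suc k) G" by (simp add: cone_bd_def)
qed

text \<open>There is no degree below \<open>0\<close>, and \<open>cone_map\<close> for \<iota> is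
  injective: a cocycle that becomes trivial in \<open>J\<close> was trivial.\<close>

lemma acyclic_sub_0:
  assumes ZJ: "acyclic_at 0 J"
  shows "acyclic_at 0 G"
  unfolding acyclic_at_def
proof (intro ballI impI)
  fix w assume w: "w \<in> carrier (cone 0 G)" "cone_diff 0 G w = \<one>\<^bsub>cone (Suc 0) G\<^esub>"
  have "cone_diff 0 J (cone_map 0 G \<iota> w) = \<one>\<^bsub>cone (Suc 0) J\<^esub>"
    unfolding cone_map_dd[OF G J i w(1), symmetric] w(2) by (rule cone_map_one[OF G J i])
  then have "cone_map 0 G \<iota> w \<in> cone_bd 0 J" by (rule acyclic_atD[OF ZJ cone_map_closed[OF G J i w(1)]])
  then have "cone_map 0 G \<iota> w = cone_map 0 G \<iota> \<one>\<^bsub>cone 0 G\<^esub>" unfolding cone_map_one[OF G J i] by (simp add: cone_bd_def)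
  moreover have "\<one>\<^bsub>cone 0 G\<^esub> \<in> carrier (cone 0 G)" using cone_group[OF G] by (intro monoid.one_closed group.is_monoid)
  ultimately have "w = \<one>\<^bsub>cone 0 G\<^esub>" using cone_map_inj w(1) by (auto dest: inj_onD simp del: cone_simps)
  then show "w \<in> cone_bd 0 G" by (simp add: cone_bd_def)
qed

text \<open>The same long exact sequence at its middle term, without a shift of degree.\<close>

lemma acyclic_mid:
  assumes ZG: "acyclic_at k G" and ZH: "acyclic_at k H"
  shows "acyclic_at k J"
  unfolding acyclic_at_def
proof (intro ballI impI)
  fix w assume w: "w \<in> carrier (cone k J)" "cone_diff k J w = \<one>\<^bsub>cone (Suc k) J\<^esub>"
  show "w \<in> cone_bd k J"
  proof (rule les_mid[where B = "cone k J" and C = "cone k H" and ?B1.0 = "cone (Suc k) J" and ?A1.0 = "cone (Suc k) G" and A = "cone k G"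
      and ?C1.0 = "cone (Suc k) H" and p = "cone_map k J q" and dB = "cone_diff k J" and i = "cone_map k G \<iota>" and ?i1.0 = "cone_map (Suc k) G \<iota>"
      and dA = "cone_diff k G" and ?p1.0 = "cone_map (Suc k) J q" and dC = "cone_diff k H" and bA = "cone_bd k G" and bC = "cone_bd k H"])
    show "group (cone k J)" "group (cone k H)" "group (cone (Suc k) J)" by (rule cone_group[OF J] cone_group[OF H])+
    show "\<one>\<^bsub>cone (Suc k) G\<^esub> \<in> carrier (cone (Suc k) G)" using cone_group[OF G] by (intro monoid.one_closed group.is_monoid)
    show "cone_map k J q \<in> hom (cone k J) (cone k H)" by (rule cone_map_hom[OF J H q])
    show "cone_diff k J \<in> hom (cone k J) (cone (Suc k) J)" by (rule cone_diff_hom[OF J])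
    show "cone_map k G \<iota> \<in> carrier (cone k G) \<rightarrow> carrier (cone k J)" using cone_map_closed[OF G J i] by blast
    show "inj_on (cone_map (Suc k) G \<iota>) (carrier (cone (Suc k) G))" by (rule cone_map_inj)
    show "cone_diff k G \<in> carrier (cone k G) \<rightarrow> carrier (cone (Suc k) G)" using cone_diff_closed[OF G] by blast
    show "b \<in> cone_map k G \<iota> ` carrier (cone k G)" if "b \<in> carrier (cone k J)" "cone_map k J q b = \<one>\<^bsub>cone k H\<^esub>" for b
      by (rule cone_map_exact[OF that])
    show "cone_map (Suc k) G \<iota> (cone_diff k G a) = cone_diff k J (cone_map k G \<iota> a)" if "a \<in> carrier (cone k G)" for a
      by (rule cone_map_dd[OF G J i that])
    show "cone_map (Suc k) J q (cone_diff k J b) = cone_diff k H (cone_map k J q b)" if "b \<in> carrier (cone k J)" for b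
      by (rule cone_map_dd[OF J H q that])
    show "cone_map (Suc k) G \<iota> \<one>\<^bsub>cone (Suc k) G\<^esub> = \<one>\<^bsub>cone (Suc k) J\<^esub>" by (rule cone_map_one[OF G J i])
    show "cone_map (Suc k) J q \<one>\<^bsub>cone (Suc k) J\<^esub> = \<one>\<^bsub>cone (Suc k) H\<^esub>" by (rule cone_map_one[OF J H q])
    show "a \<in> cone_bd k G" if "a \<in> carrier (cone k G)" "cone_diff k G a = \<one>\<^bsub>cone (Suc k) G\<^esub>" for a
      by (rule acyclic_atD[OF ZG that])
    show "c \<in> cone_bd k H" if "c \<in> carrier (cone k H)" "cone_diff k H c = \<one>\<^bsub>cone (Suc k) H\<^esub>" for c
      by (rule acyclic_atD[OF ZH that])
    show "\<exists>b\<in>cone_bd k J. b \<in> carrier (cone k J) \<and> cone_map k J q b = c \<and> cone_diff k J b = \<one>\<^bsub>cone (Suc k) J\<^esub>" if "c \<in> cone_bd k H" for c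
      by (rule cone_bd_lift[OF that])
    show "cone_map k G \<iota> a \<in> cone_bd k J" if a: "a \<in> cone_bd k G" for a
    proof (cases k)
      case 0
      then show ?thesis using a cone_map_one[OF G J i, of 0] by (simp add: cone_bd_def del: cone_simps)
    next
      case (Suc j)
      obtain a' where a': "a' \<in> carrier (cone j G)" "a = cone_diff j G a'" using a unfolding Suc cone_bd_def by auto
      have "cone_map k G \<iota> a = cone_diff j J (cone_map j G \<iota> a')" unfolding Suc a'(2) by (rule cone_map_dd[OF G J i a'(1)])
      then show ?thesis using cone_map_closed[OF G J i a'(1)] unfolding Suc cone_bd_def by auto
    qed
    show "b \<otimes>\<^bsub>cone k J\<^esub> b' \<in> cone_bd k J" if "b \<in> cone_bd k J" "b' \<in> cone_bd k J" for b b' by (rule cone_bd_mult[OF J that])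
  qed (fact w)+
qed

end

text \<open>Maps from \<open>P\<close> to \<open>J\<close> are maps from \<open>f P\<close> to
  \<open>f J\<close>, and both \<open>f P\<close> and \<open>Q\<close> are exact complexes over
  \<open>f F\<close>. Since \<open>Hom(-, f J)\<close> preserves this exactness, each of the two
  complexes has cohomology \<open>Hom(f F, f J)\<close> in degree \<open>0\<close> and none above,
  and \<open>comp_map\<close> identifies them. The proof follows a cone cocycle through this
  argument.\<close>

lemma schur_closed_acyclic:
  assumes gd: "schur_closed d TYPE('v) J"
  shows "acyclic_at k J"
  unfolding acyclic_at_def
proof (intro ballI impI)
  fix w assume w: "w \<in> carrier (cone k J)" and dw: "cone_diff k J w = \<one>\<^bsub>cone (Suc k) J\<^esub>"
  have J: "strict_poly_functor d J" using gd by (simp add: schur_closed_def)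
  have bij: "bij_betw (schur_map d F') (nat_trans \<G> F' J) (nat_trans \<S> (schur d F') (schur d J))"
    if "strict_poly_functor d F'" for F' :: "('k, 'v) spf" using gd that by (simp add: schur_closed_def)
  have full: "\<exists>\<theta>\<in>nat_trans \<G> F' J. schur_map d F' \<theta> = \<psi>"
    if "strict_poly_functor d F'" "\<psi> \<in> nat_trans \<S> (schur d F') (schur d J)" for F' :: "('k, 'v) spf" and \<psi>
    using bij[OF that(1)] that(2) unfolding bij_betw_def by (metis imageE)
  have faith: "\<theta> = \<theta>'" if "strict_poly_functor d F'" "\<theta> \<in> nat_trans \<G> F' J" "\<theta>' \<in> nat_trans \<G> F' J"
    "schur_map d F' \<theta> = schur_map d F' \<theta>'" for F' :: "('k, 'v) spf" and \<theta> \<theta>'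
    using bij[OF that(1)] that(2-4) unfolding bij_betw_def by (metis inj_onD)
  have inj: "\<exists>\<kappa>\<in>nat_trans \<S> C (schur d J). ncomp B \<kappa> \<theta> = \<gamma>"
    if "is_functor \<S> A" "is_functor \<S> B" "is_functor \<S> C" "\<eta> \<in> nat_trans \<S> A B" "\<theta> \<in> nat_trans \<S> B C"
      "exact_at A \<eta> B \<theta> C" "\<gamma> \<in> nat_trans \<S> B (schur d J)" "ncomp A \<gamma> \<eta> = \<zero>\<^bsub>hom_module \<S> A (schur d J)\<^esub>"
    for A B C :: "('k, nat \<Rightarrow> (nat list \<Rightarrow> 'k) \<Rightarrow> 'v) sym_mod" and \<eta> \<theta> \<gamma>
    using gd that unfolding schur_closed_def by blast
  note SJ = schur_functor[OF J]
  let ?a = "fst w" and ?g = "snd w" and ?f = "schur_map d (P k) (fst w)"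
  let ?N = "\<lambda>i. hom_module \<S> (Q i) (schur d J)"
  note VN = HQ[OF J] and VP = HP[OF J]
  have a: "?a \<in> nat_trans \<G> (P k) J" and g: "?g \<in> nat_trans \<S> (Qt k) (schur d J)" using w by auto
  have fa: "?f \<in> nat_trans \<S> (schur d (P k)) (schur d J)" by (rule schur_map_nt[OF PF J a])
  have aD: "ncomp (P (Suc k)) ?a (D k) = \<zero>\<^bsub>hom_module \<G> (P (Suc k)) J\<^esub>" using dw by (simp add: cone_diff_def)
  have c: "comp_map k ?a \<in> carrier (?N k)" "ncomp (Q k) ?g (Dt k) \<in> carrier (?N k)"
    using lin_maps_closed[OF comp_map_lin[OF J], of ?a k] lin_maps_closed[OF pre_Dt[OF J], of ?g k] a g by auto
  have ag: "comp_map k ?a = ncomp (Q k) ?g (Dt k)"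
    by (rule vs_diff_zero[OF VN c]) (use dw in \<open>simp add: cone_diff_def\<close>)
  have fD: "ncomp (schur d (P (Suc k))) ?f (schur_map d (P (Suc k)) (D k)) = \<zero>\<^bsub>hom_module \<S> (schur d (P (Suc k))) (schur d J)\<^esub>"
    unfolding schur_map_comp[OF PD, symmetric] aD by (rule schur_map_zero[OF PF J])
  have sD: "schur_map d (P (Suc i)) (D i) \<in> nat_trans \<S> (schur d (P (Suc i))) (schur d (P i))" for i
    by (rule schur_map_nt[OF PF PF PD])
  have se: "schur_map d (P 0) \<epsilon> \<in> nat_trans \<S> (schur d (P 0)) (schur d F)"
    by (rule schur_map_nt[OF PF F res_eps[OF RP]])
  have ex0: "exact_at (schur d (P (Suc 0))) (schur_map d (P (Suc 0)) (D 0)) (schur d (P 0)) (schur_map d (P 0) \<epsilon>) (schur d F)"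
    by (rule schur_exact[OF PF PF F PD res_eps[OF RP]]) (use RP in \<open>simp add: proj_resolution_def\<close>)
  have exS: "exact_at (schur d (P (Suc (Suc i)))) (schur_map d (P (Suc (Suc i))) (D (Suc i))) (schur d (P (Suc i)))
      (schur_map d (P (Suc i)) (D i)) (schur d (P i))" for i
    by (rule schur_exact[OF PF PF PF PD PD]) (use RP in \<open>simp add: proj_resolution_def\<close>)
  show "w \<in> cone_bd k J"
  proof (cases k)
    case 0
    \<comment> \<open>The image of the first component extends along the augmentation to
      \<open>h\<close> on \<open>f F\<close>; it must vanish, because it vanishes after the
      surjection \<epsilon>'.\<close>
    obtain h where h: "h \<in> nat_trans \<S> (schur d F) (schur d J)" "ncomp (schur d (P 0)) h (schur_map d (P 0) \<epsilon>) = ?f"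
      using inj[OF SPF SPF SF sD se ex0, of ?f] fa fD unfolding 0 by blast
    have "?g = \<zero>\<^bsub>hom_module \<S> zero_functor (schur d J)\<^esub>"
      using nt_from_zero_functor[OF SJ] g unfolding 0 by simp
    then have "comp_map 0 ?a = \<zero>\<^bsub>?N 0\<^esub>"
      using ag Dt_nt[of 0] unfolding 0 by (simp add: ncomp_zero_left[OF QF zero_functor_functor SJ])
    moreover have "comp_map 0 ?a = ncomp (Q 0) h \<epsilon>'"
      using h(2) unfolding comp_map_def 0 phi_eps[symmetric] ncomp_assoc[OF phi_nt, symmetric] by simp
    ultimately have hz: "ncomp (Q 0) h \<epsilon>' = \<zero>\<^bsub>?N 0\<^esub>" by simp
    have "h = \<zero>\<^bsub>hom_module \<S> (schur d F) (schur d J)\<^esub>"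
    proof (rule nt_eqI[OF h(1) hom_closed(1)[OF SF SJ]])
      fix a y assume y: "y \<in> carrier (Ob (schur d F) a)"
      then have "y \<in> \<epsilon>' a ` carrier (Ob (Q 0) a)" using res_surj[OF RQ, of a] by simp
      then obtain x where x: "x \<in> carrier (Ob (Q 0) a)" "y = \<epsilon>' a x" by (rule imageE)
      show "h a y = \<zero>\<^bsub>hom_module \<S> (schur d F) (schur d J)\<^esub> a y"
        using fun_cong[OF fun_cong[OF hz, of a], of x] x y by simp
    qed
    then have "?f = \<zero>\<^bsub>hom_module \<S> (schur d (P 0)) (schur d J)\<^esub>"
      using h(2) ncomp_zero_left[OF SPF SF SJ se] by simp
    then have "?a = \<zero>\<^bsub>hom_module \<G> (P 0) J\<^esub>"
      using a schur_map_zero[OF PF[of 0] J] unfolding 0 by (intro faith[OF PF _ hom_closed(1)[OF PF J]]) simp_all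
    then show ?thesis
      using \<open>?g = _\<close> unfolding 0 cone_bd_def by (simp add: prod_eq_iff)
  next
    case (Suc j)
    obtain b' where b': "b' \<in> nat_trans \<S> (schur d (P j)) (schur d J)" "ncomp (schur d (P (Suc j))) b' (schur_map d (P (Suc j)) (D j)) = ?f"
      using inj[OF SPF SPF SPF sD sD exS, of ?f] fa fD unfolding Suc by blast
    obtain b where b: "b \<in> nat_trans \<G> (P j) J" "schur_map d (P j) b = b'" using full[OF PF b'(1)] by blast
    have bD: "ncomp (P (Suc j)) b (D j) = ?a"
      by (rule faith[OF PF ncomp_closed[OF PF PD b(1)]]) (use a b'(2) b(2) in \<open>simp_all add: Suc schur_map_comp[OF PD]\<close>)
    have g': "?g \<in> carrier (?N j)" using g by (simp add: Suc)
    have bc: "comp_map j b \<in> carrier (?N j)" using lin_maps_closed[OF comp_map_lin[OF J], of b j] b(1) by simp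
    \<comment> \<open>With \<open>b\<close> a primitive of the first component, \<open>z\<close> is
      what the second component still lacks. It is a cocycle on \<open>Q\<close>.\<close>
    define z where "z = ?g \<oplus>\<^bsub>?N j\<^esub> \<ominus>\<^bsub>?N j\<^esub> comp_map j b"
    have z: "z \<in> nat_trans \<S> (Q j) (schur d J)"
      using vs_add[OF VN g' vs_neg[OF VN bc]] by (simp add: z_def)
    have gz: "comp_map j b \<oplus>\<^bsub>?N j\<^esub> z = ?g"
      unfolding z_def using g' bc
      by (simp only: vs_lcomm[OF VN bc g' vs_neg[OF VN bc]] vs_rneg[OF VN bc] vs_add_zero[OF VN g'])
    note L = precomp_lin[OF QF QF SJ QD[of j]]
    have e1: "ncomp (Q (Suc j)) ?g (D' j) = ncomp (Q (Suc j)) (comp_map j b) (D' j)"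
      using ag comp_map_D[OF J b(1)] unfolding Suc bD by simp
    have zD: "ncomp (Q (Suc j)) z (D' j) = \<zero>\<^bsub>?N (Suc j)\<^esub>"
      unfolding z_def lin_maps_add[OF L g' vs_neg[OF VN bc]] lin_maps_neg[OF L VN VN bc] e1
      by (rule vs_rneg[OF VN lin_maps_closed[OF L bc]])
    have "\<exists>v\<in>carrier (cone j J). cone_diff j J v = w"
    proof (cases j)
      case 0
      have "exact_at (Q (Suc 0)) (D' 0) (Q 0) \<epsilon>' (schur d F)" using RQ by (simp add: proj_resolution_def)
      then obtain h where h: "h \<in> nat_trans \<S> (schur d F) (schur d J)" "ncomp (Q 0) h \<epsilon>' = z"
        using inj[OF QF QF SF QD res_eps[OF RQ], of z] z zD unfolding 0 by blast
      obtain h' where h': "h' \<in> nat_trans \<G> F J" "schur_map d F h' = h" using full[OF F h(1)] by blast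
      note e = res_eps[OF RP]
      have he: "ncomp (P 0) h' \<epsilon> \<in> nat_trans \<G> (P 0) J" by (rule ncomp_closed[OF PF e h'(1)])
      \<comment> \<open>There is no term of \<open>Q\<close> below degree \<open>0\<close> to absorb
        \<open>z\<close>. Instead \<open>z\<close> comes from a map on \<open>f F\<close>, hence
        from \<open>h'\<close> on \<open>F\<close>, and \<open>b\<close> is corrected by the cocycle
        \<open>h'\<close> after \<epsilon>, which \<open>comp_map\<close> sends to
        \<open>z\<close>.\<close>
      define v where "v = (b \<oplus>\<^bsub>hom_module \<G> (P 0) J\<^esub> ncomp (P 0) h' \<epsilon>, \<zero>\<^bsub>hom_module \<S> (Qt 0) (schur d J)\<^esub>)"
      have b0: "b \<in> nat_trans \<G> (P 0) J" using b(1) by (simp add: 0)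
      have v: "v \<in> carrier (cone 0 J)"
        using hom_closed(2)[OF PF J b0 he] hom_closed(1)[OF zero_functor_functor SJ] by (simp add: v_def)
      have eD: "ncomp (P (Suc 0)) \<epsilon> (D 0) = \<zero>\<^bsub>hom_module \<G> (P (Suc 0)) F\<^esub>"
        by (rule exact_comp_zero[OF PF PF F PD e]) (use RP in \<open>simp add: proj_resolution_def\<close>)
      have hD: "ncomp (P (Suc 0)) (ncomp (P 0) h' \<epsilon>) (D 0) = \<zero>\<^bsub>hom_module \<G> (P (Suc 0)) J\<^esub>"
        unfolding ncomp_assoc[OF PD] eD by (rule ncomp_zero_right[OF PF F J h'(1)])
      have 1: "ncomp (P (Suc 0)) (fst v) (D 0) = ?a"
        using lin_maps_add[OF pre_D[OF J, of 0], of b "ncomp (P 0) h' \<epsilon>"] b0 he bD a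
        by (simp add: v_def hD Suc 0 vs_add_zero[OF VP])
      have ch: "comp_map 0 (ncomp (P 0) h' \<epsilon>) = z"
        unfolding comp_map_def schur_map_comp[OF e] h'(2) ncomp_assoc[OF phi_nt] phi_eps h(2) ..
      have "comp_map 0 (fst v) = comp_map 0 b \<oplus>\<^bsub>?N 0\<^esub> z"
        using lin_maps_add[OF comp_map_lin[OF J, of 0], of b "ncomp (P 0) h' \<epsilon>"] b0 he by (simp add: v_def ch)
      then have 2: "comp_map 0 (fst v) = ?g" using gz by (simp add: 0)
      have 3: "ncomp (Q 0) (snd v) (Dt 0) = \<zero>\<^bsub>?N 0\<^esub>"
        using ncomp_zero_left[OF QF zero_functor_functor SJ, of "Dt 0"] Dt_nt[of 0] by (simp add: v_def)
      have nz: "\<ominus>\<^bsub>?N 0\<^esub> \<zero>\<^bsub>?N 0\<^esub> = \<zero>\<^bsub>?N 0\<^esub>"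
        using vs_neg_eq[OF VN vs_zero[OF VN]] vs_smult_zero[OF VN] by simp
      have "cone_diff 0 J v = w"
        unfolding cone_diff_def 1 2 3 nz using vs_add_zero[OF VN g'] by (simp add: 0)
      then show ?thesis using v unfolding 0 by blast
    next
      case (Suc i)
      have "exact_at (Q (Suc (Suc i))) (D' (Suc i)) (Q (Suc i)) (D' i) (Q i)" using RQ by (simp add: proj_resolution_def)
      then obtain h where h: "h \<in> nat_trans \<S> (Q i) (schur d J)" "ncomp (Q (Suc i)) h (D' i) = z"
        using inj[OF QF QF QF QD QD, of i z] z zD unfolding Suc by blast
      \<comment> \<open>Here \<open>z\<close> is the coboundary of \<open>h\<close>; the sign of
        \<open>h\<close> compensates for the minus sign in \<open>cone_diff\<close>.\<close>
      define v where "v = (b, \<ominus>\<^bsub>?N i\<^esub> h)"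
      have hc: "h \<in> carrier (?N i)" using h(1) by simp
      have v: "v \<in> carrier (cone j J)" using b(1) vs_neg[OF VN hc] by (simp add: v_def Suc)
      note L' = precomp_lin[OF QF QF SJ QD[of i]]
      have zc: "z \<in> carrier (?N (Suc i))" using z by (simp add: Suc)
      have "ncomp (Q (Suc i)) (\<ominus>\<^bsub>?N i\<^esub> h) (D' i) = \<ominus>\<^bsub>?N (Suc i)\<^esub> z"
        unfolding lin_maps_neg[OF L' VN VN hc] h(2) ..
      moreover have "\<ominus>\<^bsub>?N (Suc i)\<^esub> (\<ominus>\<^bsub>?N (Suc i)\<^esub> z) = z"
        using vs_neg_eq[OF VN zc] vs_neg_eq[OF VN vs_neg[OF VN zc]] vs_smult_smult[OF VN zc, of "-1" "-1"] vs_one[OF VN zc] by simp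
      ultimately have "cone_diff j J v = w"
        using gz bD by (simp add: cone_diff_def v_def Suc \<open>k = Suc j\<close> prod_eq_iff)
      then show ?thesis using v by blast
    qed
    then show ?thesis unfolding Suc cone_bd_def by auto
  qed
qed

text \<open>\<open>f N\<close> is zero, so only the part \<open>Hom(P, N)\<close> of the cone
  remains. Its cohomology is Ext of \<open>F\<close> with values in \<open>N\<close>, which vanishes
  by comparison with \<open>P'\<close>.\<close>

lemma torsion_acyclic:
  assumes N: "strict_poly_functor d N"
    and N0: "nat_trans \<G> (tens_functor d) N \<subseteq> {\<zero>\<^bsub>hom_module \<G> (tens_functor d) N\<^esub>}"
    and R': "proj_resolution \<G> F P' E \<epsilon>''" and van: "nat_trans \<G> (P' k) N \<subseteq> {\<zero>\<^bsub>hom_module \<G> (P' k) N\<^esub>}"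
  shows "acyclic_at k N"
  unfolding acyclic_at_def
proof (intro ballI impI)
  fix w assume w: "w \<in> carrier (cone k N)" and dw: "cone_diff k N w = \<one>\<^bsub>cone (Suc k) N\<^esub>"
  note SN = schur_functor[OF N]
  have a: "fst w \<in> Ext_cocycles \<G> P D N k" using w dw by (auto simp: Ext_cocycles_def cone_diff_def)
  have b: "fst w \<in> Ext_coboundaries \<G> P D N k" by (rule ext_vanishing[OF F N RP R' van a])
  have z: "\<gamma> = \<gamma>'" if "is_functor \<S> M" "\<gamma> \<in> nat_trans \<S> M (schur d N)" "\<gamma>' \<in> nat_trans \<S> M (schur d N)"
    for M :: "('k, nat \<Rightarrow> (nat list \<Rightarrow> 'k) \<Rightarrow> 'v) sym_mod" and \<gamma> \<gamma>'
  proof (rule nt_eqI[OF that(2,3)])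
    fix u x assume "x \<in> carrier (Ob M u)"
    then have "\<gamma> u x \<in> nat_trans \<G> (tens_functor d) N" "\<gamma>' u x \<in> nat_trans \<G> (tens_functor d) N"
      using nt_closed[OF that(2)] nt_closed[OF that(3)] by auto
    then show "\<gamma> u x = \<gamma>' u x" using N0[THEN subsetD, of "\<gamma> u x"] N0[THEN subsetD, of "\<gamma>' u x"] by simp
  qed
  have g: "snd w \<in> nat_trans \<S> (Qt k) (schur d N)" using w by auto
  show "w \<in> cone_bd k N"
  proof (cases k)
    case 0
    then have "fst w = \<zero>\<^bsub>hom_module \<G> (P 0) N\<^esub>" using b by (simp add: Ext_coboundaries_def)
    moreover have "snd w = \<zero>\<^bsub>hom_module \<S> (Qt 0) (schur d N)\<^esub>"
      by (rule z[OF Qt_functor[of 0]]) (use g hom_closed(1)[OF zero_functor_functor SN] 0 in simp_all)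
    ultimately show ?thesis by (simp add: 0 cone_bd_def prod_eq_iff)
  next
    case (Suc j)
    then obtain \<beta> where be: "\<beta> \<in> nat_trans \<G> (P j) N" "fst w = ncomp (P (Suc j)) \<beta> (D j)"
      using b by (auto simp: Ext_coboundaries_def)
    define v where "v = (\<beta>, \<zero>\<^bsub>hom_module \<S> (Qt j) (schur d N)\<^esub>)"
    have v: "v \<in> carrier (cone j N)" using be(1) hom_closed(1)[OF Qt_functor SN] by (simp add: v_def)
    have "snd (cone_diff j N v) = snd w"
      by (rule z[OF Qt_functor[of k]]) (use cone_diff_closed[OF N v] g Suc in auto)
    moreover have "fst (cone_diff j N v) = fst w" by (simp add: cone_diff_def v_def be(2))
    ultimately have "cone_diff j N v = w" by (simp add: prod_eq_iff)
    then show ?thesis using v unfolding Suc cone_bd_def by auto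
  qed
qed

text \<open>Induction on \<open>k\<close> with \<open>G\<close> arbitrary: degree \<open>k\<close>
  for \<open>G\<close> reduces to degree \<open>k - 1\<close> for a cokernel \<open>H\<close> about
  which nothing is known beyond its being a functor.\<close>

lemma left_bounded_acyclic:
  assumes inf: "infinite (UNIV :: 'v set)" and p: "CHAR('k) = p" "p > 0"
    and R': "proj_resolution \<G> F P' E \<epsilon>''" and L: "\<And>i. i < n \<Longrightarrow> left_p_bounded p d (P' i)"
    and G: "strict_poly_functor d G" and k: "k < n"
  shows "acyclic_at k G"
  using k G
proof (induction k arbitrary: G)
  have step: "\<exists>N J B H \<iota> \<kappa> j q. ses N \<iota> G \<kappa> B \<and> ses B j J q H \<and> acyclic_at k N \<and> acyclic_at k J"
    if k: "k < n" and G: "strict_poly_functor d G" for k and G :: "('k, 'v) spf"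
  proof -
    obtain J :: "('k, 'v) spf" and \<kappa> where J: "schur_closed d TYPE('v) J" and ka: "\<kappa> \<in> nat_trans \<G> G J"
      and ker: "\<And>n y. y \<in> carrier (Ob G n) \<Longrightarrow> \<kappa> n y = \<zero>\<^bsub>Ob J n\<^esub> \<longleftrightarrow>
        (\<forall>w\<in>words {..<n} d. Mp G n d (bx d (idw d) (dl w)) y = \<zero>\<^bsub>Ob G d\<^esub>)"
      using schur_closed_hull[OF inf G] by metis
    have Jf: "strict_poly_functor d J" using J by (simp add: schur_closed_def)
    \<comment> \<open>The map to the hull is split into two short exact sequences: kernel,
      \<open>G\<close>, image, and image, hull, cokernel.\<close>
    let ?K = "\<lambda>n. {y \<in> carrier (Ob G n). \<kappa> n y = \<zero>\<^bsub>Ob J n\<^esub>}" and ?B = "\<lambda>n. \<kappa> n ` carrier (Ob G n)"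
    note sK = kernel_subf[OF G Jf ka] and sB = image_subf[OF G Jf ka]
    let ?N = "subfun G ?K" and ?I = "subfun J ?B"
    have N: "strict_poly_functor d ?N" by (rule subfun_functor[OF G sK])
    have I: "strict_poly_functor d ?I" by (rule subfun_functor[OF Jf sB])
    have kI: "\<kappa> \<in> nat_trans \<G> G ?I" by (rule corestrict_nt[OF ka]) simp
    have s1: "ses ?N (idn ?N) G \<kappa> ?I"
      unfolding ses_def using N G I incl_nt[OF G sK] kI
      by (auto simp: is_mono_def is_epi_def exact_at_def idn_def ntr_def inj_on_def image_iff)
    obtain H :: "('k, 'v) spf" and q where H: "strict_poly_functor d H" and q: "q \<in> nat_trans \<G> J H" "is_epi J H q"
      "\<And>a x. x \<in> carrier (Ob J a) \<Longrightarrow> q a x = \<zero>\<^bsub>Ob H a\<^esub> \<longleftrightarrow> x \<in> ?B a"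
      using quotient_functor[OF Jf sB] by metis
    have "idn ?I a ` carrier (Ob ?I a) = {y \<in> carrier (Ob J a). q a y = \<zero>\<^bsub>Ob H a\<^esub>}" for a
      using q(3) nt_closed[OF ka] by (auto simp: idn_def ntr_def image_iff)
    then have s2: "ses ?I (idn ?I) J q H"
      unfolding ses_def using I Jf H incl_nt[OF Jf sB] q(1,2)
      by (auto simp: is_mono_def exact_at_def idn_def ntr_def inj_on_def)
    \<comment> \<open>The value of \<psi> at \<open>idw d\<close> is fixed by the idempotent
      \<open>bx d (idw d) (idw d)\<close>, being a value at \<open>idw d\<close>, and killed by it,
      being in the kernel of \<kappa>.\<close>
    have N0: "nat_trans \<G> (tens_functor d) ?N \<subseteq> {\<zero>\<^bsub>hom_module \<G> (tens_functor d) ?N\<^esub>}"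
    proof
      fix \<psi> assume ps: "\<psi> \<in> nat_trans \<G> (tens_functor d) ?N"
      let ?y = "\<psi> d (idw d)"
      have y: "?y \<in> carrier (Ob ?N d)" by (rule nt_closed[OF ps]) (simp add: idw_tens)
      then have "Mp G d d (bx d (idw d) (idw d)) ?y = \<zero>\<^bsub>Ob G d\<^esub>"
        using ker[of ?y d] upt_words[of d] by simp
      then have y0: "?y = \<zero>\<^bsub>Ob G d\<^esub>" using yoneda[OF ps idw_tens] by simp
      have "\<psi> = \<zero>\<^bsub>hom_module \<G> (tens_functor d) ?N\<^esub>"
        by (rule schur_ext[OF ps hom_closed(1)[OF tens_functor_functor N]]) (simp add: y0 idw_tens)
      then show "\<psi> \<in> {\<zero>\<^bsub>hom_module \<G> (tens_functor d) ?N\<^esub>}" by simp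
    qed
    have ac: "acyclic_at k ?N"
    proof (rule torsion_acyclic[OF N N0 R'])
      show "nat_trans \<G> (P' k) ?N \<subseteq> {\<zero>\<^bsub>hom_module \<G> (P' k) ?N\<^esub>}"
        using left_p_bounded_hom_zero[OF p L[OF k] res_functor[OF R'] N N0] by blast
    qed
    have "acyclic_at k J" by (rule schur_closed_acyclic[OF J])
    from conjI[OF s1 conjI[OF s2 conjI[OF ac this]]] show ?thesis by (intro exI)
  qed
  {
    case 0
    obtain N J B H \<iota> \<kappa> j q where "ses N \<iota> G \<kappa> B" "ses B j J q H" "acyclic_at 0 N" "acyclic_at 0 J"
      using step[OF 0] by blast
    then show ?case using acyclic_mid acyclic_sub_0 by blast
  next
    case (Suc k)
    obtain N J B H \<iota> \<kappa> j q where s: "ses N \<iota> G \<kappa> B" "ses B j J q H" "acyclic_at (Suc k) N" "acyclic_at (Suc k) J"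
      using step[OF Suc.prems] by blast
    have "strict_poly_functor d H" using s(2) by (simp add: ses_def)
    then have "acyclic_at k H" using Suc by simp
    then show ?case using acyclic_mid[OF s(1,3)] acyclic_sub[OF s(2,4)] by blast
  }
qed

text \<open>The first injective term is acyclic in all degrees, so the cone of \<open>G\<close> in
  degree \<open>k\<close> is controlled by that of its cosyzygy in degree \<open>k - 1\<close>. The
  cosyzygy has an injective resolution with one right bounded term fewer.\<close>

lemma right_bounded_acyclic:
  assumes inf: "infinite (UNIV :: 'v set)" and p: "CHAR('k) = p" "p > 0"
    and base: "\<And>k G. \<lbrakk>k < n; strict_poly_functor d G\<rbrakk> \<Longrightarrow> acyclic_at k G"
    and G: "strict_poly_functor d G" and R: "inj_resolution \<G> G J \<delta> \<iota>"
    and B: "\<And>i. i < m \<Longrightarrow> right_p_bounded p d (J i)" and k: "k < n + m"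
  shows "acyclic_at k G"
  using G R B k
proof (induction m arbitrary: G J \<delta> \<iota> k)
  case 0
  then show ?case using base by simp
next
  case (Suc m)
  have inj: "injective \<G> (J i)" and de: "\<delta> i \<in> nat_trans \<G> (J i) (J (Suc i))" for i
    using Suc.prems(2) by (simp_all add: inj_resolution_def)
  have Jf: "strict_poly_functor d (J i)" for i using inj[of i] by (simp add: injective_def)
  have ex: "exact_at (J i) (\<delta> i) (J (Suc i)) (\<delta> (Suc i)) (J (Suc (Suc i)))" for i
    using Suc.prems(2) by (simp add: inj_resolution_def)
  \<comment> \<open>The first cosyzygy is taken as the image of \<delta> inside \<open>J 1\<close>,
    so the remaining terms resolve it through the inclusion.\<close>
  let ?Y = "\<lambda>a. \<delta> 0 a ` carrier (Ob (J 0) a)"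
  let ?H = "subfun (J (Suc 0)) ?Y"
  note sY = image_subf[OF Jf Jf de[of 0]]
  have H: "strict_poly_functor d ?H" by (rule subfun_functor[OF Jf sY])
  have dH: "\<delta> 0 \<in> nat_trans \<G> (J 0) ?H" by (rule corestrict_nt[OF de]) simp
  have s: "ses G \<iota> (J 0) (\<delta> 0) ?H"
    unfolding ses_def using Suc.prems(1,2) Jf H dH
    by (auto simp: inj_resolution_def exact_at_def is_epi_def)
  have "exact_at ?H (idn ?H) (J (Suc 0)) (\<delta> (Suc 0)) (J (Suc (Suc 0)))"
    using ex[of 0] unfolding exact_at_def by (simp add: idn_def ntr_def image_iff)
  then have R': "inj_resolution \<G> ?H (\<lambda>i. J (Suc i)) (\<lambda>i. \<delta> (Suc i)) (idn ?H)"
    unfolding inj_resolution_def using inj de ex incl_nt[OF Jf sY]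
    by (simp add: is_mono_def idn_def ntr_def inj_on_def)
  obtain M :: "('k, 'v) spf" and \<kappa> where M: "schur_closed d TYPE('v) M" and ka: "\<kappa> \<in> nat_trans \<G> (J 0) M"
    and ker: "\<And>n y. y \<in> carrier (Ob (J 0) n) \<Longrightarrow> \<kappa> n y = \<zero>\<^bsub>Ob M n\<^esub> \<longleftrightarrow>
      (\<forall>w\<in>words {..<n} d. Mp (J 0) n d (bx d (idw d) (dl w)) y = \<zero>\<^bsub>Ob (J 0) d\<^esub>)"
    using schur_closed_hull[OF inf Jf[of 0]] by metis
  have Mf: "strict_poly_functor d M" using M by (simp add: schur_closed_def)
  note V = fun_vs[OF Jf[of 0]] and VM = fun_vs[OF Mf]
  \<comment> \<open>The kernel of the hull map consists of elements killed by all coefficient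
    readers, and right bounded functors have no such elements but zero.\<close>
  have "is_mono (J 0) \<kappa>"
    unfolding is_mono_def
  proof (intro allI inj_onI)
    fix n x y assume x: "x \<in> carrier (Ob (J 0) n)" and y: "y \<in> carrier (Ob (J 0) n)" and e: "\<kappa> n x = \<kappa> n y"
    let ?z = "x \<oplus>\<^bsub>Ob (J 0) n\<^esub> \<ominus>\<^bsub>Ob (J 0) n\<^esub> y"
    have z: "?z \<in> carrier (Ob (J 0) n)" using x y by (simp add: vs_closed V)
    have "\<kappa> n ?z = \<zero>\<^bsub>Ob M n\<^esub>"
      using x y by (simp add: nt_add[OF ka] nt_neg[OF ka Jf Mf] vs_closed V e vs_rneg VM nt_closed[OF ka])
    then have "?z = \<zero>\<^bsub>Ob (J 0) n\<^esub>"
      using ker[OF z] by (intro right_p_bounded_separated[OF p Suc.prems(3) Jf z]) auto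
    then show "x = y" by (rule vs_diff_zero[OF V x y])
  qed
  \<comment> \<open>Injectivity of \<open>J 0\<close> extends its identity along \<kappa>, which
    makes it a retract of the hull.\<close>
  then obtain r where r: "r \<in> nat_trans \<G> M (J 0)" "ncomp (J 0) r \<kappa> = idn (J 0)"
    using inj[of 0] Jf[of 0] Mf ka idn_closed[OF Jf[of 0]] unfolding injective_def by blast
  have Z: "acyclic_at i (J 0)" for i by (rule schur_closed_acyclic[OF schur_closed_retract[OF M Jf ka r]])
  show ?case
  proof (cases k)
    case 0
    then show ?thesis using acyclic_sub_0[OF s Z] by simp
  next
    case (Suc k')
    have "acyclic_at k' ?H"
      by (rule Suc.IH[OF H R']) (use Suc.prems(3,4) Suc in auto)
    then show ?thesis using acyclic_sub[OF s Z] by (simp add: Suc)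
  qed
qed

end

section \<open>The induced map on cohomology\<close>

text \<open>Cosets become the fibres of a linear map \<open>q\<close> with kernel \<open>B\<close>,
  the complement of a projection onto \<open>B\<close>. Coset arithmetic then reduces to linear
  equations.\<close>

lemma coset_kernel:
  assumes N: "vspace N" and B: "subsp N B"
  obtains q where "q \<in> lin_maps N N" "\<And>a. a \<in> carrier N \<Longrightarrow> q a = \<zero>\<^bsub>N\<^esub> \<longleftrightarrow> a \<in> B"
    "\<And>a. a \<in> carrier N \<Longrightarrow> a_r_coset N B a = {y \<in> carrier N. q y = q a}"
proof -
  obtain p where p: "p \<in> lin_maps N N" "\<And>x. x \<in> carrier N \<Longrightarrow> p x \<in> B" "\<And>x. x \<in> B \<Longrightarrow> p x = x"
    using subsp_projection[OF N B] by metis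
  define q where "q x = x \<oplus>\<^bsub>N\<^esub> \<ominus>\<^bsub>N\<^esub> p x" for x
  have Bc: "x \<in> carrier N" if "x \<in> B" for x using subspD(1)[OF B] that by (rule subsetD)
  have pc: "p x \<in> carrier N" if "x \<in> carrier N" for x using p(1) that by (rule lin_maps_closed)
  have q: "q \<in> lin_maps N N"
  proof (rule lin_mapsI)
    fix x y r assume x: "x \<in> carrier N"
    show "q x \<in> carrier N" using x by (simp add: q_def N vs_closed pc)
    show "q (r \<odot>\<^bsub>N\<^esub> x) = r \<odot>\<^bsub>N\<^esub> q x"
      using x by (simp add: q_def lin_maps_smult[OF p(1)] vs_smult_add vs_neg_eq[symmetric] vs_smult_smult N vs_closed pc mult.commute)
    assume y: "y \<in> carrier N"
    show "q (x \<oplus>\<^bsub>N\<^esub> y) = q x \<oplus>\<^bsub>N\<^esub> q y"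
      using x y by (simp add: q_def lin_maps_add[OF p(1)] vs_smult_add vs_neg_eq[symmetric] vs_assoc vs_lcomm N vs_closed pc)
  qed
  have k: "q a = \<zero>\<^bsub>N\<^esub> \<longleftrightarrow> a \<in> B" if a: "a \<in> carrier N" for a
  proof
    assume "q a = \<zero>\<^bsub>N\<^esub>"
    then have "a = p a" unfolding q_def by (rule vs_diff_zero[OF N a pc[OF a]])
    then show "a \<in> B" using p(2)[OF a] by simp
  qed (simp add: q_def p(3) vs_rneg N a)
  have "a_r_coset N B a = {y \<in> carrier N. q y = q a}" if a: "a \<in> carrier N" for a
  proof (intro Set.set_eqI iffI)
    fix y assume "y \<in> a_r_coset N B a"
    then obtain h where h: "h \<in> B" "y = h \<oplus>\<^bsub>N\<^esub> a" by (auto simp: a_r_coset_def')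
    then have "q y = q a"
      using k[OF Bc[OF h(1)]] lin_maps_closed[OF q a] by (simp add: lin_maps_add[OF q Bc a] vs_zero_add N)
    then show "y \<in> {y \<in> carrier N. q y = q a}" using h Bc a by (simp add: vs_add N)
  next
    fix y assume "y \<in> {y \<in> carrier N. q y = q a}"
    then have y: "y \<in> carrier N" "q y = q a" by auto
    let ?h = "y \<oplus>\<^bsub>N\<^esub> \<ominus>\<^bsub>N\<^esub> a"
    have "q ?h = \<zero>\<^bsub>N\<^esub>"
      using lin_maps_closed[OF q a] a y(1)
      by (simp add: lin_maps_add[OF q] lin_maps_neg[OF q] y(2) vs_rneg vs_closed N)
    then have "?h \<in> B" using k[of ?h] y(1) a by (simp add: vs_closed N)
    moreover have "?h \<oplus>\<^bsub>N\<^esub> a = y" using y(1) a by (simp add: vs_assoc vs_lneg vs_add_zero vs_closed N)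
    ultimately show "y \<in> a_r_coset N B a" by (force simp: a_r_coset_def')
  qed
  with q k show ?thesis by (rule that)
qed

lemma quot_simps:
  "carrier (quot_module (M\<lparr>carrier := K\<rparr>) B) = a_r_coset M B ` K"
  "R \<oplus>\<^bsub>quot_module (M\<lparr>carrier := K\<rparr>) B\<^esub> S = set_add M R S"
  "r \<odot>\<^bsub>quot_module (M\<lparr>carrier := K\<rparr>) B\<^esub> R = (\<Union>x\<in>R. a_r_coset M B (r \<odot>\<^bsub>M\<^esub> x))"
  by (auto simp: quot_module_def A_RCOSETS_def' a_r_coset_def' set_add_def')

lemma UN_eq_const: "\<lbrakk>a \<in> A; \<And>x. x \<in> A \<Longrightarrow> f x = C\<rbrakk> \<Longrightarrow> (\<Union>x\<in>A. f x) = C"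
  by auto

lemma coset_eq_iff:
  assumes V: "vspace V" and S: "subsp V S" and a: "a \<in> carrier V" and b: "b \<in> carrier V"
  shows "a_r_coset V S a = a_r_coset V S b \<longleftrightarrow> a \<oplus>\<^bsub>V\<^esub> \<ominus>\<^bsub>V\<^esub> b \<in> S"
proof (rule coset_kernel[OF V S])
  fix q assume q: "q \<in> lin_maps V V" "\<And>a. a \<in> carrier V \<Longrightarrow> q a = \<zero>\<^bsub>V\<^esub> \<longleftrightarrow> a \<in> S"
    "\<And>a. a \<in> carrier V \<Longrightarrow> a_r_coset V S a = {y \<in> carrier V. q y = q a}"
  note qc = lin_maps_closed[OF q(1) a] lin_maps_closed[OF q(1) b]
  have "a_r_coset V S a = a_r_coset V S b \<longleftrightarrow> q a = q b" unfolding q(3)[OF a] q(3)[OF b] using a by auto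
  also have "\<dots> \<longleftrightarrow> q a \<oplus>\<^bsub>V\<^esub> \<ominus>\<^bsub>V\<^esub> q b = \<zero>\<^bsub>V\<^esub>" using vs_diff_zero[OF V qc] vs_rneg[OF V qc(2)] by auto
  also have "\<dots> \<longleftrightarrow> q (a \<oplus>\<^bsub>V\<^esub> \<ominus>\<^bsub>V\<^esub> b) = \<zero>\<^bsub>V\<^esub>"
    unfolding lin_maps_add[OF q(1) a vs_neg[OF V b]] lin_maps_neg[OF q(1) V V b] ..
  also have "\<dots> \<longleftrightarrow> a \<oplus>\<^bsub>V\<^esub> \<ominus>\<^bsub>V\<^esub> b \<in> S" by (rule q(2)[OF vs_add[OF V a vs_neg[OF V b]]])
  finally show ?thesis .
qed

lemma coset_mem:
  assumes V: "vspace V" and S: "subsp V S" and a: "a \<in> carrier V"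
  shows "x \<in> a_r_coset V S a \<longleftrightarrow> x \<in> carrier V \<and> a_r_coset V S x = a_r_coset V S a"
proof (rule coset_kernel[OF V S])
  fix q assume q: "q \<in> lin_maps V V" "\<And>a. a \<in> carrier V \<Longrightarrow> a_r_coset V S a = {y \<in> carrier V. q y = q a}"
  have "a_r_coset V S x = a_r_coset V S a \<longleftrightarrow> q x = q a" if "x \<in> carrier V"
    unfolding q(2)[OF that] q(2)[OF a] using that by auto
  then show ?thesis unfolding q(2)[OF a] by auto
qed

lemma coset_smult:
  assumes N: "vspace N" and B: "subsp N B" and a: "a \<in> carrier N"
  shows "(\<Union>x\<in>a_r_coset N B a. a_r_coset N B (r \<odot>\<^bsub>N\<^esub> x)) = a_r_coset N B (r \<odot>\<^bsub>N\<^esub> a)"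
proof (rule UN_eq_const[of a])
  show "a \<in> a_r_coset N B a" using a by (simp add: coset_mem[OF N B a])
  fix x assume "x \<in> a_r_coset N B a"
  then have x: "x \<in> carrier N" "a_r_coset N B x = a_r_coset N B a" by (simp_all add: coset_mem[OF N B a])
  have "r \<odot>\<^bsub>N\<^esub> x \<oplus>\<^bsub>N\<^esub> \<ominus>\<^bsub>N\<^esub> (r \<odot>\<^bsub>N\<^esub> a) = r \<odot>\<^bsub>N\<^esub> (x \<oplus>\<^bsub>N\<^esub> \<ominus>\<^bsub>N\<^esub> a)"
    using x(1) a by (simp add: vs_neg_eq[symmetric] vs_smult_add vs_smult_smult N vs_closed mult.commute)
  then show "a_r_coset N B (r \<odot>\<^bsub>N\<^esub> x) = a_r_coset N B (r \<odot>\<^bsub>N\<^esub> a)"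
    using x(2) subspD(4)[OF B]
    unfolding coset_eq_iff[OF N B x(1) a] coset_eq_iff[OF N B vs_smult[OF N x(1)] vs_smult[OF N a]] by simp
qed

lemma coset_add:
  assumes N: "vspace N" and B: "subsp N B" and a: "a \<in> carrier N" and b: "b \<in> carrier N"
  shows "set_add N (a_r_coset N B a) (a_r_coset N B b) = a_r_coset N B (a \<oplus>\<^bsub>N\<^esub> b)"
proof (rule coset_kernel[OF N B])
  fix q assume q: "q \<in> lin_maps N N" "\<And>a. a \<in> carrier N \<Longrightarrow> a_r_coset N B a = {y \<in> carrier N. q y = q a}"
  note qc = lin_maps_closed[OF q(1) a] lin_maps_closed[OF q(1) b] and ab = vs_add[OF N a b]
  show ?thesis
  proof (intro Set.set_eqI iffI)
    fix z assume "z \<in> set_add N (a_r_coset N B a) (a_r_coset N B b)"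
    then obtain x y where x: "x \<in> carrier N" "q x = q a" and y: "y \<in> carrier N" "q y = q b" and z: "z = x \<oplus>\<^bsub>N\<^esub> y"
      unfolding set_add_def' q(2)[OF a] q(2)[OF b] by blast
    show "z \<in> a_r_coset N B (a \<oplus>\<^bsub>N\<^esub> b)"
      unfolding q(2)[OF ab] z using vs_add[OF N x(1) y(1)]
      by (simp add: lin_maps_add[OF q(1) x(1) y(1)] lin_maps_add[OF q(1) a b] x y)
  next
    fix z assume "z \<in> a_r_coset N B (a \<oplus>\<^bsub>N\<^esub> b)"
    then have z: "z \<in> carrier N" "q z = q a \<oplus>\<^bsub>N\<^esub> q b"
      unfolding q(2)[OF ab] lin_maps_add[OF q(1) a b] by simp_all
    let ?x = "z \<oplus>\<^bsub>N\<^esub> \<ominus>\<^bsub>N\<^esub> b"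
    note nb = vs_neg[OF N b]
    have "q ?x = q a"
      unfolding lin_maps_add[OF q(1) z(1) nb] lin_maps_neg[OF q(1) N N b] z(2)
      using qc by (simp add: vs_closed N vs_assoc vs_rneg vs_add_zero)
    then have "?x \<in> a_r_coset N B a" unfolding q(2)[OF a] using vs_add[OF N z(1) nb] by simp
    moreover have "b \<in> a_r_coset N B b" unfolding q(2)[OF b] using b by simp
    moreover have "z = ?x \<oplus>\<^bsub>N\<^esub> b" using z(1) b by (simp add: vs_assoc vs_lneg vs_add_zero vs_closed N)
    ultimately show "z \<in> set_add N (a_r_coset N B a) (a_r_coset N B b)" unfolding set_add_def' by blast
  qed
qed

section \<open>Linear maps induced on quotients\<close>

context
  fixes M :: "('k::field, 'v) module" and N :: "('k, 'w) module" and \<Phi> K B K' B'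
  assumes M: "vspace M" and N: "vspace N" and P: "\<Phi> \<in> lin_maps M N" and K: "K \<subseteq> carrier M" and K': "K' \<subseteq> carrier N"
    and B: "subsp M B" and B': "subsp N B'"
    and PK: "\<And>x. x \<in> K \<Longrightarrow> \<Phi> x \<in> K'" and PB: "\<And>x. x \<in> B \<Longrightarrow> \<Phi> x \<in> B'"
begin

text \<open>Well-definedness in the form used by \<open>schur_Ext\<close>: all representatives yield
  the same target coset, so the union over them is that coset.\<close>

lemma quot_map_coset:
  assumes a: "a \<in> carrier M"
  shows "(\<Union>x\<in>a_r_coset M B a. a_r_coset N B' (\<Phi> x)) = a_r_coset N B' (\<Phi> a)"
proof -
  note Pc = lin_maps_closed[OF P]
  have mem: "x \<in> a_r_coset M B a \<longleftrightarrow> (x \<in> carrier M \<and> x \<oplus>\<^bsub>M\<^esub> \<ominus>\<^bsub>M\<^esub> a \<in> B)" for x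
    using coset_mem[OF M B a, of x] coset_eq_iff[OF M B _ a, of x] by blast
  show ?thesis
  proof (rule UN_eq_const[of a])
    show "a \<in> a_r_coset M B a" using a subspD(2)[OF B] by (simp add: mem vs_rneg M)
    fix x assume "x \<in> a_r_coset M B a"
    then have x: "x \<in> carrier M" "\<Phi> (x \<oplus>\<^bsub>M\<^esub> \<ominus>\<^bsub>M\<^esub> a) \<in> B'" using PB by (simp_all add: mem)
    then show "a_r_coset N B' (\<Phi> x) = a_r_coset N B' (\<Phi> a)"
      using a by (simp add: coset_eq_iff[OF N B' Pc Pc] lin_maps_add[OF P] lin_maps_neg[OF P] vs_closed M N)
  qed
qed

abbreviation "\<Psi> A \<equiv> \<Union>x\<in>A. a_r_coset N B' (\<Phi> x)"

lemma quot_map_lin: "\<Psi> \<in> lin_maps (quot_module (M\<lparr>carrier := K\<rparr>) B) (quot_module (N\<lparr>carrier := K'\<rparr>) B')"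
proof (rule lin_mapsI)
  note Pc = lin_maps_closed[OF P]
  fix R r assume "R \<in> carrier (quot_module (M\<lparr>carrier := K\<rparr>) B)"
  then obtain a where a: "a \<in> K" "R = a_r_coset M B a" by (auto simp: quot_simps)
  have aM: "a \<in> carrier M" using K a(1) by blast
  show "\<Psi> R \<in> carrier (quot_module (N\<lparr>carrier := K'\<rparr>) B')"
    unfolding a(2) quot_map_coset[OF aM] using PK[OF a(1)] by (simp add: quot_simps)
  show "\<Psi> (r \<odot>\<^bsub>quot_module (M\<lparr>carrier := K\<rparr>) B\<^esub> R) = r \<odot>\<^bsub>quot_module (N\<lparr>carrier := K'\<rparr>) B'\<^esub> \<Psi> R"
    unfolding a(2) quot_simps coset_smult[OF M B aM] quot_map_coset[OF aM] quot_map_coset[OF vs_smult[OF M aM]]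
      coset_smult[OF N B' Pc[OF aM]] lin_maps_smult[OF P aM] ..
  fix S assume "S \<in> carrier (quot_module (M\<lparr>carrier := K\<rparr>) B)"
  then obtain b where b: "b \<in> K" "S = a_r_coset M B b" by (auto simp: quot_simps)
  have bM: "b \<in> carrier M" using K b(1) by blast
  show "\<Psi> (R \<oplus>\<^bsub>quot_module (M\<lparr>carrier := K\<rparr>) B\<^esub> S) = \<Psi> R \<oplus>\<^bsub>quot_module (N\<lparr>carrier := K'\<rparr>) B'\<^esub> \<Psi> S"
    unfolding a(2) b(2) quot_simps coset_add[OF M B aM bM] quot_map_coset[OF aM] quot_map_coset[OF bM]
      quot_map_coset[OF vs_add[OF M aM bM]] coset_add[OF N B' Pc[OF aM] Pc[OF bM]] lin_maps_add[OF P aM bM] ..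
qed

lemma quot_map_inj:
  assumes Ks: "\<And>x y. \<lbrakk>x \<in> K; y \<in> K\<rbrakk> \<Longrightarrow> x \<oplus>\<^bsub>M\<^esub> \<ominus>\<^bsub>M\<^esub> y \<in> K" and i: "\<And>x. \<lbrakk>x \<in> K; \<Phi> x \<in> B'\<rbrakk> \<Longrightarrow> x \<in> B"
  shows "inj_on \<Psi> (carrier (quot_module (M\<lparr>carrier := K\<rparr>) B))"
proof (rule inj_onI)
  note Pc = lin_maps_closed[OF P]
  fix R S assume "R \<in> carrier (quot_module (M\<lparr>carrier := K\<rparr>) B)" "S \<in> carrier (quot_module (M\<lparr>carrier := K\<rparr>) B)"
    and e: "\<Psi> R = \<Psi> S"
  then obtain a b where a: "a \<in> K" "R = a_r_coset M B a" and b: "b \<in> K" "S = a_r_coset M B b" by (auto simp: quot_simps)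
  have aM: "a \<in> carrier M" "b \<in> carrier M" using K a(1) b(1) by auto
  have "\<Phi> (a \<oplus>\<^bsub>M\<^esub> \<ominus>\<^bsub>M\<^esub> b) \<in> B'"
    using e aM unfolding a(2) b(2) quot_map_coset[OF aM(1)] quot_map_coset[OF aM(2)] coset_eq_iff[OF N B' Pc[OF aM(1)] Pc[OF aM(2)]]
    by (simp add: lin_maps_add[OF P] lin_maps_neg[OF P] vs_closed M N)
  then show "R = S" unfolding a(2) b(2) coset_eq_iff[OF M B aM] by (intro i Ks a(1) b(1))
qed

lemma quot_map_surj:
  assumes s: "\<And>y. y \<in> K' \<Longrightarrow> \<exists>x\<in>K. \<Phi> x \<oplus>\<^bsub>N\<^esub> \<ominus>\<^bsub>N\<^esub> y \<in> B'"
  shows "carrier (quot_module (N\<lparr>carrier := K'\<rparr>) B') \<subseteq> \<Psi> ` carrier (quot_module (M\<lparr>carrier := K\<rparr>) B)"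
proof
  note Pc = lin_maps_closed[OF P]
  fix S assume "S \<in> carrier (quot_module (N\<lparr>carrier := K'\<rparr>) B')"
  then obtain y where y: "y \<in> K'" "S = a_r_coset N B' y" by (auto simp: quot_simps)
  obtain x where x: "x \<in> K" "\<Phi> x \<oplus>\<^bsub>N\<^esub> \<ominus>\<^bsub>N\<^esub> y \<in> B'" using s[OF y(1)] by blast
  have xM: "x \<in> carrier M" and yN: "y \<in> carrier N" using x(1) K y(1) K' by auto
  have "S = \<Psi> (a_r_coset M B x)"
    unfolding y(2) quot_map_coset[OF xM] using coset_eq_iff[OF N B' Pc[OF xM] yN] x(2) by simp
  then show "S \<in> \<Psi> ` carrier (quot_module (M\<lparr>carrier := K\<rparr>) B)" using x(1) by (auto simp: quot_simps)
qed

end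

section \<open>From acyclicity of the cone to Ext\<close>

lemma Ext_cocycles_subsp:
  assumes R: "proj_resolution C F P D \<epsilon>" and G: "is_functor C G"
  shows "subsp (hom_module C (P k) G) (Ext_cocycles C P D G k)"
  using subsp_kernel[OF hom_vspace[OF res_functor[OF R] G] hom_vspace[OF res_functor[OF R] G]
      precomp_lin[OF res_functor[OF R] res_functor[OF R] G res_D[OF R, of k]]]
  by (simp add: Ext_cocycles_def)

lemma Ext_coboundaries_subsp:
  assumes R: "proj_resolution C F P D \<epsilon>" and G: "is_functor C G"
  shows "subsp (hom_module C (P k) G) (Ext_coboundaries C P D G k)"
proof (cases k)
  case 0
  note V = hom_vspace[OF res_functor[OF R, of 0] G]
  show ?thesis
    unfolding subsp_def Ext_coboundaries_def 0
    using vs_zero[OF V] vs_add_zero[OF V vs_zero[OF V]] vs_smult_zero[OF V] by simp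
next
  case (Suc j)
  show ?thesis
    using subsp_image[OF hom_vspace[OF res_functor[OF R] G] hom_vspace[OF res_functor[OF R] G]
        precomp_lin[OF res_functor[OF R] res_functor[OF R] G res_D[OF R, of j]]]
    by (simp add: Ext_coboundaries_def Suc)
qed

context schur_comparison
begin

context
  fixes G :: "('k, 'v) spf" assumes G: "strict_poly_functor d G"
begin

lemma comp_map_cocycles:
  assumes "\<alpha> \<in> Ext_cocycles \<G> P D G k"
  shows "comp_map k \<alpha> \<in> Ext_cocycles \<S> Q D' (schur d G) k"
proof -
  have a: "\<alpha> \<in> nat_trans \<G> (P k) G" "ncomp (P (Suc k)) \<alpha> (D k) = \<zero>\<^bsub>hom_module \<G> (P (Suc k)) G\<^esub>"
    using assms by (auto simp: Ext_cocycles_def)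
  have "comp_map k \<alpha> \<in> nat_trans \<S> (Q k) (schur d G)"
    using lin_maps_closed[OF comp_map_lin[OF G], of \<alpha> k] a(1) by simp
  moreover have "ncomp (Q (Suc k)) (comp_map k \<alpha>) (D' k) = \<zero>\<^bsub>hom_module \<S> (Q (Suc k)) (schur d G)\<^esub>"
    unfolding comp_map_D[OF G a(1), symmetric] a(2) by (rule lin_maps_zero[OF comp_map_lin[OF G] HP[OF G] HQ[OF G]])
  ultimately show ?thesis by (simp add: Ext_cocycles_def)
qed

lemma comp_map_coboundaries:
  assumes "\<alpha> \<in> Ext_coboundaries \<G> P D G k"
  shows "comp_map k \<alpha> \<in> Ext_coboundaries \<S> Q D' (schur d G) k"
proof (cases k)
  case 0
  then show ?thesis
    using assms lin_maps_zero[OF comp_map_lin[OF G, of 0] HP[OF G] HQ[OF G]] by (simp add: Ext_coboundaries_def)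
next
  case (Suc j)
  then obtain \<beta> where b: "\<beta> \<in> nat_trans \<G> (P j) G" "\<alpha> = ncomp (P (Suc j)) \<beta> (D j)"
    using assms by (auto simp: Ext_coboundaries_def)
  have "comp_map j \<beta> \<in> nat_trans \<S> (Q j) (schur d G)"
    using lin_maps_closed[OF comp_map_lin[OF G], of \<beta> j] b(1) by simp
  then show ?thesis unfolding Suc b(2) comp_map_D[OF G b(1)] by (simp add: Ext_coboundaries_def)
qed

lemma schur_Ext_quot:
  "schur_Ext d P G Q D' \<phi> k = (\<lambda>A. \<Union>\<alpha>\<in>A. a_r_coset (hom_module \<S> (Q k) (schur d G))
    (Ext_coboundaries \<S> Q D' (schur d G) k) (comp_map k \<alpha>))"
  by (rule ext) (simp only: schur_Ext_def comp_map_def)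

lemmas cocy = Ext_cocycles_subsp[OF RP G] and cocy' = Ext_cocycles_subsp[OF RQ schur_functor[OF G]]
lemmas quot_assms = HP[OF G] HQ[OF G] comp_map_lin[OF G] subspD(1)[OF cocy] subspD(1)[OF cocy']
  Ext_coboundaries_subsp[OF RP G] Ext_coboundaries_subsp[OF RQ schur_functor[OF G]] comp_map_cocycles comp_map_coboundaries

text \<open>A primitive \<gamma> of the image of \<alpha> makes \<open>(\<alpha>, \<gamma>)\<close>
  a cocycle of the cone in degree \<open>k\<close>. Being a boundary, it exhibits \<alpha> as a
  coboundary in its first component.\<close>

lemma coboundary_lift:
  assumes Z: "acyclic_at k G" and a: "\<alpha> \<in> Ext_cocycles \<G> P D G k"
    and b: "comp_map k \<alpha> \<in> Ext_coboundaries \<S> Q D' (schur d G) k"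
  shows "\<alpha> \<in> Ext_coboundaries \<G> P D G k"
proof -
  note SG = schur_functor[OF G]
  have a': "\<alpha> \<in> nat_trans \<G> (P k) G" "ncomp (P (Suc k)) \<alpha> (D k) = \<zero>\<^bsub>hom_module \<G> (P (Suc k)) G\<^esub>"
    using a by (auto simp: Ext_cocycles_def)
  obtain \<gamma> where g: "\<gamma> \<in> nat_trans \<S> (Qt k) (schur d G)" "comp_map k \<alpha> = ncomp (Q k) \<gamma> (Dt k)"
  proof (cases k)
    case 0
    \<comment> \<open>In degree \<open>0\<close> a coboundary is zero, and the zero map on the
      prepended zero term serves as \<gamma>.\<close>
    have "comp_map k \<alpha> = ncomp (Q k) \<zero>\<^bsub>hom_module \<S> (Qt k) (schur d G)\<^esub> (Dt k)"
      using b ncomp_zero_left[OF QF Qt_functor SG Dt_nt[of 0, simplified Qt_simps(2)]] unfolding 0 by (simp add: Ext_coboundaries_def)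
    then show ?thesis by (rule that[OF hom_closed(1)[OF Qt_functor SG]])
  next
    case (Suc j)
    then show ?thesis using b that by (auto simp: Ext_coboundaries_def)
  qed
  have "comp_map k \<alpha> \<in> carrier (hom_module \<S> (Q k) (schur d G))"
    using lin_maps_closed[OF comp_map_lin[OF G], of \<alpha> k] a'(1) by simp
  then have "cone_diff k G (\<alpha>, \<gamma>) = \<one>\<^bsub>cone (Suc k) G\<^esub>"
    using vs_rneg[OF HQ[OF G]] by (simp add: cone_diff_def a'(2) g(2))
  then have w: "(\<alpha>, \<gamma>) \<in> cone_bd k G" using Z a'(1) g(1) by (intro acyclic_atD) simp_all
  show ?thesis
  proof (cases k)
    case 0
    then show ?thesis using w by (simp add: cone_bd_def Ext_coboundaries_def)
  next
    case (Suc j)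
    then show ?thesis using w by (auto simp: cone_bd_def cone_diff_def Ext_coboundaries_def)
  qed
qed

text \<open>\<open>(0, \<beta>)\<close> is a cocycle of the cone in degree \<open>k + 1\<close>. A
  primitive of it consists of a cocycle on \<open>P\<close> and a cochain on \<open>Q\<close> whose
  coboundary is the difference to \<beta>.\<close>

lemma cocycle_lift:
  assumes Z: "acyclic_at (Suc k) G" and b: "\<beta> \<in> Ext_cocycles \<S> Q D' (schur d G) k"
  shows "\<exists>\<alpha>\<in>Ext_cocycles \<G> P D G k. comp_map k \<alpha> \<oplus>\<^bsub>hom_module \<S> (Q k) (schur d G)\<^esub>
    \<ominus>\<^bsub>hom_module \<S> (Q k) (schur d G)\<^esub> \<beta> \<in> Ext_coboundaries \<S> Q D' (schur d G) k"
proof -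
  note SG = schur_functor[OF G]
  let ?N = "\<lambda>k. hom_module \<S> (Q k) (schur d G)" and ?M = "\<lambda>k. hom_module \<G> (P k) G"
  have b': "\<beta> \<in> nat_trans \<S> (Q k) (schur d G)" "ncomp (Q (Suc k)) \<beta> (D' k) = \<zero>\<^bsub>?N (Suc k)\<^esub>"
    using b by (auto simp: Ext_cocycles_def)
  define w where "w = (\<zero>\<^bsub>?M (Suc k)\<^esub>, \<beta>)"
  have w: "w \<in> carrier (cone (Suc k) G)" using b'(1) hom_closed(1)[OF PF G] by (simp add: w_def)
  have nz: "\<ominus>\<^bsub>?N (Suc k)\<^esub> \<zero>\<^bsub>?N (Suc k)\<^esub> = \<zero>\<^bsub>?N (Suc k)\<^esub>"
    using vs_neg_eq[OF HQ[OF G] vs_zero[OF HQ[OF G]]] vs_smult_zero[OF HQ[OF G]] by simp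
  have "cone_diff (Suc k) G w = \<one>\<^bsub>cone (Suc (Suc k)) G\<^esub>"
    unfolding cone_diff_def w_def fst_conv snd_conv Dt_simps b'(2) nz
      lin_maps_zero[OF comp_map_lin[OF G] HP[OF G] HQ[OF G]] ncomp_zero_left[OF PF PF G PD]
    using vs_add_zero[OF HQ[OF G] vs_zero[OF HQ[OF G]]] by simp
  then have "w \<in> cone_diff k G ` carrier (cone k G)" using acyclic_atD[OF Z w] by (simp add: cone_bd_def)
  then obtain v where v: "v \<in> carrier (cone k G)" "w = cone_diff k G v" by (rule imageE)
  have v': "fst v \<in> nat_trans \<G> (P k) G" "snd v \<in> nat_trans \<S> (Qt k) (schur d G)" using v(1) by auto
  let ?c = "ncomp (Q k) (snd v) (Dt k)"
  have m: "comp_map k (fst v) \<in> carrier (?N k)" "?c \<in> carrier (?N k)" "\<beta> \<in> carrier (?N k)"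
    using lin_maps_closed[OF comp_map_lin[OF G], of "fst v" k] lin_maps_closed[OF pre_Dt[OF G], of "snd v" k] v' b'(1) by simp_all
  have e: "ncomp (P (Suc k)) (fst v) (D k) = \<zero>\<^bsub>?M (Suc k)\<^esub>"
    "\<beta> = comp_map k (fst v) \<oplus>\<^bsub>?N k\<^esub> \<ominus>\<^bsub>?N k\<^esub> ?c"
    using v(2) unfolding w_def cone_diff_def by simp_all
  have "comp_map k (fst v) \<oplus>\<^bsub>?N k\<^esub> \<ominus>\<^bsub>?N k\<^esub> \<beta> = ?c"
  proof -
    note V = HQ[OF G, of k]
    have "comp_map k (fst v) = ?c \<oplus>\<^bsub>?N k\<^esub> \<beta>"
      unfolding e(2) using m by (simp only: vs_lcomm[OF V] vs_neg[OF V] vs_rneg[OF V] vs_add_zero[OF V])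
    then show ?thesis using m by (simp only: vs_assoc[OF V] vs_neg[OF V] vs_rneg[OF V] vs_add_zero[OF V])
  qed
  moreover have "?c \<in> Ext_coboundaries \<S> Q D' (schur d G) k"
  proof (cases k)
    case 0
    have "snd v = \<zero>\<^bsub>hom_module \<S> zero_functor (schur d G)\<^esub>"
      using nt_from_zero_functor[OF SG] v'(2) unfolding 0 by simp
    then show ?thesis
      using ncomp_zero_left[OF QF zero_functor_functor SG, of "Dt 0"] Dt_nt[of 0]
      unfolding 0 by (simp add: Ext_coboundaries_def)
  next
    case (Suc j)
    then show ?thesis using v'(2) by (simp add: Ext_coboundaries_def)
  qed
  moreover have "fst v \<in> Ext_cocycles \<G> P D G k" using v'(1) e(1) by (simp add: Ext_cocycles_def)
  ultimately show ?thesis by (intro bexI[of _ "fst v"]) simp_all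
qed

lemma schur_Ext_lin_monos:
  assumes Z: "acyclic_at k G"
  shows "schur_Ext d P G Q D' \<phi> k \<in> lin_monos (Ext_module \<G> P D G k) (Ext_module \<S> Q D' (schur d G) k)"
  unfolding lin_monos_def Ext_module_def schur_Ext_quot
proof (intro CollectI conjI)
  show "(\<lambda>A. \<Union>\<alpha>\<in>A. a_r_coset (hom_module \<S> (Q k) (schur d G)) (Ext_coboundaries \<S> Q D' (schur d G) k) (comp_map k \<alpha>))
    \<in> lin_maps (quot_module ((hom_module \<G> (P k) G)\<lparr>carrier := Ext_cocycles \<G> P D G k\<rparr>) (Ext_coboundaries \<G> P D G k))
      (quot_module ((hom_module \<S> (Q k) (schur d G))\<lparr>carrier := Ext_cocycles \<S> Q D' (schur d G) k\<rparr>)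
        (Ext_coboundaries \<S> Q D' (schur d G) k))"
    by (rule quot_map_lin[OF quot_assms])
  show "inj_on (\<lambda>A. \<Union>\<alpha>\<in>A. a_r_coset (hom_module \<S> (Q k) (schur d G)) (Ext_coboundaries \<S> Q D' (schur d G) k) (comp_map k \<alpha>))
    (carrier (quot_module ((hom_module \<G> (P k) G)\<lparr>carrier := Ext_cocycles \<G> P D G k\<rparr>) (Ext_coboundaries \<G> P D G k)))"
  proof (rule quot_map_inj[OF quot_assms])
    fix x y assume x: "x \<in> Ext_cocycles \<G> P D G k" and y: "y \<in> Ext_cocycles \<G> P D G k"
    have yc: "y \<in> carrier (hom_module \<G> (P k) G)" using subspD(1)[OF cocy] y by (rule subsetD)
    show "x \<oplus>\<^bsub>hom_module \<G> (P k) G\<^esub> \<ominus>\<^bsub>hom_module \<G> (P k) G\<^esub> y \<in> Ext_cocycles \<G> P D G k"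
      unfolding vs_neg_eq[OF HP[OF G] yc, symmetric] by (rule subspD(3)[OF cocy x subspD(4)[OF cocy y]])
  qed (assumption | rule coboundary_lift[OF Z])+
qed

text \<open>Degree \<open>k\<close> of the cone gives injectivity through
  \<open>coboundary_lift\<close>, degree \<open>k + 1\<close> gives surjectivity through
  \<open>cocycle_lift\<close>.\<close>

lemma schur_Ext_lin_isos:
  assumes Z: "acyclic_at k G" "acyclic_at (Suc k) G"
  shows "schur_Ext d P G Q D' \<phi> k \<in> lin_isos (Ext_module \<G> P D G k) (Ext_module \<S> Q D' (schur d G) k)"
proof -
  have m: "schur_Ext d P G Q D' \<phi> k \<in> lin_maps (Ext_module \<G> P D G k) (Ext_module \<S> Q D' (schur d G) k)"
    "inj_on (schur_Ext d P G Q D' \<phi> k) (carrier (Ext_module \<G> P D G k))"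
    using schur_Ext_lin_monos[OF Z(1)] by (simp_all add: lin_monos_def)
  have "carrier (Ext_module \<S> Q D' (schur d G) k) \<subseteq> schur_Ext d P G Q D' \<phi> k ` carrier (Ext_module \<G> P D G k)"
    unfolding Ext_module_def schur_Ext_quot by (rule quot_map_surj[OF quot_assms cocycle_lift[OF Z(2)]])
  moreover have "schur_Ext d P G Q D' \<phi> k ` carrier (Ext_module \<G> P D G k) \<subseteq> carrier (Ext_module \<S> Q D' (schur d G) k)"
    by (rule image_subsetI) (rule lin_maps_closed[OF m(1)])
  ultimately show ?thesis using m unfolding lin_isos_def bij_betw_def by blast
qed

end

end

text \<open>The case \<open>m = 0\<close> accounts for an empty \<open>B\<close>, whose supremum is \<open>0\<close>.\<close>

lemma enat_less_Sup_add:
  assumes k: "enat k < Sup (enat ` A) + Sup (enat ` B)" and A: "0 \<in> A"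
  obtains n m where "n \<in> A" "m \<in> B \<or> m = 0" "k < n + m"
proof -
  \<comment> \<open>A finite bound at most the supremum is reached by an element: its predecessor
    lies strictly below the supremum. For the bound \<open>0\<close> any element serves.\<close>
  have att: "\<exists>n\<in>A. enat i \<le> enat n" if A: "0 \<in> A" and i: "enat i \<le> Sup (enat ` A)" for i A
  proof (cases i)
    case (Suc j)
    have "enat j < enat i" by (simp add: Suc)
    also note i
    finally obtain n where "n \<in> A" "enat j < enat n" unfolding less_Sup_iff by blast
    then show ?thesis using Suc by (intro bexI[of _ n]) simp_all
  qed (use A in auto)
  let ?B = "insert 0 B"
  have k': "enat k < Sup (enat ` A) + Sup (enat ` ?B)" using k by (simp add: zero_enat_def[symmetric] bot_enat_def[symmetric])
  \<comment> \<open>If one supremum is infinite, it alone exceeds \<open>k\<close>; otherwise both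
    suprema are natural numbers and serve as \<open>i\<close> and \<open>j\<close>.\<close>
  obtain i j where ij: "enat i \<le> Sup (enat ` A)" "enat j \<le> Sup (enat ` ?B)" "k < i + j"
  proof (cases "Sup (enat ` A)")
    case infinity
    then show ?thesis using that[of "Suc k" 0] by (simp add: zero_enat_def[symmetric])
  next
    case a: (enat a)
    show ?thesis
    proof (cases "Sup (enat ` ?B)")
      case infinity
      then show ?thesis using that[of 0 "Suc k"] by (simp add: zero_enat_def[symmetric])
    next
      case b: (enat b)
      show ?thesis by (rule that[of a b]) (use k' in \<open>simp_all only: a b order_refl plus_enat_simps enat_ord_simps\<close>)
    qed
  qed
  obtain n where n: "n \<in> A" "i \<le> n" using att[OF A ij(1)] by auto
  obtain m where m: "m \<in> ?B" "j \<le> m" using att[of ?B, OF _ ij(2)] by auto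
  show ?thesis by (rule that[of n m]) (use n m ij(3) in auto)
qed

theorem theorem8p2:
  fixes F G :: "('k::field, 'v) spf"
    and P :: "nat \<Rightarrow> ('k, 'v) spf"
    and Q :: "nat \<Rightarrow> ('k, nat \<Rightarrow> (nat list \<Rightarrow> 'k) \<Rightarrow> 'v) sym_mod"
    and p d k :: nat
  assumes "CHAR('k) = p" and "p > 0" and "d > 0"
    and "infinite (UNIV :: 'v set)" and "\<exists>h :: 'k \<Rightarrow> 'v. inj h"
    and "strict_poly_functor d F" and "strict_poly_functor d G"
    and "proj_resolution (Gamma_cat d) F P D \<epsilon>"
    and "proj_resolution (Sym_cat d) (schur d F) Q D' \<epsilon>'"
    and "schur_lift d P D \<epsilon> Q D' \<epsilon>' \<phi>"
  shows "(enat (k + 1) < p_index p d F + i_index p d G \<longrightarrow>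
      schur_Ext d P G Q D' \<phi> k \<in>
        lin_isos (Ext_module (Gamma_cat d) P D G k) (Ext_module (Sym_cat d) Q D' (schur d G) k))
    \<and> (enat (k + 1) = p_index p d F + i_index p d G \<longrightarrow>
      schur_Ext d P G Q D' \<phi> k \<in>
        lin_monos (Ext_module (Gamma_cat d) P D G k) (Ext_module (Sym_cat d) Q D' (schur d G) k))"
proof -
  interpret schur_comparison d F P D \<epsilon> Q D' \<epsilon>' \<phi> by unfold_locales (use assms in auto)
  note G = assms(7)
  define A where "A = {n. \<exists>P D \<epsilon>. proj_resolution (Gamma_cat d) F P D \<epsilon> \<and> (\<forall>i<n. left_p_bounded p d (P i))}"
  define B where "B = {n. \<exists>J \<delta> \<iota>. inj_resolution (Gamma_cat d) G J \<delta> \<iota> \<and> (\<forall>i<n. right_p_bounded p d (J i))}"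
  have idx: "p_index p d F = Sup (enat ` A)" "i_index p d G = Sup (enat ` B)"
    by (simp_all add: p_index_def i_index_def A_def B_def setcompr_eq_image)
  \<comment> \<open>The given resolution itself witnesses the bound \<open>0\<close>, so the set for
    \<open>F\<close> is never empty.\<close>
  have A0: "0 \<in> A" using assms(8) by (auto simp: A_def)
  have ac: "acyclic_at i G" if i: "enat i < p_index p d F + i_index p d G" for i
  proof -
    obtain n m where n: "n \<in> A" and m: "m \<in> B \<or> m = 0" and s: "i < n + m"
      using enat_less_Sup_add[OF i[unfolded idx] A0] by blast
    from n obtain P' E \<epsilon>'' where P': "proj_resolution \<G> F P' E \<epsilon>''" "\<forall>i<n. left_p_bounded p d (P' i)"
      unfolding A_def by blast
    \<comment> \<open>Acyclicity below \<open>n\<close> for all coefficients, not just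
      \<open>G\<close>, as the induction on the injective side requires.\<close>
    have base: "acyclic_at k G'" if "k < n" "strict_poly_functor d G'" for k and G' :: "('k, 'v) spf"
      using left_bounded_acyclic[OF assms(4,1,2) P'(1) _ that(2,1)] P'(2) by blast
    show ?thesis
    proof (cases "m \<in> B")
      case True
      then obtain J \<delta> \<iota> where J: "inj_resolution \<G> G J \<delta> \<iota>" "\<forall>i<m. right_p_bounded p d (J i)"
        unfolding B_def by blast
      show ?thesis
        by (rule right_bounded_acyclic[OF assms(4,1,2) base G J(1) _ s]) (use J(2) in auto)
    next
      case False
      then show ?thesis using m s by (intro base G) simp
    qed
  qed
  \<comment> \<open>The cone is acyclic in every degree below the sum of the indices. Injectivity
    asks for this in degree \<open>k\<close>, an isomorphism also in degree \<open>k + 1\<close>,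
    which is the difference between the two cases.\<close>
  have "enat k < enat (k + 1)" by simp
  then have lt: "acyclic_at k G" if "enat (k + 1) \<le> p_index p d F + i_index p d G"
    using that by (intro ac) (rule order_less_le_trans)
  have "acyclic_at (Suc k) G" if "enat (k + 1) < p_index p d F + i_index p d G"
    using that by (intro ac) simp
  then show ?thesis
    using schur_Ext_lin_isos[OF G] schur_Ext_lin_monos[OF G] lt by (metis order_less_imp_le order_refl)
qed

end
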